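(* Let $B(t)$, $t\ge 0$, be a real-valued Lévy process having finite second moments. For $T>0$ let $f_T$ be the minimizer of $\mathcal{E}_T(f,B)=\int_0^T\left[(f(s)-B(s))^2+f'(s)^2\right]ds$ over $f\in\mathbb{W}_2^1[0,T]$. Then, as $T\to\infty$, \[ T^{-1}\mathcal{E}_T(f_T,B)\to Z \] both in $L_1$ and almost surely, where \[ Z=\mathcal{C}=|\mathbb{E}B(1)|^2+\frac{\mathrm{Var}\,B(1)}{2}. \]
   Context: A Lévy process is a process with independent stationary increments (with $B(0)=0$, stochastically continuous, with a measurable, e.g. càdlàg, version). $\mathbb{W}_2^1[0,T]$ denotes the space of absolutely continuous functions $f:[0,T]\to\mathbb{R}$ with square integrable derivative. For each path in $L_2[0,T]$ the minimizer $f_T$ exists and is unique; it is taken path by path. For a real-valued process with wide-sense stationary increments and spectral representation $B(t)=D_0t+\int_{\mathbb{R}\setminus\{0\}}(e^{itu}-1)X(du)$, $t\in\mathbb{R}$ ($D_0$ a square integrable random variable, $X$ a zero-mean uncorrelated random measure uncorrelated with $D_0$, $\mu_B(A)=\mathbb{E}|X(A)|^2$), the paper defines $\mathcal{C}:=\mathbb{E}|D_0|^2+\int_{\mathbb{R}\setminus\{0\}}\frac{u^2}{1+u^2}\mu_B(du)$ and $Z:=|D_0|^2+\int_{\mathbb{R}\setminus\{0\}}\frac{u^2}{1+u^2}\mu_B(du)$. For the Lévy process these refer to its two-sided extension, in which $-B(-t)$, $t\ge 0$, is an independent copy of $B(t)$, $t\ge0$. *)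

theory Defs
  imports "HOL-Probability.Probability"
begin

definition square_integrable :: "'a measure \<Rightarrow> ('a \<Rightarrow> 'b::euclidean_space) \<Rightarrow> bool" where
  "square_integrable M f \<longleftrightarrow> f \<in> borel_measurable M \<and> integrable M (\<lambda>x. (norm (f x))\<^sup>2)"

text \<open>
  The completion of \<open>M\<close> only matters for random variables that are specified up to a null set:
  on the exceptional null event where a path is not square integrable there is no energy minimizer,
  and nothing is prescribed there.
\<close>
definition tendsto_L1 :: "'a measure \<Rightarrow> (real \<Rightarrow> 'a \<Rightarrow> real) \<Rightarrow> ('a \<Rightarrow> real) \<Rightarrow> bool" where
  "tendsto_L1 M Y Z \<longleftrightarrow>
     (\<forall>\<^sub>F T in at_top. integrable (completion M) (Y T)) \<and> integrable (completion M) Z \<and>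
     ((\<lambda>T. LINT \<omega>|completion M. \<bar>Y T \<omega> - Z \<omega>\<bar>) \<longlongrightarrow> 0) at_top"

definition tendsto_AE :: "'a measure \<Rightarrow> (real \<Rightarrow> 'a \<Rightarrow> real) \<Rightarrow> ('a \<Rightarrow> real) \<Rightarrow> bool" where
  "tendsto_AE M Y Z \<longleftrightarrow> (AE \<omega> in M. ((\<lambda>T. Y T \<omega>) \<longlongrightarrow> Z \<omega>) at_top)"

text \<open>
  Time is \<open>t \<ge> 0\<close>; values \<open>B t\<close> for \<open>t < 0\<close> are irrelevant. The first measurability condition
  says that \<open>B\<close> is a measurable process, which covers every version with cadlag paths.
\<close>
definition levy_process :: "'a measure \<Rightarrow> (real \<Rightarrow> 'a \<Rightarrow> real) \<Rightarrow> bool" where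
  "levy_process M B \<longleftrightarrow>
     prob_space M \<and>
     (\<lambda>(t, \<omega>). B t \<omega>) \<in> borel_measurable (restrict_space borel {0..} \<Otimes>\<^sub>M M) \<and>
     (AE \<omega> in M. B 0 \<omega> = 0) \<and>
     (\<forall>n (t :: nat \<Rightarrow> real). 0 \<le> t 0 \<and> (\<forall>i<n. t i \<le> t (Suc i)) \<longrightarrow>
        prob_space.indep_vars M (\<lambda>_. borel) (\<lambda>i \<omega>. B (t (Suc i)) \<omega> - B (t i) \<omega>) {..<n}) \<and>
     (\<forall>s\<ge>0. \<forall>h\<ge>0. distr M borel (\<lambda>\<omega>. B (s + h) \<omega> - B s \<omega>) = distr M borel (B h)) \<and>
     (\<forall>s\<ge>0. \<forall>\<epsilon>>0.
        ((\<lambda>t. measure M {\<omega> \<in> space M. \<epsilon> \<le> \<bar>B t \<omega> - B s \<omega>\<bar>}) \<longlongrightarrow> 0) (at s within {0..}))"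

text \<open>
  The process \<open>B'\<close>, indexed by the whole line, lives on a probability space \<open>M'\<close> that extends
  \<open>M\<close> through the measure preserving map \<open>\<pi>\<close>, since \<open>M\<close> itself need not carry an independent
  copy of \<open>B\<close>.
\<close>
definition two_sided_extension ::
  "'a measure \<Rightarrow> (real \<Rightarrow> 'a \<Rightarrow> real) \<Rightarrow> 'b measure \<Rightarrow> ('b \<Rightarrow> 'a) \<Rightarrow> (real \<Rightarrow> 'b \<Rightarrow> real) \<Rightarrow> bool" where
  "two_sided_extension M B M' \<pi> B' \<longleftrightarrow>
     prob_space M' \<and> \<pi> \<in> M' \<rightarrow>\<^sub>M M \<and> distr M' M \<pi> = M \<and>
     (\<forall>t\<ge>0. \<forall>\<omega>\<in>space M'. B' t \<omega> = B t (\<pi> \<omega>)) \<and>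
     prob_space.indep_var M'
       (\<Pi>\<^sub>M t\<in>{0..}. borel) (\<lambda>\<omega>. \<lambda>t\<in>{0..}. B' t \<omega>)
       (\<Pi>\<^sub>M t\<in>{0..}. borel) (\<lambda>\<omega>. \<lambda>t\<in>{0..}. - B' (- t) \<omega>) \<and>
     distr M' (\<Pi>\<^sub>M t\<in>{0..}. borel) (\<lambda>\<omega>. \<lambda>t\<in>{0..}. - B' (- t) \<omega>) =
       distr M (\<Pi>\<^sub>M t\<in>{0..}. borel) (\<lambda>\<omega>. \<lambda>t\<in>{0..}. B t \<omega>)"

text \<open>
  Zero-mean uncorrelated random measure \<open>X\<close> on the real line without the origin, with
  \<open>\<mu> A = E |X A|\<^sup>2\<close>. As \<open>\<mu>\<close> may be infinite near the origin, \<open>X A\<close> is only considered for Borel sets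
  \<open>A\<close> of finite \<open>\<mu>\<close>-measure. Finite additivity of \<open>X\<close> together with countable additivity of \<open>\<mu>\<close>
  gives countable additivity of \<open>X\<close> in mean square.
\<close>
definition uncorrelated_random_measure ::
  "'a measure \<Rightarrow> real measure \<Rightarrow> (real set \<Rightarrow> 'a \<Rightarrow> complex) \<Rightarrow> bool" where
  "uncorrelated_random_measure M \<mu> X \<longleftrightarrow>
     sets \<mu> = sets (restrict_space borel (- {0})) \<and>
     (\<forall>A\<in>fmeasurable \<mu>.
        square_integrable M (X A) \<and>
        (LINT \<omega>|M. X A \<omega>) = 0 \<and>
        (LINT \<omega>|M. (norm (X A \<omega>))\<^sup>2) = measure \<mu> A) \<and>
     (\<forall>A\<in>fmeasurable \<mu>. \<forall>A'\<in>fmeasurable \<mu>. A \<inter> A' = {} \<longrightarrow>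
        (LINT \<omega>|M. X A \<omega> * cnj (X A' \<omega>)) = 0 \<and>
        (AE \<omega> in M. X (A \<union> A') \<omega> = X A \<omega> + X A' \<omega>))"

definition simple_stochastic_integral ::
  "real measure \<Rightarrow> (real set \<Rightarrow> 'a \<Rightarrow> complex) \<Rightarrow> (real \<Rightarrow> complex) \<Rightarrow> 'a \<Rightarrow> complex" where
  "simple_stochastic_integral \<mu> X s \<omega> = (\<Sum>z\<in>s ` space \<mu> - {0}. z * X (s -` {z} \<inter> space \<mu>) \<omega>)"

text \<open>\<open>I\<close> is (a version of) the mean square integral of \<open>g\<close> with respect to \<open>X\<close>.\<close>
definition has_stochastic_integral ::
  "'a measure \<Rightarrow> real measure \<Rightarrow> (real set \<Rightarrow> 'a \<Rightarrow> complex) \<Rightarrow> (real \<Rightarrow> complex) \<Rightarrow> ('a \<Rightarrow> complex) \<Rightarrow> bool"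
where
  "has_stochastic_integral M \<mu> X g I \<longleftrightarrow>
     square_integrable \<mu> g \<and> square_integrable M I \<and>
     (\<exists>s :: nat \<Rightarrow> real \<Rightarrow> complex.
        (\<forall>n. simple_function \<mu> (s n) \<and> emeasure \<mu> {u \<in> space \<mu>. s n u \<noteq> 0} < \<infinity>) \<and>
        (\<lambda>n. LINT u|\<mu>. (norm (s n u - g u))\<^sup>2) \<longlonglongrightarrow> 0 \<and>
        (\<lambda>n. LINT \<omega>|M. (norm (simple_stochastic_integral \<mu> X (s n) \<omega> - I \<omega>))\<^sup>2) \<longlonglongrightarrow> 0)"

text \<open>
  Since \<open>X A\<close> has mean zero, being uncorrelated with \<open>D\<close> means \<open>E (D * cnj (X A)) = 0\<close>.
  The Levy condition that \<open>u\<^sup>2 / (1 + u\<^sup>2)\<close> is \<open>\<mu>\<close>-integrable is not required separately: it follows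
  from the existence of the stochastic integrals for a process with stationary increments.
\<close>
definition spectral_representation ::
  "'a measure \<Rightarrow> (real \<Rightarrow> 'a \<Rightarrow> real) \<Rightarrow> ('a \<Rightarrow> complex) \<Rightarrow> (real set \<Rightarrow> 'a \<Rightarrow> complex) \<Rightarrow> real measure \<Rightarrow> bool"
where
  "spectral_representation M B D X \<mu> \<longleftrightarrow>
     square_integrable M D \<and>
     uncorrelated_random_measure M \<mu> X \<and>
     (\<forall>A\<in>fmeasurable \<mu>. (LINT \<omega>|M. D \<omega> * cnj (X A \<omega>)) = 0) \<and>
     (\<forall>t. \<exists>I. has_stochastic_integral M \<mu> X (\<lambda>u. exp (\<i> * of_real (t * u)) - 1) I \<and>
        (AE \<omega> in M. of_real (B t \<omega>) = D \<omega> * of_real t + I \<omega>))"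

definition spectral_Z :: "('a \<Rightarrow> complex) \<Rightarrow> real measure \<Rightarrow> 'a \<Rightarrow> real" where
  "spectral_Z D \<mu> \<omega> = (norm (D \<omega>))\<^sup>2 + (LINT u|\<mu>. u\<^sup>2 / (1 + u\<^sup>2))"

definition spectral_C :: "'a measure \<Rightarrow> ('a \<Rightarrow> complex) \<Rightarrow> real measure \<Rightarrow> real" where
  "spectral_C M D \<mu> = (LINT \<omega>|M. (norm (D \<omega>))\<^sup>2) + (LINT u|\<mu>. u\<^sup>2 / (1 + u\<^sup>2))"

definition abs_continuous_on_interval :: "real \<Rightarrow> real \<Rightarrow> (real \<Rightarrow> real) \<Rightarrow> bool" where
  "abs_continuous_on_interval a b f \<longleftrightarrow>
     (\<forall>\<epsilon>>0. \<exists>\<delta>>0. \<forall>\<D> S. \<D> division_of S \<and> S \<subseteq> {a..b} \<and> (\<Sum>K\<in>\<D>. Sup K - Inf K) < \<delta> \<longrightarrow>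
        (\<Sum>K\<in>\<D>. \<bar>f (Sup K) - f (Inf K)\<bar>) < \<epsilon>)"

text \<open>
  The values of \<open>f\<close> outside \<open>[0, T]\<close> are irrelevant: they only affect \<open>deriv f\<close> at the two end points.
  Almost everywhere differentiability is listed because \<open>deriv\<close> is total; it is automatic for
  absolutely continuous functions.
\<close>
definition W21 :: "real \<Rightarrow> (real \<Rightarrow> real) set" where
  "W21 T = {f. abs_continuous_on_interval 0 T f \<and>
     (AE s in lebesgue_on {0..T}. f field_differentiable (at s)) \<and>
     square_integrable (lebesgue_on {0..T}) (deriv f)}"

definition energy :: "real \<Rightarrow> (real \<Rightarrow> real) \<Rightarrow> (real \<Rightarrow> real) \<Rightarrow> real" where
  "energy T f w = (LINT s|lebesgue_on {0..T}. (f s - w s)\<^sup>2 + (deriv f s)\<^sup>2)"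

definition energy_minimizer :: "real \<Rightarrow> (real \<Rightarrow> real) \<Rightarrow> (real \<Rightarrow> real) \<Rightarrow> bool" where
  "energy_minimizer T w f \<longleftrightarrow> f \<in> W21 T \<and> (\<forall>g\<in>W21 T. energy T f w \<le> energy T g w)"

end

theory Submission
  imports Defs
begin

text \<open>
  For a single path \<open>w\<close>, let \<open>y\<close> solve \<open>y' = w - y\<close>, \<open>y(0) = 0\<close>, so that \<open>y\<close> is the exponential
  smoothing of \<open>w\<close>, and let \<open>d = w - y\<close>. For a competitor \<open>f\<close> put \<open>e = f - y\<close>. Completing squares gives
  \<open>(f - w)\<^sup>2 + f'\<^sup>2 = d\<^sup>2 + (e\<^sup>2)' + (f' - e)\<^sup>2\<close>. The same holds for every solution \<open>y + a exp(-t)\<close> of the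
  equation in place of \<open>y\<close>; with \<open>a = f(0)\<close> the boundary term at 0 disappears, and the energy of \<open>f\<close> is at
  least the integral of \<open>(d - a exp(-s))\<^sup>2\<close>. Solving \<open>f' = e\<close> backwards from \<open>e(T) = 0\<close> attains the
  minimum over \<open>a\<close> (\<open>energy_minimizer_value\<close>), so the minimal energy is
  \<open>\<integral> d\<^sup>2 - 2 (\<integral> exp(-s) d)\<^sup>2 / (1 - exp(-2T))\<close>, integrals over \<open>[0, T]\<close>. For \<open>T \<ge> 1\<close> the second term is at
  most \<open>4 \<integral> exp(-s) d\<^sup>2\<close>, which does not contribute after division by \<open>T\<close>. The identity needs the
  fundamental theorem of calculus for absolutely continuous functions
  (\<open>abs_continuous_fundamental_theorem\<close>).

  For a Levy path, \<open>d\<close> is the Ornstein-Uhlenbeck process driven by it. Over the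
  unit block \<open>[n, n + 1]\<close> the integral of \<open>d\<^sup>2\<close> equals \<open>\<Theta>\<^sub>n + X\<^sub>n H\<^sub>n + (X\<^sub>n\<^sup>2 - X\<^sub>n\<^sub>+\<^sub>1\<^sup>2)/2\<close>, where \<open>X\<^sub>n = d(n)\<close>
  satisfies \<open>X\<^sub>n\<^sub>+\<^sub>1 = exp(-1) X\<^sub>n + \<xi>\<^sub>n\<close> and \<open>(\<xi>\<^sub>n, H\<^sub>n, \<Theta>\<^sub>n)\<close> is a functional of the increments of the path in
  that block (\<open>residual_energy_blocks\<close>). These triples are independent and identically distributed. Only
  the first moment of \<open>\<Theta>\<close> is available, so its averages are handled by the strong law in the form of
  Etemadi (\<open>strong_law_iid_nonneg\<close>); the products \<open>X\<^sub>n (H\<^sub>n - E H\<^sub>n)\<close> are orthogonal with bounded second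
  moments, which suffices for a strong law by a subsequence argument (\<open>strong_law_orthogonal\<close>). Both are
  combined in \<open>strong_law_autoregression\<close>.

  Mean and variance of the process are linear in time, with slopes \<open>m\<close> and \<open>v\<close>. Hence
  \<open>E d(t)\<^sup>2 = v (1 - exp(-2t))/2 + m\<^sup>2 (1 - exp(-t))\<^sup>2\<close> (\<open>expectation_residual_square\<close>), which tends to
  \<open>m\<^sup>2 + v/2\<close>. This is the limit of the expected time averages of \<open>d\<^sup>2\<close>, and also their almost sure limit
  as computed from the moments of the block functionals; being nonnegative, the time averages then
  converge in mean (\<open>Scheffe_at_top\<close>).

  By the isometry of the stochastic integral, the spectral representation gives
  \<open>v t + m\<^sup>2 t\<^sup>2 = t\<^sup>2 E|D|\<^sup>2 + \<integral> (2 - 2 cos(t u)) d\<mu>(u)\<close>. The Laplace transform in \<open>t\<close>, taken at 1, turns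
  \<open>2 - 2 cos(t u)\<close> into \<open>2 u\<^sup>2/(1 + u\<^sup>2)\<close> and yields \<open>E|D|\<^sup>2 + \<integral> u\<^sup>2/(1 + u\<^sup>2) d\<mu> = m\<^sup>2 + v/2\<close>. Dividing by
  \<open>t\<^sup>2\<close> and letting \<open>t\<close> tend to infinity gives \<open>E|D|\<^sup>2 = m\<^sup>2\<close>, while \<open>E D = m\<close>; so \<open>D = m\<close> almost surely
  and \<open>Z\<close> is constant (\<open>spectral_data_of_linear_variance\<close>).
\<close>

section \<open>Absolutely continuous functions on an interval\<close>

lemma tagged_division_length_le_measure:
  fixes p :: "(real \<times> real set) set"
  assumes "p tagged_partial_division_of S" "(\<Union>(x,K)\<in>p. K) \<subseteq> U"
    "U \<in> lmeasurable"
  shows "(\<Sum>K\<in>snd ` p. Sup K - Inf K) \<le> measure lebesgue U"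
proof -
  let ?D = "snd ` p"
  have div: "?D division_of \<Union>?D"
    using assms(1) tagged_partial_division_of_Union_self division_of_tagged_division by blast
  have "(\<Sum>K\<in>?D. Sup K - Inf K) = (\<Sum>K\<in>?D. measure lebesgue K)"
  proof (rule sum.cong)
    fix K assume "K \<in> ?D"
    then obtain a b where "K = cbox a b" "K \<noteq> {}"
      using division_ofD[OF div] by metis
    then show "Sup K - Inf K = measure lebesgue K" by simp
  qed simp
  also have "\<dots> = measure lebesgue (\<Union>?D)"
    using content_division[OF div] by simp
  also have "\<dots> \<le> measure lebesgue U"
  proof (rule measure_mono_fmeasurable)
    show "\<Union> ?D \<subseteq> U" using assms(2) by force
    show "\<Union> ?D \<in> sets lebesgue"
      by (intro sets.finite_Union division_ofD(1)[OF div])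
        (metis division_ofD(4)[OF div] box_real(2) fmeasurableD lmeasurable_cbox subsetI)
    show "U \<in> lmeasurable" by fact
  qed
  finally show ?thesis .
qed

lemma has_derivative_straddle:
  fixes f :: "real \<Rightarrow> real"
  assumes "\<And>y. \<bar>y - x\<bar> < d \<Longrightarrow> \<bar>f y - f x - D * (y - x)\<bar> \<le> e * \<bar>y - x\<bar>"
    "u \<le> x" "x \<le> v" "\<bar>u - x\<bar> < d" "\<bar>v - x\<bar> < d"
  shows "\<bar>(v - u) * D - (f v - f u)\<bar> \<le> e * (v - u)"
proof -
  let ?A = "f v - f x - D * (v - x)" and ?B = "f u - f x - D * (u - x)"
  have "\<bar>?A\<bar> \<le> e * (v - x)"
    using assms(1)[OF assms(5)] assms(3) by (metis abs_of_nonneg diff_ge_0_iff_ge)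
  moreover have "\<bar>?B\<bar> \<le> e * (x - u)"
    using assms(1)[OF assms(4)] assms(2) by (metis abs_minus_commute abs_of_nonneg diff_ge_0_iff_ge)
  moreover have "(v - u) * D - (f v - f u) = ?B - ?A"
    by (simp add: algebra_simps)
  moreover have "e * (v - u) = e * (v - x) + e * (x - u)" by (simp add: algebra_simps)
  moreover have "\<bar>?B - ?A\<bar> \<le> \<bar>?A\<bar> + \<bar>?B\<bar>" by (rule abs_triangle_ineq4[THEN order_trans]) simp
  ultimately show ?thesis by simp
qed

text \<open>
  Outside the null set \<open>N\<close> differentiability makes the increment of \<open>f\<close> over a small enough interval
  close to the derivative at its tag times the length. The intervals with tags in \<open>N\<close> are forced by the
  gauge into an open set of small measure around \<open>N\<close>; absolute continuity bounds the increments of \<open>f\<close>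
  over them.
\<close>

theorem abs_continuous_fundamental_theorem:
  fixes f :: "real \<Rightarrow> real"
  assumes ac: "abs_continuous_on_interval a b f" and "a \<le> b"
    and N: "negligible N" and diff: "\<And>x. x \<in> {a..b} - N \<Longrightarrow> f field_differentiable (at x)"
  shows "(deriv f has_integral (f b - f a)) {a..b}"
proof -
  (* With the value 0 on N, tags in N contribute nothing to the Riemann sum. *)
  let ?g = "\<lambda>x. if x \<in> N then 0 else deriv f x"
  have "(?g has_integral (f b - f a)) {a..b}"
    unfolding has_integral_real
  proof (intro allI impI)
    fix e :: real assume "e > 0"
    define e' where "e' = e / (2 * (b - a + 1))"
    have e': "e' > 0" "e' * (b - a) < e / 2"
      using \<open>e > 0\<close> \<open>a \<le> b\<close> by (auto simp: e'_def field_simps)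
    obtain \<delta> where \<delta>: "\<delta> > 0" and ac': "\<And>\<D> S. \<D> division_of S \<Longrightarrow> S \<subseteq> {a..b} \<Longrightarrow>
        (\<Sum>K\<in>\<D>. Sup K - Inf K) < \<delta> \<Longrightarrow> (\<Sum>K\<in>\<D>. \<bar>f (Sup K) - f (Inf K)\<bar>) < e / 2"
      using ac \<open>e > 0\<close> unfolding abs_continuous_on_interval_def by (meson half_gt_zero)
    have "N \<in> sets lebesgue" using N negligible_imp_sets by blast
    then obtain U where U: "open U" "N \<subseteq> U" "U - N \<in> lmeasurable" "emeasure lebesgue (U - N) < ennreal \<delta>"
      using sets_lebesgue_outer_open \<delta> by metis
    have U1: "U \<in> lmeasurable"
      using U N by (metis Diff_partition fmeasurable.Un negligible_iff_measure)
    have "measure lebesgue U = measure lebesgue (U - N)"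
      using N U1 by (simp add: measure_Diff_null_set negligible_iff_null_sets fmeasurableD)
    also have "\<dots> < \<delta>" using U(3,4)
      using emeasure_eq_measure2[OF U(3)] \<delta> by (simp add: ennreal_less_iff)
    finally have U2: "measure lebesgue U < \<delta>" .
    have "\<forall>x\<in>{a..b} - N. \<exists>d>0. \<forall>y. \<bar>y - x\<bar> < d \<longrightarrow> \<bar>f y - f x - deriv f x * (y - x)\<bar> \<le> e' * \<bar>y - x\<bar>"
    proof
      fix x assume "x \<in> {a..b} - N"
      then have "(f has_field_derivative deriv f x) (at x)"
        using diff field_differentiable_derivI by blast
      then have "(f has_derivative (*) (deriv f x)) (at x)"
        by (simp add: has_field_derivative_def)
      then show "\<exists>d>0. \<forall>y. \<bar>y - x\<bar> < d \<longrightarrow> \<bar>f y - f x - deriv f x * (y - x)\<bar> \<le> e' * \<bar>y - x\<bar>"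
        using e'(1) unfolding has_derivative_at_alt by simp
    qed
    then obtain d where d: "\<And>x. x \<in> {a..b} - N \<Longrightarrow> d x > 0"
      "\<And>x y. x \<in> {a..b} - N \<Longrightarrow> \<bar>y - x\<bar> < d x \<Longrightarrow> \<bar>f y - f x - deriv f x * (y - x)\<bar> \<le> e' * \<bar>y - x\<bar>"
      by metis
    (* Intervals tagged in N stay inside U, of measure below the absolute continuity threshold. *)
    define \<gamma> where "\<gamma> x = (if x \<in> N then U else if x \<in> {a..b} then ball x (d x) else ball x 1)" for x
    have "gauge \<gamma>"
      using U d(1) by (auto simp: gauge_def \<gamma>_def)
    moreover have "norm ((\<Sum>(x, K)\<in>p. measure lborel K *\<^sub>R ?g x) - (f b - f a)) < e"
      if p: "p tagged_division_of {a..b}" "\<gamma> fine p" for p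
    proof -
      note pD = tagged_division_ofD[OF p(1)]
      let ?q = "{(x,K)\<in>p. x \<in> N}"
      have fin: "finite p" using pD by blast
      have q: "?q tagged_partial_division_of {a..b}"
        by (rule tagged_partial_division_subset[OF p(1)[unfolded tagged_division_of_def, THEN conjunct1]]) blast
      (* Vanishes on degenerate intervals, so a sum over tagged pairs is a sum over the intervals themselves. *)
      define D where "D K = (if K = {} then 0 else f (Sup K) - f (Inf K))" for K :: "real set"
      have "norm ((\<Sum>(x, K)\<in>p. measure lborel K *\<^sub>R ?g x) - (f b - f a)) =
         \<bar>\<Sum>(x, K)\<in>p. measure lborel K * ?g x - D K\<bar>"
      proof -
        have "(\<Sum>(x, K)\<in>p. D K) = (\<Sum>(x, K)\<in>p. f (Sup K) - f (Inf K))"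
          by (intro sum.cong refl) (use pD(2) in \<open>force simp: D_def\<close>)
        also have "\<dots> = f b - f a" by (rule additive_tagged_division_1[OF \<open>a \<le> b\<close> p(1)])
        finally show ?thesis by (simp add: sum_subtractf case_prod_unfold)
      qed
      also have "\<dots> \<le> (\<Sum>(x, K)\<in>p. \<bar>measure lborel K * ?g x - D K\<bar>)"
        by (simp add: case_prod_unfold)
      also have "\<dots> \<le> (\<Sum>(x, K)\<in>p. e' * measure lborel K + (if x \<in> N then \<bar>D K\<bar> else 0))"
      proof (rule sum_mono, clarify)
        fix x K assume xK: "(x, K) \<in> p"
        then obtain u v where uv: "K = {u..v}" "u \<le> v" "x \<in> {u..v}"
          using pD(2,4)[OF xK] by (metis atLeastAtMost_iff box_real(2) order_trans)
        show "\<bar>measure lborel K * ?g x - D K\<bar> \<le> e' * measure lborel K + (if x \<in> N then \<bar>D K\<bar> else 0)"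
        proof (cases "x \<in> N")
          case True then show ?thesis using e'(1) by simp
        next
          case False
          have x: "x \<in> {a..b} - N" using False xK pD by blast
          have "K \<subseteq> \<gamma> x" using p(2) xK by (auto simp: fine_def)
          then have "K \<subseteq> ball x (d x)" using x unfolding \<gamma>_def by simp
          then have "\<bar>u - x\<bar> < d x" "\<bar>v - x\<bar> < d x"
            using uv(2) unfolding uv(1) by (auto simp: dist_real_def subset_iff abs_minus_commute[of x])
          then have "\<bar>(v - u) * deriv f x - (f v - f u)\<bar> \<le> e' * (v - u)"
            using d(2)[OF x] uv by (intro has_derivative_straddle[of x "d x"]) auto
          then show ?thesis using False uv(2) unfolding uv(1) by (simp add: D_def)
        qed
      qed
      also have "\<dots> = e' * (\<Sum>(x, K)\<in>p. measure lborel K) + (\<Sum>(x, K)\<in>p. if x \<in> N then \<bar>D K\<bar> else 0)"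
        by (simp add: sum.distrib case_prod_unfold sum_distrib_left)
      also have "(\<Sum>(x, K)\<in>p. measure lborel K) = b - a"
        using additive_content_tagged_division[of p a b] p(1) \<open>a \<le> b\<close> by simp
      also have "(\<Sum>(x, K)\<in>p. if x \<in> N then \<bar>D K\<bar> else 0) = (\<Sum>(x, K)\<in>?q. \<bar>D K\<bar>)"
        using fin by (intro sum.mono_neutral_cong_right) (auto split: if_splits)
      also have "\<dots> = (\<Sum>K\<in>snd ` ?q. \<bar>D K\<bar>)"
        using tagged_partial_division_of_Union_self[OF q]
        by (rule sum.over_tagged_division_lemma) (auto simp: D_def)
      also have "\<dots> = (\<Sum>K\<in>snd ` ?q. \<bar>f (Sup K) - f (Inf K)\<bar>)"
        by (intro sum.cong refl) (use pD(2) in \<open>force simp: D_def\<close>)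
      also have "\<dots> < e / 2"
      proof (rule ac')
        show "snd ` ?q division_of \<Union> (snd ` ?q)"
          using q tagged_partial_division_of_Union_self division_of_tagged_division by blast
        show "\<Union> (snd ` ?q) \<subseteq> {a..b}" by (auto dest!: pD(3))
        have "(\<Union>(x,K)\<in>?q. K) \<subseteq> U"
        proof clarify
          fix x K y assume xK: "(x, K) \<in> p" "x \<in> N" "y \<in> K"
          then have "K \<subseteq> \<gamma> x" using p(2) by (auto simp: fine_def)
          then show "y \<in> U" using xK by (auto simp: \<gamma>_def)
        qed
        from tagged_division_length_le_measure[OF q this U1] U2
        show "(\<Sum>K\<in>snd ` ?q. Sup K - Inf K) < \<delta>" by linarith
      qed
      finally show ?thesis using e' by linarith
    qed
    ultimately show "\<exists>\<gamma>. gauge \<gamma> \<and> (\<forall>\<D>. \<D> tagged_division_of {a..b} \<and> \<gamma> fine \<D> \<longrightarrow>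
       norm ((\<Sum>(x, K)\<in>\<D>. measure lborel K *\<^sub>R ?g x) - (f b - f a)) < e)"
      by (intro exI[of _ \<gamma>]) simp
  qed
  then show ?thesis
    by (rule has_integral_spike[OF N, rotated]) auto
qed

lemma abs_continuous_on_subinterval:
  assumes "abs_continuous_on_interval a b f" "a \<le> c" "d \<le> b"
  shows "abs_continuous_on_interval c d f"
  using assms unfolding abs_continuous_on_interval_def
  by (meson atLeastatMost_subset_iff order_trans)

section \<open>Square integrable functions on an interval\<close>

lemma integrable_mult_square_integrable:
  fixes X Y :: "'a \<Rightarrow> real"
  assumes [measurable]: "X \<in> borel_measurable M" "Y \<in> borel_measurable M"
    and "integrable M (\<lambda>\<omega>. (X \<omega>)\<^sup>2)" "integrable M (\<lambda>\<omega>. (Y \<omega>)\<^sup>2)"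
  shows "integrable M (\<lambda>\<omega>. X \<omega> * Y \<omega>)"
proof (rule Bochner_Integration.integrable_bound)
  show "integrable M (\<lambda>\<omega>. (X \<omega>)\<^sup>2 + (Y \<omega>)\<^sup>2)" using assms by simp
  have "\<bar>x * y\<bar> \<le> x\<^sup>2 + y\<^sup>2" for x y :: real
  proof -
    have "2 * \<bar>x * y\<bar> \<le> x\<^sup>2 + y\<^sup>2"
      using sum_squares_bound[of "\<bar>x\<bar>" "\<bar>y\<bar>"] by (simp add: abs_mult)
    moreover have "0 \<le> \<bar>x * y\<bar>" by simp
    ultimately show ?thesis by linarith
  qed
  then show "AE \<omega> in M. norm (X \<omega> * Y \<omega>) \<le> norm ((X \<omega>)\<^sup>2 + (Y \<omega>)\<^sup>2)" by (intro AE_I2) (auto intro: order_trans)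
qed measurable

text \<open>
  Positivity of the integral of \<open>(a f - c g)\<^sup>2\<close>, a quadratic form in \<open>a\<close> and \<open>c\<close>.
\<close>

lemma integral_Cauchy_Schwarz:
  fixes f g :: "'a \<Rightarrow> real"
  assumes [measurable]: "f \<in> borel_measurable M" "g \<in> borel_measurable M"
    and f: "integrable M (\<lambda>x. (f x)\<^sup>2)" and g: "integrable M (\<lambda>x. (g x)\<^sup>2)"
  shows "integrable M (\<lambda>x. f x * g x)" "(LINT x|M. f x * g x)\<^sup>2 \<le> (LINT x|M. (f x)\<^sup>2) * (LINT x|M. (g x)\<^sup>2)"
proof -
  show fg: "integrable M (\<lambda>x. f x * g x)" by (rule integrable_mult_square_integrable) fact+
  define F where "F = (LINT x|M. (f x)\<^sup>2)"
  define G where "G = (LINT x|M. (g x)\<^sup>2)"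
  define B where "B = (LINT x|M. f x * g x)"
  have q: "0 \<le> a\<^sup>2 * F - 2 * a * c * B + c\<^sup>2 * G" for a c
  proof -
    have "0 \<le> (LINT x|M. (a * f x - c * g x)\<^sup>2)" by (intro integral_nonneg_AE) simp
    also have "(\<lambda>x. (a * f x - c * g x)\<^sup>2) = (\<lambda>x. (a\<^sup>2 * (f x)\<^sup>2 - (2 * a * c) * (f x * g x)) + c\<^sup>2 * (g x)\<^sup>2)"
      by (auto simp: power2_eq_square algebra_simps)
    also have "(LINT x|M. (a\<^sup>2 * (f x)\<^sup>2 - (2 * a * c) * (f x * g x)) + c\<^sup>2 * (g x)\<^sup>2) = a\<^sup>2 * F - (2 * a * c) * B + c\<^sup>2 * G"
      using f g fg by (simp add: F_def G_def B_def)
    finally show ?thesis .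
  qed
  have G0: "0 \<le> G" unfolding G_def by (intro integral_nonneg_AE) simp
  have "B\<^sup>2 \<le> F * G"
  proof (cases "G = 0")
    case True
    have "B = 0"
    proof (rule ccontr)
      assume B: "B \<noteq> 0"
      have "0 \<le> F - 2 * ((F + 1) / (2 * B)) * B" using q[of 1 "(F + 1) / (2 * B)"] True by simp
      then show False using B by simp
    qed
    then show ?thesis using True by simp
  next
    case False
    then have "G > 0" using G0 by simp
    have "0 \<le> G * (F * G - B\<^sup>2)" using q[of G B] by (simp add: power2_eq_square algebra_simps)
    then show ?thesis using \<open>G > 0\<close> by (simp add: zero_le_mult_iff)
  qed
  then show "(LINT x|M. f x * g x)\<^sup>2 \<le> (LINT x|M. (f x)\<^sup>2) * (LINT x|M. (g x)\<^sup>2)"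
    by (simp add: F_def G_def B_def)
qed

text \<open>
  Square integrability is expressed with respect to \<open>lborel\<close>, where Fubini's theorem applies, instead of
  the completed measure \<open>lebesgue_on\<close> of the energy functional.
\<close>

definition L2_on :: "real set \<Rightarrow> (real \<Rightarrow> real) \<Rightarrow> bool" where
  "L2_on A f \<longleftrightarrow> set_borel_measurable lborel A f \<and> set_integrable lborel A (\<lambda>x. (f x)\<^sup>2)"

lemma L2_on_iff_indicator:
  "L2_on A f \<longleftrightarrow> (\<lambda>x. indicator A x * f x) \<in> borel_measurable lborel \<and> integrable lborel (\<lambda>x. (indicator A x * f x)\<^sup>2)"
proof -
  have "(\<lambda>x. (indicator A x * f x)\<^sup>2) = (\<lambda>x. indicator A x *\<^sub>R (f x)\<^sup>2)" by (auto simp: indicator_def)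
  then show ?thesis by (simp add: L2_on_def set_borel_measurable_def set_integrable_def)
qed

lemma set_integrable_L2_on_mult:
  assumes "L2_on A f" "L2_on A g"
  shows "set_integrable lborel A (\<lambda>x. f x * g x)"
proof -
  have "integrable lborel (\<lambda>x. (indicator A x * f x) * (indicator A x * g x))"
    using assms unfolding L2_on_iff_indicator by (intro integrable_mult_square_integrable) auto
  also have "(\<lambda>x. (indicator A x * f x) * (indicator A x * g x)) = (\<lambda>x. indicator A x *\<^sub>R (f x * g x))"
    by (auto simp: indicator_def)
  finally show ?thesis by (simp add: set_integrable_def)
qed

lemma L2_on_Cauchy_Schwarz:
  assumes "L2_on A f" "L2_on A g"
  shows "(LBINT x:A. f x * g x)\<^sup>2 \<le> (LBINT x:A. (f x)\<^sup>2) * (LBINT x:A. (g x)\<^sup>2)"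
proof -
  have "(LINT x|lborel. (indicator A x * f x) * (indicator A x * g x))\<^sup>2 \<le>
      (LINT x|lborel. (indicator A x * f x)\<^sup>2) * (LINT x|lborel. (indicator A x * g x)\<^sup>2)"
    using assms unfolding L2_on_iff_indicator by (intro integral_Cauchy_Schwarz) auto
  moreover have "(\<lambda>x. (indicator A x * f x) * (indicator A x * g x)) = (\<lambda>x. indicator A x *\<^sub>R (f x * g x))"
    "(\<lambda>x. (indicator A x * h x)\<^sup>2) = (\<lambda>x. indicator A x *\<^sub>R (h x)\<^sup>2)" for h :: "real \<Rightarrow> real"
    by (auto simp: indicator_def)
  ultimately show ?thesis by (simp add: set_lebesgue_integral_def)
qed

lemma L2_on_lincomb:
  assumes "L2_on A f" "L2_on A g"
  shows "L2_on A (\<lambda>x. a * f x + b * g x)"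
proof -
  have "set_borel_measurable lborel A (\<lambda>x. a * f x + b * g x)"
    using assms unfolding L2_on_def set_borel_measurable_def
    by (auto simp: algebra_simps)
  moreover have "set_integrable lborel A (\<lambda>x. (a\<^sup>2 * (f x)\<^sup>2 + (2 * a * b) * (f x * g x)) + b\<^sup>2 * (g x)\<^sup>2)"
    using assms set_integrable_L2_on_mult[OF assms] unfolding L2_on_def
    by (intro set_integral_add set_integrable_mult_right) auto
  moreover have "(a\<^sup>2 * (f x)\<^sup>2 + (2 * a * b) * (f x * g x)) + b\<^sup>2 * (g x)\<^sup>2 = (a * f x + b * g x)\<^sup>2" for x
    by (simp add: power2_eq_square algebra_simps)
  ultimately show ?thesis unfolding L2_on_def by simp
qed

lemma L2_on_diff: "L2_on A f \<Longrightarrow> L2_on A g \<Longrightarrow> L2_on A (\<lambda>x. f x - g x)"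
  using L2_on_lincomb[of A f g 1 "-1"] by simp

lemma L2_on_continuous:
  assumes "continuous_on {a..b} f"
  shows "L2_on {a..b} f"
  unfolding L2_on_def
proof
  have "set_integrable lborel {a..b} f" by (intro borel_integrable_atLeastAtMost' assms)
  then show "set_borel_measurable lborel {a..b} f"
    unfolding set_integrable_def set_borel_measurable_def by auto
  show "set_integrable lborel {a..b} (\<lambda>x. (f x)\<^sup>2)"
    by (intro borel_integrable_atLeastAtMost' continuous_intros assms)
qed

lemma L2_on_continuous_mult:
  assumes g: "continuous_on {a..b} g" and f: "L2_on {a..b} f"
  shows "L2_on {a..b} (\<lambda>x. g x * f x)"
  unfolding L2_on_def
proof
  show gf: "set_borel_measurable lborel {a..b} (\<lambda>x. g x * f x)"
    using set_integrable_L2_on_mult[OF L2_on_continuous[OF g] f]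
    by (auto simp: set_integrable_def set_borel_measurable_def)
  have "bounded (g ` {a..b})" using compact_continuous_image[OF g] compact_imp_bounded by blast
  then obtain C where C: "\<And>x. x \<in> {a..b} \<Longrightarrow> \<bar>g x\<bar> \<le> C" unfolding bounded_pos by (metis imageI real_norm_def)
  have "(\<lambda>x. (indicator {a..b} x *\<^sub>R (g x * f x))\<^sup>2) \<in> borel_measurable lborel"
    using gf unfolding set_borel_measurable_def by (rule borel_measurable_power)
  also have "(\<lambda>x. (indicator {a..b} x *\<^sub>R (g x * f x))\<^sup>2) = (\<lambda>x. indicator {a..b} x *\<^sub>R (g x * f x)\<^sup>2)"
    by (auto simp: indicator_def)
  finally have m: "set_borel_measurable lborel {a..b} (\<lambda>x. (g x * f x)\<^sup>2)" by (simp add: set_borel_measurable_def)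
  have "set_integrable lborel {a..b} (\<lambda>x. C\<^sup>2 * (f x)\<^sup>2)" using f by (simp add: L2_on_def)
  then show "set_integrable lborel {a..b} (\<lambda>x. (g x * f x)\<^sup>2)"
  proof (rule set_integrable_bound[OF _ m])
    have "(g x * f x)\<^sup>2 \<le> C\<^sup>2 * (f x)\<^sup>2" if "x \<in> {a..b}" for x
      unfolding power_mult_distrib using C[OF that] power_mono[of "\<bar>g x\<bar>" C 2] by (intro mult_right_mono) auto
    then show "AE x in lborel. x \<in> {a..b} \<longrightarrow> norm ((g x * f x)\<^sup>2) \<le> norm (C\<^sup>2 * (f x)\<^sup>2)"
      by (intro AE_I2) auto
  qed
qed

lemma L2_on_subset:
  assumes "L2_on A f" "B \<subseteq> A" "B \<in> sets borel"
  shows "L2_on B f"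
proof -
  have "(\<lambda>x. indicator A x *\<^sub>R f x) \<in> borel_measurable lborel"
    using assms unfolding L2_on_def set_borel_measurable_def by blast
  then have "(\<lambda>x. indicator B x *\<^sub>R (indicator A x *\<^sub>R f x)) \<in> borel_measurable lborel"
    by (rule borel_measurable_scaleR[rotated]) (use assms(3) in auto)
  then have "set_borel_measurable lborel B f"
    unfolding set_borel_measurable_def
    by (rule measurable_cong[THEN iffD1, rotated]) (use assms in \<open>auto simp: indicator_def\<close>)
  then show ?thesis
    using assms set_integrable_subset[of lborel A "\<lambda>x. (f x)\<^sup>2" B] unfolding L2_on_def by auto
qed

lemma set_integrable_L2_on:
  assumes "L2_on {a..b} f"
  shows "set_integrable lborel {a..b} f"
  using set_integrable_L2_on_mult[OF assms L2_on_continuous[of a b "\<lambda>_. 1"]] by simp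

lemma LBINT_nonneg: "(\<And>x. x \<in> A \<Longrightarrow> 0 \<le> f x) \<Longrightarrow> 0 \<le> (LBINT x:A. f x :: real)"
  unfolding set_lebesgue_integral_def by (intro integral_nonneg_AE AE_I2) (auto simp: indicator_def)

lemma LBINT_shift:
  fixes f :: "real \<Rightarrow> real"
  shows "(LBINT r:{a..b}. f r) = (LBINT r:{a - c..b - c}. f (c + r))"
proof -
  have "(LBINT r:{a..b}. f r) = (LINT r|lborel. indicator {a..b} (c + r) *\<^sub>R f (c + r))"
    unfolding set_lebesgue_integral_def using lborel_integral_real_affine[of 1 "\<lambda>r. indicator {a..b} r *\<^sub>R f r" c] by simp
  also have "\<dots> = (LBINT r:{a - c..b - c}. f (c + r))"
    unfolding set_lebesgue_integral_def by (intro Bochner_Integration.integral_cong) (auto simp: indicator_def)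
  finally show ?thesis .
qed

lemma L2_on_shift:
  assumes "L2_on {a..b} f"
  shows "L2_on {a - c..b - c} (\<lambda>r. f (c + r))"
proof -
  have eq: "indicator {a..b} (c + r) = (indicator {a - c..b - c} r :: real)" for r by (auto simp: indicator_def)
  have "(\<lambda>r. indicator {a..b} (c + r) *\<^sub>R f (c + r)) \<in> borel_measurable lborel"
  proof -
    have m: "(\<lambda>r. indicator {a..b} r *\<^sub>R f r) \<in> borel_measurable borel"
      using assms by (simp add: L2_on_def set_borel_measurable_def)
    have "(\<lambda>r. c + r) \<in> borel_measurable lborel" by simp
    from measurable_compose[OF this m] show ?thesis .
  qed
  moreover have "integrable lborel (\<lambda>r. indicator {a..b} (c + r) *\<^sub>R (f (c + r))\<^sup>2)"
    using assms lborel_integrable_real_affine_iff[of 1 "\<lambda>r. indicator {a..b} r *\<^sub>R (f r)\<^sup>2" c]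
    by (simp add: L2_on_def set_integrable_def)
  ultimately show ?thesis by (simp add: L2_on_def set_borel_measurable_def set_integrable_def eq)
qed

lemma LBINT_combine:
  fixes f :: "real \<Rightarrow> real"
  assumes "set_integrable lborel {a..c} f" "a \<le> b" "b \<le> c"
  shows "(LBINT x:{a..c}. f x) = (LBINT x:{a..b}. f x) + (LBINT x:{b..c}. f x :: real)"
proof -
  have sub: "set_integrable lborel {a..b} f" "set_integrable lborel {b..c} f"
    using assms by (auto intro!: set_integrable_subset[OF assms(1)])
  have "integral {a..b} f + integral {b..c} f = integral {a..c} f"
    using assms by (intro Henstock_Kurzweil_Integration.integral_combine set_borel_integral_eq_integral(1)) auto
  then show ?thesis
    unfolding set_borel_integral_eq_integral(2)[OF sub(1)] set_borel_integral_eq_integral(2)[OF sub(2)]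
      set_borel_integral_eq_integral(2)[OF assms(1)] by simp
qed

lemma continuous_on_indefinite_LBINT:
  fixes p :: "real \<Rightarrow> real"
  assumes "set_integrable lborel {0..T} p"
  shows "continuous_on {0..T} (\<lambda>s. LBINT r:{0..s}. p r)"
proof -
  have "p integrable_on {0..T}" using set_borel_integral_eq_integral(1)[OF assms] .
  then have "continuous_on {0..T} (\<lambda>s. integral {0..s} p)"
    by (rule indefinite_integral_continuous_1)
  then show ?thesis
    by (rule continuous_on_cong[THEN iffD1, rotated 2])
      (auto intro!: set_borel_integral_eq_integral(2)[symmetric] set_integrable_subset[OF assms])
qed

lemma LBINT_FTC_real:
  fixes F :: "real \<Rightarrow> real"
  assumes "a \<le> b" "\<And>x. a \<le> x \<Longrightarrow> x \<le> b \<Longrightarrow> (F has_real_derivative f x) (at x)"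
    "continuous_on {a..b} f"
  shows "(LBINT x:{a..b}. f x) = F b - F a"
proof -
  have "(f has_integral (F b - F a)) {a..b}"
    using assms by (intro fundamental_theorem_of_calculus)
      (auto simp: has_real_derivative_iff_has_vector_derivative[symmetric] intro: has_field_derivative_at_within)
  then show ?thesis
    using set_borel_integral_eq_integral(2)[OF borel_integrable_atLeastAtMost'[OF assms(3)]]
    by (simp add: integral_unique)
qed

lemma continuous_on_indefinite_integral:
  fixes p F :: "real \<Rightarrow> real"
  assumes "set_integrable lborel {0..T} p" "\<And>s. s \<in> {0..T} \<Longrightarrow> F s = c + (LBINT r:{0..s}. p r)"
  shows "continuous_on {0..T} F"
proof -
  have "continuous_on {0..T} (\<lambda>s. c + (LBINT r:{0..s}. p r))"
    by (rule continuous_on_add[OF continuous_on_const continuous_on_indefinite_LBINT[OF assms(1)]])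
  then show ?thesis by (rule continuous_on_cong[THEN iffD1, rotated 2]) (use assms(2) in auto)
qed

text \<open>
  Integration by parts for primitives of integrable functions. The two integrals are those of
  \<open>q(s) p(r)\<close> over the triangles \<open>r \<le> s\<close> and \<open>s \<le> r\<close>; together these tile the square \<open>[0, T]\<^sup>2\<close>, up to the
  diagonal.
\<close>

lemma integral_product_indefinite:
  fixes p q :: "real \<Rightarrow> real"
  assumes p: "set_integrable lborel {0..T} p" and q: "set_integrable lborel {0..T} q"
  defines "P \<equiv> \<lambda>s. LBINT r:{0..s}. p r" and "Q \<equiv> \<lambda>s. LBINT r:{0..s}. q r"
  shows "set_integrable lborel {0..T} (\<lambda>s. P s * q s)"
    "set_integrable lborel {0..T} (\<lambda>s. p s * Q s)"
    "(LBINT s:{0..T}. P s * q s) + (LBINT s:{0..T}. p s * Q s) = P T * Q T"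
proof -
  define p' where "p' r = indicator {0..T} r * p r" for r
  define q' where "q' r = indicator {0..T} r * q r" for r
  have p': "integrable lborel p'" and q': "integrable lborel q'"
    using p q unfolding p'_def q'_def set_integrable_def by auto
  have [measurable]: "p' \<in> borel_measurable borel" "q' \<in> borel_measurable borel"
    using p' q' by auto
  have Pe: "P s = (LINT r|lborel. indicator {..s} r * p' r)" if "s \<le> T" for s
    unfolding P_def set_lebesgue_integral_def p'_def using that
    by (intro Bochner_Integration.integral_cong) (auto simp: indicator_def)
  have Qe: "Q s = (LINT r|lborel. indicator {..s} r * q' r)" if "s \<le> T" for s
    unfolding Q_def set_lebesgue_integral_def q'_def using that
    by (intro Bochner_Integration.integral_cong) (auto simp: indicator_def)
  have pq: "integrable (lborel \<Otimes>\<^sub>M lborel) (\<lambda>(s, r). q' s * p' r)"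
    by (rule lborel_pair.Fubini_integrable) (use p' q' in \<open>auto simp: abs_mult intro: AE_I2\<close>)
  have i1: "integrable (lborel \<Otimes>\<^sub>M lborel) (\<lambda>(s, r). if r \<le> s then q' s * p' r else 0)"
    by (rule Bochner_Integration.integrable_bound[OF pq]) auto
  have i2: "integrable (lborel \<Otimes>\<^sub>M lborel) (\<lambda>(s, r). if s < r then q' s * p' r else 0)"
    by (rule Bochner_Integration.integrable_bound[OF pq]) auto
  have i3: "integrable (lborel \<Otimes>\<^sub>M lborel) (\<lambda>(s, r). if s \<le> r then q' s * p' r else 0)"
    by (rule Bochner_Integration.integrable_bound[OF pq]) auto
  have in1: "(LINT r|lborel. (if r \<le> s then q' s * p' r else 0)) = indicator {0..T} s *\<^sub>R (P s * q s)" for s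
  proof (cases "s \<in> {0..T}")
    case True
    have "(LINT r|lborel. (if r \<le> s then q' s * p' r else 0)) = (LINT r|lborel. q' s * (indicator {..s} r * p' r))"
      by (intro Bochner_Integration.integral_cong) (auto simp: indicator_def)
    then show ?thesis using True by (simp add: Pe q'_def)
  next
    case False then have "q' s = 0" by (simp add: q'_def)
    then show ?thesis using False by (simp cong: if_cong)
  qed
  have in3: "(LINT s|lborel. (if s \<le> r then q' s * p' r else 0)) = indicator {0..T} r *\<^sub>R (p r * Q r)" for r
  proof (cases "r \<in> {0..T}")
    case True
    have "(LINT s|lborel. (if s \<le> r then q' s * p' r else 0)) = (LINT s|lborel. p' r * (indicator {..r} s * q' s))"
      by (intro Bochner_Integration.integral_cong) (auto simp: indicator_def)
    then show ?thesis using True by (simp add: Qe p'_def)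
  next
    case False then have "p' r = 0" by (simp add: p'_def)
    then show ?thesis using False by (simp cong: if_cong)
  qed
  have "integrable lborel (\<lambda>s. LINT r|lborel. (if r \<le> s then q' s * p' r else 0))"
    using lborel_pair.integrable_fst[OF i1] by simp
  then show "set_integrable lborel {0..T} (\<lambda>s. P s * q s)"
    unfolding in1 set_integrable_def .
  have "integrable lborel (\<lambda>r. LINT s|lborel. (if s \<le> r then q' s * p' r else 0))"
    using lborel_pair.integrable_snd[OF i3] by simp
  then show "set_integrable lborel {0..T} (\<lambda>s. p s * Q s)"
    unfolding in3 set_integrable_def .
  have "(LBINT s:{0..T}. P s * q s) = (integral\<^sup>L (lborel \<Otimes>\<^sub>M lborel) (\<lambda>(s,r). (if r \<le> s then q' s * p' r else 0)))"
    unfolding set_lebesgue_integral_def in1[symmetric] using lborel_pair.integral_fst[OF i1] by simp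
  moreover have "(LBINT s:{0..T}. p s * Q s) = (integral\<^sup>L (lborel \<Otimes>\<^sub>M lborel) (\<lambda>(s,r). (if s \<le> r then q' s * p' r else 0)))"
    unfolding set_lebesgue_integral_def in3[symmetric] using lborel_pair.integral_snd[OF i3] by simp
  moreover have "(integral\<^sup>L (lborel \<Otimes>\<^sub>M lborel) (\<lambda>(s,r). (if s \<le> r then q' s * p' r else 0))) =
     (integral\<^sup>L (lborel \<Otimes>\<^sub>M lborel) (\<lambda>(s,r). (if s < r then q' s * p' r else 0)))"
  proof -
    have "(LINT s|lborel. (if s \<le> r then q' s * p' r else 0)) = (LINT s|lborel. (if s < r then q' s * p' r else 0))" for r
    proof (rule integral_cong_AE)
      show "AE s in lborel. (if s \<le> r then q' s * p' r else 0) = (if s < r then q' s * p' r else 0)"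
        using AE_lborel_singleton[of r] by eventually_elim auto
    qed measurable
    then show ?thesis
      using lborel_pair.integral_snd[OF i3] lborel_pair.integral_snd[OF i2] by simp
  qed
  moreover have "(integral\<^sup>L (lborel \<Otimes>\<^sub>M lborel) (\<lambda>(s,r). (if r \<le> s then q' s * p' r else 0))) +
     (integral\<^sup>L (lborel \<Otimes>\<^sub>M lborel) (\<lambda>(s,r). (if s < r then q' s * p' r else 0))) = (integral\<^sup>L (lborel \<Otimes>\<^sub>M lborel) (\<lambda>(s,r). q' s * p' r))"
    unfolding Bochner_Integration.integral_add[OF i1 i2, symmetric]
    by (intro Bochner_Integration.integral_cong) auto
  moreover have "(integral\<^sup>L (lborel \<Otimes>\<^sub>M lborel) (\<lambda>(s,r). q' s * p' r)) = P T * Q T"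
  proof -
    have "(integral\<^sup>L (lborel \<Otimes>\<^sub>M lborel) (\<lambda>(s,r). q' s * p' r)) = (LINT s|lborel. LINT r|lborel. q' s * p' r)"
      using lborel_pair.integral_fst[OF pq] by simp
    also have "\<dots> = (LINT s|lborel. q' s) * (LINT r|lborel. p' r)" by simp
    also have "\<dots> = Q T * P T"
      by (simp add: P_def Q_def p'_def q'_def set_lebesgue_integral_def)
    finally show ?thesis by simp
  qed
  ultimately show "(LBINT s:{0..T}. P s * q s) + (LBINT s:{0..T}. p s * Q s) = P T * Q T" by simp
qed

text \<open>
  The chain rule \<open>(e\<^sup>2)' = 2 e e'\<close> in integrated form, for an absolutely continuous \<open>e\<close>.
\<close>

lemma integral_square_indefinite:
  fixes q e :: "real \<Rightarrow> real"
  assumes q: "set_integrable lborel {0..T} q" and "0 \<le> T"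
    and e: "\<And>s. s \<in> {0..T} \<Longrightarrow> e s = e 0 + (LBINT r:{0..s}. q r)"
  shows "set_integrable lborel {0..T} (\<lambda>s. e s * q s)" "(LBINT s:{0..T}. 2 * (e s * q s)) = (e T)\<^sup>2 - (e 0)\<^sup>2"
proof -
  define Q where "Q s = (LBINT r:{0..s}. q r)" for s
  note by_parts = integral_product_indefinite[OF q q, folded Q_def]
  have eq: "(e s * q s) = Q s * q s + e 0 * q s" if "s \<in> {0..T}" for s
    using e[OF that] by (simp add: Q_def algebra_simps)
  have "set_integrable lborel {0..T} (\<lambda>s. Q s * q s + e 0 * q s)"
    using by_parts(1) q by (intro set_integral_add set_integrable_mult_right) auto
  then show i: "set_integrable lborel {0..T} (\<lambda>s. e s * q s)"
    using set_integrable_cong[of lborel lborel "{0..T}" "{0..T}" "\<lambda>s. e s * q s" "\<lambda>s. Q s * q s + e 0 * q s"] eq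
    by simp
  have "(LBINT s:{0..T}. e s * q s) = (LBINT s:{0..T}. Q s * q s + e 0 * q s)"
    using eq by (intro set_lebesgue_integral_cong) auto
  also have "\<dots> = (LBINT s:{0..T}. Q s * q s) + e 0 * Q T"
    by (subst set_integral_add) (auto simp: Q_def intro: by_parts(1)[unfolded Q_def] q)
  also have "(LBINT s:{0..T}. Q s * q s) = (Q T)\<^sup>2 / 2"
    using by_parts(3) by (simp add: power2_eq_square mult.commute)
  finally have "2 * (LBINT s:{0..T}. e s * q s) = (e T)\<^sup>2 - (e 0)\<^sup>2"
    using e[of T] \<open>0 \<le> T\<close> by (simp add: Q_def power2_eq_square algebra_simps)
  then show "(LBINT s:{0..T}. 2 * (e s * q s)) = (e T)\<^sup>2 - (e 0)\<^sup>2"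
    by (simp only: set_integral_mult_right)
qed

section \<open>The minimal energy of a single path\<close>

text \<open>
  The solution of \<open>y' = w - y\<close>, \<open>y(0) = 0\<close>.
\<close>

definition exp_smooth :: "(real \<Rightarrow> real) \<Rightarrow> real \<Rightarrow> real" where
  "exp_smooth w t = (LBINT r:{0..t}. exp (r - t) * w r)"

text \<open>
  Equivalently \<open>w(0) exp(-t) + \<integral> exp(r - t) dw(r)\<close>: the Ornstein-Uhlenbeck process driven by \<open>w\<close>, written
  without a stochastic integral.
\<close>

definition exp_residual :: "(real \<Rightarrow> real) \<Rightarrow> real \<Rightarrow> real" where
  "exp_residual w t = w t - exp_smooth w t"

lemma exp_smooth_eq: "exp_smooth w t = exp (- t) * (LBINT r:{0..t}. exp r * w r)"
  unfolding exp_smooth_def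
  by (subst set_integral_mult_right[symmetric]) (simp add: exp_diff exp_minus field_simps)

lemma continuous_on_exp_smooth:
  assumes "L2_on {0..T} w"
  shows "continuous_on {0..T} (exp_smooth w)"
proof -
  have "set_integrable lborel {0..T} (\<lambda>r. exp r * w r)"
    by (intro set_integrable_L2_on_mult assms L2_on_continuous continuous_intros)
  from continuous_on_indefinite_LBINT[OF this] show ?thesis
    unfolding exp_smooth_eq by (intro continuous_intros)
qed

lemma L2_on_exp_residual:
  assumes "L2_on {0..T} w"
  shows "L2_on {0..T} (exp_residual w)"
  unfolding exp_residual_def
  by (intro L2_on_diff assms L2_on_continuous continuous_on_exp_smooth)

text \<open>
  The differential equation in integrated form. It is integration by parts of
  \<open>exp(-s)\<close> against the primitive of \<open>exp(s) w(s)\<close>.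
\<close>

lemma exp_smooth_ode:
  assumes w: "L2_on {0..T} w" and t: "t \<in> {0..T}"
  shows "exp_smooth w t = (LBINT s:{0..t}. exp_residual w s)"
proof -
  have w': "L2_on {0..t} w" using L2_on_subset[OF w, of "{0..t}"] t by auto
  define R where "R s = (LBINT r:{0..s}. exp r * w r)" for s
  have P: "(LBINT r:{0..s}. - exp (- r)) = exp (- s) - 1" if "0 \<le> s" for s :: real
  proof -
    have "(LBINT r:{0..s}. - exp (- r)) = exp (- s) - exp (- 0)"
      by (rule LBINT_FTC_real[OF that]) (auto intro!: derivative_eq_intros continuous_intros)
    then show ?thesis by simp
  qed
  have i1: "set_integrable lborel {0..t} (\<lambda>r::real. - exp (- r))"
    by (intro borel_integrable_atLeastAtMost' continuous_intros)
  have i2: "set_integrable lborel {0..t} (\<lambda>r. exp r * w r)"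
    by (intro set_integrable_L2_on_mult w' L2_on_continuous continuous_intros)
  have iw: "set_integrable lborel {0..t} w" using set_integrable_L2_on[OF w'] .
  have ism: "set_integrable lborel {0..t} (exp_smooth w)"
    by (intro borel_integrable_atLeastAtMost' continuous_on_exp_smooth w')
  note bp = integral_product_indefinite(3)[OF i1 i2, folded R_def]
  have "(LBINT s:{0..t}. (LBINT r:{0..s}. - exp (- r)) * (exp s * w s)) = (LBINT s:{0..t}. w s - exp s * w s)"
  proof (intro set_lebesgue_integral_cong allI impI)
    fix s assume "s \<in> {0..t}"
    then have "(LBINT r:{0..s}. - exp (- r)) = exp (- s) - 1" using P by simp
    then show "(LBINT r:{0..s}. - exp (- r)) * (exp s * w s) = w s - exp s * w s"
      by (simp add: left_diff_distrib exp_minus)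
  qed simp
  also have "\<dots> = (LBINT s:{0..t}. w s) - R t"
    unfolding R_def by (intro set_integral_diff(2) iw i2)
  finally have 1: "(LBINT s:{0..t}. (LBINT r:{0..s}. - exp (- r)) * (exp s * w s)) = (LBINT s:{0..t}. w s) - R t" .
  have 2: "(LBINT s:{0..t}. - exp (- s) * R s) = - (LBINT s:{0..t}. exp_smooth w s)"
    by (subst set_integral_uminus[OF ism, symmetric]) (simp add: exp_smooth_eq R_def)
  have "(LBINT s:{0..t}. exp_residual w s) = (LBINT s:{0..t}. w s) - (LBINT s:{0..t}. exp_smooth w s)"
    unfolding exp_residual_def by (intro set_integral_diff(2) iw ism)
  also have "\<dots> = exp (- t) * R t"
    proof -
    have "(LBINT s:{0..t}. w s) - R t - (LBINT s:{0..t}. exp_smooth w s) = (exp (- t) - 1) * R t"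
      using bp t unfolding 1 2 by (simp only: P atLeastAtMost_iff)
    then show ?thesis by (simp add: left_diff_distrib)
  qed
  finally show ?thesis by (simp add: exp_smooth_eq R_def)
qed

lemma exp_smooth_square_le:
  assumes w: "L2_on {0..t} w" and t: "0 \<le> t"
  shows "(exp_smooth w t)\<^sup>2 \<le> (LBINT r:{0..t}. (w r)\<^sup>2)"
proof -
  have "(LBINT r:{0..t}. (exp (r - t))\<^sup>2) = exp (2 * (t - t)) / 2 - exp (2 * (0 - t)) / 2"
    using t
  proof (intro LBINT_FTC_real)
    show "((\<lambda>r. exp (2 * (r - t)) / 2) has_real_derivative (exp (x - t))\<^sup>2) (at x)" for x
      by (auto intro!: derivative_eq_intros simp: exp_double[symmetric] right_diff_distrib)
  qed (auto intro!: continuous_intros)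
  also have "\<dots> \<le> 1"
    using exp_ge_zero[of "2 * (0 - t)"] by (simp del: exp_ge_zero)
  finally have E: "(LBINT r:{0..t}. (exp (r - t))\<^sup>2) \<le> 1" .
  have "(exp_smooth w t)\<^sup>2 \<le> (LBINT r:{0..t}. (exp (r - t))\<^sup>2) * (LBINT r:{0..t}. (w r)\<^sup>2)"
    unfolding exp_smooth_def by (intro L2_on_Cauchy_Schwarz w L2_on_continuous continuous_intros)
  also have "\<dots> \<le> 1 * (LBINT r:{0..t}. (w r)\<^sup>2)"
    by (intro mult_right_mono E LBINT_nonneg) simp
  finally show ?thesis by simp
qed

text \<open>
  With \<open>e = F - Y\<close> one has \<open>e' = p - (w - Y)\<close>, and pointwise
  \<open>(F - w)\<^sup>2 + p\<^sup>2 = (w - Y)\<^sup>2 + 2 e e' + (p - e)\<^sup>2\<close>; the middle term integrates to the boundary terms.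
\<close>

lemma energy_decomposition:
  assumes T: "0 \<le> T" and w: "L2_on {0..T} w" and p: "L2_on {0..T} p" and Y2: "L2_on {0..T} Y"
    and F: "\<And>s. s \<in> {0..T} \<Longrightarrow> F s = F 0 + (LBINT r:{0..s}. p r)"
    and Y: "\<And>s. s \<in> {0..T} \<Longrightarrow> Y s = Y 0 + (LBINT r:{0..s}. w r - Y r)"
  shows "(LBINT s:{0..T}. (F s - w s)\<^sup>2 + (p s)\<^sup>2) =
    (LBINT s:{0..T}. (w s - Y s)\<^sup>2) + (F T - Y T)\<^sup>2 - (F 0 - Y 0)\<^sup>2 + (LBINT s:{0..T}. (p s - (F s - Y s))\<^sup>2)"
proof -
  have F2: "L2_on {0..T} F" by (intro L2_on_continuous continuous_on_indefinite_integral[OF set_integrable_L2_on[OF p] F])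
  define q where "q s = p s - (w s - Y s)" for s
  define e where "e s = F s - Y s" for s
  have wY: "L2_on {0..T} (\<lambda>s. w s - Y s)" by (intro L2_on_diff w Y2)
  have q: "L2_on {0..T} q" unfolding q_def by (intro L2_on_diff w p Y2)
  have e2: "L2_on {0..T} e" unfolding e_def by (intro L2_on_diff F2 Y2)
  have pe: "L2_on {0..T} (\<lambda>s. p s - e s)" by (intro L2_on_diff p e2)
  have e: "e s = e 0 + (LBINT r:{0..s}. q r)" if s: "s \<in> {0..T}" for s
  proof -
    have sub: "set_integrable lborel {0..s} h" if "L2_on {0..T} h" for h
      using set_integrable_subset[OF set_integrable_L2_on[OF that], of "{0..s}"] s by auto
    have "(LBINT r:{0..s}. q r) = (LBINT r:{0..s}. p r) - (LBINT r:{0..s}. w r - Y r)"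
      unfolding q_def by (intro set_integral_diff sub p wY)
    then show ?thesis using F[OF s] Y[OF s] by (simp add: e_def)
  qed
  note sq = integral_square_indefinite[OF set_integrable_L2_on[OF q] T e]
  have i1: "set_integrable lborel {0..T} (\<lambda>s. (w s - Y s)\<^sup>2)" using wY by (simp add: L2_on_def)
  have i2: "set_integrable lborel {0..T} (\<lambda>s. 2 * (e s * q s))" using sq(1) by simp
  have i3: "set_integrable lborel {0..T} (\<lambda>s. (p s - e s)\<^sup>2)" using pe by (simp add: L2_on_def)
  have "(LBINT s:{0..T}. (F s - w s)\<^sup>2 + (p s)\<^sup>2) =
    (LBINT s:{0..T}. ((w s - Y s)\<^sup>2 + 2 * (e s * q s)) + (p s - e s)\<^sup>2)"
    by (intro set_lebesgue_integral_cong) (auto simp: e_def q_def power2_eq_square algebra_simps)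
  also have "\<dots> = (LBINT s:{0..T}. (w s - Y s)\<^sup>2) + (LBINT s:{0..T}. 2 * (e s * q s)) + (LBINT s:{0..T}. (p s - e s)\<^sup>2)"
    using i1 i2 i3 by (simp add: set_integral_add)
  finally show ?thesis using sq(2) by (simp add: e_def)
qed

text \<open>
  The derivative of a function in \<open>W21\<close> is only Lebesgue measurable. Passing to a Borel representative of it
  moves the problem from \<open>lebesgue_on\<close> to \<open>lborel\<close>.
\<close>

lemma W21_indefinite_integral:
  assumes f: "f \<in> W21 T" and T: "0 \<le> T"
  obtains p where "L2_on {0..T} p" "AE s in lborel. s \<in> {0..T} \<longrightarrow> p s = deriv f s"
    "\<And>t. t \<in> {0..T} \<Longrightarrow> f t = f 0 + (LBINT r:{0..t}. p r)"
proof -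
  have ac: "abs_continuous_on_interval 0 T f"
    and diff: "AE s in lebesgue_on {0..T}. f field_differentiable (at s)"
    and m: "deriv f \<in> borel_measurable (lebesgue_on {0..T})"
    and i: "integrable (lebesgue_on {0..T}) (\<lambda>x. (deriv f x)\<^sup>2)"
    using f by (auto simp: W21_def square_integrable_def)
  have "AE s in lebesgue. s \<in> {0..T} \<longrightarrow> f field_differentiable (at s)"
    using diff by (simp add: AE_restrict_space_iff)
  then obtain N where N': "{s \<in> space lebesgue. \<not> (s \<in> {0..T} \<longrightarrow> f field_differentiable (at s))} \<subseteq> N"
      "emeasure lebesgue N = 0" "N \<in> sets lebesgue"
    by (rule AE_E)
  then have N: "N \<in> null_sets lebesgue" "{s. \<not> (s \<in> {0..T} \<longrightarrow> f field_differentiable (at s))} \<subseteq> N"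
    by (auto intro: null_setsI)
  then have negl: "negligible N" by (simp add: negligible_iff_null_sets)
  define g where "g s = indicator {0..T} s * deriv f s" for s
  have g: "g \<in> borel_measurable lebesgue"
    using m unfolding g_def by (subst (asm) borel_measurable_restrict_space_iff) auto
  then obtain p where [measurable]: "p \<in> borel_measurable lborel" and gp: "AE x in lborel. g x = p x"
    using completion_ex_borel_measurable_real by blast
  have g2: "integrable lebesgue (\<lambda>x. (g x)\<^sup>2)"
  proof -
    have "integrable lebesgue (\<lambda>x. indicator {0..T} x *\<^sub>R (deriv f x)\<^sup>2)"
      using i by (subst (asm) integrable_restrict_space) auto
    also have "(\<lambda>x. indicator {0..T} x *\<^sub>R (deriv f x)\<^sup>2) = (\<lambda>x. (g x)\<^sup>2)"
      by (auto simp: g_def indicator_def)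
    finally show ?thesis .
  qed
  have "integrable lebesgue (\<lambda>x. (p x)\<^sup>2)"
  proof (rule integrable_cong_AE_imp[OF g2])
    show "AE x in lebesgue. (g x)\<^sup>2 = (p x)\<^sup>2"
      using AE_completion[OF gp] by eventually_elim auto
    show "(\<lambda>x. (p x)\<^sup>2) \<in> borel_measurable lebesgue" by (intro measurable_completion) measurable
  qed
  then have "integrable lborel (\<lambda>x. (p x)\<^sup>2)"
    by (subst (asm) integrable_completion) measurable
  then have p2: "L2_on {0..T} p"
    unfolding L2_on_def set_borel_measurable_def set_integrable_def
    using integrable_mult_indicator[of "{0..T}" lborel "\<lambda>x. (p x)\<^sup>2"] by auto
  have AE: "AE s in lborel. s \<in> {0..T} \<longrightarrow> p s = deriv f s"
    using gp by eventually_elim (auto simp: g_def)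
  have "f t = f 0 + (LBINT r:{0..t}. p r)" if t: "t \<in> {0..T}" for t
  proof -
    have "(deriv f has_integral (f t - f 0)) {0..t}"
      using t N(2) by (intro abs_continuous_fundamental_theorem[OF abs_continuous_on_subinterval[OF ac] _ negl]) auto
    then have "(g has_integral (f t - f 0)) {0..t}"
      by (rule has_integral_cong[THEN iffD1, rotated]) (use t in \<open>auto simp: g_def\<close>)
    then have "(p has_integral (f t - f 0)) {0..t}"
    proof (rule has_integral_AE[THEN iffD1, rotated])
      show "AE x\<in>{0..t} in lborel. g x = p x" using gp by eventually_elim simp
    qed
    moreover have "set_integrable lborel {0..t} p"
      by (intro set_integrable_L2_on L2_on_subset[OF p2]) (use t in auto)
    ultimately show ?thesis
      using set_borel_integral_eq_integral(2) by (metis add.commute diff_add_cancel integral_unique)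
  qed
  from that[OF p2 AE this] show ?thesis .
qed

lemma borel_measurable_completion_cong_AE:
  fixes f g :: "'a \<Rightarrow> real"
  assumes f: "f \<in> borel_measurable (completion M)" and eq: "AE x in completion M. f x = g x"
  shows "g \<in> borel_measurable (completion M)"
proof (rule measurableI)
  fix A :: "real set" assume "A \<in> sets borel"
  then have "f -` A \<inter> space (completion M) \<in> sets (completion M)" using f by measurable
  then show "g -` A \<inter> space (completion M) \<in> sets (completion M)"
    by (rule completion.in_sets_AE[rotated]) (use eq in \<open>auto elim: eventually_mono\<close>)
qed simp

lemma energy_eq_LBINT:
  assumes w: "L2_on {0..T} w" and F: "L2_on {0..T} f" and p: "L2_on {0..T} p"
    and AE: "AE s in lborel. s \<in> {0..T} \<longrightarrow> p s = deriv f s"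
  shows "energy T f w = (LBINT s:{0..T}. (f s - w s)\<^sup>2 + (p s)\<^sup>2)"
proof -
  define h where "h s = indicator {0..T} s * ((f s - w s)\<^sup>2 + (p s)\<^sup>2)" for s
  have "L2_on {0..T} (\<lambda>s. f s - w s)" by (intro L2_on_diff F w)
  then have "set_integrable lborel {0..T} (\<lambda>s. (f s - w s)\<^sup>2 + (p s)\<^sup>2)"
    using p by (intro set_integral_add) (auto simp: L2_on_def)
  then have h: "integrable lborel h" by (simp add: set_integrable_def h_def[abs_def])
  then have [measurable]: "h \<in> borel_measurable lborel" by auto
  have AE': "AE s in lebesgue. h s = indicator {0..T} s * ((f s - w s)\<^sup>2 + (deriv f s)\<^sup>2)"
    using AE_completion[OF AE] by eventually_elim (auto simp: h_def indicator_def)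
  have "energy T f w = (LINT s|lebesgue. indicator {0..T} s * ((f s - w s)\<^sup>2 + (deriv f s)\<^sup>2))"
    unfolding energy_def by (subst integral_restrict_space) auto
  also have "\<dots> = integral\<^sup>L lebesgue h"
  proof (rule integral_cong_AE)
    show "AE s in lebesgue. indicator {0..T} s * ((f s - w s)\<^sup>2 + (deriv f s)\<^sup>2) = h s"
      using AE' by eventually_elim simp
    show "h \<in> borel_measurable lebesgue" by (intro measurable_completion) simp
    then show "(\<lambda>s. indicator {0..T} s * ((f s - w s)\<^sup>2 + (deriv f s)\<^sup>2)) \<in> borel_measurable lebesgue"
      by (rule borel_measurable_completion_cong_AE) (rule AE')
  qed
  also have "\<dots> = integral\<^sup>L lborel h" by (rule integral_completion) simp
  finally show ?thesis by (simp add: h_def[abs_def] set_lebesgue_integral_def)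
qed

text \<open>
  The derivative at the two end points is one-sided and may differ from \<open>deriv f\<close> there, hence the
  formulation up to a null set. Absolute continuity comes from the Lipschitz bound.
\<close>

lemma C1_imp_W21:
  assumes T: "0 \<le> T" and g: "continuous_on {0..T} g"
    and der: "\<And>s. s \<in> {0..T} \<Longrightarrow> (f has_real_derivative g s) (at s within {0..T})"
  shows "f \<in> W21 T" "AE s in lborel. s \<in> {0..T} \<longrightarrow> g s = deriv f s"
proof -
  have der': "(f has_real_derivative g s) (at s)" if "s \<in> {0<..<T}" for s
    using der[of s] that by (auto simp: at_within_Icc_at)
  have AE01: "AE s in lborel. s \<noteq> 0 \<and> s \<noteq> T"
    using AE_lborel_singleton[of 0] AE_lborel_singleton[of T] by eventually_elim simp
  then show AE: "AE s in lborel. s \<in> {0..T} \<longrightarrow> g s = deriv f s"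
  proof eventually_elim
    case (elim s) then show ?case using DERIV_imp_deriv[OF der'[of s]] by auto
  qed
  have diff: "AE s in lebesgue_on {0..T}. f field_differentiable (at s)"
    unfolding AE_restrict_space_iff[of "{0..T}" lebesgue, simplified]
    using AE_completion[OF AE01]
  proof eventually_elim
    case (elim s) then show ?case using der'[of s] by (auto simp: field_differentiable_def)
  qed
  obtain K where K: "\<And>s. s \<in> {0..T} \<Longrightarrow> \<bar>g s\<bar> \<le> K" "K > 0"
  proof -
    have "bounded (g ` {0..T})" using compact_continuous_image[OF g] compact_imp_bounded by blast
    then show ?thesis using that unfolding bounded_pos by (metis imageI real_norm_def)
  qed
  have lip: "\<bar>f x - f y\<bar> \<le> K * \<bar>x - y\<bar>" if "x \<in> {0..T}" "y \<in> {0..T}" for x y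
    using field_differentiable_bound[of "{0..T}" f g K x y] der K that by auto
  have ac: "abs_continuous_on_interval 0 T f"
    unfolding abs_continuous_on_interval_def
  proof (intro allI impI)
    fix e :: real assume "0 < e"
    show "\<exists>\<delta>>0. \<forall>\<D> S. \<D> division_of S \<and> S \<subseteq> {0..T} \<and> (\<Sum>K\<in>\<D>. Sup K - Inf K) < \<delta> \<longrightarrow>
        (\<Sum>K\<in>\<D>. \<bar>f (Sup K) - f (Inf K)\<bar>) < e"
    proof (intro exI[of _ "e / K"] conjI allI impI; (elim conjE)?)
      show "0 < e / K" using \<open>0 < e\<close> K by simp
      fix \<D> :: "real set set" and S assume D: "\<D> division_of S" "S \<subseteq> {0..T}" "(\<Sum>K\<in>\<D>. Sup K - Inf K) < e / K"
      have "(\<Sum>J\<in>\<D>. \<bar>f (Sup J) - f (Inf J)\<bar>) \<le> (\<Sum>J\<in>\<D>. K * (Sup J - Inf J))"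
      proof (rule sum_mono)
        fix J assume J: "J \<in> \<D>"
        then obtain a b where ab: "J = cbox a b" "J \<noteq> {}" using division_ofD(3,4)[OF D(1)] by metis
        then have "a \<le> b" by simp
        moreover have "J \<subseteq> {0..T}" using division_ofD(2)[OF D(1) J] D(2) by blast
        ultimately have "a \<in> {0..T}" "b \<in> {0..T}" using ab by auto
        then show "\<bar>f (Sup J) - f (Inf J)\<bar> \<le> K * (Sup J - Inf J)"
          using lip[of b a] ab \<open>a \<le> b\<close> by simp
      qed
      also have "\<dots> = K * (\<Sum>J\<in>\<D>. Sup J - Inf J)" by (simp add: sum_distrib_left)
      also have "\<dots> < K * (e / K)" using D(3) K(2) by (intro mult_strict_left_mono) auto
      finally show "(\<Sum>J\<in>\<D>. \<bar>f (Sup J) - f (Inf J)\<bar>) < e" using K(2) by simp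
    qed
  qed
  define h where "h s = indicator {0..T} s * g s" for s
  have h: "L2_on {0..T} g" by (rule L2_on_continuous[OF g])
  have hm: "h \<in> borel_measurable lborel"
    using h by (simp add: L2_on_def set_borel_measurable_def h_def[abs_def])
  have AEh: "AE s in lebesgue. h s = indicator {0..T} s * deriv f s"
    using AE_completion[OF AE] by eventually_elim (auto simp: h_def indicator_def)
  have m: "(\<lambda>s. indicator {0..T} s * deriv f s) \<in> borel_measurable lebesgue"
    by (rule borel_measurable_completion_cong_AE[OF measurable_completion[OF hm] AEh])
  have "integrable lborel (\<lambda>s. (h s)\<^sup>2)"
  proof -
    have "integrable lborel (\<lambda>s. indicator {0..T} s *\<^sub>R (g s)\<^sup>2)"
      using h by (simp add: L2_on_def set_integrable_def)
    also have "(\<lambda>s. indicator {0..T} s *\<^sub>R (g s)\<^sup>2) = (\<lambda>s. (h s)\<^sup>2)"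
      by (auto simp: h_def indicator_def)
    finally show ?thesis .
  qed
  then have "integrable lebesgue (\<lambda>s. (h s)\<^sup>2)"
    using hm by (subst integrable_completion) auto
  then have "integrable lebesgue (\<lambda>s. (indicator {0..T} s * deriv f s)\<^sup>2)"
    by (rule integrable_cong_AE_imp) (use AEh m in \<open>auto elim!: eventually_mono\<close>)
  then have "square_integrable (lebesgue_on {0..T}) (deriv f)"
  proof -
    assume i: "integrable lebesgue (\<lambda>s. (indicator {0..T} s * deriv f s)\<^sup>2)"
    have "(\<lambda>s. (indicator {0..T} s * deriv f s)\<^sup>2) = (\<lambda>s. indicator {0..T} s *\<^sub>R (deriv f s)\<^sup>2)"
      by (auto simp: indicator_def)
    with i have "integrable (lebesgue_on {0..T}) (\<lambda>s. (deriv f s)\<^sup>2)"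
      by (subst integrable_restrict_space) auto
    moreover have "deriv f \<in> borel_measurable (lebesgue_on {0..T})"
      using m by (subst borel_measurable_restrict_space_iff) auto
    ultimately show ?thesis by (simp add: square_integrable_def)
  qed
  with ac diff show "f \<in> W21 T" by (simp add: W21_def)
qed

text \<open>
  The solution of \<open>f' = f - Y\<close> with terminal value \<open>f(T) = Y(T)\<close>; these are the conditions under which the
  two nonnegative terms of \<open>energy_decomposition\<close> that involve \<open>F\<close> vanish.
\<close>

definition optimal_profile :: "real \<Rightarrow> (real \<Rightarrow> real) \<Rightarrow> real \<Rightarrow> real" where
  "optimal_profile T Y s = exp s * (exp (- T) * Y T + (LBINT r:{0..T}. exp (- r) * Y r) - (LBINT r:{0..s}. exp (- r) * Y r))"

lemma optimal_profile:
  assumes T: "0 \<le> T" and Y: "continuous_on {0..T} Y"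
  shows "optimal_profile T Y T = Y T"
    "s \<in> {0..T} \<Longrightarrow> (optimal_profile T Y has_real_derivative (optimal_profile T Y s - Y s)) (at s within {0..T})"
proof -
  show "optimal_profile T Y T = Y T"
    by (simp add: optimal_profile_def exp_minus)
  assume s: "s \<in> {0..T}"
  have c: "continuous_on {0..T} (\<lambda>r. exp (- r) * Y r)" by (intro continuous_intros Y)
  have "((\<lambda>u. integral {0..u} (\<lambda>r. exp (- r) * Y r)) has_real_derivative exp (- s) * Y s) (at s within {0..T})"
    using integral_has_real_derivative[OF c s] .
  then have d: "((\<lambda>u. LBINT r:{0..u}. exp (- r) * Y r) has_real_derivative exp (- s) * Y s) (at s within {0..T})"
  proof (rule has_field_derivative_transform_within[where d=1])
    fix u assume "u \<in> {0..T}"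
    then have "continuous_on {0..u} (\<lambda>r. exp (- r) * Y r)" using continuous_on_subset[OF c] by simp
    then show "integral {0..u} (\<lambda>r. exp (- r) * Y r) = (LBINT r:{0..u}. exp (- r) * Y r)"
      by (intro set_borel_integral_eq_integral(2)[symmetric] borel_integrable_atLeastAtMost')
  qed (use s in auto)
  show "(optimal_profile T Y has_real_derivative (optimal_profile T Y s - Y s)) (at s within {0..T})"
    unfolding optimal_profile_def
    by (rule derivative_eq_intros d refl)+ (simp add: algebra_simps exp_minus)
qed

definition min_energy :: "real \<Rightarrow> (real \<Rightarrow> real) \<Rightarrow> real" where
  "min_energy T w = (LBINT s:{0..T}. (exp_residual w s)\<^sup>2)
     - 2 * (LBINT s:{0..T}. exp (- s) * exp_residual w s)\<^sup>2 / (1 - exp (- 2 * T))"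

text \<open>
  The quadratic polynomial in \<open>a\<close> whose minimum over \<open>a\<close> is the minimal energy.
\<close>

lemma shifted_residual:
  assumes w: "L2_on {0..T} w" and T: "0 \<le> T"
  shows "(LBINT s:{0..T}. (exp_residual w s - a * exp (- s))\<^sup>2) =
     (LBINT s:{0..T}. (exp_residual w s)\<^sup>2) - 2 * a * (LBINT s:{0..T}. exp (- s) * exp_residual w s)
     + a\<^sup>2 * ((1 - exp (- 2 * T)) / 2)"
proof -
  have d: "L2_on {0..T} (exp_residual w)" by (rule L2_on_exp_residual[OF w])
  have e: "L2_on {0..T} (\<lambda>s. exp (- s))" by (intro L2_on_continuous continuous_intros)
  have i1: "set_integrable lborel {0..T} (\<lambda>s. (exp_residual w s)\<^sup>2)" using d by (simp add: L2_on_def)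
  have i2: "set_integrable lborel {0..T} (\<lambda>s. exp (- s) * exp_residual w s)"
    by (rule set_integrable_L2_on_mult[OF e d])
  have i3: "set_integrable lborel {0..T} (\<lambda>s. (exp (- s))\<^sup>2)" using e by (simp add: L2_on_def)
  have "(LBINT s:{0..T}. (exp (- s))\<^sup>2) = - exp (- 2 * T) / 2 - - exp (- 2 * 0) / 2"
    using T
  proof (intro LBINT_FTC_real)
    show "((\<lambda>s. - exp (- 2 * s) / 2) has_real_derivative (exp (- s))\<^sup>2) (at s)" for s
      by (auto intro!: derivative_eq_intros simp: exp_double[symmetric])
  qed (auto intro!: continuous_intros)
  then have E: "(LBINT s:{0..T}. (exp (- s))\<^sup>2) = (1 - exp (- 2 * T)) / 2" by simp
  have "(LBINT s:{0..T}. (exp_residual w s - a * exp (- s))\<^sup>2) =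
     (LBINT s:{0..T}. ((exp_residual w s)\<^sup>2 - (2 * a) * (exp (- s) * exp_residual w s)) + a\<^sup>2 * (exp (- s))\<^sup>2)"
    by (intro set_lebesgue_integral_cong) (auto simp: power2_eq_square algebra_simps)
  also have "\<dots> = (LBINT s:{0..T}. (exp_residual w s)\<^sup>2) - (2 * a) * (LBINT s:{0..T}. exp (- s) * exp_residual w s)
     + a\<^sup>2 * (LBINT s:{0..T}. (exp (- s))\<^sup>2)"
    using i1 i2 i3 by (simp add: set_integral_add set_integral_diff set_integrable_mult_right)
  finally show ?thesis unfolding E .
qed

lemma smooth_with_initial_value:
  assumes w: "L2_on {0..T} w" and t: "t \<in> {0..T}"
  shows "exp_smooth w t + a * exp (- t) = a + (LBINT r:{0..t}. w r - (exp_smooth w r + a * exp (- r)))"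
proof -
  have sub: "L2_on {0..t} w" by (rule L2_on_subset[OF w]) (use t in auto)
  have "(LBINT r:{0..t}. w r - (exp_smooth w r + a * exp (- r))) = (LBINT r:{0..t}. exp_residual w r - a * exp (- r))"
    by (intro set_lebesgue_integral_cong) (auto simp: exp_residual_def)
  also have "\<dots> = (LBINT r:{0..t}. exp_residual w r) - (LBINT r:{0..t}. a * exp (- r))"
    by (intro set_integral_diff set_integrable_L2_on L2_on_exp_residual sub borel_integrable_atLeastAtMost' continuous_intros)
  also have "(LBINT r:{0..t}. a * exp (- r)) = - a * exp (- t) - (- a * exp (- 0))"
    using t by (intro LBINT_FTC_real) (auto intro!: derivative_eq_intros continuous_intros)
  finally show ?thesis using exp_smooth_ode[OF w t] by simp
qed

text \<open>
  For the lower bound the comparison function \<open>Y\<close> is started at \<open>a = f(0)\<close>, so that the only negative term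
  of the decomposition vanishes and the energy is at least the quadratic in \<open>a\<close> of \<open>shifted_residual\<close>. For
  the upper bound \<open>a\<close> is the vertex of this quadratic and the competitor is \<open>optimal_profile\<close>; the negative
  term can only help.
\<close>

theorem energy_minimizer_value:
  assumes T: "0 < T" and w: "L2_on {0..T} w" and f: "energy_minimizer T w f"
  shows "energy T f w = min_energy T w"
proof -
  define A where "A = (LBINT s:{0..T}. (exp_residual w s)\<^sup>2)"
  define b where "b = (LBINT s:{0..T}. exp (- s) * exp_residual w s)"
  define C where "C = (1 - exp (- 2 * T)) / 2"
  have C: "C > 0" using T by (simp add: C_def)
  define Y where "Y a s = exp_smooth w s + a * exp (- s)" for a s
  have Yc: "continuous_on {0..T} (Y a)" for a
    unfolding Y_def by (intro continuous_intros continuous_on_exp_smooth w)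
  have Y0: "Y a 0 = a" for a using smooth_with_initial_value[OF w, of 0 a] T
    by (simp add: Y_def set_integral_at_point)
  have YI: "Y a s = Y a 0 + (LBINT r:{0..s}. w r - Y a r)" if "s \<in> {0..T}" for a s
    unfolding Y0 using smooth_with_initial_value[OF w that, of a] by (simp add: Y_def)
  (* The term of the decomposition that does not involve the competitor. *)
  have J: "(LBINT s:{0..T}. (w s - Y a s)\<^sup>2) = A - 2 * a * b + a\<^sup>2 * C" for a
    using shifted_residual[OF w, of a] T
    by (simp add: A_def b_def C_def Y_def exp_residual_def diff_diff_eq)
  have dec: "energy T g w = (A - 2 * a * b + a\<^sup>2 * C) + (g T - Y a T)\<^sup>2 - (g 0 - a)\<^sup>2
      + (LBINT s:{0..T}. (p s - (g s - Y a s))\<^sup>2)"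
    if p: "L2_on {0..T} p" "AE s in lborel. s \<in> {0..T} \<longrightarrow> p s = deriv g s"
      "\<And>t. t \<in> {0..T} \<Longrightarrow> g t = g 0 + (LBINT r:{0..t}. p r)" for g a p
  proof -
    have "L2_on {0..T} g"
      by (intro L2_on_continuous continuous_on_indefinite_integral[OF set_integrable_L2_on[OF p(1)] p(3)])
    from energy_eq_LBINT[OF w this p(1,2)]
      energy_decomposition[OF less_imp_le[OF T] w p(1) L2_on_continuous[OF Yc] p(3) YI]
    show ?thesis by (simp add: J Y0)
  qed
  have lower: "A - b\<^sup>2 / C \<le> energy T f w"
  proof -
    have "f \<in> W21 T" using f by (simp add: energy_minimizer_def)
    then obtain p where p: "L2_on {0..T} p" "AE s in lborel. s \<in> {0..T} \<longrightarrow> p s = deriv f s"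
      "\<And>t. t \<in> {0..T} \<Longrightarrow> f t = f 0 + (LBINT r:{0..t}. p r)"
      using W21_indefinite_integral less_imp_le[OF T] by blast
    let ?a = "f 0"
    have "0 \<le> (LBINT s:{0..T}. (p s - (f s - Y ?a s))\<^sup>2)"
      unfolding set_lebesgue_integral_def by (intro integral_nonneg_AE) auto
    then have "A - 2 * ?a * b + ?a\<^sup>2 * C \<le> energy T f w"
      using dec[OF p, where a="?a"] by simp
    moreover have "0 \<le> C * (?a - b / C)\<^sup>2" using C by simp
    moreover have "C * (?a - b / C)\<^sup>2 = b\<^sup>2 / C - 2 * ?a * b + ?a\<^sup>2 * C"
      using C by (simp add: power2_eq_square field_simps)
    ultimately show ?thesis by linarith
  qed
  have upper: "energy T f w \<le> A - b\<^sup>2 / C"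
  proof -
    (* The vertex of the quadratic J. *)
    define a where "a = b / C"
    define g where "g = optimal_profile T (Y a)"
    note prof = optimal_profile[OF less_imp_le[OF T] Yc[of a], folded g_def]
    define p where "p s = g s - Y a s" for s
    have pder: "(g has_real_derivative p s) (at s within {0..T})" if "s \<in> {0..T}" for s
      using prof(2)[OF that] by (simp add: p_def)
    then have "continuous_on {0..T} g" by (intro DERIV_continuous_on)
    then have pc: "continuous_on {0..T} p" unfolding p_def by (intro continuous_intros Yc)
    have g: "g \<in> W21 T" "AE s in lborel. s \<in> {0..T} \<longrightarrow> p s = deriv g s"
      using C1_imp_W21[OF less_imp_le[OF T] pc pder] by auto
    have gI: "g t = g 0 + (LBINT r:{0..t}. p r)" if t: "t \<in> {0..T}" for t
    proof -
      have "(p has_integral (g t - g 0)) {0..t}"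
        using t by (intro fundamental_theorem_of_calculus)
          (auto simp: has_real_derivative_iff_has_vector_derivative[symmetric] intro!: DERIV_subset[OF pder])
      moreover have "set_integrable lborel {0..t} p"
        using t by (intro borel_integrable_atLeastAtMost' continuous_on_subset[OF pc]) auto
      ultimately show ?thesis
        using set_borel_integral_eq_integral(2) by (metis add.commute diff_add_cancel integral_unique)
    qed
    have "energy T g w = (A - 2 * a * b + a\<^sup>2 * C) - (g 0 - a)\<^sup>2"
      using dec[OF L2_on_continuous[OF pc] g(2) gI, of a] prof(1) by (simp add: p_def)
    also have "\<dots> \<le> A - 2 * a * b + a\<^sup>2 * C" by simp
    also have "\<dots> = A - b\<^sup>2 / C" using C by (simp add: a_def power2_eq_square field_simps)
    finally show ?thesis using f g(1) unfolding energy_minimizer_def by force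
  qed
  have "b\<^sup>2 / C = 2 * b\<^sup>2 / (1 - exp (- 2 * T))" by (simp add: C_def)
  then show ?thesis using lower upper by (simp add: min_energy_def A_def b_def)
qed

text \<open>
  The mixed term is controlled by the Cauchy-Schwarz inequality with the weight \<open>exp(-s)\<close> split evenly.
\<close>

lemma min_energy_bounds:
  assumes T: "1 \<le> T" and w: "L2_on {0..T} w"
  shows "min_energy T w \<le> (LBINT s:{0..T}. (exp_residual w s)\<^sup>2)"
    "(LBINT s:{0..T}. (exp_residual w s)\<^sup>2) - 4 * (LBINT s:{0..T}. exp (- s) * (exp_residual w s)\<^sup>2) \<le> min_energy T w"
proof -
  define b where "b = (LBINT s:{0..T}. exp (- s) * exp_residual w s)"
  have d: "L2_on {0..T} (exp_residual w)" by (rule L2_on_exp_residual[OF w])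
  have c: "1 - exp (- 2 * T) \<ge> 1 / 2"
  proof -
    have "exp (- 2 * T) \<le> exp (- 1)" using T by simp
    also have "exp (- 1 :: real) \<le> 1 / 2"
      using exp_ge_add_one_self[of "1::real"] by (simp add: exp_minus field_simps)
    finally show ?thesis by simp
  qed
  show "min_energy T w \<le> (LBINT s:{0..T}. (exp_residual w s)\<^sup>2)"
  proof -
    have "0 \<le> 2 * b\<^sup>2 / (1 - exp (- 2 * T))" using c T by (intro divide_nonneg_pos) auto
    then show ?thesis by (simp add: min_energy_def b_def)
  qed
  have "b\<^sup>2 \<le> (LBINT s:{0..T}. exp (- s) * (exp_residual w s)\<^sup>2)"
  proof -
    have e: "exp (- s) = exp (- s / 2) * exp (- s / 2)" for s :: real by (simp add: exp_add[symmetric])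
    have E: "(LBINT s:{0..T}. exp (- s)) = - exp (- T) - (- exp (- 0))"
      using T by (intro LBINT_FTC_real) (auto intro!: derivative_eq_intros continuous_intros)
    have "b\<^sup>2 = (LBINT s:{0..T}. exp (- s / 2) * (exp (- s / 2) * exp_residual w s))\<^sup>2"
      unfolding b_def e by (simp only: mult.assoc)
    also have "\<dots> \<le> (LBINT s:{0..T}. (exp (- s / 2))\<^sup>2) * (LBINT s:{0..T}. (exp (- s / 2) * exp_residual w s)\<^sup>2)"
      by (intro L2_on_Cauchy_Schwarz L2_on_continuous_mult d L2_on_continuous continuous_intros) auto
    also have "\<dots> = (LBINT s:{0..T}. exp (- s)) * (LBINT s:{0..T}. exp (- s) * (exp_residual w s)\<^sup>2)"
      by (simp add: power_mult_distrib exp_double[symmetric])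
    also have "\<dots> \<le> 1 * (LBINT s:{0..T}. exp (- s) * (exp_residual w s)\<^sup>2)"
      unfolding E by (intro mult_right_mono LBINT_nonneg) auto
    finally show ?thesis by simp
  qed
  moreover have "2 * b\<^sup>2 / (1 - exp (- 2 * T)) \<le> 2 * b\<^sup>2 / (1 / 2)"
    using c T by (intro divide_left_mono) auto
  ultimately show "(LBINT s:{0..T}. (exp_residual w s)\<^sup>2) - 4 * (LBINT s:{0..T}. exp (- s) * (exp_residual w s)\<^sup>2) \<le> min_energy T w"
    by (simp add: min_energy_def b_def)
qed

section \<open>Decomposition of the residual energy into unit blocks\<close>

text \<open>
  The restart at time \<open>a\<close> forgets the past at rate \<open>exp(-t)\<close> and afterwards only sees the increments of
  \<open>w\<close> after \<open>a\<close>: for a Levy process this is the Markov property of the Ornstein-Uhlenbeck process.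
\<close>

lemma exp_residual_shift:
  assumes w: "L2_on {0..a + t} w" and a: "0 \<le> a" "0 \<le> t"
  shows "exp_residual w (a + t) = exp (- t) * exp_residual w a + exp_residual (\<lambda>r. w (a + r) - w a) t"
proof -
  have wi: "set_integrable lborel {0..a + t} (\<lambda>r. exp (r - (a + t)) * w r)"
    by (intro set_integrable_L2_on_mult w L2_on_continuous continuous_intros)
  have w2: "L2_on {0..t} (\<lambda>r. w (a + r))"
  proof -
    have "L2_on {a..a + t} w" by (rule L2_on_subset[OF w]) (use a in auto)
    from L2_on_shift[OF this, of a] show ?thesis by simp
  qed
  have i2: "set_integrable lborel {0..t} (\<lambda>r. exp (r - t) * w (a + r))"
    by (intro set_integrable_L2_on_mult w2 L2_on_continuous continuous_intros)
  have i3: "set_integrable lborel {0..t} (\<lambda>r. exp (r - t) * w a)"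
    by (intro borel_integrable_atLeastAtMost' continuous_intros)
  have "exp_smooth w (a + t) = (LBINT r:{0..a}. exp (r - (a + t)) * w r) + (LBINT r:{a..a + t}. exp (r - (a + t)) * w r)"
    unfolding exp_smooth_def using a by (intro LBINT_combine wi) auto
  also have "(LBINT r:{0..a}. exp (r - (a + t)) * w r) = (LBINT r:{0..a}. exp (- t) * (exp (r - a) * w r))"
  proof -
    have "exp (r - (a + t)) = exp (- t) * exp (r - a)" for r
      by (simp add: exp_add[symmetric])
    then show ?thesis by (simp add: mult.assoc)
  qed
  also have "\<dots> = exp (- t) * exp_smooth w a"
    unfolding exp_smooth_def by (rule set_integral_mult_right)
  also have "(LBINT r:{a..a + t}. exp (r - (a + t)) * w r) = (LBINT r:{0..t}. exp (r - t) * w (a + r))"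
    by (subst LBINT_shift[of a "a + t" _ a]) simp
  finally have 1: "exp_smooth w (a + t) = exp (- t) * exp_smooth w a + (LBINT r:{0..t}. exp (r - t) * w (a + r))" .
  have "exp_smooth (\<lambda>r. w (a + r) - w a) t = (LBINT r:{0..t}. exp (r - t) * w (a + r)) - (LBINT r:{0..t}. exp (r - t) * w a)"
    unfolding exp_smooth_def right_diff_distrib by (rule set_integral_diff(2)[OF i2 i3])
  moreover have "(LBINT r:{0..t}. exp (r - t) * w a) = exp (t - t) * w a - exp (0 - t) * w a"
    using a by (intro LBINT_FTC_real) (auto intro!: derivative_eq_intros continuous_intros)
  ultimately show ?thesis using 1 by (simp add: exp_residual_def algebra_simps)
qed

lemma exp_residual_diff:
  assumes "L2_on {0..T} w" "L2_on {0..T} w'" "t \<in> {0..T}"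
  shows "exp_residual w t - exp_residual w' t = exp_residual (\<lambda>r. w r - w' r) t"
proof -
  have "set_integrable lborel {0..t} (\<lambda>r. exp (r - t) * u r)" if "L2_on {0..T} u" for u
    using assms(3) by (intro set_integrable_L2_on_mult L2_on_continuous continuous_intros L2_on_subset[OF that]) auto
  from set_integral_diff(2)[OF this[OF assms(1)] this[OF assms(2)]]
  show ?thesis by (simp add: exp_residual_def exp_smooth_def right_diff_distrib)
qed

lemma exp_residual_square_integral_le:
  assumes e: "L2_on {0..1} e"
  shows "(LBINT t:{0..1}. (exp_residual e t)\<^sup>2) \<le> 4 * (LBINT t:{0..1}. (e t)\<^sup>2)"
proof -
  define D where "D = (LBINT t:{0..1}. (e t)\<^sup>2)"
  have i: "set_integrable lborel {0..1} (\<lambda>t. (e t)\<^sup>2)" using e by (simp add: L2_on_def)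
  have s: "(exp_smooth e t)\<^sup>2 \<le> D" if t: "t \<in> {0..1}" for t
  proof -
    have "(exp_smooth e t)\<^sup>2 \<le> (LBINT r:{0..t}. (e r)\<^sup>2)"
      by (rule exp_smooth_square_le[OF L2_on_subset[OF e]]) (use t in auto)
    also have "\<dots> \<le> (LBINT r:{0..t}. (e r)\<^sup>2) + (LBINT r:{t..1}. (e r)\<^sup>2)"
      by (simp add: LBINT_nonneg)
    also have "\<dots> = D" unfolding D_def by (rule LBINT_combine[OF i, symmetric]) (use t in auto)
    finally show ?thesis .
  qed
  have "(LBINT t:{0..1}. (exp_residual e t)\<^sup>2) \<le> (LBINT t:{0..1::real}. 2 * (e t)\<^sup>2 + 2 * D)"
  proof (rule set_integral_mono)
    show "set_integrable lborel {0..1} (\<lambda>t. (exp_residual e t)\<^sup>2)" using L2_on_exp_residual[OF e] by (simp add: L2_on_def)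
    show "set_integrable lborel {0..1::real} (\<lambda>t. 2 * (e t)\<^sup>2 + 2 * D)"
      using i borel_integrable_atLeastAtMost'[OF continuous_on_const, of 0 1 "2 * D"]
        set_integral_add(1)[of lborel "{0..1}" "\<lambda>t. 2 * (e t)\<^sup>2" "\<lambda>_. 2 * D"]
      by simp
    fix t :: real assume t: "t \<in> {0..1}"
    have "0 \<le> (e t + exp_smooth e t)\<^sup>2" by simp
    then have "(exp_residual e t)\<^sup>2 \<le> 2 * (e t)\<^sup>2 + 2 * (exp_smooth e t)\<^sup>2"
      by (simp add: exp_residual_def power2_eq_square algebra_simps)
    then show "(exp_residual e t)\<^sup>2 \<le> 2 * (e t)\<^sup>2 + 2 * D" using s[OF t] by simp
  qed
  also have "\<dots> = 2 * D + (LBINT t:{0..1::real}. 2 * D)"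
  proof -
    have "set_integrable lborel {0..1::real} (\<lambda>t. 2 * D)" by (intro borel_integrable_atLeastAtMost' continuous_intros)
    then show ?thesis using i by (simp add: set_integral_add D_def)
  qed
  also have "(LBINT t:{0..1::real}. 2 * D) = 2 * D" by (simp add: set_lebesgue_integral_def)
  finally show ?thesis by (simp add: D_def)
qed

text \<open>
  The three functionals of the increments \<open>b\<close> over a unit block that determine the residual energy of the
  block, given the state \<open>x\<close> at its beginning. The terms with \<open>block_end\<close> in the other two definitions are
  chosen such that in \<open>block_identity\<close> the squares of the states telescope.
\<close>

definition block_end :: "(real \<Rightarrow> real) \<Rightarrow> real" where
  "block_end b = exp_residual b 1"

definition block_cross :: "(real \<Rightarrow> real) \<Rightarrow> real" where
  "block_cross b = 2 * (LBINT t:{0..1}. exp (- t) * exp_residual b t) + exp (- 1) * block_end b"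

definition block_energy :: "(real \<Rightarrow> real) \<Rightarrow> real" where
  "block_energy b = (LBINT t:{0..1}. (exp_residual b t)\<^sup>2) + (block_end b)\<^sup>2 / 2"

text \<open>
  Expand \<open>(exp(-t) x + exp_residual b t)\<^sup>2\<close>. The coefficient \<open>(1 - exp(-2))/2\<close> of \<open>x\<^sup>2\<close> is the one for which
  \<open>x\<^sup>2/2\<close> minus half of the square of the next state \<open>x/e + block_end b\<close> absorbs it.
\<close>

lemma block_identity:
  assumes w: "L2_on {0..a + 1} w" and a: "0 \<le> a"
  defines "b \<equiv> \<lambda>r. w (a + r) - w a" and "x \<equiv> exp_residual w a"
  shows "exp_residual w (a + 1) = exp (- 1) * x + block_end b"
    "(LBINT s:{a..a + 1}. (exp_residual w s)\<^sup>2) =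
      block_energy b + x * block_cross b + (x\<^sup>2 - (exp_residual w (a + 1))\<^sup>2) / 2"
proof -
  have sh: "exp_residual w (a + t) = exp (- t) * x + exp_residual b t" if "t \<in> {0..1}" for t
    unfolding x_def b_def by (rule exp_residual_shift[OF L2_on_subset[OF w]]) (use that a in auto)
  show end1: "exp_residual w (a + 1) = exp (- 1) * x + block_end b" using sh[of 1] by (simp add: block_end_def)
  have b: "L2_on {0..1} b"
  proof -
    have "L2_on {a..a + 1} w" by (rule L2_on_subset[OF w]) (use a in auto)
    from L2_on_shift[OF this, of a] have "L2_on {0..1} (\<lambda>r. w (a + r))" by simp
    then show ?thesis
      unfolding b_def by (rule L2_on_diff[OF _ L2_on_continuous[OF continuous_on_const]])
  qed
  have d: "L2_on {0..1} (exp_residual b)" by (rule L2_on_exp_residual[OF b])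
  have i1: "set_integrable lborel {0..1} (\<lambda>t. (exp_residual b t)\<^sup>2)" using d by (simp add: L2_on_def)
  have i2: "set_integrable lborel {0..1} (\<lambda>t. exp (- t) * exp_residual b t)"
    by (intro set_integrable_L2_on_mult d L2_on_continuous continuous_intros)
  have i3: "set_integrable lborel {0..1} (\<lambda>t::real. exp (- 2 * t))"
    by (intro borel_integrable_atLeastAtMost' continuous_intros)
  have E: "(LBINT t:{0..1}. exp (- 2 * t)) = - exp (- 2 * 1) / 2 - - exp (- 2 * 0) / (2::real)"
    by (intro LBINT_FTC_real) (auto intro!: derivative_eq_intros continuous_intros)
  have "(LBINT s:{a..a + 1}. (exp_residual w s)\<^sup>2) = (LBINT t:{0..1}. (exp_residual w (a + t))\<^sup>2)"
    by (subst LBINT_shift[of a "a + 1" _ a]) simp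
  also have "\<dots> = (LBINT t:{0..1}. ((exp_residual b t)\<^sup>2 + (2 * x) * (exp (- t) * exp_residual b t)) + x\<^sup>2 * exp (- 2 * t))"
  proof (intro set_lebesgue_integral_cong allI impI)
    fix t :: real assume "t \<in> {0..1}"
    moreover have "exp (- 2 * t) = (exp (- t))\<^sup>2" by (simp add: exp_double[symmetric])
    ultimately show "(exp_residual w (a + t))\<^sup>2 = ((exp_residual b t)\<^sup>2 + (2 * x) * (exp (- t) * exp_residual b t)) + x\<^sup>2 * exp (- 2 * t)"
      by (simp add: sh power2_eq_square algebra_simps)
  qed simp
  also have "\<dots> = (LBINT t:{0..1}. (exp_residual b t)\<^sup>2) + (2 * x) * (LBINT t:{0..1}. exp (- t) * exp_residual b t)
      + x\<^sup>2 * ((1 - exp (- 2)) / 2)"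
    using i1 i2 i3 E by (simp add: set_integral_add set_integrable_mult_right diff_divide_distrib)
  also have "\<dots> = block_energy b + x * block_cross b + (x\<^sup>2 - (exp_residual w (a + 1))\<^sup>2) / 2"
  proof -
    have "exp (- 2 :: real) = (exp (- 1))\<^sup>2" by (simp add: exp_double[symmetric])
    then show ?thesis unfolding end1 block_energy_def block_cross_def
      by (simp add: power2_eq_square field_simps)
  qed
  finally show "(LBINT s:{a..a + 1}. (exp_residual w s)\<^sup>2) =
      block_energy b + x * block_cross b + (x\<^sup>2 - (exp_residual w (a + 1))\<^sup>2) / 2" .
qed

lemma residual_energy_blocks:
  assumes w: "\<And>T. L2_on {0..T} w"
  defines "b \<equiv> \<lambda>n r. w (real n + r) - w (real n)"
  shows "(LBINT s:{0..real N}. (exp_residual w s)\<^sup>2) =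
    (\<Sum>n<N. block_energy (b n) + exp_residual w (real n) * block_cross (b n))
      + ((exp_residual w 0)\<^sup>2 - (exp_residual w (real N))\<^sup>2) / 2"
proof (induction N)
  case 0 then show ?case by (simp add: set_integral_at_point)
next
  case (Suc N)
  have "L2_on {0..real (Suc N)} (exp_residual w)" by (rule L2_on_exp_residual[OF w])
  then have "set_integrable lborel {0..real (Suc N)} (\<lambda>s. (exp_residual w s)\<^sup>2)" by (simp add: L2_on_def)
  then have "(LBINT s:{0..real (Suc N)}. (exp_residual w s)\<^sup>2) =
     (LBINT s:{0..real N}. (exp_residual w s)\<^sup>2) + (LBINT s:{real N..real (Suc N)}. (exp_residual w s)\<^sup>2)"
    by (rule LBINT_combine) auto
  moreover have "(LBINT s:{real N..real N + 1}. (exp_residual w s)\<^sup>2) =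
    block_energy (b N) + exp_residual w (real N) * block_cross (b N) + ((exp_residual w (real N))\<^sup>2 - (exp_residual w (real N + 1))\<^sup>2) / 2"
    unfolding b_def by (rule block_identity(2)[OF w]) simp
  ultimately show ?case using Suc by (simp add: add.commute field_simps)
qed

text \<open>
  Under convergence in \<open>L2[0, 1]\<close> together with equality of the end values, which enter \<open>block_end\<close>
  pointwise and are not controlled by the \<open>L2\<close> distance.
\<close>

lemma block_functionals_continuous:
  assumes w: "L2_on {0..1} w" and wk: "\<And>k. L2_on {0..1} (wk k)" and e1: "\<And>k. wk k 1 = w 1"
    and lim: "(\<lambda>k. LBINT t:{0..1}. (wk k t - w t)\<^sup>2) \<longlonglongrightarrow> 0"
  shows "(\<lambda>k. block_end (wk k)) \<longlonglongrightarrow> block_end w"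
    "(\<lambda>k. block_cross (wk k)) \<longlonglongrightarrow> block_cross w"
    "(\<lambda>k. block_energy (wk k)) \<longlonglongrightarrow> block_energy w"
proof -
  define D where "D k = (LBINT t:{0..1}. (wk k t - w t)\<^sup>2)" for k
  define u where "u = exp_residual w"
  define v where "v k t = exp_residual (wk k) t - u t" for k t
  have e: "L2_on {0..1} (\<lambda>t. wk k t - w t)" for k by (intro L2_on_diff w wk)
  have u: "L2_on {0..1} u" unfolding u_def by (rule L2_on_exp_residual[OF w])
  have v: "L2_on {0..1} (v k)" for k unfolding v_def by (intro L2_on_diff u L2_on_exp_residual wk)
  have veq: "v k t = exp_residual (\<lambda>r. wk k r - w r) t" if "t \<in> {0..1}" for k t
    unfolding v_def u_def by (rule exp_residual_diff[OF wk w that])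
  have v2: "(LBINT t:{0..1}. (v k t)\<^sup>2) \<le> 4 * D k" for k
  proof -
    have "(LBINT t:{0..1}. (v k t)\<^sup>2) = (LBINT t:{0..1}. (exp_residual (\<lambda>r. wk k r - w r) t)\<^sup>2)"
      by (intro set_lebesgue_integral_cong) (auto simp: veq)
    also have "\<dots> \<le> 4 * D k" unfolding D_def by (rule exp_residual_square_integral_le[OF e])
    finally show ?thesis .
  qed
  have D: "D \<longlonglongrightarrow> 0" using lim by (simp add: D_def[abs_def])
  have V: "(\<lambda>k. LBINT t:{0..1}. (v k t)\<^sup>2) \<longlonglongrightarrow> 0"
  proof (rule tendsto_sandwich[OF _ _ tendsto_const])
    show "(\<lambda>k. 4 * D k) \<longlonglongrightarrow> 0" using tendsto_mult_left[OF D, of 4] by simp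
  qed (use v2 in \<open>auto intro!: always_eventually LBINT_nonneg\<close>)
  have cross: "(\<lambda>k. LBINT t:{0..1}. g t * v k t) \<longlonglongrightarrow> 0" if g: "L2_on {0..1} g" for g
  proof -
    have "(\<lambda>k. (LBINT t:{0..1}. g t * v k t)\<^sup>2) \<longlonglongrightarrow> 0"
    proof (rule tendsto_sandwich[OF _ _ tendsto_const])
      show "(\<lambda>k. (LBINT t:{0..1}. (g t)\<^sup>2) * (LBINT t:{0..1}. (v k t)\<^sup>2)) \<longlonglongrightarrow> 0"
        using tendsto_mult_left[OF V] by simp
    qed (auto intro!: always_eventually L2_on_Cauchy_Schwarz g v)
    from tendsto_real_sqrt[OF this] have "(\<lambda>k. \<bar>LBINT t:{0..1}. g t * v k t\<bar>) \<longlonglongrightarrow> 0" by simp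
    then show ?thesis by (simp only: tendsto_rabs_zero_iff)
  qed
  show be: "(\<lambda>k. block_end (wk k)) \<longlonglongrightarrow> block_end w"
  proof -
    have "(\<lambda>k. (v k 1)\<^sup>2) \<longlonglongrightarrow> 0"
    proof (rule tendsto_sandwich[OF _ _ tendsto_const D])
      have "v k 1 = - exp_smooth (\<lambda>r. wk k r - w r) 1" for k
        using veq[of 1 k] by (simp add: exp_residual_def e1)
      then show "\<forall>\<^sub>F k in sequentially. (v k 1)\<^sup>2 \<le> D k"
        using exp_smooth_square_le[OF e] by (intro always_eventually allI) (simp add: D_def)
    qed simp
    from tendsto_real_sqrt[OF this] have "(\<lambda>k. \<bar>v k 1\<bar>) \<longlonglongrightarrow> 0" by simp
    then have "(\<lambda>k. v k 1) \<longlonglongrightarrow> 0" by (simp only: tendsto_rabs_zero_iff)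
    then show ?thesis unfolding v_def u_def block_end_def by (rule LIM_zero_cancel)
  qed
  show "(\<lambda>k. block_cross (wk k)) \<longlonglongrightarrow> block_cross w"
  proof -
    have g: "L2_on {0..1} (\<lambda>t. exp (- t))" by (intro L2_on_continuous continuous_intros)
    have "(LBINT t:{0..1}. exp (- t) * exp_residual (wk k) t) = (LBINT t:{0..1}. exp (- t) * u t) + (LBINT t:{0..1}. exp (- t) * v k t)" for k
      by (subst set_integral_add(2)[symmetric, OF set_integrable_L2_on_mult[OF g u] set_integrable_L2_on_mult[OF g v]])
        (simp add: v_def algebra_simps)
    moreover have "(\<lambda>k. 2 * ((LBINT t:{0..1}. exp (- t) * u t) + (LBINT t:{0..1}. exp (- t) * v k t)) + exp (- 1) * block_end (wk k))
       \<longlonglongrightarrow> 2 * ((LBINT t:{0..1}. exp (- t) * u t) + 0) + exp (- 1) * block_end w"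
      by (intro tendsto_intros cross g be)
    ultimately show ?thesis by (simp add: block_cross_def u_def)
  qed
  show "(\<lambda>k. block_energy (wk k)) \<longlonglongrightarrow> block_energy w"
  proof -
    have "(LBINT t:{0..1}. (exp_residual (wk k) t)\<^sup>2) =
       (LBINT t:{0..1}. (u t)\<^sup>2) + 2 * (LBINT t:{0..1}. u t * v k t) + (LBINT t:{0..1}. (v k t)\<^sup>2)" for k
    proof -
      have "(LBINT t:{0..1}. (exp_residual (wk k) t)\<^sup>2) = (LBINT t:{0..1}. ((u t)\<^sup>2 + 2 * (u t * v k t)) + (v k t)\<^sup>2)"
        by (intro set_lebesgue_integral_cong) (auto simp: v_def power2_eq_square algebra_simps)
      also have "\<dots> = (LBINT t:{0..1}. (u t)\<^sup>2) + 2 * (LBINT t:{0..1}. u t * v k t) + (LBINT t:{0..1}. (v k t)\<^sup>2)"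
        using u v[of k] set_integrable_L2_on_mult[OF u v[of k]]
        by (simp add: set_integral_add set_integrable_mult_right L2_on_def)
      finally show ?thesis .
    qed
    moreover have "(\<lambda>k. (LBINT t:{0..1}. (u t)\<^sup>2) + 2 * (LBINT t:{0..1}. u t * v k t) + (LBINT t:{0..1}. (v k t)\<^sup>2) + (block_end (wk k))\<^sup>2 / 2)
       \<longlonglongrightarrow> (LBINT t:{0..1}. (u t)\<^sup>2) + 2 * 0 + 0 + (block_end w)\<^sup>2 / 2"
      by (intro tendsto_intros cross u V be) simp
    ultimately show ?thesis by (simp add: block_energy_def u_def)
  qed
qed

section \<open>Strong laws of large numbers\<close>

lemma AE_tendsto_0_of_summable_integral:
  fixes X :: "nat \<Rightarrow> 'a \<Rightarrow> real"
  assumes X: "\<And>n. integrable M (X n)" "\<And>n \<omega>. 0 \<le> X n \<omega>" and s: "summable (\<lambda>n. integral\<^sup>L M (X n))"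
  shows "AE \<omega> in M. (\<lambda>n. X n \<omega>) \<longlonglongrightarrow> 0"
proof -
  have [measurable]: "X n \<in> borel_measurable M" for n using X(1) by auto
  have "(\<integral>\<^sup>+\<omega>. (\<Sum>n. ennreal (X n \<omega>)) \<partial>M) = (\<Sum>n. \<integral>\<^sup>+\<omega>. ennreal (X n \<omega>) \<partial>M)"
    by (rule nn_integral_suminf) simp
  also have "\<dots> = (\<Sum>n. ennreal (integral\<^sup>L M (X n)))"
    by (intro suminf_cong nn_integral_eq_integral X AE_I2)
  also have "\<dots> < \<top>"
    using s X by (simp add: suminf_ennreal2 integral_nonneg_AE top.not_eq_extremum[symmetric])
  finally have "AE \<omega> in M. (\<Sum>n. ennreal (X n \<omega>)) \<noteq> \<infinity>"
    by (intro nn_integral_PInf_AE) auto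
  then show ?thesis
  proof eventually_elim
    case (elim \<omega>)
    then have "summable (\<lambda>n. X n \<omega>)"
      using X(2) by (intro summable_suminf_not_top) auto
    then show ?case by (rule summable_LIMSEQ_zero)
  qed
qed

text \<open>
  Pythagoras in \<open>L2\<close>.
\<close>

lemma sum_square_orthogonal:
  fixes Z :: "nat \<Rightarrow> 'a \<Rightarrow> real"
  assumes [measurable]: "\<And>n. Z n \<in> borel_measurable M"
    and int: "\<And>n. integrable M (\<lambda>\<omega>. (Z n \<omega>)\<^sup>2)"
    and orth: "\<And>m n. m < n \<Longrightarrow> (LINT \<omega>|M. Z m \<omega> * Z n \<omega>) = 0"
  shows "integrable M (\<lambda>\<omega>. (\<Sum>n<N. Z n \<omega>)\<^sup>2)"
    "(LINT \<omega>|M. (\<Sum>n<N. Z n \<omega>)\<^sup>2) = (\<Sum>n<N. LINT \<omega>|M. (Z n \<omega>)\<^sup>2)"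
proof -
  have prod: "integrable M (\<lambda>\<omega>. Z m \<omega> * Z n \<omega>)" for m n
    using int by (intro integrable_mult_square_integrable) auto
  have orth': "(LINT \<omega>|M. Z m \<omega> * Z n \<omega>) = (if m = n then LINT \<omega>|M. (Z n \<omega>)\<^sup>2 else 0)" for m n
  proof (cases m n rule: linorder_cases)
    case greater
    then show ?thesis using orth[of n m] by (simp add: mult.commute[of "Z m _"])
  qed (use orth[of m n] in \<open>simp_all add: power2_eq_square\<close>)
  have eq: "(\<Sum>n<N. Z n \<omega>)\<^sup>2 = (\<Sum>m<N. \<Sum>n<N. Z m \<omega> * Z n \<omega>)" for \<omega>
    by (simp add: power2_eq_square sum_product)
  show "integrable M (\<lambda>\<omega>. (\<Sum>n<N. Z n \<omega>)\<^sup>2)" unfolding eq by (intro Bochner_Integration.integrable_sum prod)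
  have "(LINT \<omega>|M. (\<Sum>n<N. Z n \<omega>)\<^sup>2) = (\<Sum>m<N. \<Sum>n<N. (LINT \<omega>|M. Z m \<omega> * Z n \<omega>))"
    unfolding eq by (simp add: Bochner_Integration.integral_sum prod)
  also have "\<dots> = (\<Sum>n<N. LINT \<omega>|M. (Z n \<omega>)\<^sup>2)" by (simp add: orth' sum.delta)
  finally show "(LINT \<omega>|M. (\<Sum>n<N. Z n \<omega>)\<^sup>2) = (\<Sum>n<N. LINT \<omega>|M. (Z n \<omega>)\<^sup>2)" .
qed

lemma ex_square_bracket: "\<exists>k::nat. k\<^sup>2 \<le> n \<and> n < (Suc k)\<^sup>2"
proof (induction n)
  case (Suc n)
  then obtain k where "k\<^sup>2 \<le> n" "n < (Suc k)\<^sup>2" by blast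
  show ?case
  proof (cases "Suc n < (Suc k)\<^sup>2")
    case True then show ?thesis using \<open>k\<^sup>2 \<le> n\<close> by (intro exI[of _ k]) simp
  next
    case False
    then have "Suc n = (Suc k)\<^sup>2" using \<open>n < (Suc k)\<^sup>2\<close> by simp
    then show ?thesis by (intro exI[of _ "Suc k"]) (simp add: power2_eq_square)
  qed
qed (auto intro: exI[of _ 0])

text \<open>
  Along the squares \<open>k\<^sup>2\<close> the mean square of the average is of order \<open>1/k\<^sup>2\<close>, which is summable. The sum of
  the \<open>2k + 1\<close> absolute values between two squares has mean square of order \<open>k\<^sup>2\<close>, hence it is also
  negligible against \<open>k\<^sup>2\<close>.
\<close>

theorem strong_law_orthogonal:
  fixes Z :: "nat \<Rightarrow> 'a \<Rightarrow> real"
  assumes meas[measurable]: "\<And>n. Z n \<in> borel_measurable M"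
    and int: "\<And>n. integrable M (\<lambda>\<omega>. (Z n \<omega>)\<^sup>2)"
    and bound: "\<And>n. (LINT \<omega>|M. (Z n \<omega>)\<^sup>2) \<le> K"
    and orth: "\<And>m n. m < n \<Longrightarrow> (LINT \<omega>|M. Z m \<omega> * Z n \<omega>) = 0"
  shows "AE \<omega> in M. (\<lambda>N. (\<Sum>n<N. Z n \<omega>) / real N) \<longlonglongrightarrow> 0"
proof -
  define D where "D k \<omega> = (\<Sum>n\<in>{k\<^sup>2..<(Suc k)\<^sup>2}. \<bar>Z n \<omega>\<bar>)" for k \<omega>
  define S where "S N \<omega> = (\<Sum>n<N. Z n \<omega>)" for N \<omega>
  have K: "0 \<le> K" using bound[of 0] by (intro order_trans[OF _ bound[of 0]] integral_nonneg_AE) auto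
  have cardk: "card {k\<^sup>2..<(Suc k)\<^sup>2} = 2 * k + 1" for k :: nat by (simp add: power2_eq_square)
  have iD0: "integrable M (\<lambda>\<omega>. real (2 * k + 1) * (\<Sum>n\<in>{k\<^sup>2..<(Suc k)\<^sup>2}. (Z n \<omega>)\<^sup>2))" for k
    by (intro Bochner_Integration.integrable_mult_right Bochner_Integration.integrable_sum int)
  have Dle: "(D k \<omega>)\<^sup>2 \<le> real (2 * k + 1) * (\<Sum>n\<in>{k\<^sup>2..<(Suc k)\<^sup>2}. (Z n \<omega>)\<^sup>2)" for k \<omega>
    using sum_squared_le_sum_of_squares[of "\<lambda>n. \<bar>Z n \<omega>\<bar>" "{k\<^sup>2..<(Suc k)\<^sup>2}"] unfolding D_def cardk
    by (simp add: mult.commute)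
  have iD: "integrable M (\<lambda>\<omega>. (D k \<omega>)\<^sup>2)" for k
  proof (rule Bochner_Integration.integrable_bound[OF iD0[of k]])
    show "AE \<omega> in M. norm ((D k \<omega>)\<^sup>2) \<le> norm (real (2 * k + 1) * (\<Sum>n\<in>{k\<^sup>2..<(Suc k)\<^sup>2}. (Z n \<omega>)\<^sup>2))"
    proof (rule AE_I2)
      fix \<omega>
      have "norm ((D k \<omega>)\<^sup>2) = (D k \<omega>)\<^sup>2" by simp
      also note Dle
      also have "x \<le> norm x" for x :: real by simp
      finally show "norm ((D k \<omega>)\<^sup>2) \<le> norm (real (2 * k + 1) * (\<Sum>n\<in>{k\<^sup>2..<(Suc k)\<^sup>2}. (Z n \<omega>)\<^sup>2))" .
    qed
    show "(\<lambda>\<omega>. (D k \<omega>)\<^sup>2) \<in> borel_measurable M" unfolding D_def by measurable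
  qed
  have ED: "(LINT \<omega>|M. (D k \<omega>)\<^sup>2) \<le> (2 * real k + 1)\<^sup>2 * K" for k
  proof -
    have "(LINT \<omega>|M. (D k \<omega>)\<^sup>2) \<le> (LINT \<omega>|M. real (2 * k + 1) * (\<Sum>n\<in>{k\<^sup>2..<(Suc k)\<^sup>2}. (Z n \<omega>)\<^sup>2))"
      by (intro integral_mono iD iD0 Dle)
    also have "\<dots> = real (2 * k + 1) * (\<Sum>n\<in>{k\<^sup>2..<(Suc k)\<^sup>2}. LINT \<omega>|M. (Z n \<omega>)\<^sup>2)"
      by (simp only: integral_mult_right_zero Bochner_Integration.integral_sum[OF int])
    also have "\<dots> \<le> real (2 * k + 1) * (\<Sum>n\<in>{k\<^sup>2..<(Suc k)\<^sup>2}. K)"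
      by (intro mult_left_mono sum_mono bound) auto
    also have "\<dots> = (2 * real k + 1)\<^sup>2 * K" unfolding sum_constant cardk by (simp add: power2_eq_square algebra_simps)
    finally show ?thesis .
  qed
  note sq0 = sum_square_orthogonal[of Z, OF meas int orth]
  have sq: "integrable M (\<lambda>\<omega>. (S N \<omega>)\<^sup>2)" "(LINT \<omega>|M. (S N \<omega>)\<^sup>2) = (\<Sum>n<N. LINT \<omega>|M. (Z n \<omega>)\<^sup>2)" for N
    unfolding S_def by (rule sq0; assumption)+
  have ES: "(LINT \<omega>|M. (S N \<omega>)\<^sup>2) \<le> real N * K" for N
    unfolding sq using sum_mono[of "{..<N}" "\<lambda>n. LINT \<omega>|M. (Z n \<omega>)\<^sup>2" "\<lambda>_. K"] bound by simp
  (* Summability of the means of V controls the values at squares and the gaps simultaneously. *)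
  define V where "V k \<omega> = ((S (k\<^sup>2) \<omega>)\<^sup>2 + (D k \<omega>)\<^sup>2) / real k ^ 4" for k \<omega>
  have iV: "integrable M (V k)" for k unfolding V_def by (intro Bochner_Integration.integrable_divide Bochner_Integration.integrable_add sq iD)
  have EV: "integral\<^sup>L M (V k) \<le> 10 * K * (1 / real k ^ 2)" for k
  proof (cases "k = 0")
    case False
    have "integral\<^sup>L M (V k) = ((LINT \<omega>|M. (S (k\<^sup>2) \<omega>)\<^sup>2) + (LINT \<omega>|M. (D k \<omega>)\<^sup>2)) / real k ^ 4"
      unfolding V_def by (simp add: sq(1) iD Bochner_Integration.integral_add)
    also have "\<dots> \<le> (real (k\<^sup>2) * K + (2 * real k + 1)\<^sup>2 * K) / real k ^ 4"
      by (intro divide_right_mono add_mono ES ED) auto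
    also have "\<dots> \<le> (real k ^ 2 * K + (3 * real k)\<^sup>2 * K) / real k ^ 4"
      using False K by (intro divide_right_mono add_mono mult_right_mono power_mono) auto
    also have "\<dots> = 10 * K * (1 / real k ^ 2)"
      using False by (simp add: field_simps power2_eq_square power4_eq_xxxx)
    finally show ?thesis .
  qed (simp add: V_def[abs_def])
  have "summable (\<lambda>k. integral\<^sup>L M (V k))"
  proof (rule summable_comparison_test')
    show "summable (\<lambda>k. 10 * K * (1 / real k ^ 2))"
      by (intro summable_mult inverse_power_summable[THEN summable_cong[THEN iffD1, rotated]]) (auto simp: field_simps)
    show "norm (integral\<^sup>L M (V k)) \<le> 10 * K * (1 / real k ^ 2)" if "0 \<le> k" for k
    proof -
      have "0 \<le> integral\<^sup>L M (V k)" by (intro integral_nonneg_AE) (auto simp: V_def)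
      then show ?thesis using EV[of k] by simp
    qed
  qed
  then have "AE \<omega> in M. (\<lambda>k. V k \<omega>) \<longlonglongrightarrow> 0"
    by (rule AE_tendsto_0_of_summable_integral[rotated 2]) (use iV in \<open>auto simp: V_def\<close>)
  then show ?thesis
  proof eventually_elim
    case (elim \<omega>)
    show ?case
    proof (rule LIMSEQ_I)
      fix r :: real assume r: "0 < r"
      have "(r/2)\<^sup>2 > 0" using r by simp
      from LIMSEQ_D[OF elim this] obtain k0 where k0: "\<And>k. k \<ge> k0 \<Longrightarrow> V k \<omega> < (r/2)\<^sup>2"
        by (auto simp: abs_less_iff)
      show "\<exists>no. \<forall>n\<ge>no. norm ((\<Sum>n<n. Z n \<omega>) / real n - 0) < r"
      proof (intro exI[of _ "(Suc k0)\<^sup>2"] allI impI)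
        fix n assume n: "(Suc k0)\<^sup>2 \<le> n"
        obtain k where k: "k\<^sup>2 \<le> n" "n < (Suc k)\<^sup>2" using ex_square_bracket by blast
        have "(Suc k0)\<^sup>2 < (Suc k)\<^sup>2" using n k by linarith
        then have "Suc k0 < Suc k" by (rule power_less_imp_less_base) simp
        then have kk: "k \<ge> k0" "k > 0" by auto
        have kp: "real k > 0" using kk by simp
        have V: "(S (k\<^sup>2) \<omega>)\<^sup>2 + (D k \<omega>)\<^sup>2 < (r/2)\<^sup>2 * real k ^ 4"
          using k0[OF kk(1)] kp by (simp add: V_def divide_less_eq)
        have e: "(r/2)\<^sup>2 * real k ^ 4 = (r/2 * real k ^ 2)\<^sup>2" by (simp add: power_mult_distrib power2_eq_square power4_eq_xxxx)
        have "(S (k\<^sup>2) \<omega>)\<^sup>2 < (r/2 * real k ^ 2)\<^sup>2" "(D k \<omega>)\<^sup>2 < (r/2 * real k ^ 2)\<^sup>2"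
          using V unfolding e by (smt (verit) zero_le_power2)+
        then have "\<bar>S (k\<^sup>2) \<omega>\<bar> < r/2 * real k ^ 2" "\<bar>D k \<omega>\<bar> < r/2 * real k ^ 2"
          using r by (metis abs_le_square_iff abs_of_nonneg linorder_not_less mult_nonneg_nonneg zero_le_power2 half_gt_zero less_imp_le)+
        moreover have "\<bar>S n \<omega>\<bar> \<le> \<bar>S (k\<^sup>2) \<omega>\<bar> + D k \<omega>"
        proof -
          have "S n \<omega> = S (k\<^sup>2) \<omega> + (\<Sum>j\<in>{k\<^sup>2..<n}. Z j \<omega>)"
            unfolding S_def using k(1) by (simp add: lessThan_atLeast0 sum.atLeastLessThan_concat)
          moreover have "\<bar>\<Sum>j\<in>{k\<^sup>2..<n}. Z j \<omega>\<bar> \<le> (\<Sum>j\<in>{k\<^sup>2..<n}. \<bar>Z j \<omega>\<bar>)" by (rule sum_abs)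
          moreover have "(\<Sum>j\<in>{k\<^sup>2..<n}. \<bar>Z j \<omega>\<bar>) \<le> D k \<omega>"
            unfolding D_def using k by (intro sum_mono2) auto
          ultimately show ?thesis by linarith
        qed
        ultimately have "\<bar>S n \<omega>\<bar> < r * real k ^ 2" by linarith
        also have "\<dots> \<le> r * real n"
        proof -
          have "real (k\<^sup>2) \<le> real n" using k(1) by (rule of_nat_mono)
          then show ?thesis using r by simp
        qed
        finally have "\<bar>S n \<omega>\<bar> < r * real n" .
        moreover have "real n > 0" using n by (simp add: power2_eq_square)
        ultimately show "norm ((\<Sum>n<n. Z n \<omega>) / real n - 0) < r"
          by (simp add: S_def divide_less_eq abs_divide)
      qed
    qed
  qed
qed

lemma cesaro_mean:
  fixes a :: "nat \<Rightarrow> real"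
  assumes "a \<longlonglongrightarrow> l"
  shows "(\<lambda>N. (\<Sum>n<N. a n) / real N) \<longlonglongrightarrow> l"
proof (rule LIMSEQ_I)
  fix r :: real assume r: "0 < r"
  then obtain n0 where n0: "\<And>n. n \<ge> n0 \<Longrightarrow> \<bar>a n - l\<bar> < r / 2"
    using LIMSEQ_D[OF assms, of "r/2"] by auto
  define C where "C = (\<Sum>n<n0. \<bar>a n - l\<bar>)"
  obtain n1 :: nat where n1: "real n1 > 2 * C / r" using reals_Archimedean2 by blast
  show "\<exists>no. \<forall>N\<ge>no. norm ((\<Sum>n<N. a n) / real N - l) < r"
  proof (intro exI[of _ "max (Suc n0) n1"] allI impI)
    fix N assume N: "max (Suc n0) n1 \<le> N"
    then have Np: "real N > 0" by auto
    have "(\<Sum>n<N. a n) / real N - l = (\<Sum>n<N. a n - l) / real N"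
      using Np by (simp add: sum_subtractf field_simps)
    also have "\<bar>\<dots>\<bar> \<le> (\<Sum>n<N. \<bar>a n - l\<bar>) / real N"
      unfolding abs_divide using Np by (auto intro!: divide_right_mono sum_abs)
    also have "(\<Sum>n<N. \<bar>a n - l\<bar>) = C + (\<Sum>n\<in>{n0..<N}. \<bar>a n - l\<bar>)"
      unfolding C_def using N by (simp add: lessThan_atLeast0 sum.atLeastLessThan_concat)
    also have "(\<Sum>n\<in>{n0..<N}. \<bar>a n - l\<bar>) \<le> (\<Sum>n\<in>{n0..<N}. r / 2)"
      using n0 by (intro sum_mono less_imp_le) auto
    also have "\<dots> \<le> real N * (r / 2)" using r by simp
    finally have "\<bar>(\<Sum>n<N. a n) / real N - l\<bar> \<le> (C + real N * (r / 2)) / real N"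
      using Np by (simp add: divide_right_mono)
    also have "\<dots> < r"
    proof -
      have "2 * C / r < real N" using n1 N by linarith
      then have "C < real N * (r / 2)" using r by (simp add: field_simps)
      then show ?thesis using Np by (simp add: field_simps)
    qed
    finally show "norm ((\<Sum>n<N. a n) / real N - l) < r" by simp
  qed
qed

text \<open>
  The powers of \<open>q\<close> below the level \<open>d\<close> sum to at most a constant times \<open>d\<close>. This bounds the inner sum
  after the two summations have been interchanged in \<open>strong_law_truncated\<close>.
\<close>

lemma sum_geometric_tail_le:
  fixes q d :: real
  assumes q: "0 < q" "q < 1" and d: "0 \<le> d"
  shows "(\<Sum>m<M. if q ^ m \<le> d then q ^ m else 0) \<le> d / (1 - q)"
  using d
proof (induction M arbitrary: d)
  case 0 then show ?case using q by simp
next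
  case (Suc M)
  show ?case
  proof (cases "1 \<le> d")
    case True
    have "(\<Sum>m<Suc M. if q ^ m \<le> d then q ^ m else 0) \<le> (\<Sum>m<Suc M. q ^ m)"
      using q by (intro sum_mono) auto
    also have "\<dots> = (1 - q ^ Suc M) / (1 - q)" using q by (simp only: sum_gp_strict) simp
    also have "\<dots> \<le> d / (1 - q)"
      using q True zero_le_power[of q "Suc M"] by (intro divide_right_mono) (auto intro: order_trans[of _ 1])
    finally show ?thesis .
  next
    case False
    have "(\<Sum>m<Suc M. if q ^ m \<le> d then q ^ m else 0) = (\<Sum>m<M. if q ^ Suc m \<le> d then q ^ Suc m else 0)"
      using False by (subst sum.lessThan_Suc_shift) simp
    also have "\<dots> = q * (\<Sum>m<M. if q ^ m \<le> d / q then q ^ m else 0)"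
      unfolding sum_distrib_left using q by (intro sum.cong) (auto simp: field_simps)
    also have "\<dots> \<le> q * ((d / q) / (1 - q))" using Suc.prems q by (intro mult_left_mono Suc.IH) auto
    finally show ?thesis using q by simp
  qed
qed

text \<open>
  Terms with \<open>k < x\<close> contribute 1 each and the remaining ones \<open>x\<^sup>2 \<Sum> 1/k\<^sup>2\<close>, both of order \<open>x\<close>. Taking
  expectations bounds the weighted second moments of the truncated variables by a first moment.
\<close>

lemma sum_truncated_squares_le:
  fixes x :: real
  assumes "0 \<le> x"
  shows "(\<Sum>k<n. (min x (real (Suc k)))\<^sup>2 / (real (Suc k))\<^sup>2) \<le> 3 * x"
proof -
  have "(\<Sum>k<n. (min x (real (Suc k)))\<^sup>2 / (real (Suc k))\<^sup>2) \<le>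
      (if real n \<le> x then real n else 3 * x - x\<^sup>2 / real n)"
  proof (induction n)
    case 0 then show ?case using assms by simp
  next
    case (Suc n)
    consider "real (Suc n) \<le> x" | "real n \<le> x" "x < real (Suc n)" | "x < real n" by linarith
    then show ?case
    proof cases
      case 1 then show ?thesis using Suc by simp
    next
      case 2
      have "2 * x\<^sup>2 / real (Suc n) \<le> 2 * x"
      proof -
        have "2 * x\<^sup>2 \<le> 2 * x * real (Suc n)"
          using mult_left_mono[of x "real (Suc n)" "2 * x"] 2 assms by (simp add: power2_eq_square)
        then show ?thesis by (simp add: divide_le_eq)
      qed
      moreover have "x\<^sup>2 / (real (Suc n))\<^sup>2 \<le> x\<^sup>2 / real (Suc n)"
        by (intro divide_left_mono) (auto simp: power2_eq_square)
      ultimately show ?thesis using 2 Suc by (simp add: min_def)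
    next
      case 3
      then have n: "n > 0" using assms by (cases n) auto
      have "1 / (real (Suc n))\<^sup>2 + 1 / real (Suc n) \<le> 1 / real n"
      proof -
        have "1 / (real (Suc n))\<^sup>2 \<le> 1 / (real n * real (Suc n))"
          using n by (intro divide_left_mono) (auto simp: power2_eq_square)
        moreover have "1 / real n - 1 / real (Suc n) = 1 / (real n * real (Suc n))"
          using n by (simp add: field_simps)
        ultimately show ?thesis by linarith
      qed
      then have "x\<^sup>2 * (1 / (real (Suc n))\<^sup>2 + 1 / real (Suc n)) \<le> x\<^sup>2 * (1 / real n)"
        by (intro mult_left_mono) auto
      then have "x\<^sup>2 / (real (Suc n))\<^sup>2 + x\<^sup>2 / real (Suc n) \<le> x\<^sup>2 / real n"
        by (simp add: distrib_left)
      moreover have "min x (real (Suc n)) = x" using 3 by simp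
      ultimately show ?thesis using 3 Suc by (simp del: of_nat_Suc)
    qed
  qed
  also have "\<dots> \<le> 3 * x" using assms by auto
  finally show ?thesis .
qed

text \<open>
  In expectation: tail probabilities sum to at most the mean.
\<close>

lemma sum_exceedances_le:
  fixes x :: real
  assumes "0 \<le> x"
  shows "(\<Sum>k<n. if real (Suc k) < x then 1 else 0 :: real) \<le> x"
proof -
  have "(\<Sum>k<n. if real (Suc k) < x then 1 else 0 :: real) \<le> min (real n) x"
  proof (induction n)
    case (Suc n) then show ?case using assms by (auto simp: min_def split: if_splits)
  qed (use assms in simp)
  then show ?thesis by simp
qed

context prob_space
begin

text \<open>
  Etemadi's argument along the geometric times \<open>\<alpha>\<^sup>m\<close>. The variances of the averages of the variables
  truncated at their index are summable, by \<open>sum_geometric_tail_le\<close> and \<open>sum_truncated_squares_le\<close>, so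
  the centred averages vanish; the means of the truncated variables converge to the mean.
\<close>

lemma strong_law_truncated:
  fixes X :: "nat \<Rightarrow> 'a \<Rightarrow> real"
  assumes ind: "indep_vars (\<lambda>_. borel) X UNIV"
    and law: "\<And>n. distr M borel (X n) = distr M borel (X 0)"
    and nonneg: "\<And>n \<omega>. 0 \<le> X n \<omega>" and int: "integrable M (X 0)" and \<alpha>: "1 < \<alpha>"
  shows "AE \<omega> in M. (\<lambda>m. (\<Sum>k<nat \<lfloor>\<alpha> ^ m\<rfloor>. min (X k \<omega>) (real (Suc k))) / \<alpha> ^ m) \<longlonglongrightarrow> expectation (X 0)"
proof -
  have [measurable]: "X n \<in> borel_measurable M" for n using ind by (simp add: indep_vars_def2)
  define Y where "Y k \<omega> = min (X k \<omega>) (real (Suc k))" for k \<omega>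
  have [measurable]: "Y k \<in> borel_measurable M" for k unfolding Y_def by simp
  have Yb: "0 \<le> Y k \<omega>" "Y k \<omega> \<le> real (Suc k)" for k \<omega> using nonneg[of k \<omega>] by (auto simp: Y_def)
  have iY: "integrable M (Y k)" for k
    by (rule integrable_const_bound[of _ "real (Suc k)"]) (use Yb in auto)
  have iY2: "integrable M (\<lambda>\<omega>. (Y k \<omega>)\<^sup>2)" for k
    by (rule integrable_const_bound[of _ "(real (Suc k))\<^sup>2"]) (use Yb in \<open>auto intro!: power_mono\<close>)
  have lawE: "(LINT \<omega>|M. h (X k \<omega>)) = (LINT \<omega>|M. h (X 0 \<omega>))" if [measurable]: "h \<in> borel_measurable borel"
    for k and h :: "real \<Rightarrow> real"
  proof -
    have "(LINT \<omega>|M. h (X k \<omega>)) = integral\<^sup>L (distr M borel (X k)) h" by (rule integral_distr[symmetric]) auto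
    also have "\<dots> = (LINT \<omega>|M. h (X 0 \<omega>))" unfolding law[of k] by (rule integral_distr) auto
    finally show ?thesis .
  qed
  define a where "a k = expectation (Y k)" for k
  define b where "b k = (LINT \<omega>|M. (Y k \<omega>)\<^sup>2)" for k
  have a: "a k = (LINT \<omega>|M. min (X 0 \<omega>) (real (Suc k)))" for k
    unfolding a_def Y_def by (rule lawE) simp
  have b: "b k = (LINT \<omega>|M. (min (X 0 \<omega>) (real (Suc k)))\<^sup>2)" for k
    unfolding b_def Y_def by (rule lawE[of "\<lambda>x. (min x (real (Suc k)))\<^sup>2"]) simp
  have b0: "0 \<le> b k" for k unfolding b_def by (intro integral_nonneg_AE) auto
  have alim: "a \<longlonglongrightarrow> expectation (X 0)"
    unfolding a
  proof (rule integral_dominated_convergence[where w="X 0"])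
    show "AE \<omega> in M. (\<lambda>k. min (X 0 \<omega>) (real (Suc k))) \<longlonglongrightarrow> X 0 \<omega>"
    proof (rule AE_I2)
      fix \<omega>
      obtain n0 :: nat where "X 0 \<omega> \<le> real n0" using real_arch_simple by blast
      then have "eventually (\<lambda>k. X 0 \<omega> = min (X 0 \<omega>) (real (Suc k))) sequentially"
        by (intro eventually_sequentiallyI[of n0]) auto
      then show "(\<lambda>k. min (X 0 \<omega>) (real (Suc k))) \<longlonglongrightarrow> X 0 \<omega>"
        by (rule Lim_transform_eventually[OF tendsto_const])
    qed
  qed (use int nonneg in \<open>auto simp: min_def\<close>)
  have bsum: "(\<Sum>k<n. b k / (real (Suc k))\<^sup>2) \<le> 3 * expectation (X 0)" for n
  proof -
    have i: "integrable M (\<lambda>\<omega>. (min (X 0 \<omega>) (real (Suc k)))\<^sup>2)" for k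
      by (rule integrable_const_bound[of _ "(real (Suc k))\<^sup>2"]) (use nonneg[of 0] in \<open>auto intro!: power_mono\<close>)
    have "(\<Sum>k<n. b k / (real (Suc k))\<^sup>2) = (LINT \<omega>|M. (\<Sum>k<n. (min (X 0 \<omega>) (real (Suc k)))\<^sup>2 / (real (Suc k))\<^sup>2))"
      unfolding b by (subst Bochner_Integration.integral_sum) (use i in \<open>auto simp del: of_nat_Suc\<close>)
    also have "\<dots> \<le> (LINT \<omega>|M. 3 * X 0 \<omega>)"
      by (intro integral_mono Bochner_Integration.integrable_sum Bochner_Integration.integrable_divide i
          sum_truncated_squares_le nonneg Bochner_Integration.integrable_mult_right int)
    finally show ?thesis by simp
  qed
  define Z where "Z k \<omega> = Y k \<omega> - a k" for k \<omega>
  have [measurable]: "Z k \<in> borel_measurable M" for k unfolding Z_def by simp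
  have iZ: "integrable M (Z k)" for k unfolding Z_def using iY by simp
  have EZ2: "integrable M (\<lambda>\<omega>. (Z k \<omega>)\<^sup>2)" "(LINT \<omega>|M. (Z k \<omega>)\<^sup>2) \<le> b k" for k
  proof -
    have eq: "(Z k \<omega>)\<^sup>2 = ((Y k \<omega>)\<^sup>2 - 2 * a k * Y k \<omega>) + (a k)\<^sup>2" for \<omega>
      by (simp add: Z_def power2_eq_square algebra_simps)
    show "integrable M (\<lambda>\<omega>. (Z k \<omega>)\<^sup>2)"
      unfolding eq by (intro Bochner_Integration.integrable_add Bochner_Integration.integrable_diff iY2 Bochner_Integration.integrable_mult_right iY integrable_const)
    have "(LINT \<omega>|M. (Z k \<omega>)\<^sup>2) = b k - 2 * a k * a k + (a k)\<^sup>2"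
      unfolding eq b_def by (simp add: iY iY2 a_def prob_space)
    then show "(LINT \<omega>|M. (Z k \<omega>)\<^sup>2) \<le> b k" by (simp add: power2_eq_square)
  qed
  have orth: "(LINT \<omega>|M. Z j \<omega> * Z k \<omega>) = 0" if "j < k" for j k
  proof -
    have "indep_vars (\<lambda>_. borel) (\<lambda>n \<omega>. min (X n \<omega>) (real (Suc n)) - a n) UNIV"
      by (rule indep_vars_compose2[OF ind]) simp
    then have "indep_vars (\<lambda>_. borel) Z {j, k}"
      unfolding Z_def[abs_def] Y_def by (rule indep_vars_subset) simp
    from indep_vars_lebesgue_integral[OF _ this]
    have "(LINT \<omega>|M. Z j \<omega> * Z k \<omega>) = expectation (Z j) * expectation (Z k)"
      using that iZ by simp
    moreover have "expectation (Z k) = 0" unfolding Z_def using iY by (simp add: a_def prob_space)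
    ultimately show ?thesis by simp
  qed
  note sq = sum_square_orthogonal[of Z, OF _ EZ2(1) orth]
  define N where "N m = nat \<lfloor>\<alpha> ^ m\<rfloor>" for m
  have \<alpha>0: "0 < \<alpha>" using \<alpha> by simp
  have Nle: "real (N m) \<le> \<alpha> ^ m" for m using \<alpha>0 by (simp add: N_def)
  define q where "q = (1 / \<alpha>)\<^sup>2"
  have q: "0 < q" "q < 1" using \<alpha> by (auto simp: q_def power_less_one_iff power2_eq_square field_simps intro: less_1_mult)
  have qm: "q ^ m = 1 / (\<alpha> ^ m)\<^sup>2" for m by (simp add: q_def power_divide power_mult[symmetric] mult.commute)
  define V where "V m \<omega> = ((\<Sum>k<N m. Z k \<omega>) / \<alpha> ^ m)\<^sup>2" for m \<omega>
  have Veq: "V m \<omega> = q ^ m * (\<Sum>k<N m. Z k \<omega>)\<^sup>2" for m \<omega>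
    by (simp add: V_def qm power_divide)
  have iV: "integrable M (V m)" for m
    unfolding Veq[abs_def] by (intro Bochner_Integration.integrable_mult_right sq) auto
  have EV: "integral\<^sup>L M (V m) \<le> (\<Sum>k<N m. q ^ m * b k)" for m
  proof -
    have "integral\<^sup>L M (V m) = q ^ m * (\<Sum>k<N m. LINT \<omega>|M. (Z k \<omega>)\<^sup>2)"
      unfolding Veq[abs_def] using sq(2)[of "N m"] by simp
    also have "\<dots> \<le> q ^ m * (\<Sum>k<N m. b k)" using q by (intro mult_left_mono sum_mono EZ2) auto
    finally show ?thesis by (simp add: sum_distrib_left)
  qed
  have "summable (\<lambda>m. integral\<^sup>L M (V m))"
  proof (rule summableI_nonneg_bounded)
    fix L
    define R where "R = Max (N ` {..<Suc L})"
    have NR: "N m \<le> R" if "m < L" for m unfolding R_def using that by (intro Max_ge) auto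
    (* Interchange the sums: the index k occurs only for times m with k < N m, and these powers of q
       form the tail of a geometric series. *)
    have "(\<Sum>m<L. integral\<^sup>L M (V m)) \<le> (\<Sum>m<L. \<Sum>k<N m. q ^ m * b k)" by (intro sum_mono EV)
    also have "\<dots> \<le> (\<Sum>m<L. \<Sum>k<R. b k * (if q ^ m \<le> 1 / (real (Suc k))\<^sup>2 then q ^ m else 0))"
    proof (rule sum_mono)
      fix m assume m: "m \<in> {..<L}"
      have "(\<Sum>k<N m. q ^ m * b k) = (\<Sum>k<N m. b k * (if q ^ m \<le> 1 / (real (Suc k))\<^sup>2 then q ^ m else 0))"
      proof (rule sum.cong)
        fix k assume "k \<in> {..<N m}"
        then have "real (Suc k) \<le> \<alpha> ^ m" using Nle[of m] by simp
        then have "(real (Suc k))\<^sup>2 \<le> (\<alpha> ^ m)\<^sup>2" by (intro power_mono) auto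
        then have "q ^ m \<le> 1 / (real (Suc k))\<^sup>2" unfolding qm by (intro divide_left_mono) (use \<alpha>0 in auto)
        then show "q ^ m * b k = b k * (if q ^ m \<le> 1 / (real (Suc k))\<^sup>2 then q ^ m else 0)" by simp
      qed simp
      also have "\<dots> \<le> (\<Sum>k<R. b k * (if q ^ m \<le> 1 / (real (Suc k))\<^sup>2 then q ^ m else 0))"
        using m NR[of m] b0 q by (intro sum_mono2) auto
      finally show "(\<Sum>k<N m. q ^ m * b k) \<le> (\<Sum>k<R. b k * (if q ^ m \<le> 1 / (real (Suc k))\<^sup>2 then q ^ m else 0))" .
    qed
    also have "\<dots> = (\<Sum>k<R. b k * (\<Sum>m<L. if q ^ m \<le> 1 / (real (Suc k))\<^sup>2 then q ^ m else 0))"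
      by (subst sum.swap) (simp add: sum_distrib_left)
    also have "\<dots> \<le> (\<Sum>k<R. b k * ((1 / (real (Suc k))\<^sup>2) / (1 - q)))"
      by (intro sum_mono mult_left_mono sum_geometric_tail_le q b0) auto
    also have "\<dots> = (\<Sum>k<R. b k / (real (Suc k))\<^sup>2) / (1 - q)" by (simp add: sum_divide_distrib)
    also have "\<dots> \<le> 3 * expectation (X 0) / (1 - q)" using q by (intro divide_right_mono bsum) auto
    finally show "(\<Sum>m<L. integral\<^sup>L M (V m)) \<le> 3 * expectation (X 0) / (1 - q)" .
  qed (auto simp: V_def intro!: integral_nonneg_AE)
  then have V0: "AE \<omega> in M. (\<lambda>m. V m \<omega>) \<longlonglongrightarrow> 0"
    by (rule AE_tendsto_0_of_summable_integral[rotated 2]) (use iV in \<open>auto simp: V_def\<close>)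
  have Ntop: "filterlim N at_top sequentially"
  proof -
    have "eventually (\<lambda>m. c \<le> N m) sequentially" for c
    proof -
      obtain n where n: "real c < \<alpha> ^ n" using real_arch_pow[OF \<alpha>] by blast
      show ?thesis
      proof (rule eventually_sequentiallyI[of n])
        fix m assume "n \<le> m"
        then have "\<alpha> ^ n \<le> \<alpha> ^ m" using \<alpha> by (intro power_increasing) auto
        then show "c \<le> N m" using n unfolding N_def by linarith
      qed
    qed
    then show ?thesis by (simp add: filterlim_at_top)
  qed
  have Nratio: "(\<lambda>m. real (N m) / \<alpha> ^ m) \<longlonglongrightarrow> 1"
  proof (rule tendsto_sandwich[OF _ _ _ tendsto_const])
    have "(\<lambda>m. 1 - (1 / \<alpha>) ^ m) \<longlonglongrightarrow> 1 - 0"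
      using \<alpha> by (intro tendsto_intros LIMSEQ_power_zero) auto
    then show "(\<lambda>m. 1 - (1 / \<alpha>) ^ m) \<longlonglongrightarrow> 1" by simp
    show "eventually (\<lambda>m. real (N m) / \<alpha> ^ m \<le> 1) sequentially"
      using Nle \<alpha>0 by (intro always_eventually) (simp add: divide_le_eq)
    show "eventually (\<lambda>m. 1 - (1 / \<alpha>) ^ m \<le> real (N m) / \<alpha> ^ m) sequentially"
    proof (intro always_eventually allI)
      fix m
      have "\<alpha> ^ m - 1 \<le> real (N m)" unfolding N_def using \<alpha>0 by linarith
      then have "(\<alpha> ^ m - 1) / \<alpha> ^ m \<le> real (N m) / \<alpha> ^ m" using \<alpha>0 by (intro divide_right_mono) auto
      then show "1 - (1 / \<alpha>) ^ m \<le> real (N m) / \<alpha> ^ m" using \<alpha>0 by (simp add: diff_divide_distrib power_divide)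
    qed
  qed
  have "(\<lambda>m. (\<Sum>k<N m. a k) / real (N m)) \<longlonglongrightarrow> expectation (X 0)"
    by (rule filterlim_compose[OF cesaro_mean[OF alim] Ntop])
  then have "(\<lambda>m. (\<Sum>k<N m. a k) / real (N m) * (real (N m) / \<alpha> ^ m)) \<longlonglongrightarrow> expectation (X 0) * 1"
    by (intro tendsto_mult Nratio)
  moreover have "(\<Sum>k<N m. a k) / real (N m) * (real (N m) / \<alpha> ^ m) = (\<Sum>k<N m. a k) / \<alpha> ^ m" for m
    by (cases "N m = 0") auto
  ultimately have Alim: "(\<lambda>m. (\<Sum>k<N m. a k) / \<alpha> ^ m) \<longlonglongrightarrow> expectation (X 0)"
    by (simp only: mult_1_right)
  show ?thesis
    using V0
  proof eventually_elim
    case (elim \<omega>)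
    have "(\<lambda>m. sqrt (V m \<omega>)) \<longlonglongrightarrow> 0" using tendsto_real_sqrt[OF elim] by simp
    then have "(\<lambda>m. (\<Sum>k<N m. Z k \<omega>) / \<alpha> ^ m) \<longlonglongrightarrow> 0"
      by (simp only: V_def real_sqrt_abs tendsto_rabs_zero_iff)
    from tendsto_add[OF this Alim]
    have "(\<lambda>m. (\<Sum>k<N m. Z k \<omega>) / \<alpha> ^ m + (\<Sum>k<N m. a k) / \<alpha> ^ m) \<longlonglongrightarrow> expectation (X 0)" by simp
    moreover have "(\<Sum>k<N m. Z k \<omega>) / \<alpha> ^ m + (\<Sum>k<N m. a k) / \<alpha> ^ m = (\<Sum>k<N m. Y k \<omega>) / \<alpha> ^ m" for m
      by (simp add: Z_def sum_subtractf diff_divide_distrib)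
    ultimately show ?case by (simp add: N_def Y_def)
  qed
qed

text \<open>
  The first Borel-Cantelli lemma: truncation changes only finitely many terms.
\<close>

lemma eventually_le_index_AE:
  fixes X :: "nat \<Rightarrow> 'a \<Rightarrow> real"
  assumes meas[measurable]: "\<And>n. X n \<in> borel_measurable M"
    and law: "\<And>n. distr M borel (X n) = distr M borel (X 0)"
    and nonneg: "\<And>n \<omega>. 0 \<le> X n \<omega>" and int: "integrable M (X 0)"
  shows "AE \<omega> in M. eventually (\<lambda>k. X k \<omega> \<le> real (Suc k)) sequentially"
proof -
  define Z where "Z k \<omega> = (if real (Suc k) < X k \<omega> then 1 else 0 :: real)" for k \<omega>
  have [measurable]: "Z k \<in> borel_measurable M" for k unfolding Z_def by measurable
  have iZ: "integrable M (Z k)" for k by (rule integrable_const_bound[of _ 1]) (auto simp: Z_def)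
  have i0: "integrable M (\<lambda>\<omega>. if real (Suc k) < X 0 \<omega> then 1 else 0 :: real)" for k
    by (rule integrable_const_bound[of _ 1]) auto
  have EZ: "integral\<^sup>L M (Z k) = (LINT \<omega>|M. (if real (Suc k) < X 0 \<omega> then 1 else 0))" for k
  proof -
    let ?h = "\<lambda>x. if real (Suc k) < x then 1 else 0 :: real"
    have "integral\<^sup>L M (Z k) = integral\<^sup>L (distr M borel (X k)) ?h"
      unfolding Z_def[abs_def] by (rule integral_distr[symmetric]) auto
    also have "\<dots> = (LINT \<omega>|M. ?h (X 0 \<omega>))" unfolding law[of k] by (rule integral_distr) auto
    finally show ?thesis .
  qed
  have "summable (\<lambda>k. integral\<^sup>L M (Z k))"
  proof (rule summableI_nonneg_bounded)
    fix n
    have "(\<Sum>k<n. integral\<^sup>L M (Z k)) = (LINT \<omega>|M. (\<Sum>k<n. if real (Suc k) < X 0 \<omega> then 1 else 0))"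
      unfolding EZ by (subst Bochner_Integration.integral_sum) (use i0 in auto)
    also have "\<dots> \<le> expectation (X 0)"
      by (intro integral_mono Bochner_Integration.integrable_sum i0 int sum_exceedances_le nonneg)
    finally show "(\<Sum>k<n. integral\<^sup>L M (Z k)) \<le> expectation (X 0)" .
  qed (auto simp: Z_def intro!: integral_nonneg_AE)
  then have "AE \<omega> in M. (\<lambda>k. Z k \<omega>) \<longlonglongrightarrow> 0"
    by (rule AE_tendsto_0_of_summable_integral[rotated 2]) (use iZ in \<open>auto simp: Z_def\<close>)
  then show ?thesis
  proof eventually_elim
    case (elim \<omega>)
    then have "eventually (\<lambda>k. Z k \<omega> < 1) sequentially" by (rule order_tendstoD) simp
    then show ?case by eventually_elim (auto simp: Z_def split: if_splits)
  qed
qed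

end

lemma ex_power_bracket:
  fixes \<alpha> x :: real
  assumes "1 < \<alpha>" "1 \<le> x"
  shows "\<exists>m. \<alpha> ^ m \<le> x \<and> x < \<alpha> ^ Suc m"
proof -
  obtain n where "x < \<alpha> ^ n" using real_arch_pow[OF assms(1)] by blast
  then have L: "x < \<alpha> ^ (LEAST n. x < \<alpha> ^ n)" by (rule LeastI)
  then have "(LEAST n. x < \<alpha> ^ n) \<noteq> 0" using assms(2) by (metis linorder_not_less power_0)
  then obtain m where m: "(LEAST n. x < \<alpha> ^ n) = Suc m" using not0_implies_Suc by blast
  then have "\<not> x < \<alpha> ^ m" by (metis lessI not_less_Least)
  then show ?thesis using L m by (intro exI[of _ m]) auto
qed

text \<open>
  Between two consecutive times \<open>\<alpha>\<^sup>m \<le> N < \<alpha>\<^sup>m\<^sup>+\<^sup>1\<close> a monotone sum changes the average by at most the factor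
  \<open>\<alpha>\<close>, which may be taken arbitrarily close to 1.
\<close>

lemma mean_tendsto_of_geometric_times:
  fixes S :: "nat \<Rightarrow> real" and \<alpha> :: "nat \<Rightarrow> real"
  assumes S: "mono S" "\<And>n. 0 \<le> S n"
    and \<alpha>: "\<And>j. 1 < \<alpha> j" "\<alpha> \<longlonglongrightarrow> 1"
    and lim: "\<And>j. (\<lambda>m. S (nat \<lfloor>\<alpha> j ^ m\<rfloor>) / \<alpha> j ^ m) \<longlonglongrightarrow> \<mu>"
  shows "(\<lambda>N. S N / real N) \<longlonglongrightarrow> \<mu>"
proof -
  have bounds: "eventually (\<lambda>N. (\<mu> - \<epsilon>) / \<alpha> j \<le> S N / real N \<and> S N / real N \<le> \<alpha> j * (\<mu> + \<epsilon>)) sequentially"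
    if \<epsilon>: "\<epsilon> > 0" for j \<epsilon>
  proof -
    have "eventually (\<lambda>m. dist (S (nat \<lfloor>\<alpha> j ^ m\<rfloor>) / \<alpha> j ^ m) \<mu> < \<epsilon>) sequentially"
      using tendstoD[OF lim \<epsilon>] .
    then obtain m0 where m0: "\<And>m. m \<ge> m0 \<Longrightarrow> \<bar>S (nat \<lfloor>\<alpha> j ^ m\<rfloor>) / \<alpha> j ^ m - \<mu>\<bar> < \<epsilon>"
      by (auto simp: eventually_sequentially dist_real_def)
    obtain n0 :: nat where n0: "\<alpha> j ^ Suc m0 \<le> real n0" using real_arch_simple by blast
    show ?thesis
    proof (rule eventually_sequentiallyI[of "max 1 n0"])
      fix N assume N: "max 1 n0 \<le> N"
      have \<alpha>0: "0 < \<alpha> j" using \<alpha>(1)[of j] by simp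
      obtain m where m: "\<alpha> j ^ m \<le> real N" "real N < \<alpha> j ^ Suc m"
        using ex_power_bracket[OF \<alpha>(1)[of j], of "real N"] N by auto
      have "\<alpha> j ^ Suc m0 < \<alpha> j ^ Suc m" using n0 N m(2) by linarith
      then have "m0 \<le> m" using \<alpha>(1)[of j] by (simp add: power_strict_increasing_iff)
      then have lo: "(\<mu> - \<epsilon>) * \<alpha> j ^ m \<le> S (nat \<lfloor>\<alpha> j ^ m\<rfloor>)" and hi: "S (nat \<lfloor>\<alpha> j ^ Suc m\<rfloor>) \<le> (\<mu> + \<epsilon>) * \<alpha> j ^ Suc m"
      proof -
        have "\<mu> - \<epsilon> \<le> S (nat \<lfloor>\<alpha> j ^ m\<rfloor>) / \<alpha> j ^ m" using m0[OF \<open>m0 \<le> m\<close>] by linarith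
        then show "(\<mu> - \<epsilon>) * \<alpha> j ^ m \<le> S (nat \<lfloor>\<alpha> j ^ m\<rfloor>)"
          using zero_less_power[OF \<alpha>0, of m] by (simp only: pos_le_divide_eq)
        have "S (nat \<lfloor>\<alpha> j ^ Suc m\<rfloor>) / \<alpha> j ^ Suc m \<le> \<mu> + \<epsilon>" using m0[of "Suc m"] \<open>m0 \<le> m\<close> by linarith
        then show "S (nat \<lfloor>\<alpha> j ^ Suc m\<rfloor>) \<le> (\<mu> + \<epsilon>) * \<alpha> j ^ Suc m"
          using zero_less_power[OF \<alpha>0, of "Suc m"] by (simp only: pos_divide_le_eq)
      qed
      have n1: "nat \<lfloor>\<alpha> j ^ m\<rfloor> \<le> N" using m(1) by linarith
      have n2: "N \<le> nat \<lfloor>\<alpha> j ^ Suc m\<rfloor>" using m(2) by linarith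
      have "(\<mu> - \<epsilon>) * \<alpha> j ^ m \<le> S N" using lo monoD[OF S(1) n1] by simp
      have Np: "real N > 0" using N by simp
      have up: "S N \<le> (\<mu> + \<epsilon>) * \<alpha> j ^ Suc m" using hi monoD[OF S(1) n2] by simp
      then have "0 \<le> (\<mu> + \<epsilon>) * \<alpha> j ^ Suc m" using S(2)[of N] by simp
      then have mu: "0 \<le> \<mu> + \<epsilon>" using \<alpha>0 zero_less_power[OF \<alpha>0, of "Suc m"] by (metis linorder_not_less mult_neg_pos)
      have "(\<mu> + \<epsilon>) * \<alpha> j ^ Suc m \<le> \<alpha> j * (\<mu> + \<epsilon>) * real N"
        using mult_left_mono[OF m(1), of "\<alpha> j * (\<mu> + \<epsilon>)"] mu \<alpha>0 by (simp add: mult.assoc mult.left_commute)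
      then have 1: "S N / real N \<le> \<alpha> j * (\<mu> + \<epsilon>)" using up Np by (simp add: divide_le_eq)
      have 2: "(\<mu> - \<epsilon>) / \<alpha> j \<le> S N / real N"
      proof (cases "\<mu> - \<epsilon> \<le> 0")
        case True
        then have "(\<mu> - \<epsilon>) / \<alpha> j \<le> 0" using \<alpha>0 by (simp add: divide_le_0_iff)
        also have "0 \<le> S N / real N" using S(2) by simp
        finally show ?thesis .
      next
        case False
        have "(\<mu> - \<epsilon>) / \<alpha> j * real N \<le> (\<mu> - \<epsilon>) / \<alpha> j * \<alpha> j ^ Suc m"
          using m(2) False \<alpha>0 by (intro mult_left_mono) auto
        also have "\<dots> = (\<mu> - \<epsilon>) * \<alpha> j ^ m" using \<alpha>0 by simp
        also have "\<dots> \<le> S N" by fact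
        finally show ?thesis using Np by (simp add: pos_le_divide_eq)
      qed
      from 1 2 show "(\<mu> - \<epsilon>) / \<alpha> j \<le> S N / real N \<and> S N / real N \<le> \<alpha> j * (\<mu> + \<epsilon>)" by simp
    qed
  qed
  show ?thesis
  proof (rule order_tendstoI)
    fix y assume y: "y < \<mu>"
    have "(\<lambda>j. (\<mu> - (\<mu> - y) / 2) / \<alpha> j) \<longlonglongrightarrow> (\<mu> - (\<mu> - y) / 2) / 1" by (intro tendsto_intros \<alpha>) auto
    then have "eventually (\<lambda>j. y < (\<mu> - (\<mu> - y) / 2) / \<alpha> j) sequentially"
      by (rule order_tendstoD) (use y in \<open>simp add: field_simps\<close>)
    then obtain j where j: "y < (\<mu> - (\<mu> - y) / 2) / \<alpha> j" by (auto simp: eventually_sequentially)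
    have "(\<mu> - y) / 2 > 0" using y by simp
    from bounds[OF this, of j] show "eventually (\<lambda>N. y < S N / real N) sequentially"
      by eventually_elim (use j in linarith)
  next
    fix y assume y: "\<mu> < y"
    have "(\<lambda>j. \<alpha> j * (\<mu> + (y - \<mu>) / 2)) \<longlonglongrightarrow> 1 * (\<mu> + (y - \<mu>) / 2)" by (intro tendsto_intros \<alpha>)
    then have "eventually (\<lambda>j. \<alpha> j * (\<mu> + (y - \<mu>) / 2) < y) sequentially"
      by (rule order_tendstoD) (use y in \<open>simp add: field_simps\<close>)
    then obtain j where j: "\<alpha> j * (\<mu> + (y - \<mu>) / 2) < y" by (auto simp: eventually_sequentially)
    have "(y - \<mu>) / 2 > 0" using y by simp
    from bounds[OF this, of j] show "eventually (\<lambda>N. S N / real N < y) sequentially"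
      by eventually_elim (use j in linarith)
  qed
qed

lemma mean_tendsto_eventually_equal_terms:
  fixes x y :: "nat \<Rightarrow> real"
  assumes eq: "eventually (\<lambda>k. x k = y k) sequentially"
    and lim: "(\<lambda>N. (\<Sum>k<N. y k) / real N) \<longlonglongrightarrow> \<mu>"
  shows "(\<lambda>N. (\<Sum>k<N. x k) / real N) \<longlonglongrightarrow> \<mu>"
proof -
  obtain n0 where n0: "\<And>k. k \<ge> n0 \<Longrightarrow> x k = y k" using eq by (auto simp: eventually_sequentially)
  have "(\<lambda>N. (\<Sum>k<n0. x k - y k) / real N) \<longlonglongrightarrow> 0"
    by (rule lim_const_over_n)
  from tendsto_add[OF this lim]
  have "(\<lambda>N. (\<Sum>k<n0. x k - y k) / real N + (\<Sum>k<N. y k) / real N) \<longlonglongrightarrow> \<mu>" by simp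
  moreover have "eventually (\<lambda>N. (\<Sum>k<n0. x k - y k) / real N + (\<Sum>k<N. y k) / real N = (\<Sum>k<N. x k) / real N) sequentially"
  proof (rule eventually_sequentiallyI[of n0])
    fix N assume N: "n0 \<le> N"
    have "(\<Sum>k<N. x k - y k) = (\<Sum>k<n0. x k - y k)"
      using N n0 by (intro sum.mono_neutral_right) auto
    then show "(\<Sum>k<n0. x k - y k) / real N + (\<Sum>k<N. y k) / real N = (\<Sum>k<N. x k) / real N"
      by (simp add: sum_subtractf add_divide_distrib[symmetric])
  qed
  ultimately show ?thesis by (rule Lim_transform_eventually)
qed

text \<open>
  Truncation and geometric times follow Etemadi's proof of Kolmogorov's strong law; nonnegativity gives the
  monotonicity of the sums.
\<close>

theorem (in prob_space) strong_law_iid_nonneg: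
  fixes X :: "nat \<Rightarrow> 'a \<Rightarrow> real"
  assumes ind: "indep_vars (\<lambda>_. borel) X UNIV"
    and law: "\<And>n. distr M borel (X n) = distr M borel (X 0)"
    and nonneg: "\<And>n \<omega>. 0 \<le> X n \<omega>" and int: "integrable M (X 0)"
  shows "AE \<omega> in M. (\<lambda>N. (\<Sum>k<N. X k \<omega>) / real N) \<longlonglongrightarrow> expectation (X 0)"
proof -
  have m: "X n \<in> borel_measurable M" for n using ind by (simp add: indep_vars_def2)
  (* Countably many factors, so that one null set serves all of them. *)
  define \<alpha> :: "nat \<Rightarrow> real" where "\<alpha> j = 1 + 1 / real (Suc j)" for j
  have \<alpha>: "1 < \<alpha> j" for j by (simp add: \<alpha>_def)
  have \<alpha>lim: "\<alpha> \<longlonglongrightarrow> 1"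
    using tendsto_add[OF tendsto_const LIMSEQ_Suc[OF lim_1_over_n], of 1] by (simp add: \<alpha>_def[abs_def])
  have "AE \<omega> in M. \<forall>j. (\<lambda>m. (\<Sum>k<nat \<lfloor>\<alpha> j ^ m\<rfloor>. min (X k \<omega>) (real (Suc k))) / \<alpha> j ^ m) \<longlonglongrightarrow> expectation (X 0)"
    unfolding AE_all_countable by (intro allI strong_law_truncated ind law nonneg int \<alpha>)
  moreover have "AE \<omega> in M. eventually (\<lambda>k. X k \<omega> \<le> real (Suc k)) sequentially"
    by (intro eventually_le_index_AE m law nonneg int)
  ultimately show ?thesis
  proof eventually_elim
    case (elim \<omega>)
    have "(\<lambda>N. (\<Sum>k<N. min (X k \<omega>) (real (Suc k))) / real N) \<longlonglongrightarrow> expectation (X 0)"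
    proof (rule mean_tendsto_of_geometric_times[where S="\<lambda>N. \<Sum>k<N. min (X k \<omega>) (real (Suc k))", OF _ _ \<alpha> \<alpha>lim])
      show "mono (\<lambda>N. \<Sum>k<N. min (X k \<omega>) (real (Suc k)))"
        by (intro monoI sum_mono2) (auto simp: nonneg)
      show "0 \<le> (\<Sum>k<n. min (X k \<omega>) (real (Suc k)))" for n
        by (intro sum_nonneg) (auto simp: nonneg)
    qed (use elim in blast)
    then show ?case
      by (rule mean_tendsto_eventually_equal_terms[rotated]) (use elim(2) in \<open>eventually_elim, simp\<close>)
  qed
qed

text \<open>
  From some index on the perturbation is below \<open>(1 - q) \<epsilon>/2\<close>, for which \<open>\<epsilon>/2\<close> is the fixed point of the
  recursion; the initial excess decays geometrically.
\<close>

lemma contraction_tendsto_0: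
  fixes u r :: "nat \<Rightarrow> real"
  assumes q: "0 \<le> q" "q < 1" and u: "\<And>n. 0 \<le> u n" and rec: "\<And>n. u (Suc n) \<le> q * u n + r n" and r: "r \<longlonglongrightarrow> 0"
  shows "u \<longlonglongrightarrow> 0"
proof (rule LIMSEQ_I)
  fix e :: real assume e: "0 < e"
  then have "(1 - q) * e / 2 > 0" using q by simp
  then obtain n0 where n0: "\<And>n. n \<ge> n0 \<Longrightarrow> \<bar>r n\<bar> < (1 - q) * e / 2"
    using LIMSEQ_D[OF r] by (metis diff_zero real_norm_def)
  have le: "u (n0 + k) \<le> q ^ k * u n0 + e / 2" for k
  proof (induction k)
    case (Suc k)
    have "u (n0 + Suc k) \<le> q * u (n0 + k) + (1 - q) * e / 2"
      using rec[of "n0 + k"] n0[of "n0 + k"] by auto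
    also have "\<dots> \<le> q * (q ^ k * u n0 + e / 2) + (1 - q) * e / 2"
      using Suc q by (intro add_right_mono mult_left_mono) auto
    also have "\<dots> = q ^ Suc k * u n0 + e / 2" by (simp add: field_simps)
    finally show ?case .
  qed (use e in simp)
  have "(\<lambda>k. q ^ k * u n0) \<longlonglongrightarrow> 0 * u n0"
    using q by (intro tendsto_intros LIMSEQ_power_zero) auto
  then have "eventually (\<lambda>k. q ^ k * u n0 < e / 2) sequentially"
    by (rule order_tendstoD) (use e in simp)
  then obtain k0 where k0: "\<And>k. k \<ge> k0 \<Longrightarrow> q ^ k * u n0 < e / 2" by (auto simp: eventually_sequentially)
  show "\<exists>no. \<forall>n\<ge>no. norm (u n - 0) < e"
  proof (intro exI[of _ "n0 + k0"] allI impI)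
    fix n assume n: "n0 + k0 \<le> n"
    then have "u n \<le> q ^ (n - n0) * u n0 + e / 2" using le[of "n - n0"] by simp
    moreover have "q ^ (n - n0) * u n0 < e / 2" using k0[of "n - n0"] n by simp
    ultimately show "norm (u n - 0) < e" using u[of n] by simp
  qed
qed

lemma mean_tendsto_imp_term_tendsto_0:
  fixes x :: "nat \<Rightarrow> real"
  assumes lim: "(\<lambda>N. (\<Sum>k<N. x k) / real N) \<longlonglongrightarrow> \<mu>"
  shows "(\<lambda>n. x n / real (Suc n)) \<longlonglongrightarrow> 0"
proof -
  have "(\<lambda>n. real n / real (Suc n)) \<longlonglongrightarrow> 1" by (rule LIMSEQ_n_over_Suc_n)
  from tendsto_diff[OF LIMSEQ_Suc[OF lim] tendsto_mult[OF lim this]]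
  have "(\<lambda>n. (\<Sum>k<Suc n. x k) / real (Suc n) - (\<Sum>k<n. x k) / real n * (real n / real (Suc n))) \<longlonglongrightarrow> 0" by simp
  moreover have "(\<Sum>k<Suc n. x k) / real (Suc n) - (\<Sum>k<n. x k) / real n * (real n / real (Suc n)) = x n / real (Suc n)" for n
    by (cases "n = 0") (simp_all add: add_divide_distrib del: of_nat_Suc)
  ultimately show ?thesis by simp
qed

lemma abs_le_one_plus_square: "\<bar>x\<bar> \<le> 1 + x\<^sup>2" for x :: real
proof -
  have "2 * \<bar>x\<bar> \<le> x\<^sup>2 + 1" using sum_squares_bound[of "\<bar>x\<bar>" 1] by simp
  then show ?thesis using zero_le_power2[of x] by linarith
qed

text \<open>
  Convexity of the square at \<open>q x + (1 - q) z\<close>, where \<open>z = y/(1 - q)\<close>.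
\<close>

lemma square_affine_le:
  fixes q x y :: real
  assumes "0 < q" "q < 1"
  shows "(q * x + y)\<^sup>2 \<le> q * x\<^sup>2 + y\<^sup>2 / (1 - q)"
proof -
  define d where "d = 1 - q"
  define z where "z = y / d"
  have d: "0 < d" "q = 1 - d" using assms by (auto simp: d_def)
  have y: "y = d * z" using d by (simp add: z_def)
  have "0 \<le> q * d * (x - z)\<^sup>2" using assms d by simp
  also have "\<dots> = q * x\<^sup>2 + d * z\<^sup>2 - (q * x + d * z)\<^sup>2"
    unfolding d(2) by (simp add: power2_eq_square algebra_simps)
  also have "d * z\<^sup>2 = y\<^sup>2 / (1 - q)" using d by (simp add: y power2_eq_square)
  finally show ?thesis by (simp add: y)
qed

context prob_space
begin

lemma indep_var_past_present:
  fixes Y :: "nat \<Rightarrow> 'a \<Rightarrow> 'b::topological_space"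
  assumes ind: "indep_vars (\<lambda>_. borel) Y UNIV"
    and g: "g \<in> measurable (PiM {..<k} (\<lambda>_. borel)) N1" and h: "h \<in> measurable borel N2"
  shows "indep_var N1 (\<lambda>\<omega>. g (\<lambda>i\<in>{..<k}. Y i \<omega>)) N2 (\<lambda>\<omega>. h (Y k \<omega>))"
proof -
  have "indep_var N1 (g \<circ> (\<lambda>\<omega>. restrict (\<lambda>i. Y i \<omega>) {..<k})) N2 ((\<lambda>f. h (f k)) \<circ> (\<lambda>\<omega>. restrict (\<lambda>i. Y i \<omega>) {k}))"
    by (rule indep_var_compose[OF indep_var_restrict[OF ind]])
      (auto intro!: g measurable_compose[OF _ h])
  then show ?thesis by (simp add: comp_def)
qed

lemma integrable_square_imp_integrable:
  fixes X :: "'a \<Rightarrow> real"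
  assumes [measurable]: "X \<in> borel_measurable M" and "integrable M (\<lambda>\<omega>. (X \<omega>)\<^sup>2)"
  shows "integrable M X"
proof (rule Bochner_Integration.integrable_bound)
  show "integrable M (\<lambda>\<omega>. 1 + (X \<omega>)\<^sup>2)" using assms by simp
  note abs_le_one_plus_square
  then show "AE \<omega> in M. norm (X \<omega>) \<le> norm (1 + (X \<omega>)\<^sup>2)" by (intro AE_I2) (auto intro: order_trans)
qed measurable

text \<open>
  The recursion \<open>X\<close> is a function of the past, so with \<open>H\<close> centred the products \<open>X\<^sub>n H\<^sub>n\<close> are orthogonal, and
  their second moments factorize and stay bounded. Averages of \<open>X\<close> are obtained by summing the recursion,
  which expresses them through the averages of \<open>\<xi>\<close> and the final state. The bound of \<open>\<xi>\<^sup>2\<close> by \<open>\<Theta>\<close>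
  makes \<open>X\<^sub>N\<^sup>2/N\<close> vanish almost surely although \<open>\<Theta>\<close> has only a first moment: convergence of the averages of
  \<open>\<Theta>\<close> implies \<open>\<Theta>\<^sub>n/n \<rightarrow> 0\<close>, and the recursion is a contraction.
\<close>

theorem strong_law_autoregression:
  fixes Y :: "nat \<Rightarrow> 'a \<Rightarrow> real \<times> real \<times> real" and X \<xi> H \<Theta> :: "nat \<Rightarrow> 'a \<Rightarrow> real"
  assumes ind: "indep_vars (\<lambda>_. borel) Y UNIV"
    and law: "\<And>n. distr M borel (Y n) = distr M borel (Y 0)"
    and Y: "\<And>n \<omega>. Y n \<omega> = (\<xi> n \<omega>, H n \<omega>, \<Theta> n \<omega>)"
    and \<Theta>: "\<And>n \<omega>. (\<xi> n \<omega>)\<^sup>2 \<le> 2 * \<Theta> n \<omega>" "integrable M (\<Theta> 0)" and H: "integrable M (\<lambda>\<omega>. (H 0 \<omega>)\<^sup>2)"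
    and q: "0 < q" "q < 1" and X: "\<And>\<omega>. X 0 \<omega> = 0" "\<And>n \<omega>. X (Suc n) \<omega> = q * X n \<omega> + \<xi> n \<omega>"
  shows "AE \<omega> in M. (\<lambda>N. (\<Sum>n<N. \<Theta> n \<omega> + X n \<omega> * H n \<omega>) / real N) \<longlonglongrightarrow>
      expectation (\<Theta> 0) + expectation (H 0) * (expectation (\<xi> 0) / (1 - q)) \<and>
    (\<lambda>N. (X N \<omega>)\<^sup>2 / real N) \<longlonglongrightarrow> 0"
proof -
  have Ym[measurable]: "Y n \<in> borel_measurable M" for n using ind by (simp add: indep_vars_def2)
  have \<xi>Y: "\<xi> n = (\<lambda>\<omega>. fst (Y n \<omega>))" and HY: "H n = (\<lambda>\<omega>. fst (snd (Y n \<omega>)))"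
    and \<Theta>Y: "\<Theta> n = (\<lambda>\<omega>. snd (snd (Y n \<omega>)))" for n by (simp_all add: Y)
  have [measurable]: "fst \<in> borel_measurable (borel :: (real \<times> real \<times> real) measure)"
    "(\<lambda>y. fst (snd y)) \<in> borel_measurable (borel :: (real \<times> real \<times> real) measure)"
    "(\<lambda>y. snd (snd y)) \<in> borel_measurable (borel :: (real \<times> real \<times> real) measure)"
    by (intro borel_measurable_continuous_onI continuous_intros)+
  have m[measurable]: "\<xi> n \<in> borel_measurable M" "H n \<in> borel_measurable M" "\<Theta> n \<in> borel_measurable M" for n
    unfolding \<xi>Y HY \<Theta>Y by measurable
  have \<Theta>0: "0 \<le> \<Theta> n \<omega>" for n \<omega> using \<Theta>(1)[of n \<omega>] zero_le_power2[of "\<xi> n \<omega>"] by linarith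
  have lawI: "integrable M (\<lambda>\<omega>. h (Y n \<omega>)) \<longleftrightarrow> integrable M (\<lambda>\<omega>. h (Y 0 \<omega>))"
    and lawE: "(LINT \<omega>|M. h (Y n \<omega>)) = (LINT \<omega>|M. h (Y 0 \<omega>))"
    if [measurable]: "h \<in> borel_measurable borel" for n and h :: "real \<times> real \<times> real \<Rightarrow> real"
  proof -
    have "(LINT \<omega>|M. h (Y n \<omega>)) = integral\<^sup>L (distr M borel (Y n)) h" by (rule integral_distr[symmetric]) auto
    also have "\<dots> = (LINT \<omega>|M. h (Y 0 \<omega>))" unfolding law[of n] by (rule integral_distr) auto
    finally show "(LINT \<omega>|M. h (Y n \<omega>)) = (LINT \<omega>|M. h (Y 0 \<omega>))" .
    have "integrable M (\<lambda>\<omega>. h (Y n \<omega>)) \<longleftrightarrow> integrable (distr M borel (Y n)) h" by (rule integrable_distr_eq[symmetric]) auto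
    also have "\<dots> \<longleftrightarrow> integrable M (\<lambda>\<omega>. h (Y 0 \<omega>))" unfolding law[of n] by (rule integrable_distr_eq) auto
    finally show "integrable M (\<lambda>\<omega>. h (Y n \<omega>)) \<longleftrightarrow> integrable M (\<lambda>\<omega>. h (Y 0 \<omega>))" .
  qed
  have i\<xi>0: "integrable M (\<lambda>\<omega>. (\<xi> 0 \<omega>)\<^sup>2)"
  proof (rule Bochner_Integration.integrable_bound)
    show "integrable M (\<lambda>\<omega>. 2 * \<Theta> 0 \<omega>)" using \<Theta>(2) by simp
    show "AE \<omega> in M. norm ((\<xi> 0 \<omega>)\<^sup>2) \<le> norm (2 * \<Theta> 0 \<omega>)"
      using \<Theta>(1) \<Theta>0 by (intro AE_I2) (simp add: abs_of_nonneg)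
  qed measurable
  have i\<xi>2: "integrable M (\<lambda>\<omega>. (\<xi> n \<omega>)\<^sup>2)" and E\<xi>2: "(LINT \<omega>|M. (\<xi> n \<omega>)\<^sup>2) = (LINT \<omega>|M. (\<xi> 0 \<omega>)\<^sup>2)"
    and E\<xi>: "expectation (\<xi> n) = expectation (\<xi> 0)" for n
  proof -
    show "integrable M (\<lambda>\<omega>. (\<xi> n \<omega>)\<^sup>2)"
      using lawI[of "\<lambda>y. (fst y)\<^sup>2" n] i\<xi>0 unfolding \<xi>Y by simp
    show "(LINT \<omega>|M. (\<xi> n \<omega>)\<^sup>2) = (LINT \<omega>|M. (\<xi> 0 \<omega>)\<^sup>2)"
      unfolding \<xi>Y by (rule lawE[of "\<lambda>y. (fst y)\<^sup>2"]) measurable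
    show "expectation (\<xi> n) = expectation (\<xi> 0)"
      unfolding \<xi>Y by (rule lawE) measurable
  qed
  have iH2: "integrable M (\<lambda>\<omega>. (H n \<omega>)\<^sup>2)" and EH2: "(LINT \<omega>|M. (H n \<omega>)\<^sup>2) = (LINT \<omega>|M. (H 0 \<omega>)\<^sup>2)"
    and EH: "expectation (H n) = expectation (H 0)" for n
  proof -
    show "integrable M (\<lambda>\<omega>. (H n \<omega>)\<^sup>2)"
      using lawI[of "\<lambda>y. (fst (snd y))\<^sup>2" n] H unfolding HY by simp
    show "(LINT \<omega>|M. (H n \<omega>)\<^sup>2) = (LINT \<omega>|M. (H 0 \<omega>)\<^sup>2)"
      unfolding HY by (rule lawE[of "\<lambda>y. (fst (snd y))\<^sup>2"]) measurable
    show "expectation (H n) = expectation (H 0)"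
      unfolding HY by (rule lawE) measurable
  qed
  have i\<xi>: "integrable M (\<xi> n)" and iH: "integrable M (H n)" for n
    by (rule integrable_square_imp_integrable[OF m(1) i\<xi>2], rule integrable_square_imp_integrable[OF m(2) iH2])
  define \<mu> where "\<mu> = expectation (\<xi> 0)"
  define \<eta> where "\<eta> = expectation (H 0)"
  define v where "v = (LINT \<omega>|M. (\<xi> 0 \<omega>)\<^sup>2)"
  have v0: "0 \<le> v" unfolding v_def by (intro integral_nonneg_AE) auto
  define Hc where "Hc n \<omega> = H n \<omega> - \<eta>" for n \<omega>
  have Hc2: "integrable M (\<lambda>\<omega>. (Hc n \<omega>)\<^sup>2)" "(LINT \<omega>|M. (Hc n \<omega>)\<^sup>2) \<le> (LINT \<omega>|M. (H 0 \<omega>)\<^sup>2)"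
    "integrable M (Hc n)" "expectation (Hc n) = 0" for n
  proof -
    have eq: "(Hc n \<omega>)\<^sup>2 = ((H n \<omega>)\<^sup>2 - 2 * \<eta> * H n \<omega>) + \<eta>\<^sup>2" for \<omega>
      by (simp add: Hc_def power2_eq_square algebra_simps)
    show "integrable M (\<lambda>\<omega>. (Hc n \<omega>)\<^sup>2)" unfolding eq using iH2 iH by simp
    have "(LINT \<omega>|M. (Hc n \<omega>)\<^sup>2) = (LINT \<omega>|M. (H 0 \<omega>)\<^sup>2) - 2 * \<eta> * \<eta> + \<eta>\<^sup>2"
      unfolding eq using iH2 iH EH[of n] EH2[of n] by (simp add: \<eta>_def prob_space)
    then show "(LINT \<omega>|M. (Hc n \<omega>)\<^sup>2) \<le> (LINT \<omega>|M. (H 0 \<omega>)\<^sup>2)" by (simp add: power2_eq_square)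
    show "integrable M (Hc n)" unfolding Hc_def using iH by simp
    show "expectation (Hc n) = 0" unfolding Hc_def using iH EH[of n] by (simp add: \<eta>_def prob_space)
  qed
  have [measurable]: "Hc n \<in> borel_measurable M" for n unfolding Hc_def by measurable
  have Xm[measurable]: "X n \<in> borel_measurable M" for n
  proof (induction n)
    case (Suc n)
    have "X (Suc n) = (\<lambda>\<omega>. q * X n \<omega> + \<xi> n \<omega>)" by (rule ext) (rule X(2))
    then show ?case using Suc by simp
  next
    case 0
    have "X 0 = (\<lambda>\<omega>. 0)" by (rule ext) (rule X(1))
    then show ?case by simp
  qed
  have iX2: "integrable M (\<lambda>\<omega>. (X n \<omega>)\<^sup>2)" for n
  proof (induction n)
    case (Suc n)
    show ?case
    proof (rule Bochner_Integration.integrable_bound)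
      show "integrable M (\<lambda>\<omega>. q * (X n \<omega>)\<^sup>2 + (\<xi> n \<omega>)\<^sup>2 / (1 - q))" using Suc i\<xi>2 by simp
      show "AE \<omega> in M. norm ((X (Suc n) \<omega>)\<^sup>2) \<le> norm (q * (X n \<omega>)\<^sup>2 + (\<xi> n \<omega>)\<^sup>2 / (1 - q))"
        unfolding X(2) using q by (intro AE_I2) (simp add: square_affine_le)
    qed measurable
  qed (simp add: X(1))
  have EX2: "(LINT \<omega>|M. (X n \<omega>)\<^sup>2) \<le> v / (1 - q)\<^sup>2" for n
  proof (induction n)
    case (Suc n)
    have "(LINT \<omega>|M. (X (Suc n) \<omega>)\<^sup>2) \<le> (LINT \<omega>|M. q * (X n \<omega>)\<^sup>2 + (\<xi> n \<omega>)\<^sup>2 / (1 - q))"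
      using iX2[of n] i\<xi>2 iX2[of "Suc n"] q unfolding X(2) by (intro integral_mono square_affine_le) auto
    also have "\<dots> = q * (LINT \<omega>|M. (X n \<omega>)\<^sup>2) + v / (1 - q)"
      using iX2 i\<xi>2 E\<xi>2[of n] by (simp add: v_def)
    also have "\<dots> \<le> q * (v / (1 - q)\<^sup>2) + v / (1 - q)" using Suc q by (intro add_right_mono mult_left_mono) auto
    also have "\<dots> = v / (1 - q)\<^sup>2"
    proof -
      have "v / (1 - q) = v * (1 - q) / (1 - q)\<^sup>2" using q by (simp add: power2_eq_square)
      then show ?thesis by (simp add: add_divide_distrib[symmetric] right_diff_distrib mult.commute)
    qed
    finally show ?case .
  qed (use v0 q in \<open>simp add: X(1)\<close>)
  (* The state at time n as a function of the innovations before n. *)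
  define G where "G n y = (\<Sum>i<n. q ^ (n - Suc i) * fst (y i))" for n and y :: "nat \<Rightarrow> real \<times> real \<times> real"
  have XG: "X n \<omega> = G n (\<lambda>i\<in>{..<k}. Y i \<omega>)" if "n \<le> k" for n k \<omega>
  proof -
    have "X n \<omega> = (\<Sum>i<n. q ^ (n - Suc i) * \<xi> i \<omega>)"
    proof (induction n)
      case (Suc n)
      have "(\<Sum>i<n. q ^ (Suc n - Suc i) * \<xi> i \<omega>) = q * (\<Sum>i<n. q ^ (n - Suc i) * \<xi> i \<omega>)"
        unfolding sum_distrib_left by (intro sum.cong) (auto simp: Suc_diff_Suc[symmetric] Suc_diff_le)
      then show ?case by (simp add: X(2) Suc)
    qed (simp add: X(1))
    also have "\<dots> = G n (\<lambda>i\<in>{..<k}. Y i \<omega>)"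
      unfolding G_def using that by (intro sum.cong) (auto simp: Y)
    finally show ?thesis .
  qed
  have Gm: "G n \<in> borel_measurable (PiM {..<k} (\<lambda>_. borel))" if "n \<le> k" for n k
    unfolding G_def using that by (intro borel_measurable_sum borel_measurable_times borel_measurable_const
        measurable_compose[OF measurable_component_singleton]) auto
  have indXH: "indep_var borel (\<lambda>\<omega>. (X n \<omega>)\<^sup>2) borel (\<lambda>\<omega>. (Hc n \<omega>)\<^sup>2)" for n
  proof -
    have "indep_var borel (\<lambda>\<omega>. (\<lambda>y. (G n y)\<^sup>2) (\<lambda>i\<in>{..<n}. Y i \<omega>)) borel (\<lambda>\<omega>. (\<lambda>y. (fst (snd y) - \<eta>)\<^sup>2) (Y n \<omega>))"
      by (rule indep_var_past_present[OF ind]) (use Gm[of n n] in measurable)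
    then show ?thesis by (simp add: XG[of n n] Hc_def Y)
  qed
  define Z where "Z n \<omega> = X n \<omega> * Hc n \<omega>" for n \<omega>
  have [measurable]: "Z n \<in> borel_measurable M" for n unfolding Z_def by measurable
  have Z2: "(Z n \<omega>)\<^sup>2 = (X n \<omega>)\<^sup>2 * (Hc n \<omega>)\<^sup>2" for n \<omega> by (simp add: Z_def power_mult_distrib)
  have iZ2: "integrable M (\<lambda>\<omega>. (Z n \<omega>)\<^sup>2)" for n
    unfolding Z2 by (rule indep_var_integrable[OF indXH iX2 Hc2(1)])
  have EZ2: "(LINT \<omega>|M. (Z n \<omega>)\<^sup>2) \<le> v / (1 - q)\<^sup>2 * (LINT \<omega>|M. (H 0 \<omega>)\<^sup>2)" for n
  proof -
    have "(LINT \<omega>|M. (Z n \<omega>)\<^sup>2) = (LINT \<omega>|M. (X n \<omega>)\<^sup>2) * (LINT \<omega>|M. (Hc n \<omega>)\<^sup>2)"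
      unfolding Z2 by (rule indep_var_lebesgue_integral[OF indXH iX2 Hc2(1)])
    also have "\<dots> \<le> v / (1 - q)\<^sup>2 * (LINT \<omega>|M. (H 0 \<omega>)\<^sup>2)"
      by (intro mult_mono EX2 Hc2) (use v0 in \<open>auto intro!: integral_nonneg_AE\<close>)
    finally show ?thesis .
  qed
  have orthZ: "(LINT \<omega>|M. Z j \<omega> * Z k \<omega>) = 0" if jk: "j < k" for j k
  proof -
    let ?P = "\<lambda>y. G j y * (fst (snd (y j)) - \<eta>) * G k y"
    have m1: "(\<lambda>y. fst (snd (y j)) - \<eta>) \<in> borel_measurable (PiM {..<k} (\<lambda>_. borel :: (real \<times> real \<times> real) measure))"
      using jk by (intro borel_measurable_diff borel_measurable_const
        measurable_compose[OF measurable_component_singleton, where g="\<lambda>y. fst (snd y)"]) auto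
    have "?P \<in> borel_measurable (PiM {..<k} (\<lambda>_. borel))"
      by (intro borel_measurable_times m1 Gm) (use jk in auto)
    then have "indep_var borel (\<lambda>\<omega>. ?P (\<lambda>i\<in>{..<k}. Y i \<omega>)) borel (\<lambda>\<omega>. (\<lambda>y. fst (snd y) - \<eta>) (Y k \<omega>))"
      by (rule indep_var_past_present[OF ind]) measurable
    moreover have "?P (\<lambda>i\<in>{..<k}. Y i \<omega>) = Z j \<omega> * X k \<omega>" for \<omega>
      using jk by (simp add: XG[of j k] XG[of k k] Z_def Hc_def Y)
    ultimately have "indep_var borel (\<lambda>\<omega>. Z j \<omega> * X k \<omega>) borel (Hc k)"
      by (simp add: Hc_def[abs_def] Y)
    from indep_var_lebesgue_integral[OF this integrable_mult_square_integrable[OF _ _ iZ2 iX2] Hc2(3)]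
    have "(LINT \<omega>|M. Z j \<omega> * X k \<omega> * Hc k \<omega>) = 0" by (simp add: Hc2(4))
    then show ?thesis by (simp add: Z_def mult.assoc)
  qed
  have AE_Z: "AE \<omega> in M. (\<lambda>N. (\<Sum>n<N. Z n \<omega>) / real N) \<longlonglongrightarrow> 0"
    by (rule strong_law_orthogonal[OF _ iZ2 EZ2 orthZ]) auto
  have AE_\<xi>: "AE \<omega> in M. (\<lambda>N. (\<Sum>n<N. \<xi> n \<omega> - \<mu>) / real N) \<longlonglongrightarrow> 0"
  proof (rule strong_law_orthogonal)
    fix n
    have eq: "(\<xi> n \<omega> - \<mu>)\<^sup>2 = ((\<xi> n \<omega>)\<^sup>2 - 2 * \<mu> * \<xi> n \<omega>) + \<mu>\<^sup>2" for \<omega>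
      by (simp add: power2_eq_square algebra_simps)
    show "integrable M (\<lambda>\<omega>. (\<xi> n \<omega> - \<mu>)\<^sup>2)" unfolding eq using i\<xi>2 i\<xi> by simp
    have "(LINT \<omega>|M. (\<xi> n \<omega> - \<mu>)\<^sup>2) = v - 2 * \<mu> * \<mu> + \<mu>\<^sup>2"
      unfolding eq using i\<xi>2 i\<xi> E\<xi>[of n] E\<xi>2[of n] by (simp add: \<mu>_def v_def prob_space)
    then show "(LINT \<omega>|M. (\<xi> n \<omega> - \<mu>)\<^sup>2) \<le> v" by (simp add: power2_eq_square)
  next
    fix j k :: nat assume jk: "j < k"
    have "indep_vars (\<lambda>_. borel) (\<lambda>n \<omega>. fst (Y n \<omega>) - \<mu>) UNIV"
      by (rule indep_vars_compose2[OF ind]) measurable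
    then have "indep_vars (\<lambda>_. borel) (\<lambda>n \<omega>. \<xi> n \<omega> - \<mu>) {j, k}"
      unfolding \<xi>Y by (rule indep_vars_subset) simp
    from indep_vars_lebesgue_integral[OF _ this]
    have "(LINT \<omega>|M. (\<xi> j \<omega> - \<mu>) * (\<xi> k \<omega> - \<mu>)) = (LINT \<omega>|M. \<xi> j \<omega> - \<mu>) * (LINT \<omega>|M. \<xi> k \<omega> - \<mu>)"
      using jk i\<xi> by simp
    also have "(LINT \<omega>|M. \<xi> k \<omega> - \<mu>) = 0" using i\<xi> E\<xi>[of k] by (simp add: \<mu>_def prob_space)
    finally show "(LINT \<omega>|M. (\<xi> j \<omega> - \<mu>) * (\<xi> k \<omega> - \<mu>)) = 0" by simp
  qed measurable
  have AE_\<Theta>: "AE \<omega> in M. (\<lambda>N. (\<Sum>n<N. \<Theta> n \<omega>) / real N) \<longlonglongrightarrow> expectation (\<Theta> 0)"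
  proof (rule strong_law_iid_nonneg)
    show "indep_vars (\<lambda>_. borel) \<Theta> UNIV"
      unfolding \<Theta>Y by (rule indep_vars_compose2[OF ind]) measurable
    show "distr M borel (\<Theta> n) = distr M borel (\<Theta> 0)" for n
    proof -
      have "distr M borel (\<Theta> k) = distr (distr M borel (Y k)) borel (\<lambda>y. snd (snd y))" for k
        unfolding \<Theta>Y by (subst distr_distr) (auto simp: comp_def)
      then show ?thesis using law[of n] by metis
    qed
  qed (use \<Theta>0 \<Theta> in auto)
  from AE_Z AE_\<xi> AE_\<Theta> show ?thesis
  proof eventually_elim
    case (elim \<omega>)
    have r0: "(\<lambda>n. \<Theta> n \<omega> / real (Suc n)) \<longlonglongrightarrow> 0"
      by (rule mean_tendsto_imp_term_tendsto_0[OF elim(3)])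
    have X2lim: "(\<lambda>N. (X N \<omega>)\<^sup>2 / real N) \<longlonglongrightarrow> 0"
    proof (rule contraction_tendsto_0)
      show "(\<lambda>n. 2 / (1 - q) * (\<Theta> n \<omega> / real (Suc n))) \<longlonglongrightarrow> 0"
        using tendsto_mult_left[OF r0, of "2 / (1 - q)"] by simp
      fix n
      have "(X (Suc n) \<omega>)\<^sup>2 \<le> q * (X n \<omega>)\<^sup>2 + (2 / (1 - q)) * \<Theta> n \<omega>"
      proof -
        have "(\<xi> n \<omega>)\<^sup>2 / (1 - q) \<le> 2 * \<Theta> n \<omega> / (1 - q)" using q by (intro divide_right_mono \<Theta>) auto
        then show ?thesis using square_affine_le[OF q, of "X n \<omega>" "\<xi> n \<omega>"] by (simp add: X(2))
      qed
      then have "(X (Suc n) \<omega>)\<^sup>2 / real (Suc n) \<le> (q * (X n \<omega>)\<^sup>2 + (2 / (1 - q)) * \<Theta> n \<omega>) / real (Suc n)"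
        by (intro divide_right_mono) auto
      also have "\<dots> = q * ((X n \<omega>)\<^sup>2 / real (Suc n)) + 2 / (1 - q) * (\<Theta> n \<omega> / real (Suc n))"
        by (simp add: add_divide_distrib)
      also have "(X n \<omega>)\<^sup>2 / real (Suc n) \<le> (X n \<omega>)\<^sup>2 / real n"
        by (cases "n = 0") (auto simp: X(1) intro!: divide_left_mono)
      finally show "(X (Suc n) \<omega>)\<^sup>2 / real (Suc n) \<le> q * ((X n \<omega>)\<^sup>2 / real n) + 2 / (1 - q) * (\<Theta> n \<omega> / real (Suc n))"
        using q by simp
    qed (use q in auto)
    have Xlim: "(\<lambda>N. X N \<omega> / real N) \<longlonglongrightarrow> 0"
    proof (rule Lim_null_comparison)
      show "(\<lambda>N. 1 / real N + (X N \<omega>)\<^sup>2 / real N) \<longlonglongrightarrow> 0"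
        using tendsto_add[OF lim_1_over_n X2lim] by simp
      note abs_le_one_plus_square
      then show "\<forall>\<^sub>F N in sequentially. norm (X N \<omega> / real N) \<le> 1 / real N + (X N \<omega>)\<^sup>2 / real N"
        by (intro always_eventually allI) (simp add: add_divide_distrib[symmetric] divide_right_mono)
    qed
    have Xsum: "(1 - q) * (\<Sum>n<N. X n \<omega>) = (\<Sum>n<N. \<xi> n \<omega>) - X N \<omega>" for N
    proof (induction N)
      case (Suc N)
      have "(1 - q) * (\<Sum>n<Suc N. X n \<omega>) = (1 - q) * (\<Sum>n<N. X n \<omega>) + (X N \<omega> - q * X N \<omega>)"
        by (simp add: algebra_simps)
      then show ?case unfolding Suc by (simp add: X(2))
    qed (simp add: X(1))
    have Xmean: "(\<lambda>N. (\<Sum>n<N. X n \<omega>) / real N) \<longlonglongrightarrow> \<mu> / (1 - q)"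
    proof -
      have "(\<lambda>N. ((\<Sum>n<N. \<xi> n \<omega> - \<mu>) / real N - X N \<omega> / real N + \<mu>) / (1 - q)) \<longlonglongrightarrow> (0 - 0 + \<mu>) / (1 - q)"
        using q by (intro tendsto_intros elim Xlim) auto
      moreover have "eventually (\<lambda>N. ((\<Sum>n<N. \<xi> n \<omega> - \<mu>) / real N - X N \<omega> / real N + \<mu>) / (1 - q) = (\<Sum>n<N. X n \<omega>) / real N) sequentially"
      proof (rule eventually_sequentiallyI[of 1])
        fix N :: nat assume N: "1 \<le> N"
        have "(\<Sum>n<N. X n \<omega>) = ((\<Sum>n<N. \<xi> n \<omega>) - X N \<omega>) / (1 - q)" using Xsum[of N] q by (simp add: field_simps)
        then show "((\<Sum>n<N. \<xi> n \<omega> - \<mu>) / real N - X N \<omega> / real N + \<mu>) / (1 - q) = (\<Sum>n<N. X n \<omega>) / real N"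
          using N by (simp add: sum_subtractf diff_divide_distrib add_divide_distrib mult.commute[of _ "1 - q"])
      qed
      ultimately show ?thesis by (simp add: Lim_transform_eventually)
    qed
    have "(\<lambda>N. (\<Sum>n<N. \<Theta> n \<omega>) / real N + ((\<Sum>n<N. Z n \<omega>) / real N + \<eta> * ((\<Sum>n<N. X n \<omega>) / real N)))
        \<longlonglongrightarrow> expectation (\<Theta> 0) + (0 + \<eta> * (\<mu> / (1 - q)))"
      by (intro tendsto_intros elim Xmean)
    moreover have "(\<Sum>n<N. \<Theta> n \<omega>) / real N + ((\<Sum>n<N. Z n \<omega>) / real N + \<eta> * ((\<Sum>n<N. X n \<omega>) / real N)) =
       (\<Sum>n<N. \<Theta> n \<omega> + X n \<omega> * H n \<omega>) / real N" for N
    proof -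
      have "(\<Sum>n<N. \<Theta> n \<omega> + X n \<omega> * H n \<omega>) = (\<Sum>n<N. \<Theta> n \<omega>) + ((\<Sum>n<N. Z n \<omega>) + \<eta> * (\<Sum>n<N. X n \<omega>))"
        by (simp add: Z_def Hc_def sum.distrib sum_distrib_left algebra_simps sum_subtractf)
      then show ?thesis by (simp add: add_divide_distrib)
    qed
    ultimately show ?case using X2lim by (simp add: \<eta>_def \<mu>_def)
  qed
qed

end

section \<open>Independence and equality in law under almost sure limits\<close>

text \<open>
  Continuous functions increasing to the indicator of an open set; they pass from expectations of bounded
  continuous functions to probabilities of open sets, which form an intersection-stable generator of the
  Borel sets. The case distinction is due to \<open>infdist x {} = 0\<close>.
\<close>

definition open_approx :: "'b::metric_space set \<Rightarrow> nat \<Rightarrow> 'b \<Rightarrow> real" where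
  "open_approx U m x = (if U = UNIV then 1 else min 1 (real m * infdist x (- U)))"

lemma open_approx_continuous: "continuous_on UNIV (open_approx U m)"
  unfolding open_approx_def by (cases "U = UNIV") (auto intro!: continuous_intros)

lemma open_approx_bounds: "0 \<le> open_approx U m x" "open_approx U m x \<le> 1"
  by (auto simp: open_approx_def infdist_nonneg)

lemma open_approx_tendsto:
  assumes "open U"
  shows "(\<lambda>m. open_approx U m x) \<longlonglongrightarrow> indicator U x"
proof (cases "U = UNIV")
  case True then show ?thesis by (simp add: open_approx_def)
next
  case False
  show ?thesis
  proof (cases "x \<in> U")
    case True
    have "closed (- U)" "- U \<noteq> {}" using assms False by auto
    then have d: "infdist x (- U) > 0"
      using True by (metis ComplD in_closed_iff_infdist_zero infdist_nonneg less_le)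
    obtain n0 :: nat where n0: "1 / infdist x (- U) \<le> real n0" using real_arch_simple by blast
    have "eventually (\<lambda>m. indicator U x = open_approx U m x) sequentially"
    proof (rule eventually_sequentiallyI[of n0])
      fix m assume "n0 \<le> m"
      then have "1 / infdist x (- U) \<le> real m" using n0 by linarith
      then have "1 \<le> real m * infdist x (- U)" using d by (simp add: divide_le_eq)
      then show "indicator U x = open_approx U m x" using True False by (simp add: open_approx_def)
    qed
    then show ?thesis by (rule Lim_transform_eventually[OF tendsto_const])
  next
    case F: False
    then show ?thesis using False by (simp add: open_approx_def)
  qed
qed

lemma AE_tendsto_imp_expectation_tendsto:
  fixes Y :: "nat \<Rightarrow> 'a \<Rightarrow> 'b::metric_space" and g :: "'b \<Rightarrow> real"
  assumes "finite_measure M" and [measurable]: "\<And>k. Y k \<in> borel_measurable M" "Z \<in> borel_measurable M"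
    and lim: "AE \<omega> in M. (\<lambda>k. Y k \<omega>) \<longlonglongrightarrow> Z \<omega>"
    and g: "continuous_on UNIV g" "\<And>x. \<bar>g x\<bar> \<le> C"
  shows "(\<lambda>k. LINT \<omega>|M. g (Y k \<omega>)) \<longlonglongrightarrow> (LINT \<omega>|M. g (Z \<omega>))"
proof -
  interpret finite_measure M by fact
  have [measurable]: "g \<in> borel_measurable borel" using g(1) by (rule borel_measurable_continuous_onI)
  show ?thesis
  proof (rule integral_dominated_convergence[where w="\<lambda>_. C"])
    show "AE \<omega> in M. (\<lambda>k. g (Y k \<omega>)) \<longlonglongrightarrow> g (Z \<omega>)"
      using lim by eventually_elim (rule continuous_on_tendsto_compose[OF g(1)], auto)
  qed (use g in auto)
qed

text \<open>
  A law on a metric space is determined by its integrals of bounded continuous functions, and these pass to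
  almost sure limits by dominated convergence.
\<close>

lemma distr_eq_AE_limit:
  fixes Y Y' :: "nat \<Rightarrow> 'a \<Rightarrow> 'b::metric_space"
  assumes M: "prob_space M"
    and m: "\<And>k. Y k \<in> borel_measurable M" "\<And>k. Y' k \<in> borel_measurable M" "Z \<in> borel_measurable M" "Z' \<in> borel_measurable M"
    and lim: "AE \<omega> in M. (\<lambda>k. Y k \<omega>) \<longlonglongrightarrow> Z \<omega>" "AE \<omega> in M. (\<lambda>k. Y' k \<omega>) \<longlonglongrightarrow> Z' \<omega>"
    and eq: "\<And>k. distr M borel (Y k) = distr M borel (Y' k)"
  shows "distr M borel Z = distr M borel Z'"
proof -
  interpret prob_space M by fact
  note [measurable] = m
  have E: "(LINT \<omega>|M. g (Z \<omega>)) = (LINT \<omega>|M. g (Z' \<omega>))"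
    if g: "continuous_on UNIV g" "\<And>x. \<bar>g x\<bar> \<le> C" for g :: "'b \<Rightarrow> real" and C
  proof (rule LIMSEQ_unique)
    have gm[measurable]: "g \<in> borel_measurable borel" using g(1) by (rule borel_measurable_continuous_onI)
    show "(\<lambda>k. LINT \<omega>|M. g (Y k \<omega>)) \<longlonglongrightarrow> (LINT \<omega>|M. g (Z \<omega>))"
      by (rule AE_tendsto_imp_expectation_tendsto[OF finite_measure_axioms m(1,3) lim(1) g])
    have "(\<lambda>k. LINT \<omega>|M. g (Y' k \<omega>)) \<longlonglongrightarrow> (LINT \<omega>|M. g (Z' \<omega>))"
      by (rule AE_tendsto_imp_expectation_tendsto[OF finite_measure_axioms m(2,4) lim(2) g])
    moreover have "(LINT \<omega>|M. g (Y k \<omega>)) = (LINT \<omega>|M. g (Y' k \<omega>))" for k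
    proof -
      have "(LINT \<omega>|M. g (Y k \<omega>)) = integral\<^sup>L (distr M borel (Y k)) g" by (rule integral_distr[symmetric]) auto
      also have "\<dots> = (LINT \<omega>|M. g (Y' k \<omega>))" unfolding eq by (rule integral_distr) auto
      finally show ?thesis .
    qed
    ultimately show "(\<lambda>k. LINT \<omega>|M. g (Y k \<omega>)) \<longlonglongrightarrow> (LINT \<omega>|M. g (Z' \<omega>))" by simp
  qed
  have prob_lim: "(\<lambda>j. LINT \<omega>|M. open_approx U j (W \<omega>)) \<longlonglongrightarrow> measure M (W -` U \<inter> space M)"
    if U: "open U" and [measurable]: "W \<in> borel_measurable M" for U :: "'b set" and W
  proof -
    have [measurable]: "U \<in> sets borel" using U by simp
    have [measurable]: "open_approx U j \<in> borel_measurable borel" for j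
      by (rule borel_measurable_continuous_onI[OF open_approx_continuous])
    have "(\<lambda>j. LINT \<omega>|M. open_approx U j (W \<omega>)) \<longlonglongrightarrow> (LINT \<omega>|M. indicator U (W \<omega>))"
      by (rule integral_dominated_convergence[where w="\<lambda>_. 1"])
        (auto simp: open_approx_bounds open_approx_tendsto[OF U])
    also have "(LINT \<omega>|M. indicator U (W \<omega>)) = (LINT \<omega>|M. indicator (W -` U \<inter> space M) \<omega>)"
      by (intro Bochner_Integration.integral_cong) (auto simp: indicator_def)
    finally show ?thesis by simp
  qed
  have P: "measure M (Z -` U \<inter> space M) = measure M (Z' -` U \<inter> space M)" if U: "open U" for U
  proof (rule LIMSEQ_unique[OF prob_lim[OF U m(3)]])
    show "(\<lambda>j. LINT \<omega>|M. open_approx U j (Z \<omega>)) \<longlonglongrightarrow> measure M (Z' -` U \<inter> space M)"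

    proof -
      have "(LINT \<omega>|M. open_approx U j (Z \<omega>)) = (LINT \<omega>|M. open_approx U j (Z' \<omega>))" for j
        by (rule E[of "open_approx U j" 1]) (simp_all add: open_approx_continuous open_approx_bounds)
      then show ?thesis using prob_lim[OF U m(4)] by simp
    qed
  qed
  show ?thesis
  proof (rule measure_eqI_generator_eq[where E="{U. open U}" and \<Omega>=UNIV and A="\<lambda>_. UNIV"])
    show "Int_stable {U. open U}" by (auto simp: Int_stable_def)
    show "emeasure (distr M borel Z) X = emeasure (distr M borel Z') X" if "X \<in> {U. open U}" for X
      using that P[of X] by (simp add: emeasure_distr emeasure_eq_measure)
    show "emeasure (distr M borel Z) UNIV \<noteq> \<infinity>" by (simp add: emeasure_distr)
  qed (auto simp: borel_def)
qed

text \<open>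
  Independence is the factorization of the expectation of products of bounded continuous functions of finitely
  many of the variables; this passes to almost sure limits by dominated convergence.
\<close>

lemma (in prob_space) indep_vars_AE_limit:
  fixes Y :: "nat \<Rightarrow> 'i \<Rightarrow> 'a \<Rightarrow> 'b::metric_space"
  assumes ind: "\<And>k. indep_vars (\<lambda>_. borel) (Y k) I"
    and Z: "\<And>i. i \<in> I \<Longrightarrow> Z i \<in> borel_measurable M"
    and lim: "\<And>i. i \<in> I \<Longrightarrow> AE \<omega> in M. (\<lambda>k. Y k i \<omega>) \<longlonglongrightarrow> Z i \<omega>"
  shows "indep_vars (\<lambda>_. borel) Z I"
proof -
  have Ym: "Y k i \<in> borel_measurable M" if "i \<in> I" for k i
    using ind[of k] that by (simp add: indep_vars_def2)
  have E: "(LINT \<omega>|M. (\<Prod>i\<in>J. g i (Z i \<omega>))) = (\<Prod>i\<in>J. LINT \<omega>|M. g i (Z i \<omega>))"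
    if J: "J \<subseteq> I" "finite J" and g: "\<And>i. continuous_on UNIV (g i)" "\<And>i x. \<bar>g i x\<bar> \<le> 1"
    for J and g :: "'i \<Rightarrow> 'b \<Rightarrow> real"
  proof (rule LIMSEQ_unique)
    have gm[measurable]: "g i \<in> borel_measurable borel" for i using g(1) by (rule borel_measurable_continuous_onI)
    note [measurable] = Ym Z
    have lim': "AE \<omega> in M. \<forall>i\<in>J. (\<lambda>k. Y k i \<omega>) \<longlonglongrightarrow> Z i \<omega>"
      using J lim by (intro AE_finite_allI) auto
    have gp: "\<bar>\<Prod>i\<in>J. g i (x i)\<bar> \<le> 1" for x
      unfolding abs_prod by (intro prod_le_1) (auto simp: g)
    show "(\<lambda>k. LINT \<omega>|M. (\<Prod>i\<in>J. g i (Y k i \<omega>))) \<longlonglongrightarrow> (LINT \<omega>|M. (\<Prod>i\<in>J. g i (Z i \<omega>)))"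
    proof (rule integral_dominated_convergence[where w="\<lambda>_. 1"])
      show "(\<lambda>\<omega>. \<Prod>i\<in>J. g i (Z i \<omega>)) \<in> borel_measurable M"
        using J by (intro borel_measurable_prod measurable_compose[OF Z gm]) auto
      show "(\<lambda>\<omega>. \<Prod>i\<in>J. g i (Y k i \<omega>)) \<in> borel_measurable M" for k
        using J by (intro borel_measurable_prod measurable_compose[OF Ym gm]) auto
      show "AE \<omega> in M. (\<lambda>k. \<Prod>i\<in>J. g i (Y k i \<omega>)) \<longlonglongrightarrow> (\<Prod>i\<in>J. g i (Z i \<omega>))"
        using lim' by eventually_elim (intro tendsto_prod continuous_on_tendsto_compose[OF g(1)], auto)
    qed (use gp in auto)
    have "(\<lambda>k. \<Prod>i\<in>J. LINT \<omega>|M. g i (Y k i \<omega>)) \<longlonglongrightarrow> (\<Prod>i\<in>J. LINT \<omega>|M. g i (Z i \<omega>))"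
      using J by (intro tendsto_prod AE_tendsto_imp_expectation_tendsto[OF finite_measure_axioms Ym Z lim g]) auto
    moreover have "(LINT \<omega>|M. (\<Prod>i\<in>J. g i (Y k i \<omega>))) = (\<Prod>i\<in>J. LINT \<omega>|M. g i (Y k i \<omega>))" for k
    proof (rule indep_vars_lebesgue_integral[OF J(2)])
      show "indep_vars (\<lambda>_. borel) (\<lambda>i \<omega>. g i (Y k i \<omega>)) J"
        by (rule indep_vars_compose2[OF indep_vars_subset[OF ind J(1)]]) auto
      show "integrable M (\<lambda>\<omega>. g i (Y k i \<omega>))" if "i \<in> J" for i
        using that J g by (intro integrable_const_bound[where B=1] measurable_compose[OF Ym gm]) auto
    qed
    ultimately show "(\<lambda>k. LINT \<omega>|M. (\<Prod>i\<in>J. g i (Y k i \<omega>))) \<longlonglongrightarrow> (\<Prod>i\<in>J. LINT \<omega>|M. g i (Z i \<omega>))" by simp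
  qed
  have P: "prob (\<Inter>i\<in>J. Z i -` U i \<inter> space M) = (\<Prod>i\<in>J. prob (Z i -` U i \<inter> space M))"
    if J: "J \<noteq> {}" "J \<subseteq> I" "finite J" and U: "\<And>i. i \<in> J \<Longrightarrow> open (U i)" for J and U :: "'i \<Rightarrow> 'b set"
  proof (rule LIMSEQ_unique)
    define V where "V i = (if i \<in> J then U i else UNIV)" for i
    have V: "open (V i)" for i using U by (simp add: V_def)
    have [measurable]: "V i \<in> sets borel" for i using V by simp
    have am: "open_approx (V i) j \<in> borel_measurable borel" for i j
      by (rule borel_measurable_continuous_onI[OF open_approx_continuous])
    have ind_eq: "(LINT \<omega>|M. indicat_real (V i) (Z i \<omega>)) = prob (Z i -` U i \<inter> space M)" if "i \<in> J" for i
    proof -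
      have "(LINT \<omega>|M. indicat_real (V i) (Z i \<omega>)) = (LINT \<omega>|M. indicat_real (Z i -` U i \<inter> space M) \<omega>)"
        using that by (intro Bochner_Integration.integral_cong) (auto simp: indicator_def V_def)
      then show ?thesis by simp
    qed
    have ap: "\<bar>\<Prod>i\<in>J. open_approx (V i) j (x i)\<bar> \<le> 1" for j x
      unfolding abs_prod by (intro prod_le_1) (auto simp: open_approx_bounds abs_le_iff intro: order_trans[OF _ open_approx_bounds(1)])
    have "(\<lambda>j. LINT \<omega>|M. (\<Prod>i\<in>J. open_approx (V i) j (Z i \<omega>))) \<longlonglongrightarrow> (LINT \<omega>|M. (\<Prod>i\<in>J. indicator (V i) (Z i \<omega>)))"
    proof (rule integral_dominated_convergence[where w="\<lambda>_. 1"])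
      show "(\<lambda>\<omega>. \<Prod>i\<in>J. open_approx (V i) j (Z i \<omega>)) \<in> borel_measurable M" for j
        using J by (intro borel_measurable_prod measurable_compose[OF Z am]) auto
      show "(\<lambda>\<omega>. \<Prod>i\<in>J. indicator (V i) (Z i \<omega>) :: real) \<in> borel_measurable M"
        using J by (intro borel_measurable_prod measurable_compose[OF Z]) auto
      show "AE \<omega> in M. (\<lambda>j. \<Prod>i\<in>J. open_approx (V i) j (Z i \<omega>)) \<longlonglongrightarrow> (\<Prod>i\<in>J. indicator (V i) (Z i \<omega>))"
        by (intro AE_I2 tendsto_prod open_approx_tendsto V)
    qed (use ap in auto)
    also have "(LINT \<omega>|M. (\<Prod>i\<in>J. indicator (V i) (Z i \<omega>)) :: real) = (LINT \<omega>|M. indicator (\<Inter>i\<in>J. Z i -` U i \<inter> space M) \<omega>)"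
    proof (intro Bochner_Integration.integral_cong refl)
      fix \<omega> assume w: "\<omega> \<in> space M"
      show "(\<Prod>i\<in>J. indicator (V i) (Z i \<omega>)) = (indicator (\<Inter>i\<in>J. Z i -` U i \<inter> space M) \<omega> :: real)"
      proof (cases "\<forall>i\<in>J. Z i \<omega> \<in> U i")
        case True then show ?thesis using w J by (simp add: V_def indicator_def)
      next
        case False
        then obtain i where "i \<in> J" "Z i \<omega> \<notin> U i" by blast
        then show ?thesis using J by (auto simp: V_def indicator_def prod_zero_iff)
      qed
    qed
    also have "\<dots> = prob (\<Inter>i\<in>J. Z i -` U i \<inter> space M)"
    proof -
      have "(\<Inter>i\<in>J. Z i -` U i \<inter> space M) \<in> events"
        using J U by (intro sets.finite_INT measurable_sets[OF Z]) auto
      then show ?thesis by simp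
    qed
    finally show "(\<lambda>j. LINT \<omega>|M. (\<Prod>i\<in>J. open_approx (V i) j (Z i \<omega>))) \<longlonglongrightarrow> prob (\<Inter>i\<in>J. Z i -` U i \<inter> space M)" .
    have "(\<lambda>j. LINT \<omega>|M. open_approx (V i) j (Z i \<omega>)) \<longlonglongrightarrow> (LINT \<omega>|M. indicat_real (V i) (Z i \<omega>))" if "i \<in> J" for i
    proof (rule integral_dominated_convergence[where w="\<lambda>_. 1"])
      show "(\<lambda>\<omega>. open_approx (V i) j (Z i \<omega>)) \<in> borel_measurable M" for j
        using J that by (intro measurable_compose[OF Z am]) auto
      show "(\<lambda>\<omega>. indicator (V i) (Z i \<omega>) :: real) \<in> borel_measurable M"
        using J that by (intro measurable_compose[OF Z]) auto
    qed (auto simp: open_approx_bounds open_approx_tendsto[OF V])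
    then have "(\<lambda>j. \<Prod>i\<in>J. LINT \<omega>|M. open_approx (V i) j (Z i \<omega>)) \<longlonglongrightarrow> (\<Prod>i\<in>J. prob (Z i -` U i \<inter> space M))"
      using ind_eq by (intro tendsto_prod) auto
    moreover have "(LINT \<omega>|M. (\<Prod>i\<in>J. open_approx (V i) j (Z i \<omega>))) = (\<Prod>i\<in>J. LINT \<omega>|M. open_approx (V i) j (Z i \<omega>))" for j
      by (rule E[OF J(2,3) open_approx_continuous]) (simp add: open_approx_bounds)
    ultimately show "(\<lambda>j. LINT \<omega>|M. (\<Prod>i\<in>J. open_approx (V i) j (Z i \<omega>))) \<longlonglongrightarrow> (\<Prod>i\<in>J. prob (Z i -` U i \<inter> space M))"
      by simp
  qed
  let ?E = "\<lambda>i. {Z i -` U \<inter> space M |U. open U}"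
  have "indep_sets ?E I"
  proof (rule indep_setsI)
    show "?E i \<subseteq> events" if "i \<in> I" for i using that by (auto intro!: measurable_sets[OF Z])
    fix A J assume J: "J \<noteq> {}" "J \<subseteq> I" "finite J" and A: "\<forall>j\<in>J. A j \<in> ?E j"
    then obtain U where U: "\<And>j. j \<in> J \<Longrightarrow> open (U j)" "\<And>j. j \<in> J \<Longrightarrow> A j = Z j -` U j \<inter> space M"
      by (simp only: mem_Collect_eq) metis
    have "prob (\<Inter>j\<in>J. A j) = prob (\<Inter>j\<in>J. Z j -` U j \<inter> space M)" using U(2) by (simp cong: INF_cong)
    also have "\<dots> = (\<Prod>j\<in>J. prob (Z j -` U j \<inter> space M))" by (rule P[OF J U(1)])
    also have "\<dots> = (\<Prod>j\<in>J. prob (A j))" using U(2) by (intro prod.cong) auto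
    finally show "prob (\<Inter>j\<in>J. A j) = (\<Prod>j\<in>J. prob (A j))" .
  qed
  then have "indep_sets (\<lambda>i. sigma_sets (space M) (?E i)) I"
  proof (rule indep_sets_sigma)
    fix i
    show "Int_stable (?E i)"
    proof (rule Int_stableI)
      fix a b assume "a \<in> ?E i" "b \<in> ?E i"
      then obtain U V where "open U" "open V" "a = Z i -` U \<inter> space M" "b = Z i -` V \<inter> space M" by blast
      then show "a \<inter> b \<in> ?E i" by (intro CollectI exI[of _ "U \<inter> V"]) auto
    qed
  qed
  moreover have "sigma_sets (space M) (?E i) = {Z i -` A \<inter> space M |A. A \<in> sets borel}" for i
  proof -
    have "sets (borel :: 'b measure) = sigma_sets UNIV {U. open U}" by (simp add: borel_def)
    then have "{Z i -` A \<inter> space M |A. A \<in> sets borel} = {Z i -` A \<inter> space M |A. A \<in> sigma_sets UNIV {U. open U}}" by simp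
    also have "\<dots> = sigma_sets (space M) {Z i -` A \<inter> space M |A. A \<in> {U. open U}}"
      by (rule sigma_sets_vimage_commute) auto
    finally show ?thesis by simp
  qed
  ultimately show ?thesis
    unfolding indep_vars_def2 using Z by simp
qed

section \<open>Moments of a square integrable Levy process\<close>

text \<open>
  After subtracting \<open>t \<phi>(1)\<close> the function is additive and vanishes at integers, hence is bounded on the whole
  half line by its bound on \<open>[0, 1]\<close>. A nonzero value would be contradicted by its multiples.
\<close>

lemma additive_bounded_imp_linear:
  fixes \<phi> :: "real \<Rightarrow> real"
  assumes add: "\<And>s t. 0 \<le> s \<Longrightarrow> 0 \<le> t \<Longrightarrow> \<phi> (s + t) = \<phi> s + \<phi> t"
    and bound: "\<And>t. 0 \<le> t \<Longrightarrow> t \<le> 1 \<Longrightarrow> \<bar>\<phi> t\<bar> \<le> C" and t: "0 \<le> t"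
  shows "\<phi> t = t * \<phi> 1"
proof -
  define \<psi> where "\<psi> t = \<phi> t - t * \<phi> 1" for t
  have \<psi>: "\<psi> (s + t) = \<psi> s + \<psi> t" if "0 \<le> s" "0 \<le> t" for s t
    using add[OF that] by (simp add: \<psi>_def algebra_simps)
  have \<psi>0: "\<psi> 0 = 0" using \<psi>[of 0 0] by simp
  have mult: "\<psi> (real n * s) = real n * \<psi> s" if "0 \<le> s" for n s
  proof (induction n)
    case (Suc n)
    have "\<psi> (real (Suc n) * s) = \<psi> (real n * s + s)" by (simp add: algebra_simps)
    also have "\<dots> = \<psi> (real n * s) + \<psi> s" using that by (intro \<psi>) auto
    finally show ?case using Suc by (simp add: algebra_simps)
  qed (simp add: \<psi>0)
  have C: "\<bar>\<psi> x\<bar> \<le> 2 * C" if x: "0 \<le> x" for x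
  proof -
    have fr: "0 \<le> frac x" "frac x < 1" by (auto simp: frac_lt_1)
    have "x = real (nat \<lfloor>x\<rfloor>) * 1 + frac x" using x by (simp add: frac_def)
    then have "\<psi> x = \<psi> (real (nat \<lfloor>x\<rfloor>) * 1 + frac x)" by (rule arg_cong[where f=\<psi>])
    also have "\<dots> = \<psi> (real (nat \<lfloor>x\<rfloor>) * 1) + \<psi> (frac x)" using fr by (intro \<psi>) auto
    also have "\<psi> (real (nat \<lfloor>x\<rfloor>) * 1) = 0" unfolding mult[of 1, OF zero_le_one] by (simp add: \<psi>_def)
    finally have "\<psi> x = \<phi> (frac x) - frac x * \<phi> 1" by (simp add: \<psi>_def)
    moreover have "\<bar>frac x * \<phi> 1\<bar> \<le> C"
      using mult_mono[of "frac x" 1 "\<bar>\<phi> 1\<bar>" C] bound[of 1] fr by (simp add: abs_mult)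
    moreover have "\<bar>\<phi> (frac x)\<bar> \<le> C" using bound fr by simp
    ultimately show ?thesis by linarith
  qed
  have "\<psi> t = 0"
  proof (rule ccontr)
    assume "\<psi> t \<noteq> 0"
    then have p: "\<bar>\<psi> t\<bar> > 0" by simp
    obtain n :: nat where n: "2 * C / \<bar>\<psi> t\<bar> < real n" using reals_Archimedean2 by blast
    have "real n * \<bar>\<psi> t\<bar> \<le> 2 * C" using C[of "real n * t"] t mult[OF t, of n] by (simp add: abs_mult)
    then show False using n p by (simp add: divide_less_eq)
  qed
  then show ?thesis by (simp add: \<psi>_def)
qed

text \<open>
  The process is indexed by the whole line here, so that joint measurability can be stated with the Borel
  \<sigma>-algebra of the line; a process on the half line is extended by its initial value.
\<close>

locale square_integrable_levy = prob_space M for M :: "'a measure" +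
  fixes W :: "real \<Rightarrow> 'a \<Rightarrow> real"
  assumes measurable_process: "(\<lambda>(t, \<omega>). W t \<omega>) \<in> borel_measurable (borel \<Otimes>\<^sub>M M)"
    and start: "AE \<omega> in M. W 0 \<omega> = 0"
    and indep_increments: "\<And>n t. 0 \<le> t 0 \<Longrightarrow> (\<And>i. i < n \<Longrightarrow> t i \<le> t (Suc i)) \<Longrightarrow>
      indep_vars (\<lambda>_. borel) (\<lambda>i \<omega>. W (t (Suc i)) \<omega> - W (t i) \<omega>) {..<n::nat}"
    and stationary: "\<And>s h. 0 \<le> s \<Longrightarrow> 0 \<le> h \<Longrightarrow> distr M borel (\<lambda>\<omega>. W (s + h) \<omega> - W s \<omega>) = distr M borel (W h)"
    and stochastic_continuity: "\<And>\<epsilon>. 0 < \<epsilon> \<Longrightarrow>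
      ((\<lambda>t. measure M {\<omega> \<in> space M. \<epsilon> \<le> \<bar>W t \<omega> - W 0 \<omega>\<bar>}) \<longlongrightarrow> 0) (at 0 within {0..})"
    and second_moment: "\<And>t. 0 \<le> t \<Longrightarrow> integrable M (\<lambda>\<omega>. (W t \<omega>)\<^sup>2)"
begin

text \<open>
  The slopes of mean and variance as functions of time; see \<open>expectation_W\<close> and \<open>variance_W\<close>.
\<close>

definition drift :: real where "drift = expectation (W 1)"

definition diffusivity :: real where "diffusivity = variance (W 1)"

lemma measurable_W[measurable]: "W t \<in> borel_measurable M"
  using measurable_compose[OF measurable_Pair1'[of t borel M] measurable_process] by simp

lemma measurable_path: "\<omega> \<in> space M \<Longrightarrow> (\<lambda>t. W t \<omega>) \<in> borel_measurable borel"
  using measurable_compose[OF measurable_Pair2'[of \<omega> M borel] measurable_process] by simp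

lemma measurable_process' [measurable (raw)]:
  assumes [measurable]: "f \<in> borel_measurable N" "g \<in> N \<rightarrow>\<^sub>M M"
  shows "(\<lambda>x. W (f x) (g x)) \<in> borel_measurable N"
  using measurable_compose[OF measurable_Pair[OF assms] measurable_process] by simp

lemma integrable_W: "0 \<le> t \<Longrightarrow> integrable M (W t)"
  by (rule integrable_square_imp_integrable) (use second_moment in auto)

text \<open>
  Stationarity of the increments as a rule for integrals.
\<close>

lemma increment_transfer:
  assumes [measurable]: "h \<in> borel_measurable borel" and "0 \<le> s" "0 \<le> t"
  shows "(LINT \<omega>|M. h (W (s + t) \<omega> - W s \<omega>)) = (LINT \<omega>|M. h (W t \<omega>) :: real)"
    "integrable M (\<lambda>\<omega>. h (W (s + t) \<omega> - W s \<omega>)) \<longleftrightarrow> integrable M (\<lambda>\<omega>. h (W t \<omega>) :: real)"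
proof -
  have "(LINT \<omega>|M. h (W (s + t) \<omega> - W s \<omega>)) = integral\<^sup>L (distr M borel (\<lambda>\<omega>. W (s + t) \<omega> - W s \<omega>)) h"
    by (rule integral_distr[symmetric]) auto
  also have "\<dots> = (LINT \<omega>|M. h (W t \<omega>))" unfolding stationary[OF assms(2,3)] by (rule integral_distr) auto
  finally show "(LINT \<omega>|M. h (W (s + t) \<omega> - W s \<omega>)) = (LINT \<omega>|M. h (W t \<omega>))" .
  have "integrable M (\<lambda>\<omega>. h (W (s + t) \<omega> - W s \<omega>)) \<longleftrightarrow> integrable (distr M borel (\<lambda>\<omega>. W (s + t) \<omega> - W s \<omega>)) h"
    by (rule integrable_distr_eq[symmetric]) auto
  also have "\<dots> \<longleftrightarrow> integrable M (\<lambda>\<omega>. h (W t \<omega>))" unfolding stationary[OF assms(2,3)] by (rule integrable_distr_eq) auto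
  finally show "integrable M (\<lambda>\<omega>. h (W (s + t) \<omega> - W s \<omega>)) \<longleftrightarrow> integrable M (\<lambda>\<omega>. h (W t \<omega>))" .
qed

lemma expectation_W_increment:
  assumes s: "0 \<le> s" and t: "0 \<le> t"
  shows "expectation (\<lambda>\<omega>. W s \<omega> * (W (s + t) \<omega> - W s \<omega>)) = expectation (W s) * expectation (W t)"
    "integrable M (\<lambda>\<omega>. W s \<omega> * (W (s + t) \<omega> - W s \<omega>))"
proof -
  define \<tau> where "\<tau> i = (if i = 0 then 0 else if i = 1 then s else s + t)" for i :: nat
  have "indep_vars (\<lambda>_. borel) (\<lambda>i \<omega>. W (\<tau> (Suc i)) \<omega> - W (\<tau> i) \<omega>) {..<2}"
    using s t by (intro indep_increments) (auto simp: \<tau>_def)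
  then have ind: "indep_vars (\<lambda>_. borel) (\<lambda>i \<omega>. W (\<tau> (Suc i)) \<omega> - W (\<tau> i) \<omega>) {0, 1}"
    by (rule indep_vars_subset) auto
  have i1: "integrable M (\<lambda>\<omega>. W s \<omega> - W 0 \<omega>)" and i2: "integrable M (\<lambda>\<omega>. W (s + t) \<omega> - W s \<omega>)"
    using s t by (auto intro!: Bochner_Integration.integrable_diff integrable_W)
  have E1: "expectation (\<lambda>\<omega>. W s \<omega> - W 0 \<omega>) = expectation (W s)"
    by (rule integral_cong_AE) (use start in \<open>auto elim: eventually_mono\<close>)
  have E2: "expectation (\<lambda>\<omega>. W (s + t) \<omega> - W s \<omega>) = expectation (W t)"
    using increment_transfer(1)[of "\<lambda>x. x", OF _ s t] by simp
  have ii: "integrable M (\<lambda>\<omega>. W (\<tau> (Suc i)) \<omega> - W (\<tau> i) \<omega>)" if "i \<in> {0, 1}" for i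
    using that i1 i2 by (auto simp: \<tau>_def)
  have "(LINT \<omega>|M. (\<Prod>i\<in>{0, 1}. W (\<tau> (Suc i)) \<omega> - W (\<tau> i) \<omega>)) = (\<Prod>i\<in>{0, 1}. LINT \<omega>|M. W (\<tau> (Suc i)) \<omega> - W (\<tau> i) \<omega>)"
    by (rule indep_vars_lebesgue_integral[OF _ ind ii]) auto
  then have 1: "expectation (\<lambda>\<omega>. (W s \<omega> - W 0 \<omega>) * (W (s + t) \<omega> - W s \<omega>)) = expectation (W s) * expectation (W t)"
    using E1 E2 by (simp add: \<tau>_def)
  have "integrable M (\<lambda>\<omega>. (\<Prod>i\<in>{0, 1}. W (\<tau> (Suc i)) \<omega> - W (\<tau> i) \<omega>))"
    by (rule indep_vars_integrable[OF _ ind ii]) auto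
  then have 2: "integrable M (\<lambda>\<omega>. (W s \<omega> - W 0 \<omega>) * (W (s + t) \<omega> - W s \<omega>))"
    by (simp add: \<tau>_def)
  have AE: "AE \<omega> in M. (W s \<omega> - W 0 \<omega>) * (W (s + t) \<omega> - W s \<omega>) = W s \<omega> * (W (s + t) \<omega> - W s \<omega>)"
    using start by eventually_elim simp
  show "expectation (\<lambda>\<omega>. W s \<omega> * (W (s + t) \<omega> - W s \<omega>)) = expectation (W s) * expectation (W t)"
    unfolding 1[symmetric] by (rule integral_cong_AE) (use AE in \<open>auto elim: eventually_mono\<close>)
  show "integrable M (\<lambda>\<omega>. W s \<omega> * (W (s + t) \<omega> - W s \<omega>))"
    by (rule integrable_cong_AE_imp[OF 2]) (use AE in \<open>auto elim: eventually_mono\<close>)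
qed

lemma expectation_additive: "0 \<le> s \<Longrightarrow> 0 \<le> t \<Longrightarrow> expectation (W (s + t)) = expectation (W s) + expectation (W t)"
  using increment_transfer(1)[of "\<lambda>x. x" s t] integrable_W[of "s + t"] integrable_W[of s] by simp

lemma second_moment_split:
  assumes s: "0 \<le> s" and t: "0 \<le> t"
  shows "expectation (\<lambda>\<omega>. (W (s + t) \<omega>)\<^sup>2) =
    expectation (\<lambda>\<omega>. (W s \<omega>)\<^sup>2) + 2 * expectation (W s) * expectation (W t) + expectation (\<lambda>\<omega>. (W t \<omega>)\<^sup>2)"
proof -
  have i: "integrable M (\<lambda>\<omega>. (W (s + t) \<omega> - W s \<omega>)\<^sup>2)"
    using increment_transfer(2)[of "\<lambda>x. x\<^sup>2", OF _ s t] second_moment[OF t] by simp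
  have "(W (s + t) \<omega>)\<^sup>2 = ((W s \<omega>)\<^sup>2 + 2 * (W s \<omega> * (W (s + t) \<omega> - W s \<omega>))) + (W (s + t) \<omega> - W s \<omega>)\<^sup>2" for \<omega>
    by (simp add: power2_eq_square algebra_simps)
  then have "expectation (\<lambda>\<omega>. (W (s + t) \<omega>)\<^sup>2) =
     expectation (\<lambda>\<omega>. ((W s \<omega>)\<^sup>2 + 2 * (W s \<omega> * (W (s + t) \<omega> - W s \<omega>))) + (W (s + t) \<omega> - W s \<omega>)\<^sup>2)" by simp
  also have "\<dots> = (expectation (\<lambda>\<omega>. (W s \<omega>)\<^sup>2) + 2 * expectation (\<lambda>\<omega>. W s \<omega> * (W (s + t) \<omega> - W s \<omega>)))
      + expectation (\<lambda>\<omega>. (W (s + t) \<omega> - W s \<omega>)\<^sup>2)"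
    using second_moment[OF s] expectation_W_increment(2)[OF s t] i
    by (subst Bochner_Integration.integral_add, auto)+
  also have "expectation (\<lambda>\<omega>. (W (s + t) \<omega> - W s \<omega>)\<^sup>2) = expectation (\<lambda>\<omega>. (W t \<omega>)\<^sup>2)"
    using increment_transfer(1)[of "\<lambda>x. x\<^sup>2", OF _ s t] by simp
  finally show ?thesis unfolding expectation_W_increment(1)[OF s t] by simp
qed

lemma variance_W_eq: "0 \<le> t \<Longrightarrow> variance (W t) = expectation (\<lambda>\<omega>. (W t \<omega>)\<^sup>2) - (expectation (W t))\<^sup>2"
  by (rule variance_eq) (use integrable_W second_moment in auto)

lemma variance_additive:
  assumes "0 \<le> s" "0 \<le> t"
  shows "variance (W (s + t)) = variance (W s) + variance (W t)"
proof -
  have "variance (W (s + t)) = expectation (\<lambda>\<omega>. (W (s + t) \<omega>)\<^sup>2) - (expectation (W (s + t)))\<^sup>2"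
    using assms by (intro variance_W_eq) auto
  also have "\<dots> = (expectation (\<lambda>\<omega>. (W s \<omega>)\<^sup>2) - (expectation (W s))\<^sup>2)
      + (expectation (\<lambda>\<omega>. (W t \<omega>)\<^sup>2) - (expectation (W t))\<^sup>2)"
    unfolding second_moment_split[OF assms] expectation_additive[OF assms] by (simp only: power2_sum)
  also have "\<dots> = variance (W s) + variance (W t)"
    using variance_W_eq[OF assms(1)] variance_W_eq[OF assms(2)] by (simp only:)
  finally show ?thesis .
qed

text \<open>
  Additivity and nonnegativity make the variance monotone, hence bounded on \<open>[0, 1]\<close>.
\<close>

lemma variance_W: assumes t: "0 \<le> t" shows "variance (W t) = t * diffusivity"
  unfolding diffusivity_def
proof (rule additive_bounded_imp_linear[where \<phi>="\<lambda>t. variance (W t)" and C="variance (W 1)"])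
  show "\<bar>variance (W t)\<bar> \<le> variance (W 1)" if "0 \<le> t" "t \<le> 1" for t
    using variance_additive[of t "1 - t"] that variance_positive[of "W t"] variance_positive[of "W (1 - t)"] by simp
qed (use t variance_additive in auto)

lemma diffusivity_nonneg: "0 \<le> diffusivity"
  unfolding diffusivity_def by (rule variance_positive)

text \<open>
  For small \<open>t\<close> the value \<open>W t\<close> is within \<open>1/2\<close> of its mean, by Chebyshev's inequality, and within \<open>1/2\<close> of 0,
  by stochastic continuity, each with probability greater than \<open>1/2\<close>. So both happen at some common
  point.
\<close>

lemma expectation_locally_bounded: "\<exists>\<delta>>0. \<forall>t. 0 \<le> t \<and> t < \<delta> \<longrightarrow> \<bar>expectation (W t)\<bar> \<le> 1"
proof -
  have "eventually (\<lambda>t. measure M {\<omega> \<in> space M. 1 / 2 \<le> \<bar>W t \<omega> - W 0 \<omega>\<bar>} < 1 / 2) (at 0 within {0..})"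
    using order_tendstoD(2)[OF stochastic_continuity[of "1/2"], of "1/2"] by simp
  then obtain d where d: "d > 0" "\<And>t. t \<ge> 0 \<Longrightarrow> t \<noteq> 0 \<Longrightarrow> t < d \<Longrightarrow> measure M {\<omega> \<in> space M. 1 / 2 \<le> \<bar>W t \<omega> - W 0 \<omega>\<bar>} < 1 / 2"
    by (auto simp: eventually_at dist_real_def)
  (* Makes the Chebyshev bound 4 * t * diffusivity smaller than 1 / 2. *)
  define \<delta> where "\<delta> = min d (1 / (8 * (diffusivity + 1)))"
  show ?thesis
  proof (intro exI[of _ \<delta>] conjI allI impI)
    show "\<delta> > 0" using d diffusivity_nonneg by (simp add: \<delta>_def)
    fix t assume t: "0 \<le> t \<and> t < \<delta>"
    show "\<bar>expectation (W t)\<bar> \<le> 1"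
    proof (cases "t = 0")
      case True
      have "expectation (W 0) = expectation (\<lambda>_. 0)" by (rule integral_cong_AE) (use start in auto)
      then show ?thesis using True by simp
    next
      case False
      let ?A = "{\<omega> \<in> space M. 1 / 2 \<le> \<bar>W t \<omega> - W 0 \<omega>\<bar>}" and ?B = "{\<omega> \<in> space M. 1 / 2 \<le> \<bar>W t \<omega> - expectation (W t)\<bar>}"
      have A: "prob ?A < 1 / 2" using d(2)[of t] t False by (simp add: \<delta>_def)
      have "prob ?B \<le> variance (W t) / (1 / 2)\<^sup>2"
        using t by (intro Chebyshev_inequality second_moment) auto
      also have "\<dots> = 4 * t * diffusivity" using variance_W[of t] t by (simp add: power2_eq_square)
      also have "\<dots> < 1 / 2"
      proof -
        have "t < 1 / (8 * (diffusivity + 1))" using t by (simp add: \<delta>_def)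
        then have "t * (8 * (diffusivity + 1)) < 1" using diffusivity_nonneg by (simp add: less_divide_eq)
        then show ?thesis using t diffusivity_nonneg by (simp add: algebra_simps)
      qed
      finally have B: "prob ?B < 1 / 2" .
      have "\<exists>\<omega>\<in>space M. W 0 \<omega> = 0 \<and> \<omega> \<notin> ?A \<and> \<omega> \<notin> ?B"
      proof (rule ccontr)
        assume "\<not> ?thesis"
        then have "AE \<omega> in M. \<omega> \<in> ?A \<union> ?B" using start by (auto intro: AE_mp elim: eventually_mono)
        then have "prob (?A \<union> ?B) = 1" by (subst prob_eq_1) auto
        moreover have "prob (?A \<union> ?B) \<le> prob ?A + prob ?B" by (rule measure_Un_le) auto
        ultimately show False using A B by linarith
      qed
      then obtain \<omega> where "\<omega> \<in> space M" "W 0 \<omega> = 0" "\<omega> \<notin> ?A" "\<omega> \<notin> ?B" by blast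
      then have "\<bar>W t \<omega>\<bar> < 1 / 2" "\<bar>W t \<omega> - expectation (W t)\<bar> < 1 / 2" by auto
      then show ?thesis by linarith
    qed
  qed
qed

text \<open>
  The bound near 0 extends to \<open>[0, 1]\<close> by additivity.
\<close>

lemma expectation_W: assumes t: "0 \<le> t" shows "expectation (W t) = t * drift"
proof -
  obtain \<delta> where \<delta>: "\<delta> > 0" "\<And>t. 0 \<le> t \<Longrightarrow> t < \<delta> \<Longrightarrow> \<bar>expectation (W t)\<bar> \<le> 1" using expectation_locally_bounded by blast
  obtain k :: nat where k: "1 / \<delta> < real k" using reals_Archimedean2 by blast
  have kp: "real k > 0" using k \<delta> by (meson divide_pos_pos less_trans zero_less_one)
  have mult: "expectation (W (real n * s)) = real n * expectation (W s)" if s: "0 \<le> s" for n s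
  proof (induction n)
    case 0
    have "expectation (W 0) = expectation (\<lambda>_. 0)" by (rule integral_cong_AE) (use start in auto)
    then show ?case by simp
  next
    case (Suc n)
    have "expectation (W (real (Suc n) * s)) = expectation (W (real n * s + s))" by (simp add: algebra_simps)
    also have "\<dots> = expectation (W (real n * s)) + expectation (W s)" using s by (intro expectation_additive) auto
    finally show ?case using Suc by (simp add: algebra_simps)
  qed
  show ?thesis
    unfolding drift_def
  proof (rule additive_bounded_imp_linear[where C="real k"])
    fix s :: real assume s: "0 \<le> s" "s \<le> 1"
    have "s / real k < \<delta>"
    proof -
      have "s / real k \<le> 1 / real k" using s kp by (intro divide_right_mono) auto
      also have "\<dots> < \<delta>" using k kp \<delta>(1) by (simp add: field_simps)
      finally show ?thesis .
    qed
    then have "\<bar>expectation (W (s / real k))\<bar> \<le> 1" using \<delta>(2) s kp by simp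
    then have "real k * \<bar>expectation (W (s / real k))\<bar> \<le> real k * 1" using kp by (intro mult_left_mono) auto
    then show "\<bar>expectation (W s)\<bar> \<le> real k"
      using mult[of "s / real k" k] s kp by (simp add: abs_mult)
  qed (use t expectation_additive in auto)
qed

lemma second_moment_W: assumes t: "0 \<le> t"
  shows "expectation (\<lambda>\<omega>. (W t \<omega>)\<^sup>2) = diffusivity * t + drift\<^sup>2 * t\<^sup>2"
  using variance_W_eq[OF t] variance_W[OF t] expectation_W[OF t] by (simp add: power_mult_distrib algebra_simps)

lemma second_moment_increment:
  assumes "0 \<le> s" "s \<le> t"
  shows "integrable M (\<lambda>\<omega>. (W t \<omega> - W s \<omega>)\<^sup>2)"
    "expectation (\<lambda>\<omega>. (W t \<omega> - W s \<omega>)\<^sup>2) = diffusivity * (t - s) + drift\<^sup>2 * (t - s)\<^sup>2"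
  using increment_transfer[of "\<lambda>x. x\<^sup>2" s "t - s"] second_moment_W[of "t - s"] second_moment[of "t - s"] assms by auto

lemma covariance_W:
  assumes s: "0 \<le> s" and t: "0 \<le> t"
  shows "expectation (\<lambda>\<omega>. W s \<omega> * W t \<omega>) = diffusivity * min s t + drift\<^sup>2 * s * t"
proof -
  have *: "expectation (\<lambda>\<omega>. W s \<omega> * W t \<omega>) = diffusivity * s + drift\<^sup>2 * s * t" if s: "0 \<le> s" and st: "s \<le> t" for s t
  proof -
    have "expectation (\<lambda>\<omega>. W s \<omega> * W t \<omega>) = expectation (\<lambda>\<omega>. (W s \<omega>)\<^sup>2 + W s \<omega> * (W (s + (t - s)) \<omega> - W s \<omega>))"
      by (intro Bochner_Integration.integral_cong) (auto simp: power2_eq_square algebra_simps)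
    also have "\<dots> = expectation (\<lambda>\<omega>. (W s \<omega>)\<^sup>2) + expectation (W s) * expectation (W (t - s))"
      using expectation_W_increment[of s "t - s"] second_moment[of s] s st by simp
    also have "\<dots> = (diffusivity * s + drift\<^sup>2 * s\<^sup>2) + (s * drift) * ((t - s) * drift)"
      using s st second_moment_W[of s] expectation_W[of s] expectation_W[of "t - s"] by simp
    also have "\<dots> = diffusivity * s + drift\<^sup>2 * s * t"
      by (simp add: power2_eq_square algebra_simps)
    finally show ?thesis .
  qed
  show ?thesis
  proof (cases "s \<le> t")
    case True then show ?thesis using *[OF s True] by (simp add: min_def)
  next
    case False
    then show ?thesis using *[OF t, of s] by (simp add: min_def mult.commute mult.left_commute)
  qed
qed

end

section \<open>The residual process and its moments\<close>

lemma measurable_LBINT: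
  fixes h :: "'z \<Rightarrow> real \<Rightarrow> real" and f g :: "'z \<Rightarrow> real"
  assumes h: "(\<lambda>(z, r). h z r) \<in> borel_measurable (N \<Otimes>\<^sub>M borel)"
    and f: "f \<in> borel_measurable N" and g: "g \<in> borel_measurable N"
  shows "(\<lambda>z. LBINT r:{f z..g z}. h z r) \<in> borel_measurable N"
proof -
  have "(\<lambda>x. f (fst x)) \<in> borel_measurable (N \<Otimes>\<^sub>M borel)" "(\<lambda>x. g (fst x)) \<in> borel_measurable (N \<Otimes>\<^sub>M borel)"
    by (rule measurable_compose[OF measurable_fst f], rule measurable_compose[OF measurable_fst g])
  then have "{x \<in> space (N \<Otimes>\<^sub>M borel). f (fst x) \<le> snd x \<and> snd x \<le> g (fst x)} \<in> sets (N \<Otimes>\<^sub>M borel)"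
    by (intro sets.sets_Collect borel_measurable_le measurable_snd)
  then have "(\<lambda>x. if f (fst x) \<le> snd x \<and> snd x \<le> g (fst x) then (\<lambda>(z, r). h z r) x else 0) \<in> borel_measurable (N \<Otimes>\<^sub>M borel)"
    by (intro measurable_If h measurable_const) auto
  also have "(\<lambda>x. if f (fst x) \<le> snd x \<and> snd x \<le> g (fst x) then (\<lambda>(z, r). h z r) x else 0)
      = (\<lambda>(z, r). if f z \<le> r \<and> r \<le> g z then h z r else 0)" by (auto simp: fun_eq_iff)
  also have "borel_measurable (N \<Otimes>\<^sub>M borel) = borel_measurable (N \<Otimes>\<^sub>M lborel)"
    by (intro measurable_cong_sets sets_pair_measure_cong) auto
  finally have "(\<lambda>(z, r). if f z \<le> r \<and> r \<le> g z then h z r else 0) \<in> borel_measurable (N \<Otimes>\<^sub>M lborel)" .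
  then have "(\<lambda>z. LINT r|lborel. (if f z \<le> r \<and> r \<le> g z then h z r else 0)) \<in> borel_measurable N"
    by (rule lborel.borel_measurable_lebesgue_integral)
  also have "(\<lambda>z. LINT r|lborel. (if f z \<le> r \<and> r \<le> g z then h z r else 0)) = (\<lambda>z. LBINT r:{f z..g z}. h z r)"
    unfolding set_lebesgue_integral_def by (intro ext Bochner_Integration.integral_cong) (auto simp: indicator_def)
  finally show ?thesis .
qed

lemma measurable_exp_residual:
  assumes w: "(\<lambda>(z, r). w z r) \<in> borel_measurable (N \<Otimes>\<^sub>M borel)" and [measurable]: "f \<in> borel_measurable N"
  shows "(\<lambda>z. exp_residual (w z) (f z)) \<in> borel_measurable N"
proof -
  note [measurable] = w
  have "(\<lambda>z. exp_smooth (w z) (f z)) \<in> borel_measurable N"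
    unfolding exp_smooth_def by (intro measurable_LBINT) measurable
  moreover have "(\<lambda>z. w z (f z)) \<in> borel_measurable N"
    using measurable_compose[OF measurable_Pair[OF measurable_ident_sets[OF refl] \<open>f \<in> borel_measurable N\<close>] w] by simp
  ultimately show ?thesis unfolding exp_residual_def by simp
qed

text \<open>
  A uniform bound on the first absolute moments over \<open>[0, T]\<close> is all that Fubini's theorem requires of a
  measurable process.
\<close>

lemma (in prob_space) process_integral_Fubini:
  fixes Z :: "real \<Rightarrow> 'a \<Rightarrow> real"
  assumes [measurable]: "(\<lambda>(s, \<omega>). Z s \<omega>) \<in> borel_measurable (borel \<Otimes>\<^sub>M M)"
    and int: "\<And>s. s \<in> {0..T} \<Longrightarrow> integrable M (Z s)" and bound: "\<And>s. s \<in> {0..T} \<Longrightarrow> expectation (\<lambda>\<omega>. \<bar>Z s \<omega>\<bar>) \<le> C"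
  shows "AE \<omega> in M. set_integrable lborel {0..T} (\<lambda>s. Z s \<omega>)"
    "integrable M (\<lambda>\<omega>. LBINT s:{0..T}. Z s \<omega>)"
    "expectation (\<lambda>\<omega>. LBINT s:{0..T}. Z s \<omega>) = (LBINT s:{0..T}. expectation (Z s))"
    "set_integrable lborel {0..T} (\<lambda>s. expectation (Z s))"
proof -
  interpret P: pair_sigma_finite lborel M ..
  let ?f = "\<lambda>s \<omega>. indicator {0..T} s *\<^sub>R Z s \<omega>"
  have m[measurable]: "case_prod ?f \<in> borel_measurable (lborel \<Otimes>\<^sub>M M)" by simp
  have in1: "expectation (\<lambda>\<omega>. norm (?f s \<omega>)) \<le> C * indicator {0..T} s" for s
    using bound[of s] by (auto simp: indicator_def)
  have f: "integrable (lborel \<Otimes>\<^sub>M M) (case_prod ?f)"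
  proof (rule P.Fubini_integrable)
    show "integrable lborel (\<lambda>s. expectation (\<lambda>\<omega>. norm (case_prod ?f (s, \<omega>))))"
    proof (rule Bochner_Integration.integrable_bound)
      show "integrable lborel (\<lambda>s. C * indicator {0..T} s)"
        by (intro Bochner_Integration.integrable_mult_right integrable_real_indicator) (auto simp: emeasure_lborel_Icc_eq)
      have "0 \<le> expectation (\<lambda>\<omega>. norm (?f s \<omega>))" for s by (intro integral_nonneg_AE) auto
      then show "AE s in lborel. norm (expectation (\<lambda>\<omega>. norm (case_prod ?f (s, \<omega>)))) \<le> norm (C * indicator {0..T} s)"
        using in1 by (intro AE_I2) (auto intro: order_trans[OF _ abs_ge_self])
    qed measurable
    show "AE s in lborel. integrable M (\<lambda>\<omega>. case_prod ?f (s, \<omega>))"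
      using int by (intro AE_I2) (auto simp: indicator_def)
  qed measurable
  have eq: "(\<lambda>\<omega>. LBINT s:{0..T}. Z s \<omega>) = (\<lambda>\<omega>. LINT s|lborel. ?f s \<omega>)" by (simp add: set_lebesgue_integral_def)
  have eq2: "indicator {0..T} s *\<^sub>R expectation (Z s) = expectation (?f s)" for s by simp
  show "AE \<omega> in M. set_integrable lborel {0..T} (\<lambda>s. Z s \<omega>)"
    using P.AE_integrable_snd[OF f] by (simp add: set_integrable_def)
  show "integrable M (\<lambda>\<omega>. LBINT s:{0..T}. Z s \<omega>)" unfolding eq using P.integrable_snd[OF f] by simp
  show "expectation (\<lambda>\<omega>. LBINT s:{0..T}. Z s \<omega>) = (LBINT s:{0..T}. expectation (Z s))"
    unfolding eq using P.Fubini_integral[OF f] by (simp add: set_lebesgue_integral_def)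
  show "set_integrable lborel {0..T} (\<lambda>s. expectation (Z s))"
    unfolding set_integrable_def eq2 using P.integrable_fst[OF f] by simp
qed

lemma LBINT_exp_id: "0 \<le> u \<Longrightarrow> (LBINT r:{0..u}. exp (r - t) * r) = (u - 1) * exp (u - t) + exp (- t)"
  for t u :: real
proof -
  assume "0 \<le> u"
  then have "(LBINT r:{0..u}. exp (r - t) * r) = (u - 1) * exp (u - t) - (0 - 1) * exp (0 - t)"
    by (rule LBINT_FTC_real) (auto intro!: derivative_eq_intros continuous_intros simp: algebra_simps)
  then show ?thesis by simp
qed

lemma LBINT_exp_const: "u \<le> t \<Longrightarrow> (LBINT r:{u..t}. exp (r - t) * c) = c * (1 - exp (u - t))"
  for t u :: real
proof -
  assume "u \<le> t"
  then have "(LBINT r:{u..t}. exp (r - t) * c) = c * exp (t - t) - c * exp (u - t)"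
    by (rule LBINT_FTC_real) (auto intro!: derivative_eq_intros continuous_intros simp: algebra_simps)
  then show ?thesis by (simp add: algebra_simps)
qed

lemma LBINT_exp_min:
  fixes t u :: real
  assumes u: "0 \<le> u" "u \<le> t"
  shows "(LBINT r:{0..t}. exp (r - t) * min u r) = u - exp (u - t) + exp (- t)"
proof -
  have i: "set_integrable lborel {0..t} (\<lambda>r. exp (r - t) * min u r)"
    by (intro borel_integrable_atLeastAtMost' continuous_intros)
  have "(LBINT r:{0..t}. exp (r - t) * min u r) = (LBINT r:{0..u}. exp (r - t) * min u r) + (LBINT r:{u..t}. exp (r - t) * min u r)"
    by (rule LBINT_combine[OF i u])
  also have "(LBINT r:{0..u}. exp (r - t) * min u r) = (LBINT r:{0..u}. exp (r - t) * r)"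
    by (intro set_lebesgue_integral_cong) auto
  also have "(LBINT r:{u..t}. exp (r - t) * min u r) = (LBINT r:{u..t}. exp (r - t) * u)"
    by (intro set_lebesgue_integral_cong) auto
  finally have "(LBINT r:{0..t}. exp (r - t) * min u r) = (u - 1) * exp (u - t) + exp (- t) + u * (1 - exp (u - t))"
    by (simp only: LBINT_exp_id[OF u(1)] LBINT_exp_const[OF u(2)])
  then show ?thesis by (simp add: algebra_simps)
qed

lemma LBINT_exp_iterated_min:
  fixes t :: real
  assumes t: "0 \<le> t"
  shows "(LBINT r:{0..t}. exp (r - t) * (r - exp (r - t) + exp (- t))) = t - 3 / 2 + 2 * exp (- t) - exp (- 2 * t) / 2"
proof -
  let ?F = "\<lambda>r. (r - 1) * exp (r - t) - exp (2 * (r - t)) / 2 + exp (- t) * exp (r - t)"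
  have "(LBINT r:{0..t}. exp (r - t) * (r - exp (r - t) + exp (- t))) = ?F t - ?F 0"
    using t
  proof (rule LBINT_FTC_real)
    fix r :: real
    have e: "exp (2 * (r - t)) = exp (r - t) * exp (r - t)" by (simp add: exp_add[symmetric])
    have "(?F has_real_derivative (1 * exp (r - t) + (r - 1) * exp (r - t)) - exp (2 * (r - t)) + exp (- t) * exp (r - t)) (at r)"
      by (auto intro!: derivative_eq_intros)
    moreover have "(1 * exp (r - t) + (r - 1) * exp (r - t)) - exp (2 * (r - t)) + exp (- t) * exp (r - t)
      = exp (r - t) * (r - exp (r - t) + exp (- t))" unfolding e by (simp add: algebra_simps)
    ultimately show "(?F has_real_derivative exp (r - t) * (r - exp (r - t) + exp (- t))) (at r)" by simp
  qed (auto intro!: continuous_intros)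
  moreover have "exp (- t) * exp (0 - t) = exp (- 2 * t)" "exp (2 * (0 - t)) = exp (- 2 * t)"
    by (simp_all add: exp_add[symmetric])
  ultimately show ?thesis by (simp add: algebra_simps)
qed

context square_integrable_levy
begin

lemma second_moment_le: "s \<in> {0..T} \<Longrightarrow> expectation (\<lambda>\<omega>. (W s \<omega>)\<^sup>2) \<le> diffusivity * T + drift\<^sup>2 * T\<^sup>2"
  using diffusivity_nonneg by (auto simp: second_moment_W intro!: add_mono mult_left_mono power_mono)

lemma path_L2_on_bounded: "AE \<omega> in M. L2_on {0..T} (\<lambda>s. W s \<omega>)"
proof -
  have "AE \<omega> in M. set_integrable lborel {0..T} (\<lambda>s. (W s \<omega>)\<^sup>2)"
    by (rule process_integral_Fubini(1)[where C="diffusivity * T + drift\<^sup>2 * T\<^sup>2"])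
      (use second_moment second_moment_le in auto)
  with AE_space show ?thesis
  proof eventually_elim
    case (elim \<omega>)
    have "set_borel_measurable lborel {0..T} (\<lambda>s. W s \<omega>)"
      unfolding set_borel_measurable_def using measurable_path[OF elim(1)] by simp
    then show ?case using elim by (simp add: L2_on_def)
  qed
qed

lemma path_L2_on: "AE \<omega> in M. \<forall>T. L2_on {0..T} (\<lambda>s. W s \<omega>)"
proof -
  have "AE \<omega> in M. \<forall>n::nat. L2_on {0..real n} (\<lambda>s. W s \<omega>)"
    unfolding AE_all_countable using path_L2_on_bounded by blast
  then show ?thesis
  proof eventually_elim
    case (elim \<omega>)
    show ?case
    proof
      fix T :: real
      obtain n :: nat where "T \<le> real n" using real_arch_simple by blast
      then show "L2_on {0..T} (\<lambda>s. W s \<omega>)" using elim by (intro L2_on_subset[OF spec[OF elim, of n]]) auto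
    qed
  qed
qed

definition smoothed :: "real \<Rightarrow> 'a \<Rightarrow> real" where "smoothed t \<omega> = exp_smooth (\<lambda>s. W s \<omega>) t"

definition residual :: "real \<Rightarrow> 'a \<Rightarrow> real" where "residual t \<omega> = exp_residual (\<lambda>s. W s \<omega>) t"

lemma residual_eq: "residual t \<omega> = W t \<omega> - smoothed t \<omega>"
  by (simp add: residual_def smoothed_def exp_residual_def)

lemma measurable_residual_process[measurable]: "(\<lambda>(t, \<omega>). residual t \<omega>) \<in> borel_measurable (borel \<Otimes>\<^sub>M M)"
  unfolding residual_def
  using measurable_exp_residual[of "\<lambda>(t, \<omega>) s. W s \<omega>" "borel \<Otimes>\<^sub>M M" fst]
  by (simp add: case_prod_unfold)

lemma measurable_residual[measurable]: "residual t \<in> borel_measurable M"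
  using measurable_compose[OF measurable_Pair1'[of t borel M] measurable_residual_process] by simp

lemma measurable_smoothed[measurable]: "smoothed t \<in> borel_measurable M"
proof -
  have "smoothed t = (\<lambda>\<omega>. W t \<omega> - residual t \<omega>)" by (auto simp: residual_eq)
  then show ?thesis by simp
qed

lemma expectation_mult_smoothed:
  assumes [measurable]: "Z \<in> borel_measurable M" and Z: "integrable M (\<lambda>\<omega>. (Z \<omega>)\<^sup>2)" and t: "0 \<le> t"
  shows "expectation (\<lambda>\<omega>. Z \<omega> * smoothed t \<omega>) = (LBINT r:{0..t}. exp (r - t) * expectation (\<lambda>\<omega>. Z \<omega> * W r \<omega>))"
proof -
  have i: "integrable M (\<lambda>\<omega>. Z \<omega> * W r \<omega>)" if "r \<in> {0..t}" for r
    using that by (intro integrable_mult_square_integrable Z second_moment) auto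
  have b: "expectation (\<lambda>\<omega>. \<bar>exp (r - t) * (Z \<omega> * W r \<omega>)\<bar>) \<le> expectation (\<lambda>\<omega>. (Z \<omega>)\<^sup>2) + (diffusivity * t + drift\<^sup>2 * t\<^sup>2)"
    if r: "r \<in> {0..t}" for r
  proof -
    have "expectation (\<lambda>\<omega>. \<bar>exp (r - t) * (Z \<omega> * W r \<omega>)\<bar>) \<le> expectation (\<lambda>\<omega>. (Z \<omega>)\<^sup>2 + (W r \<omega>)\<^sup>2)"
    proof (rule integral_mono)
      show "integrable M (\<lambda>\<omega>. \<bar>exp (r - t) * (Z \<omega> * W r \<omega>)\<bar>)" using i[OF r] by simp
      show "integrable M (\<lambda>\<omega>. (Z \<omega>)\<^sup>2 + (W r \<omega>)\<^sup>2)" using Z second_moment r by simp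
      fix \<omega>
      have "exp (r - t) \<le> 1" using r by simp
      then have "\<bar>exp (r - t) * (Z \<omega> * W r \<omega>)\<bar> \<le> \<bar>Z \<omega> * W r \<omega>\<bar>"
        by (simp add: abs_mult mult_left_le_one_le)
      also have "2 * \<bar>Z \<omega> * W r \<omega>\<bar> \<le> (Z \<omega>)\<^sup>2 + (W r \<omega>)\<^sup>2"
        using sum_squares_bound[of "\<bar>Z \<omega>\<bar>" "\<bar>W r \<omega>\<bar>"] by (simp add: abs_mult)
      then have "\<bar>Z \<omega> * W r \<omega>\<bar> \<le> (Z \<omega>)\<^sup>2 + (W r \<omega>)\<^sup>2" using abs_ge_zero[of "Z \<omega> * W r \<omega>"] by linarith
      finally show "\<bar>exp (r - t) * (Z \<omega> * W r \<omega>)\<bar> \<le> (Z \<omega>)\<^sup>2 + (W r \<omega>)\<^sup>2" .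
    qed
    also have "\<dots> \<le> expectation (\<lambda>\<omega>. (Z \<omega>)\<^sup>2) + (diffusivity * t + drift\<^sup>2 * t\<^sup>2)"
      using Z second_moment[of r] second_moment_le[OF r] r by simp
    finally show ?thesis .
  qed
  have "expectation (\<lambda>\<omega>. LBINT r:{0..t}. exp (r - t) * (Z \<omega> * W r \<omega>)) = (LBINT r:{0..t}. expectation (\<lambda>\<omega>. exp (r - t) * (Z \<omega> * W r \<omega>)))"
  proof (rule process_integral_Fubini(3)[OF _ _ b])
    show "(\<lambda>(r, \<omega>). exp (r - t) * (Z \<omega> * W r \<omega>)) \<in> borel_measurable (borel \<Otimes>\<^sub>M M)" by measurable
    show "integrable M (\<lambda>\<omega>. exp (r - t) * (Z \<omega> * W r \<omega>))" if "r \<in> {0..t}" for r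
      by (rule Bochner_Integration.integrable_mult_right) (use i[OF that] in simp)
  qed
  moreover have "(LBINT r:{0..t}. exp (r - t) * (Z \<omega> * W r \<omega>)) = Z \<omega> * smoothed t \<omega>" for \<omega>
    unfolding smoothed_def exp_smooth_def
    by (subst set_integral_mult_right[symmetric]) (simp add: mult.left_commute)
  ultimately show ?thesis by simp
qed

lemma integrable_smoothed_square: assumes t: "0 \<le> t" shows "integrable M (\<lambda>\<omega>. (smoothed t \<omega>)\<^sup>2)"
proof (rule Bochner_Integration.integrable_bound)
  show "integrable M (\<lambda>\<omega>. LBINT s:{0..t}. (W s \<omega>)\<^sup>2)"
    by (rule process_integral_Fubini(2)[where C="diffusivity * t + drift\<^sup>2 * t\<^sup>2"])
      (use second_moment second_moment_le in auto)
  show "AE \<omega> in M. norm ((smoothed t \<omega>)\<^sup>2) \<le> norm (LBINT s:{0..t}. (W s \<omega>)\<^sup>2)"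
    using path_L2_on_bounded[of t]
    by eventually_elim (use t in \<open>auto simp: smoothed_def intro!: order_trans[OF exp_smooth_square_le abs_ge_self]\<close>)
qed measurable

lemma integrable_residual_square: assumes t: "0 \<le> t" shows "integrable M (\<lambda>\<omega>. (residual t \<omega>)\<^sup>2)"
proof -
  have eq: "(residual t \<omega>)\<^sup>2 = ((W t \<omega>)\<^sup>2 - 2 * (W t \<omega> * smoothed t \<omega>)) + (smoothed t \<omega>)\<^sup>2" for \<omega>
    by (simp add: residual_eq power2_eq_square algebra_simps)
  show ?thesis unfolding eq
    by (intro Bochner_Integration.integrable_add Bochner_Integration.integrable_diff Bochner_Integration.integrable_mult_right
        integrable_mult_square_integrable second_moment integrable_smoothed_square t measurable_W measurable_smoothed)
qed

lemma expectation_residual: assumes t: "0 \<le> t" shows "expectation (residual t) = drift * (1 - exp (- t))"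
proof -
  have "expectation (smoothed t) = expectation (\<lambda>\<omega>. 1 * smoothed t \<omega>)" by simp
  also have "\<dots> = (LBINT r:{0..t}. exp (r - t) * expectation (\<lambda>\<omega>. 1 * W r \<omega>))"
    by (rule expectation_mult_smoothed[OF _ _ t]) auto
  also have "\<dots> = (LBINT r:{0..t}. drift * (exp (r - t) * r))"
    by (intro set_lebesgue_integral_cong) (auto simp: expectation_W)
  also have "\<dots> = drift * (t - 1 + exp (- t))" using t by (simp add: LBINT_exp_id)
  finally have "expectation (smoothed t) = drift * (t - 1 + exp (- t))" .
  moreover have "expectation (residual t) = expectation (W t) - expectation (smoothed t)"
  proof -
    have "integrable M (smoothed t)"
      by (rule integrable_square_imp_integrable[OF measurable_smoothed integrable_smoothed_square[OF t]])
    from Bochner_Integration.integral_diff[OF integrable_W[OF t] this]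
    show ?thesis by (simp only: residual_eq[abs_def])
  qed
  ultimately show ?thesis using t by (simp add: expectation_W algebra_simps)
qed

lemma expectation_W_smoothed:
  assumes u: "0 \<le> u" "u \<le> t"
  shows "expectation (\<lambda>\<omega>. W u \<omega> * smoothed t \<omega>) =
    diffusivity * (u - exp (u - t) + exp (- t)) + drift\<^sup>2 * (t - 1 + exp (- t)) * u"
proof -
  have "expectation (\<lambda>\<omega>. W u \<omega> * smoothed t \<omega>) = (LBINT r:{0..t}. exp (r - t) * expectation (\<lambda>\<omega>. W u \<omega> * W r \<omega>))"
    using u by (intro expectation_mult_smoothed second_moment) auto
  also have "\<dots> = (LBINT r:{0..t}. diffusivity * (exp (r - t) * min u r) + (drift\<^sup>2 * u) * (exp (r - t) * r))"
    using u by (intro set_lebesgue_integral_cong) (auto simp: covariance_W algebra_simps)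
  also have "\<dots> = diffusivity * (LBINT r:{0..t}. exp (r - t) * min u r) + (drift\<^sup>2 * u) * (LBINT r:{0..t}. exp (r - t) * r)"
  proof -
    have "set_integrable lborel {0..t} (\<lambda>r. exp (r - t) * min u r)" "set_integrable lborel {0..t} (\<lambda>r. exp (r - t) * r)"
      by (intro borel_integrable_atLeastAtMost' continuous_intros)+
    then show ?thesis by (simp add: set_integral_add)
  qed
  finally show ?thesis using u by (simp add: LBINT_exp_min LBINT_exp_id)
qed

text \<open>
  The second moment of the Ornstein-Uhlenbeck process, from \<open>E (W s W t) = v min(s, t) + m\<^sup>2 s t\<close> by
  integrating twice against the exponential kernel.
\<close>

lemma expectation_residual_square:
  assumes t: "0 \<le> t"
  shows "expectation (\<lambda>\<omega>. (residual t \<omega>)\<^sup>2) = diffusivity * (1 - exp (- 2 * t)) / 2 + drift\<^sup>2 * (1 - exp (- t))\<^sup>2"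
proof -
  define L where "L = t - 1 + exp (- t)"
  have "expectation (\<lambda>\<omega>. smoothed t \<omega> * smoothed t \<omega>) = (LBINT r:{0..t}. exp (r - t) * expectation (\<lambda>\<omega>. smoothed t \<omega> * W r \<omega>))"
    using t by (intro expectation_mult_smoothed integrable_smoothed_square) auto
  also have "\<dots> = (LBINT r:{0..t}. diffusivity * (exp (r - t) * (r - exp (r - t) + exp (- t))) + (drift\<^sup>2 * L) * (exp (r - t) * r))"
  proof (intro set_lebesgue_integral_cong allI impI)
    fix r :: real assume r: "r \<in> {0..t}"
    have "expectation (\<lambda>\<omega>. smoothed t \<omega> * W r \<omega>) = expectation (\<lambda>\<omega>. W r \<omega> * smoothed t \<omega>)" by (simp add: mult.commute)
    also have "\<dots> = diffusivity * (r - exp (r - t) + exp (- t)) + drift\<^sup>2 * L * r"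
      using expectation_W_smoothed[of r t] r by (simp add: L_def)
    finally show "exp (r - t) * expectation (\<lambda>\<omega>. smoothed t \<omega> * W r \<omega>) =
        diffusivity * (exp (r - t) * (r - exp (r - t) + exp (- t))) + (drift\<^sup>2 * L) * (exp (r - t) * r)"
      by (simp only:) (simp add: algebra_simps)
  qed simp
  also have "\<dots> = diffusivity * (LBINT r:{0..t}. exp (r - t) * (r - exp (r - t) + exp (- t))) + (drift\<^sup>2 * L) * (LBINT r:{0..t}. exp (r - t) * r)"
  proof -
    have i: "set_integrable lborel {0..t} (\<lambda>r. exp (r - t) * (r - exp (r - t) + exp (- t)))" "set_integrable lborel {0..t} (\<lambda>r. exp (r - t) * r)"
      by (intro borel_integrable_atLeastAtMost' continuous_intros)+
    show ?thesis
      using set_integral_add(2)[OF set_integrable_mult_right[OF i(1), of diffusivity] set_integrable_mult_right[OF i(2), of "drift\<^sup>2 * L"]]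
      by (simp only: set_integral_mult_right)
  qed
  also have "\<dots> = diffusivity * (t - 3 / 2 + 2 * exp (- t) - exp (- 2 * t) / 2) + drift\<^sup>2 * L\<^sup>2"
    using t by (simp only: LBINT_exp_iterated_min LBINT_exp_id) (simp add: L_def power2_eq_square)
  finally have S: "expectation (\<lambda>\<omega>. (smoothed t \<omega>)\<^sup>2) = diffusivity * (t - 3 / 2 + 2 * exp (- t) - exp (- 2 * t) / 2) + drift\<^sup>2 * L\<^sup>2"
    by (simp add: power2_eq_square)
  have C: "expectation (\<lambda>\<omega>. W t \<omega> * smoothed t \<omega>) = diffusivity * L + drift\<^sup>2 * L * t"
    using expectation_W_smoothed[OF t order_refl] by (simp add: L_def)
  have eq: "(residual t \<omega>)\<^sup>2 = ((W t \<omega>)\<^sup>2 - 2 * (W t \<omega> * smoothed t \<omega>)) + (smoothed t \<omega>)\<^sup>2" for \<omega>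
    by (simp add: residual_eq power2_eq_square algebra_simps)
  have i: "integrable M (\<lambda>\<omega>. W t \<omega> * smoothed t \<omega>)"
    by (intro integrable_mult_square_integrable second_moment integrable_smoothed_square t measurable_W measurable_smoothed)
  have "expectation (\<lambda>\<omega>. (residual t \<omega>)\<^sup>2) = expectation (\<lambda>\<omega>. (W t \<omega>)\<^sup>2) - 2 * expectation (\<lambda>\<omega>. W t \<omega> * smoothed t \<omega>) + expectation (\<lambda>\<omega>. (smoothed t \<omega>)\<^sup>2)"
    unfolding eq using i second_moment[OF t] integrable_smoothed_square[OF t] by simp
  also have "\<dots> = diffusivity * (t - 2 * L + (t - 3 / 2 + 2 * exp (- t) - exp (- 2 * t) / 2)) + drift\<^sup>2 * (t - L)\<^sup>2"
    unfolding S C second_moment_W[OF t] by (simp add: power2_eq_square algebra_simps)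
  also have "t - 2 * L + (t - 3 / 2 + 2 * exp (- t) - exp (- 2 * t) / 2) = (1 - exp (- 2 * t)) / 2"
    by (simp add: L_def field_simps)
  also have "t - L = 1 - exp (- t)" by (simp add: L_def)
  finally show ?thesis by simp
qed

definition limit_energy :: real where "limit_energy = drift\<^sup>2 + diffusivity / 2"

lemma residual_square_bounds:
  assumes t: "0 \<le> t"
  shows "expectation (\<lambda>\<omega>. (residual t \<omega>)\<^sup>2) \<le> limit_energy"
    "limit_energy - (diffusivity + 2 * drift\<^sup>2) * exp (- t) \<le> expectation (\<lambda>\<omega>. (residual t \<omega>)\<^sup>2)"
proof -
  have e: "exp (- 2 * t) = (exp (- t))\<^sup>2" by (simp add: exp_double[symmetric])
  have x: "0 \<le> exp (- t)" "exp (- t) \<le> 1" using t by auto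
  have eq: "expectation (\<lambda>\<omega>. (residual t \<omega>)\<^sup>2) = limit_energy - (diffusivity * (exp (- t))\<^sup>2 / 2 + drift\<^sup>2 * exp (- t) * (2 - exp (- t)))"
    unfolding expectation_residual_square[OF t] limit_energy_def e by (simp add: power2_eq_square field_simps)
  have "(exp (- t))\<^sup>2 \<le> exp (- t)" using x by (simp add: power2_eq_square mult_left_le_one_le)
  then have "diffusivity * (exp (- t))\<^sup>2 \<le> diffusivity * exp (- t)" using diffusivity_nonneg by (rule mult_left_mono)
  moreover have "0 \<le> diffusivity * (exp (- t))\<^sup>2" "0 \<le> diffusivity * exp (- t)" using diffusivity_nonneg by auto
  moreover have "0 \<le> drift\<^sup>2 * exp (- t) * (2 - exp (- t))" using x(1) x(2) by (intro mult_nonneg_nonneg zero_le_power2) linarith+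
  moreover have "drift\<^sup>2 * exp (- t) * (2 - exp (- t)) \<le> drift\<^sup>2 * exp (- t) * 2" using x by (intro mult_left_mono) auto
  moreover have "(diffusivity + 2 * drift\<^sup>2) * exp (- t) = diffusivity * exp (- t) + drift\<^sup>2 * exp (- t) * 2"
    by (simp add: algebra_simps)
  ultimately show "expectation (\<lambda>\<omega>. (residual t \<omega>)\<^sup>2) \<le> limit_energy"
    "limit_energy - (diffusivity + 2 * drift\<^sup>2) * exp (- t) \<le> expectation (\<lambda>\<omega>. (residual t \<omega>)\<^sup>2)"
    unfolding eq by linarith+
qed

end

section \<open>The block functionals are independent and identically distributed\<close>

definition block_data :: "(real \<Rightarrow> real) \<Rightarrow> real \<times> real \<times> real" where
  "block_data b = (block_end b, block_cross b, block_energy b)"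

lemma measurable_block_functionals:
  assumes w: "(\<lambda>(z, r). w z r) \<in> borel_measurable (N \<Otimes>\<^sub>M borel)"
  shows "(\<lambda>z. block_data (w z)) \<in> borel_measurable N"
proof -
  note [measurable] = w
  have w': "(\<lambda>(p, r). w (fst p) r) \<in> borel_measurable ((N \<Otimes>\<^sub>M borel) \<Otimes>\<^sub>M borel)"
    using measurable_compose[OF _ w, of "\<lambda>x. (fst (fst x), snd x)" "(N \<Otimes>\<^sub>M borel) \<Otimes>\<^sub>M borel"]
    by (simp add: case_prod_unfold)
  have j: "(\<lambda>p. exp_residual (w (fst p)) (snd p)) \<in> borel_measurable (N \<Otimes>\<^sub>M borel)"
    by (rule measurable_exp_residual[OF w']) measurable
  have [measurable]: "(\<lambda>(z, t). exp (- t) * exp_residual (w z) t) \<in> borel_measurable (N \<Otimes>\<^sub>M borel)"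
    "(\<lambda>(z, t). (exp_residual (w z) t)\<^sup>2) \<in> borel_measurable (N \<Otimes>\<^sub>M borel)"
    unfolding case_prod_unfold
     apply (intro borel_measurable_times j)
     apply measurable
    apply (intro borel_measurable_power j)
    done
  have e: "(\<lambda>z. block_end (w z)) \<in> borel_measurable N"
    unfolding block_end_def by (rule measurable_exp_residual[OF w]) simp
  moreover have "(\<lambda>z. block_cross (w z)) \<in> borel_measurable N"
    unfolding block_cross_def
    by (intro borel_measurable_add borel_measurable_times borel_measurable_const measurable_LBINT e) measurable
  moreover have "(\<lambda>z. block_energy (w z)) \<in> borel_measurable N"
    unfolding block_energy_def
    by (intro borel_measurable_add borel_measurable_divide borel_measurable_power borel_measurable_const measurable_LBINT e) measurable
  ultimately show ?thesis unfolding block_data_def by (intro borel_measurable_Pair)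
qed

lemma L2_on_bounded_measurable:
  assumes [measurable]: "f \<in> borel_measurable borel" and b: "\<And>t. \<bar>f t\<bar> \<le> C"
  shows "L2_on {a..b} f"
  unfolding L2_on_def
proof
  show "set_borel_measurable lborel {a..b} f" by (simp add: set_borel_measurable_def)
  show "set_integrable lborel {a..b} (\<lambda>x. (f x)\<^sup>2)"
  proof (rule set_integrable_bound)
    show "set_integrable lborel {a..b} (\<lambda>_. C\<^sup>2)" by (intro borel_integrable_atLeastAtMost' continuous_intros)
    show "set_borel_measurable lborel {a..b} (\<lambda>x. (f x)\<^sup>2)" by (simp add: set_borel_measurable_def)
    show "AE x in lborel. x \<in> {a..b} \<longrightarrow> norm ((f x)\<^sup>2) \<le> norm (C\<^sup>2)"
      using b by (intro AE_I2) (simp add: power2_le_iff_abs_le order_trans[OF abs_ge_zero b])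
  qed
qed

text \<open>
  The path that jumps by \<open>x j\<close> at the time \<open>(j + 1)/2\<^sup>k\<close>. On \<open>[0, 1]\<close> it is a function of finitely many
  increments, to which independence and stationarity apply directly.
\<close>

definition step_path :: "nat \<Rightarrow> (nat \<Rightarrow> real) \<Rightarrow> real \<Rightarrow> real" where
  "step_path k x t = (\<Sum>j<2 ^ k. if real (Suc j) / 2 ^ k \<le> t then x j else 0)"

lemma measurable_step_path:
  "(\<lambda>(x, t). step_path k x t) \<in> borel_measurable (PiM {..<2 ^ k} (\<lambda>_. borel) \<Otimes>\<^sub>M borel)"
proof -
  have "(\<lambda>p. if real (Suc j) / 2 ^ k \<le> snd p then fst p j else 0) \<in> borel_measurable (PiM {..<2 ^ k} (\<lambda>_. borel) \<Otimes>\<^sub>M borel)"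
    if "j < 2 ^ k" for j
  proof -
    have [measurable]: "(\<lambda>p. fst p j) \<in> borel_measurable (PiM {..<2 ^ k} (\<lambda>_. borel) \<Otimes>\<^sub>M borel)"
      using that by (intro measurable_compose[OF measurable_fst measurable_component_singleton]) auto
    show ?thesis by measurable
  qed
  then show ?thesis unfolding step_path_def case_prod_unfold by (intro borel_measurable_sum) auto
qed

lemma L2_on_step_path: "L2_on {0..1} (step_path k x)"
proof (rule L2_on_bounded_measurable)
  show "step_path k x \<in> borel_measurable borel" unfolding step_path_def[abs_def] by measurable
  show "\<bar>step_path k x t\<bar> \<le> (\<Sum>j<2 ^ k. \<bar>x j\<bar>)" for t
    unfolding step_path_def by (rule order_trans[OF sum_abs]) (auto intro!: sum_mono)
qed

lemma step_path_telescope: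
  fixes g :: "real \<Rightarrow> real"
  assumes t: "0 \<le> t" "t \<le> 1"
  shows "step_path k (\<lambda>j. g (real (Suc j) / 2 ^ k) - g (real j / 2 ^ k)) t = g (real (nat \<lfloor>2 ^ k * t\<rfloor>) / 2 ^ k) - g 0"
proof -
  define p where "p = nat \<lfloor>2 ^ k * t\<rfloor>"
  have "real p = of_int \<lfloor>2 ^ k * t\<rfloor>" using t unfolding p_def by simp
  also have "\<dots> \<le> 2 ^ k * t" by (rule of_int_floor_le)
  also have "\<dots> \<le> 2 ^ k" using t by simp
  finally have "real p \<le> 2 ^ k" .
  then have p: "p \<le> 2 ^ k" by (metis of_nat_le_iff of_nat_numeral of_nat_power)
  have iff: "real (Suc j) / 2 ^ k \<le> t \<longleftrightarrow> j < p" for j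
  proof -
    have "real (Suc j) / 2 ^ k \<le> t \<longleftrightarrow> real (Suc j) \<le> 2 ^ k * t" by (simp add: divide_le_eq mult.commute)
    also have "\<dots> \<longleftrightarrow> int (Suc j) \<le> \<lfloor>2 ^ k * t\<rfloor>" by (simp add: le_floor_iff)
    also have "\<dots> \<longleftrightarrow> j < p" using t unfolding p_def by (simp add: zless_nat_eq_int_zless) linarith
    finally show ?thesis .
  qed
  have "step_path k (\<lambda>j. g (real (Suc j) / 2 ^ k) - g (real j / 2 ^ k)) t = (\<Sum>j<2 ^ k. if j < p then g (real (Suc j) / 2 ^ k) - g (real j / 2 ^ k) else 0)"
    unfolding step_path_def iff ..
  also have "\<dots> = (\<Sum>j<p. g (real (Suc j) / 2 ^ k) - g (real j / 2 ^ k))"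
    using p by (intro sum.mono_neutral_cong_right) auto
  also have "\<dots> = g (real p / 2 ^ k) - g 0"
    using sum_lessThan_telescope[of "\<lambda>j. g (real j / 2 ^ k)" p] by simp
  finally show ?thesis by (simp add: p_def)
qed

context square_integrable_levy
begin

definition block :: "nat \<Rightarrow> 'a \<Rightarrow> real \<Rightarrow> real" where
  "block n \<omega> r = W (real n + r) \<omega> - W (real n) \<omega>"

definition dyadic_increments :: "nat \<Rightarrow> nat \<Rightarrow> 'a \<Rightarrow> nat \<Rightarrow> real" where
  "dyadic_increments k n \<omega> = (\<lambda>j\<in>{..<2 ^ k}. W (real n + real (Suc j) / 2 ^ k) \<omega> - W (real n + real j / 2 ^ k) \<omega>)"

text \<open>
  The path in the block \<open>[n, n + 1]\<close>, observed at multiples of \<open>2\<^sup>-\<^sup>k\<close> only.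
\<close>

definition dyadic_block :: "nat \<Rightarrow> nat \<Rightarrow> 'a \<Rightarrow> real \<Rightarrow> real" where
  "dyadic_block k n \<omega> = step_path k (dyadic_increments k n \<omega>)"

lemma dyadic_block_eq:
  assumes t: "0 \<le> t" "t \<le> 1"
  shows "dyadic_block k n \<omega> t = W (real n + real (nat \<lfloor>2 ^ k * t\<rfloor>) / 2 ^ k) \<omega> - W (real n) \<omega>"
proof -
  have "dyadic_block k n \<omega> t = step_path k (\<lambda>j. W (real n + real (Suc j) / 2 ^ k) \<omega> - W (real n + real j / 2 ^ k) \<omega>) t"
    unfolding dyadic_block_def dyadic_increments_def step_path_def by (intro sum.cong) auto
  then show ?thesis using step_path_telescope[OF t, of k "\<lambda>s. W (real n + s) \<omega>"] by simp
qed

text \<open>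
  The end value is observed exactly, as \<open>block_functionals_continuous\<close> requires.
\<close>

lemma dyadic_block_end: "dyadic_block k n \<omega> 1 = block n \<omega> 1"
proof -
  have "real (nat \<lfloor>2 ^ k * (1::real)\<rfloor>) / 2 ^ k = 1" by simp
  then show ?thesis using dyadic_block_eq[of 1 k n \<omega>] by (simp add: block_def)
qed

lemma measurable_dyadic_increments: "dyadic_increments k n \<in> measurable M (PiM {..<2 ^ k} (\<lambda>_. borel))"
  unfolding dyadic_increments_def by (rule measurable_restrict) measurable

lemma measurable_block_data_step: "(\<lambda>x. block_data (step_path k x)) \<in> borel_measurable (PiM {..<2 ^ k} (\<lambda>_. borel))"
  by (rule measurable_block_functionals[OF measurable_step_path])

lemma measurable_dyadic_block_data: "(\<lambda>\<omega>. block_data (dyadic_block k n \<omega>)) \<in> borel_measurable M"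
  unfolding dyadic_block_def
  by (rule measurable_compose[OF measurable_dyadic_increments measurable_block_data_step])

lemma measurable_block_process: "(\<lambda>(\<omega>, r). block n \<omega> r) \<in> borel_measurable (M \<Otimes>\<^sub>M borel)"
  unfolding block_def by measurable

lemma measurable_block_data: "(\<lambda>\<omega>. block_data (block n \<omega>)) \<in> borel_measurable M"
  by (rule measurable_block_functionals[OF measurable_block_process])

text \<open>
  All increments over dyadic intervals of length \<open>2\<^sup>-\<^sup>k\<close> are independent, and different blocks use disjoint
  sets of them.
\<close>

lemma indep_dyadic_block_data: "indep_vars (\<lambda>_. borel) (\<lambda>n \<omega>. block_data (dyadic_block k n \<omega>)) UNIV"
proof -
  define D where "D i \<omega> = W (real (Suc i) / 2 ^ k) \<omega> - W (real i / 2 ^ k) \<omega>" for i \<omega>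
  have D: "indep_vars (\<lambda>_. borel) D {..<n}" for n
    unfolding D_def[abs_def] by (rule indep_increments) (auto intro: divide_right_mono)
  (* Independence of an infinite family only concerns its finite subfamilies. *)
  have ind: "indep_vars (\<lambda>_. borel) D UNIV"
    unfolding indep_vars_def2
  proof
    show "\<forall>i\<in>UNIV. random_variable borel (D i)" unfolding D_def[abs_def] by measurable
    show "indep_sets (\<lambda>i. {D i -` A \<inter> space M |A. A \<in> sets borel}) UNIV"
    proof (subst indep_sets_finite_index_sets, intro allI impI)
      fix J :: "nat set" assume "finite J"
      then obtain n where "J \<subseteq> {..<n}" using finite_nat_bounded by blast
      then have "indep_vars (\<lambda>_. borel) D J" by (rule indep_vars_subset[OF D])
      then show "indep_sets (\<lambda>i. {D i -` A \<inter> space M |A. A \<in> sets borel}) J" by (simp add: indep_vars_def2)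
    qed
  qed
  (* The indices of the increments in the block [n, n + 1]. *)
  define K where "K n = {n * 2 ^ k..<Suc n * 2 ^ k}" for n :: nat
  have "disjoint_family_on K UNIV"
    unfolding disjoint_family_on_def
  proof (intro ballI impI)
    fix m n :: nat assume "m \<noteq> n"
    have *: "K m \<inter> K n = {}" if "m < n" for m n
    proof -
      have "Suc m * 2 ^ k \<le> n * 2 ^ k" using that by (intro mult_right_mono) auto
      then show ?thesis by (auto simp: K_def)
    qed
    show "K m \<inter> K n = {}" using \<open>m \<noteq> n\<close> *[of m n] *[of n m] by (cases "m < n") auto
  qed
  then have "indep_vars (\<lambda>n. PiM (K n) (\<lambda>_. borel)) (\<lambda>n \<omega>. restrict (\<lambda>i. D i \<omega>) (K n)) UNIV"
    by (intro indep_vars_restrict[OF ind]) auto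
  then have "indep_vars (\<lambda>_. borel) (\<lambda>n \<omega>. block_data (step_path k (\<lambda>j\<in>{..<2 ^ k}. restrict (\<lambda>i. D i \<omega>) (K n) (n * 2 ^ k + j)))) UNIV"
  proof (rule indep_vars_compose2[where Y="\<lambda>n y. block_data (step_path k (\<lambda>j\<in>{..<2 ^ k}. y (n * 2 ^ k + j)))"])
    fix n
    have "(\<lambda>y. \<lambda>j\<in>{..<2 ^ k}. y (n * 2 ^ k + j)) \<in> measurable (PiM (K n) (\<lambda>_. borel)) (PiM {..<2 ^ k} (\<lambda>_. borel))"
      by (rule measurable_restrict) (auto intro!: measurable_component_singleton simp: K_def)
    from measurable_compose[OF this measurable_block_data_step]
    show "(\<lambda>y. block_data (step_path k (\<lambda>j\<in>{..<2 ^ k}. y (n * 2 ^ k + j)))) \<in> borel_measurable (PiM (K n) (\<lambda>_. borel))" .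
  qed
  moreover have "(\<lambda>j\<in>{..<2 ^ k}. restrict (\<lambda>i. D i \<omega>) (K n) (n * 2 ^ k + j)) = dyadic_increments k n \<omega>" for n \<omega>
  proof -
    have e: "real (n * 2 ^ k + j) / 2 ^ k = real n + real j / 2 ^ k" for j by (simp add: add_divide_distrib)
    have e': "real (Suc (n * 2 ^ k + j)) / 2 ^ k = real n + real (Suc j) / 2 ^ k" for j
      using e[of "Suc j"] by simp
    show ?thesis
      unfolding dyadic_increments_def
      by (intro restrict_ext) (simp add: K_def D_def e e' del: of_nat_Suc of_nat_add of_nat_mult)
  qed
  ultimately show ?thesis by (simp add: dyadic_block_def)
qed

lemma distr_dyadic_increments:
  "distr M (PiM {..<2 ^ k} (\<lambda>_. borel)) (dyadic_increments k n) =
     PiM {..<2 ^ k} (\<lambda>_. distr M borel (W (1 / 2 ^ k)))"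
proof -
  define X where "X j \<omega> = W (real n + real (Suc j) / 2 ^ k) \<omega> - W (real n + real j / 2 ^ k) \<omega>" for j \<omega>
  have "indep_vars (\<lambda>_. borel) X {..<2 ^ k}"
    unfolding X_def[abs_def] by (rule indep_increments) (auto intro: divide_right_mono)
  then have "distr M (PiM {..<2 ^ k} (\<lambda>_. borel)) (\<lambda>\<omega>. \<lambda>j\<in>{..<2 ^ k}. X j \<omega>) = PiM {..<2 ^ k} (\<lambda>j. distr M borel (X j))"
  proof (subst indep_vars_iff_distr_eq_PiM'[symmetric])
    show "{..<2 ^ k} \<noteq> ({} :: nat set)" by (simp add: lessThan_empty_iff)
    show "random_variable borel (X i)" for i unfolding X_def[abs_def] by measurable
  qed
  also have "\<dots> = PiM {..<2 ^ k} (\<lambda>_. distr M borel (W (1 / 2 ^ k)))"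
  proof (rule PiM_cong)
    fix j
    have "X j = (\<lambda>\<omega>. W ((real n + real j / 2 ^ k) + 1 / 2 ^ k) \<omega> - W (real n + real j / 2 ^ k) \<omega>)"
      by (rule ext) (simp add: X_def add_divide_distrib add.commute add.left_commute)
    then show "distr M borel (X j) = distr M borel (W (1 / 2 ^ k))"
      by (simp only:) (rule stationary, auto)
  qed simp
  finally show ?thesis by (simp add: X_def dyadic_increments_def[abs_def])
qed

lemma distr_dyadic_block_data:
  "distr M borel (\<lambda>\<omega>. block_data (dyadic_block k n \<omega>)) = distr M borel (\<lambda>\<omega>. block_data (dyadic_block k 0 \<omega>))"
proof -
  have "distr M borel (\<lambda>\<omega>. block_data (dyadic_block k n \<omega>)) =
    distr (distr M (PiM {..<2 ^ k} (\<lambda>_. borel)) (dyadic_increments k n)) borel (\<lambda>x. block_data (step_path k x))" for n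
    by (subst distr_distr[OF measurable_block_data_step measurable_dyadic_increments]) (simp add: comp_def dyadic_block_def)
  then show ?thesis by (simp only: distr_dyadic_increments)
qed

text \<open>
  The second moment of an increment over a time of at most \<open>2\<^sup>-\<^sup>k\<close> is of order \<open>2\<^sup>-\<^sup>k\<close>, which is summable over
  \<open>k\<close>; so the mean square convergence of the approximations is almost sure.
\<close>

lemma dyadic_block_AE_tendsto:
  "AE \<omega> in M. (\<lambda>k. LBINT t:{0..1}. (dyadic_block k n \<omega> t - block n \<omega> t)\<^sup>2) \<longlonglongrightarrow> 0"
proof -
  define Z where "Z k t \<omega> = (dyadic_block k n \<omega> t - block n \<omega> t)\<^sup>2" for k t \<omega>
  define C where "C = diffusivity + drift\<^sup>2"
  have Zm[measurable]: "(\<lambda>(t, \<omega>). Z k t \<omega>) \<in> borel_measurable (borel \<Otimes>\<^sub>M M)" for k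
  proof -
    have eq: "dyadic_block k n \<omega> t = (\<Sum>j<2 ^ k. if real (Suc j) / 2 ^ k \<le> t then W (real n + real (Suc j) / 2 ^ k) \<omega> - W (real n + real j / 2 ^ k) \<omega> else 0)" for \<omega> t
      unfolding dyadic_block_def dyadic_increments_def step_path_def by (intro sum.cong) auto
    show ?thesis unfolding Z_def eq block_def by measurable
  qed
  have Z: "integrable M (Z k t)" "expectation (\<lambda>\<omega>. \<bar>Z k t \<omega>\<bar>) \<le> C / 2 ^ k" if t: "t \<in> {0..1}" for k t
  proof -
    define \<tau> where "\<tau> = real (nat \<lfloor>2 ^ k * t\<rfloor>) / 2 ^ k"
    have fl: "real (nat \<lfloor>2 ^ k * t\<rfloor>) = of_int \<lfloor>2 ^ k * t\<rfloor>" using t by simp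
    have "of_int \<lfloor>2 ^ k * t\<rfloor> \<le> 2 ^ k * t" "2 ^ k * t \<le> of_int \<lfloor>2 ^ k * t\<rfloor> + 1" by linarith+
    moreover have d: "t - \<tau> = (2 ^ k * t - of_int \<lfloor>2 ^ k * t\<rfloor>) / 2 ^ k" unfolding \<tau>_def fl by (simp add: field_simps)
    ultimately have "0 \<le> t - \<tau>" and "t - \<tau> \<le> 1 / 2 ^ k"
    proof -
      assume f: "of_int \<lfloor>2 ^ k * t\<rfloor> \<le> 2 ^ k * t" "2 ^ k * t \<le> of_int \<lfloor>2 ^ k * t\<rfloor> + 1"
      show "0 \<le> t - \<tau>" unfolding d using f by simp
      have "2 ^ k * t - of_int \<lfloor>2 ^ k * t\<rfloor> \<le> 1" using f by linarith
      then show "t - \<tau> \<le> 1 / 2 ^ k" unfolding d by (rule divide_right_mono) simp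
    qed
    then have \<tau>: "0 \<le> \<tau>" "\<tau> \<le> t" "t - \<tau> \<le> 1 / 2 ^ k" by (auto simp: \<tau>_def)
    have eq: "Z k t = (\<lambda>\<omega>. (W (real n + t) \<omega> - W (real n + \<tau>) \<omega>)\<^sup>2)"
      using t by (auto simp: Z_def dyadic_block_eq block_def \<tau>_def power2_commute)
    have inc: "integrable M (\<lambda>\<omega>. (W (real n + t) \<omega> - W (real n + \<tau>) \<omega>)\<^sup>2)"
      "expectation (\<lambda>\<omega>. (W (real n + t) \<omega> - W (real n + \<tau>) \<omega>)\<^sup>2) = diffusivity * (t - \<tau>) + drift\<^sup>2 * (t - \<tau>)\<^sup>2"
      using second_moment_increment[of "real n + \<tau>" "real n + t"] \<tau> by auto
    show "integrable M (Z k t)" unfolding eq by (rule inc)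
    have "(t - \<tau>)\<^sup>2 \<le> t - \<tau>"
    proof -
      have "t - \<tau> \<le> 1" using t \<tau> by simp
      then show ?thesis using \<tau> mult_left_mono[of "t - \<tau>" 1 "t - \<tau>"] by (simp add: power2_eq_square)
    qed
    then have "(t - \<tau>)\<^sup>2 \<le> 1 / 2 ^ k" using \<tau> by simp
    then have "diffusivity * (t - \<tau>) + drift\<^sup>2 * (t - \<tau>)\<^sup>2 \<le> diffusivity * (1 / 2 ^ k) + drift\<^sup>2 * (1 / 2 ^ k)"
      using \<tau> diffusivity_nonneg by (intro add_mono mult_left_mono) auto
    then show "expectation (\<lambda>\<omega>. \<bar>Z k t \<omega>\<bar>) \<le> C / 2 ^ k"
      unfolding eq using inc(2) by (simp add: C_def add_divide_distrib)
  qed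
  note F = process_integral_Fubini[OF Zm Z]
  have C0: "0 \<le> C" using diffusivity_nonneg by (simp add: C_def)
  have "AE \<omega> in M. (\<lambda>k. LBINT t:{0..1}. Z k t \<omega>) \<longlonglongrightarrow> 0"
  proof (rule AE_tendsto_0_of_summable_integral)
    show "integrable M (\<lambda>\<omega>. LBINT t:{0..1}. Z k t \<omega>)" for k by (rule F(2))
    show nn: "0 \<le> (LBINT t:{0..1}. Z k t \<omega>)" for k \<omega> by (rule LBINT_nonneg) (simp add: Z_def)
    show "summable (\<lambda>k. expectation (\<lambda>\<omega>. LBINT t:{0..1}. Z k t \<omega>))"
    proof (rule summable_comparison_test')
      show "summable (\<lambda>k. C * (1 / 2) ^ k)" by (intro summable_mult summable_geometric) simp
      fix k :: nat
      have "expectation (\<lambda>\<omega>. LBINT t:{0..1}. Z k t \<omega>) = (LBINT t:{0..1}. expectation (Z k t))" by (rule F(3))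
      also have "\<dots> \<le> (LBINT t:{0..1::real}. C / 2 ^ k)"
      proof (rule set_integral_mono[OF F(4)])
        show "set_integrable lborel {0..1::real} (\<lambda>_. C / 2 ^ k)" by (intro borel_integrable_atLeastAtMost' continuous_on_const)
        show "expectation (Z k t) \<le> C / 2 ^ k" if "t \<in> {0..1}" for t
          using Z(2)[OF that, of k] by (simp add: Z_def[abs_def])
      qed
      also have "\<dots> = C * (1 / 2) ^ k" by (simp add: set_lebesgue_integral_def power_divide)
      finally have "expectation (\<lambda>\<omega>. LBINT t:{0..1}. Z k t \<omega>) \<le> C * (1 / 2) ^ k" .
      moreover have "0 \<le> expectation (\<lambda>\<omega>. LBINT t:{0..1}. Z k t \<omega>)" using nn by (intro integral_nonneg_AE AE_I2)
      ultimately show "norm (expectation (\<lambda>\<omega>. LBINT t:{0..1}. Z k t \<omega>)) \<le> C * (1 / 2) ^ k" by simp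
    qed
  qed
  then show ?thesis by (simp add: Z_def)
qed

lemma L2_on_block:
  assumes "\<forall>T. L2_on {0..T} (\<lambda>s. W s \<omega>)"
  shows "L2_on {0..1} (block n \<omega>)"
proof -
  have "L2_on {real n..real n + 1} (\<lambda>s. W s \<omega>)"
    by (rule L2_on_subset[of "{0..real n + 1}"]) (use assms in auto)
  from L2_on_shift[OF this, of "real n"] have "L2_on {0..1} (\<lambda>r. W (real n + r) \<omega>)" by simp
  from L2_on_diff[OF this L2_on_continuous[OF continuous_on_const]]
  show ?thesis by (simp add: block_def[abs_def])
qed

lemma block_data_AE_tendsto: "AE \<omega> in M. (\<lambda>k. block_data (dyadic_block k n \<omega>)) \<longlonglongrightarrow> block_data (block n \<omega>)"
  using path_L2_on dyadic_block_AE_tendsto[of n]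
proof eventually_elim
  case (elim \<omega>)
  have "\<And>k. L2_on {0..1} (dyadic_block k n \<omega>)" unfolding dyadic_block_def by (rule L2_on_step_path)
  note bf = block_functionals_continuous[OF L2_on_block[OF elim(1)] this dyadic_block_end elim(2)]
  show ?case unfolding block_data_def by (intro tendsto_Pair bf)
qed

lemma indep_block_data: "indep_vars (\<lambda>_. borel) (\<lambda>n \<omega>. block_data (block n \<omega>)) UNIV"
  by (rule indep_vars_AE_limit[where Y="\<lambda>k n \<omega>. block_data (dyadic_block k n \<omega>)"])
    (intro indep_dyadic_block_data measurable_block_data block_data_AE_tendsto)+

lemma distr_block_data: "distr M borel (\<lambda>\<omega>. block_data (block n \<omega>)) = distr M borel (\<lambda>\<omega>. block_data (block 0 \<omega>))"
  by (rule distr_eq_AE_limit[where Y="\<lambda>k \<omega>. block_data (dyadic_block k n \<omega>)" and Y'="\<lambda>k \<omega>. block_data (dyadic_block k 0 \<omega>)"])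
    (intro prob_space_axioms measurable_block_data measurable_dyadic_block_data block_data_AE_tendsto distr_dyadic_block_data)+

lemma block_0_AE: "AE \<omega> in M. block 0 \<omega> = (\<lambda>r. W r \<omega>) \<and> residual 0 \<omega> = 0"
  using start by eventually_elim
    (auto simp: block_def[abs_def] residual_def exp_residual_def exp_smooth_def set_integral_at_point)

lemma measurable_block_components[measurable]:
  "(\<lambda>\<omega>. block_end (block n \<omega>)) \<in> borel_measurable M" "(\<lambda>\<omega>. block_cross (block n \<omega>)) \<in> borel_measurable M"
  "(\<lambda>\<omega>. block_energy (block n \<omega>)) \<in> borel_measurable M"
proof -
  have "(\<lambda>\<omega>. fst (block_data (block n \<omega>))) \<in> borel_measurable M"
    "(\<lambda>\<omega>. fst (snd (block_data (block n \<omega>)))) \<in> borel_measurable M"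
    "(\<lambda>\<omega>. snd (snd (block_data (block n \<omega>)))) \<in> borel_measurable M"
    by (rule measurable_compose[OF measurable_block_data],
        intro borel_measurable_continuous_onI continuous_intros)+
  then show "(\<lambda>\<omega>. block_end (block n \<omega>)) \<in> borel_measurable M" "(\<lambda>\<omega>. block_cross (block n \<omega>)) \<in> borel_measurable M"
    "(\<lambda>\<omega>. block_energy (block n \<omega>)) \<in> borel_measurable M" by (simp_all add: block_data_def)
qed

lemma residual_square_Fubini:
  "AE \<omega> in M. set_integrable lborel {0..T} (\<lambda>s. (residual s \<omega>)\<^sup>2)"
  "integrable M (\<lambda>\<omega>. LBINT s:{0..T}. (residual s \<omega>)\<^sup>2)"
  "expectation (\<lambda>\<omega>. LBINT s:{0..T}. (residual s \<omega>)\<^sup>2) = (LBINT s:{0..T}. expectation (\<lambda>\<omega>. (residual s \<omega>)\<^sup>2))"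
  "set_integrable lborel {0..T} (\<lambda>s. expectation (\<lambda>\<omega>. (residual s \<omega>)\<^sup>2))"
proof -
  have m: "(\<lambda>(s, \<omega>). (residual s \<omega>)\<^sup>2) \<in> borel_measurable (borel \<Otimes>\<^sub>M M)" by measurable
  have i: "integrable M (\<lambda>\<omega>. (residual s \<omega>)\<^sup>2)" if "s \<in> {0..T}" for s using that by (intro integrable_residual_square) auto
  have b: "expectation (\<lambda>\<omega>. \<bar>(residual s \<omega>)\<^sup>2\<bar>) \<le> limit_energy" if "s \<in> {0..T}" for s
    using that residual_square_bounds(1)[of s] by simp
  note F = process_integral_Fubini[OF m i b]
  show "AE \<omega> in M. set_integrable lborel {0..T} (\<lambda>s. (residual s \<omega>)\<^sup>2)" by (rule F(1))
  show "integrable M (\<lambda>\<omega>. LBINT s:{0..T}. (residual s \<omega>)\<^sup>2)" by (rule F(2))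
  show "expectation (\<lambda>\<omega>. LBINT s:{0..T}. (residual s \<omega>)\<^sup>2) = (LBINT s:{0..T}. expectation (\<lambda>\<omega>. (residual s \<omega>)\<^sup>2))" by (rule F(3))
  show "set_integrable lborel {0..T} (\<lambda>s. expectation (\<lambda>\<omega>. (residual s \<omega>)\<^sup>2))" by (rule F(4))
qed

text \<open>
  The process almost surely starts at 0, so the first block is the process itself. All blocks being equal in
  law, the moments of the block functionals can be computed from the residual process.
\<close>

lemma block_0_eq_AE:
  "AE \<omega> in M. block_end (block 0 \<omega>) = residual 1 \<omega>"
  "AE \<omega> in M. block_cross (block 0 \<omega>) = 2 * (LBINT t:{0..1}. exp (- t) * residual t \<omega>) + exp (- 1) * residual 1 \<omega>"
  "AE \<omega> in M. block_energy (block 0 \<omega>) = (LBINT t:{0..1}. (residual t \<omega>)\<^sup>2) + (residual 1 \<omega>)\<^sup>2 / 2"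
  using block_0_AE by (auto elim!: eventually_mono simp: block_end_def block_cross_def block_energy_def residual_def)

lemma expectation_block_end: "expectation (\<lambda>\<omega>. block_end (block 0 \<omega>)) = drift * (1 - exp (- 1))"
proof -
  have "expectation (\<lambda>\<omega>. block_end (block 0 \<omega>)) = expectation (residual 1)"
    by (rule integral_cong_AE[OF _ _ block_0_eq_AE(1)]) measurable
  then show ?thesis by (simp add: expectation_residual)
qed

lemma expectation_exp_residual_integral:
  "integrable M (\<lambda>\<omega>. LBINT t:{0..1}. exp (- t) * residual t \<omega>)"
  "expectation (\<lambda>\<omega>. LBINT t:{0..1}. exp (- t) * residual t \<omega>) = drift * (1 / 2 - exp (- 1) + exp (- 2) / 2)"
proof -
  have m: "(\<lambda>(t, \<omega>). exp (- t) * residual t \<omega>) \<in> borel_measurable (borel \<Otimes>\<^sub>M M)" by measurable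
  have i: "integrable M (residual t)" if "0 \<le> t" for t
    by (rule integrable_square_imp_integrable[OF measurable_residual integrable_residual_square[OF that]])
  have i': "integrable M (\<lambda>\<omega>. exp (- t) * residual t \<omega>)" if "t \<in> {0..1}" for t
    by (rule Bochner_Integration.integrable_mult_right) (use i that in auto)
  have b: "expectation (\<lambda>\<omega>. \<bar>exp (- t) * residual t \<omega>\<bar>) \<le> 1 + limit_energy" if t: "t \<in> {0..1}" for t
  proof -
    have "expectation (\<lambda>\<omega>. \<bar>exp (- t) * residual t \<omega>\<bar>) \<le> expectation (\<lambda>\<omega>. 1 + (residual t \<omega>)\<^sup>2)"
    proof (rule integral_mono)
      show "integrable M (\<lambda>\<omega>. \<bar>exp (- t) * residual t \<omega>\<bar>)" using i'[OF t] by (rule Bochner_Integration.integrable_abs)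
      show "integrable M (\<lambda>\<omega>. 1 + (residual t \<omega>)\<^sup>2)" using integrable_residual_square[of t] t by simp
      show "\<bar>exp (- t) * residual t \<omega>\<bar> \<le> 1 + (residual t \<omega>)\<^sup>2" for \<omega>
      proof -
        have "exp (- t) \<le> 1" using t by simp
        then have "exp (- t) * \<bar>residual t \<omega>\<bar> \<le> \<bar>residual t \<omega>\<bar>" by (rule mult_left_le_one_le[rotated 2]) auto
        then show ?thesis using abs_le_one_plus_square[of "residual t \<omega>"] by (simp add: abs_mult)
      qed
    qed
    also have "\<dots> \<le> 1 + limit_energy"
      using integrable_residual_square[of t] residual_square_bounds(1)[of t] t by (simp add: prob_space)
    finally show ?thesis .
  qed
  note F = process_integral_Fubini[OF m i' b]
  show "integrable M (\<lambda>\<omega>. LBINT t:{0..1}. exp (- t) * residual t \<omega>)" by (rule F(2))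
  have "expectation (\<lambda>\<omega>. LBINT t:{0..1}. exp (- t) * residual t \<omega>) = (LBINT t:{0..1}. expectation (\<lambda>\<omega>. exp (- t) * residual t \<omega>))"
    by (rule F(3))
  also have "\<dots> = (LBINT t:{0..1}. drift * (exp (- t) - exp (- 2 * t)))"
  proof (intro set_lebesgue_integral_cong allI impI)
    fix t :: real assume "t \<in> {0..1}"
    moreover have "exp (- 2 * t) = exp (- t) * exp (- t)" by (simp add: exp_add[symmetric])
    ultimately show "expectation (\<lambda>\<omega>. exp (- t) * residual t \<omega>) = drift * (exp (- t) - exp (- 2 * t))"
      by (simp add: expectation_residual algebra_simps)
  qed simp
  also have "\<dots> = drift * (LBINT t:{0..1}. exp (- t) - exp (- 2 * t))" by (rule set_integral_mult_right)
  also have "(LBINT t:{0..1}. exp (- t) - exp (- 2 * t)) = (- exp (- 1) + exp (- 2 * 1) / 2) - (- exp (- 0) + exp (- 2 * 0) / (2::real))"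
    by (rule LBINT_FTC_real) (auto intro!: derivative_eq_intros continuous_intros)
  finally show "expectation (\<lambda>\<omega>. LBINT t:{0..1}. exp (- t) * residual t \<omega>) = drift * (1 / 2 - exp (- 1) + exp (- 2) / 2)"
    by simp
qed

lemma exp_minus_2: "exp (- 2 :: real) = (exp (- 1))\<^sup>2"
  by (simp add: exp_double[symmetric])

lemma expectation_block_cross: "expectation (\<lambda>\<omega>. block_cross (block 0 \<omega>)) = drift * (1 - exp (- 1))"
proof -
  have m: "(\<lambda>\<omega>. LBINT t:{0..1}. exp (- t) * residual t \<omega>) \<in> borel_measurable M"
    using expectation_exp_residual_integral(1) by (rule borel_measurable_integrable)
  have "expectation (\<lambda>\<omega>. block_cross (block 0 \<omega>)) =
     expectation (\<lambda>\<omega>. 2 * (LBINT t:{0..1}. exp (- t) * residual t \<omega>) + exp (- 1) * residual 1 \<omega>)"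
    by (rule integral_cong_AE[OF _ _ block_0_eq_AE(2)]) (use m in measurable)
  also have "\<dots> = 2 * (drift * (1 / 2 - exp (- 1) + exp (- 2) / 2)) + exp (- 1) * (drift * (1 - exp (- 1)))"
  proof -
    have "integrable M (residual 1)"
      by (rule integrable_square_imp_integrable[OF measurable_residual integrable_residual_square]) simp
    then show ?thesis using expectation_exp_residual_integral by (simp add: expectation_residual)
  qed
  also have "\<dots> = drift * (1 - exp (- 1))" unfolding exp_minus_2 by (simp add: power2_eq_square field_simps)
  finally show ?thesis .
qed

lemma block_energy_moment:
  "integrable M (\<lambda>\<omega>. block_energy (block 0 \<omega>))"
  "expectation (\<lambda>\<omega>. block_energy (block 0 \<omega>)) = diffusivity / 2 + drift\<^sup>2 * exp (- 1)"
proof -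
  note F = residual_square_Fubini[of 1]
  have i1: "integrable M (\<lambda>\<omega>. (residual 1 \<omega>)\<^sup>2)" by (rule integrable_residual_square) simp
  have i: "integrable M (\<lambda>\<omega>. (LBINT t:{0..1}. (residual t \<omega>)\<^sup>2) + (residual 1 \<omega>)\<^sup>2 / 2)" using F(2) i1 by simp
  have "AE \<omega> in M. (LBINT t:{0..1}. (residual t \<omega>)\<^sup>2) + (residual 1 \<omega>)\<^sup>2 / 2 = block_energy (block 0 \<omega>)"
    using block_0_eq_AE(3) by eventually_elim simp
  then show "integrable M (\<lambda>\<omega>. block_energy (block 0 \<omega>))"
    by (rule integrable_cong_AE_imp[OF i, rotated]) measurable
  have "expectation (\<lambda>\<omega>. block_energy (block 0 \<omega>)) = expectation (\<lambda>\<omega>. (LBINT t:{0..1}. (residual t \<omega>)\<^sup>2) + (residual 1 \<omega>)\<^sup>2 / 2)"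
    by (rule integral_cong_AE[OF _ borel_measurable_integrable[OF i] block_0_eq_AE(3)]) measurable
  also have "\<dots> = (LBINT t:{0..1}. expectation (\<lambda>\<omega>. (residual t \<omega>)\<^sup>2)) + expectation (\<lambda>\<omega>. (residual 1 \<omega>)\<^sup>2) / 2"
    using F(2,3) i1 by simp
  also have "(LBINT t:{0..1}. expectation (\<lambda>\<omega>. (residual t \<omega>)\<^sup>2)) =
     (LBINT t:{0..1}. (diffusivity / 2 + drift\<^sup>2) - 2 * drift\<^sup>2 * exp (- t) + (drift\<^sup>2 - diffusivity / 2) * exp (- 2 * t))"
  proof (intro set_lebesgue_integral_cong allI impI)
    fix t :: real assume "t \<in> {0..1}"
    then have t: "0 \<le> t" by simp
    have e: "exp (- 2 * t) = (exp (- t))\<^sup>2" by (simp add: exp_double[symmetric])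
    show "expectation (\<lambda>\<omega>. (residual t \<omega>)\<^sup>2) = (diffusivity / 2 + drift\<^sup>2) - 2 * drift\<^sup>2 * exp (- t) + (drift\<^sup>2 - diffusivity / 2) * exp (- 2 * t)"
      unfolding expectation_residual_square[OF t] e by (simp add: power2_eq_square field_simps)
  qed simp
  also have "\<dots> = ((diffusivity / 2 + drift\<^sup>2) * 1 + 2 * drift\<^sup>2 * exp (- 1) - (drift\<^sup>2 - diffusivity / 2) * exp (- 2 * 1) / 2)
      - ((diffusivity / 2 + drift\<^sup>2) * 0 + 2 * drift\<^sup>2 * exp (- 0) - (drift\<^sup>2 - diffusivity / 2) * exp (- 2 * 0) / 2)"
    by (rule LBINT_FTC_real) (auto intro!: derivative_eq_intros continuous_intros simp: field_simps)
  finally have "expectation (\<lambda>\<omega>. block_energy (block 0 \<omega>)) =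
    ((diffusivity / 2 + drift\<^sup>2) + 2 * drift\<^sup>2 * exp (- 1) - (drift\<^sup>2 - diffusivity / 2) * (exp (- 1))\<^sup>2 / 2)
      - (2 * drift\<^sup>2 - (drift\<^sup>2 - diffusivity / 2) / 2)
      + (diffusivity * (1 - (exp (- 1))\<^sup>2) / 2 + drift\<^sup>2 * (1 - exp (- 1))\<^sup>2) / 2"
    using expectation_residual_square[of 1] by (simp add: exp_minus_2)
  then show "expectation (\<lambda>\<omega>. block_energy (block 0 \<omega>)) = diffusivity / 2 + drift\<^sup>2 * exp (- 1)"
    by (simp add: power2_eq_square field_simps)
qed

text \<open>
  The square of the linear functional is bounded by the quadratic ones.
\<close>

lemma integrable_block_cross_square: "integrable M (\<lambda>\<omega>. (block_cross (block 0 \<omega>))\<^sup>2)"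
proof (rule Bochner_Integration.integrable_bound)
  show "integrable M (\<lambda>\<omega>. 8 * (LBINT t:{0..1}. (residual t \<omega>)\<^sup>2) + 2 * (residual 1 \<omega>)\<^sup>2)"
    using residual_square_Fubini(2)[of 1] integrable_residual_square[of 1] by simp
  show "AE \<omega> in M. norm ((block_cross (block 0 \<omega>))\<^sup>2) \<le> norm (8 * (LBINT t:{0..1}. (residual t \<omega>)\<^sup>2) + 2 * (residual 1 \<omega>)\<^sup>2)"
    using path_L2_on_bounded[of 1] block_0_eq_AE(2)
  proof eventually_elim
    case (elim \<omega>)
    define A where "A = (LBINT t:{0..1}. exp (- t) * residual t \<omega>)"
    define R where "R = (LBINT t:{0..1}. (residual t \<omega>)\<^sup>2)"
    have R0: "0 \<le> R" unfolding R_def by (rule LBINT_nonneg) simp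
    have r: "L2_on {0..1} (\<lambda>t. residual t \<omega>)" unfolding residual_def by (rule L2_on_exp_residual[OF elim(1)])
    have e: "L2_on {0..1} (\<lambda>t. exp (- t))" by (intro L2_on_continuous continuous_intros)
    have "(LBINT t:{0..1::real}. (exp (- t))\<^sup>2) \<le> (LBINT t:{0..1::real}. 1)"
    proof (rule set_integral_mono)
      show "set_integrable lborel {0..1::real} (\<lambda>t. (exp (- t))\<^sup>2)" using e by (simp add: L2_on_def)
      show "set_integrable lborel {0..1::real} (\<lambda>t. 1 :: real)"
        by (intro borel_integrable_atLeastAtMost' continuous_on_const)
    qed (simp add: power_le_one)
    also have "(LBINT t:{0..1::real}. 1) = (1::real)" by (simp add: set_lebesgue_integral_def)
    finally have "A\<^sup>2 \<le> 1 * R"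
      unfolding A_def R_def
      by (intro order_trans[OF L2_on_Cauchy_Schwarz[OF e r]] mult_right_mono LBINT_nonneg) auto
    moreover have "(block_cross (block 0 \<omega>))\<^sup>2 \<le> 8 * A\<^sup>2 + 2 * (residual 1 \<omega>)\<^sup>2"
    proof -
      have c: "block_cross (block 0 \<omega>) = 2 * A + exp (- 1) * residual 1 \<omega>" using elim(2) by (simp add: A_def)
      have "0 \<le> (2 * A - exp (- 1) * residual 1 \<omega>)\<^sup>2" by simp
      then have "(block_cross (block 0 \<omega>))\<^sup>2 \<le> 2 * (2 * A)\<^sup>2 + 2 * (exp (- 1) * residual 1 \<omega>)\<^sup>2"
        unfolding c by (simp add: power2_eq_square algebra_simps)
      moreover have "(exp (- 1) * residual 1 \<omega>)\<^sup>2 \<le> (residual 1 \<omega>)\<^sup>2"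
        unfolding power_mult_distrib by (intro mult_left_le_one_le) (auto simp: power_le_one)
      ultimately show ?thesis by (simp add: power_mult_distrib)
    qed
    ultimately have "(block_cross (block 0 \<omega>))\<^sup>2 \<le> 8 * R + 2 * (residual 1 \<omega>)\<^sup>2" by linarith
    then show ?case using R0 by (simp add: R_def)
  qed
qed measurable

text \<open>
  The residual at integer times satisfies the recursion of \<open>strong_law_autoregression\<close> with factor \<open>1/e\<close> and
  the block functionals as innovations. The limit given there is \<open>v/2 + m\<^sup>2/e + m (1 - 1/e) m\<close>.
\<close>

theorem residual_energy_law_integer_times:
  "AE \<omega> in M. (\<lambda>N. (LBINT s:{0..real N}. (residual s \<omega>)\<^sup>2) / real N) \<longlonglongrightarrow> limit_energy"
proof -
  define q where "q = exp (- 1 :: real)"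
  define \<xi> where "\<xi> n \<omega> = block_end (block n \<omega>)" for n \<omega>
  define H where "H n \<omega> = block_cross (block n \<omega>)" for n \<omega>
  define \<Theta> where "\<Theta> n \<omega> = block_energy (block n \<omega>)" for n \<omega>
  (* Started at 0 for every \<omega>; on almost every path it is the residual at integer times. *)
  define X where "X n = rec_nat (\<lambda>_. 0) (\<lambda>n x \<omega>. q * x \<omega> + \<xi> n \<omega>) n" for n
  have X: "X 0 \<omega> = 0" "X (Suc n) \<omega> = q * X n \<omega> + \<xi> n \<omega>" for n \<omega> by (simp_all add: X_def)
  have q: "0 < q" "q < 1" by (simp_all add: q_def)
  have "AE \<omega> in M. (\<lambda>N. (\<Sum>n<N. \<Theta> n \<omega> + X n \<omega> * H n \<omega>) / real N) \<longlonglongrightarrow>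
      expectation (\<Theta> 0) + expectation (H 0) * (expectation (\<xi> 0) / (1 - q)) \<and>
    (\<lambda>N. (X N \<omega>)\<^sup>2 / real N) \<longlonglongrightarrow> 0"
  proof (rule strong_law_autoregression[OF indep_block_data distr_block_data _ _ _ _ q X])
    show "block_data (block n \<omega>) = (\<xi> n \<omega>, H n \<omega>, \<Theta> n \<omega>)" for n \<omega>
      by (simp add: block_data_def \<xi>_def H_def \<Theta>_def)
    show "(\<xi> n \<omega>)\<^sup>2 \<le> 2 * \<Theta> n \<omega>" for n \<omega>
      using LBINT_nonneg[of "{0..1}" "\<lambda>t. (exp_residual (block n \<omega>) t)\<^sup>2"] by (simp add: \<xi>_def \<Theta>_def block_energy_def)
    show "integrable M (\<Theta> 0)" unfolding \<Theta>_def by (rule block_energy_moment)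
    show "integrable M (\<lambda>\<omega>. (H 0 \<omega>)\<^sup>2)" unfolding H_def by (rule integrable_block_cross_square)
  qed
  moreover have lim: "expectation (\<Theta> 0) + expectation (H 0) * (expectation (\<xi> 0) / (1 - q)) = limit_energy"
  proof -
    have E: "expectation (\<Theta> 0) = diffusivity / 2 + drift\<^sup>2 * q" "expectation (H 0) = drift * (1 - q)" "expectation (\<xi> 0) = drift * (1 - q)"
      unfolding \<Theta>_def H_def \<xi>_def q_def by (rule block_energy_moment expectation_block_cross expectation_block_end)+
    have "drift * (1 - q) / (1 - q) = drift" using q by simp
    then show ?thesis unfolding E limit_energy_def by (simp add: power2_eq_square algebra_simps)
  qed
  ultimately have "AE \<omega> in M. (\<lambda>N. (\<Sum>n<N. \<Theta> n \<omega> + X n \<omega> * H n \<omega>) / real N) \<longlonglongrightarrow> limit_energy \<and>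
    (\<lambda>N. (X N \<omega>)\<^sup>2 / real N) \<longlonglongrightarrow> 0" by simp
  with path_L2_on block_0_AE show ?thesis
  proof eventually_elim
    case (elim \<omega>)
    have w: "\<And>T. L2_on {0..T} (\<lambda>s. W s \<omega>)" using elim(1) by blast
    have bl: "(\<lambda>r. W (real n + r) \<omega> - W (real n) \<omega>) = block n \<omega>" for n by (simp add: block_def[abs_def])
    have XR: "residual (real n) \<omega> = X n \<omega>" for n
    proof (induction n)
      case (Suc n)
      have "residual (real n + 1) \<omega> = exp (- 1) * residual (real n) \<omega> + block_end (block n \<omega>)"
        using block_identity(1)[OF w, of "real n"] unfolding residual_def bl by simp
      then show ?case using Suc by (simp add: X \<xi>_def q_def add.commute)
    qed (use elim in \<open>simp add: X\<close>)
    have eq: "(LBINT s:{0..real N}. (residual s \<omega>)\<^sup>2) / real N =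
       (\<Sum>n<N. \<Theta> n \<omega> + X n \<omega> * H n \<omega>) / real N - (X N \<omega>)\<^sup>2 / real N / 2" for N
    proof -
      have "(LBINT s:{0..real N}. (residual s \<omega>)\<^sup>2) =
        (\<Sum>n<N. \<Theta> n \<omega> + X n \<omega> * H n \<omega>) + ((X 0 \<omega>)\<^sup>2 - (X N \<omega>)\<^sup>2) / 2"
        using residual_energy_blocks[OF w, of N] unfolding bl residual_def[symmetric] XR
        using XR[of 0] by (simp add: \<Theta>_def H_def)
      then show ?thesis by (simp add: X(1) diff_divide_distrib)
    qed
    have "(\<lambda>N. (\<Sum>n<N. \<Theta> n \<omega> + X n \<omega> * H n \<omega>) / real N - (X N \<omega>)\<^sup>2 / real N / 2) \<longlonglongrightarrow> limit_energy - 0 / 2"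
      using elim by (intro tendsto_intros) auto
    then show ?case unfolding eq by simp
  qed
qed

end

section \<open>Almost sure and mean convergence of the minimal energy\<close>

lemma filterlim_nat_floor: "filterlim (\<lambda>T::real. nat \<lfloor>T\<rfloor>) sequentially at_top"
proof -
  have "eventually (\<lambda>T::real. c \<le> nat \<lfloor>T\<rfloor>) at_top" for c
    by (rule eventually_at_top_linorderI[of "real c"]) linarith
  then show ?thesis by (simp add: filterlim_at_top)
qed

text \<open>
  Sandwich \<open>T\<close> between consecutive integers, whose quotient tends to 1.
\<close>

lemma average_tendsto_real_times:
  fixes A :: "real \<Rightarrow> real"
  assumes mono: "\<And>s t. 0 \<le> s \<Longrightarrow> s \<le> t \<Longrightarrow> A s \<le> A t" and A0: "\<And>t. 0 \<le> A t"
    and lim: "(\<lambda>N. A (real N) / real N) \<longlonglongrightarrow> c"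
  shows "((\<lambda>T. A T / T) \<longlongrightarrow> c) at_top"
proof (rule tendsto_sandwich)
  have r: "(\<lambda>N. real N / real (Suc N)) \<longlonglongrightarrow> 1" by (rule LIMSEQ_n_over_Suc_n)
  have "(\<lambda>N. A (real N) / real N * (real N / real (Suc N))) \<longlonglongrightarrow> c * 1" by (intro tendsto_mult lim r)
  from filterlim_compose[OF this filterlim_nat_floor]
  show "((\<lambda>T::real. A (real (nat \<lfloor>T\<rfloor>)) / real (nat \<lfloor>T\<rfloor>) * (real (nat \<lfloor>T\<rfloor>) / real (Suc (nat \<lfloor>T\<rfloor>)))) \<longlongrightarrow> c) at_top"
    by (simp only: mult_1_right)
  have r': "(\<lambda>N. real (Suc N) / real N) \<longlonglongrightarrow> 1" using LIMSEQ_Suc_n_over_n by simp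
  have "(\<lambda>N. A (real (Suc N)) / real (Suc N) * (real (Suc N) / real N)) \<longlonglongrightarrow> c * 1"
    by (intro tendsto_mult LIMSEQ_Suc[OF lim] r')
  from filterlim_compose[OF this filterlim_nat_floor]
  show "((\<lambda>T::real. A (real (Suc (nat \<lfloor>T\<rfloor>))) / real (Suc (nat \<lfloor>T\<rfloor>)) * (real (Suc (nat \<lfloor>T\<rfloor>)) / real (nat \<lfloor>T\<rfloor>))) \<longlongrightarrow> c) at_top"
    by (simp only: mult_1_right)
  have b: "1 \<le> nat \<lfloor>T\<rfloor> \<and> real (nat \<lfloor>T\<rfloor>) \<le> T \<and> T \<le> real (Suc (nat \<lfloor>T\<rfloor>))" if "1 \<le> T" for T :: real
    using that by linarith
  show "\<forall>\<^sub>F T in at_top. A (real (nat \<lfloor>T\<rfloor>)) / real (nat \<lfloor>T\<rfloor>) * (real (nat \<lfloor>T\<rfloor>) / real (Suc (nat \<lfloor>T\<rfloor>))) \<le> A T / T"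
  proof (rule eventually_at_top_linorderI[of 1])
    fix T :: real assume T: "1 \<le> T"
    note b = b[OF T]
    have "A (real (nat \<lfloor>T\<rfloor>)) / real (nat \<lfloor>T\<rfloor>) * (real (nat \<lfloor>T\<rfloor>) / real (Suc (nat \<lfloor>T\<rfloor>))) = A (real (nat \<lfloor>T\<rfloor>)) / real (Suc (nat \<lfloor>T\<rfloor>))"
    proof -
      have "real (nat \<lfloor>T\<rfloor>) \<noteq> 0" using b by linarith
      then show ?thesis by (simp del: of_nat_Suc of_nat_0_eq_iff of_nat_eq_0_iff)
    qed
    also have "\<dots> \<le> A T / T" using b T by (intro frac_le mono A0) auto
    finally show "A (real (nat \<lfloor>T\<rfloor>)) / real (nat \<lfloor>T\<rfloor>) * (real (nat \<lfloor>T\<rfloor>) / real (Suc (nat \<lfloor>T\<rfloor>))) \<le> A T / T" .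
  qed
  show "\<forall>\<^sub>F T in at_top. A T / T \<le> A (real (Suc (nat \<lfloor>T\<rfloor>))) / real (Suc (nat \<lfloor>T\<rfloor>)) * (real (Suc (nat \<lfloor>T\<rfloor>)) / real (nat \<lfloor>T\<rfloor>))"
  proof (rule eventually_at_top_linorderI[of 1])
    fix T :: real assume T: "1 \<le> T"
    note b = b[OF T]
    have "A T / T \<le> A (real (Suc (nat \<lfloor>T\<rfloor>))) / real (nat \<lfloor>T\<rfloor>)"
      using b T by (intro frac_le mono A0) auto
    also have "\<dots> = A (real (Suc (nat \<lfloor>T\<rfloor>))) / real (Suc (nat \<lfloor>T\<rfloor>)) * (real (Suc (nat \<lfloor>T\<rfloor>)) / real (nat \<lfloor>T\<rfloor>))"
      by (simp del: of_nat_Suc)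
    finally show "A T / T \<le> A (real (Suc (nat \<lfloor>T\<rfloor>))) / real (Suc (nat \<lfloor>T\<rfloor>)) * (real (Suc (nat \<lfloor>T\<rfloor>)) / real (nat \<lfloor>T\<rfloor>))" .
  qed
qed

text \<open>
  Scheffe's argument: \<open>|Y - c| = (Y - c) + 2 max(0, c - Y)\<close>, and the positive part on the right is bounded by
  \<open>|c|\<close> since \<open>Y\<close> is nonnegative.
\<close>

lemma (in prob_space) Scheffe_at_top:
  fixes Y :: "real \<Rightarrow> 'a \<Rightarrow> real"
  assumes int: "\<And>T. integrable M (Y T)" and nn: "\<And>T \<omega>. 0 \<le> T \<Longrightarrow> 0 \<le> Y T \<omega>"
    and lim: "AE \<omega> in M. ((\<lambda>T. Y T \<omega>) \<longlongrightarrow> c) at_top" and mean: "((\<lambda>T. expectation (Y T)) \<longlongrightarrow> c) at_top"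
  shows "((\<lambda>T. expectation (\<lambda>\<omega>. \<bar>Y T \<omega> - c\<bar>)) \<longlongrightarrow> 0) at_top"
proof -
  have [measurable]: "Y T \<in> borel_measurable M" for T using int by auto
  have pos: "((\<lambda>T. expectation (\<lambda>\<omega>. max 0 (c - Y T \<omega>))) \<longlongrightarrow> expectation (\<lambda>\<omega>. 0)) at_top"
  proof (rule integral_dominated_convergence_at_top[where w="\<lambda>_. \<bar>c\<bar>"])
    show "AE \<omega> in M. ((\<lambda>T. max 0 (c - Y T \<omega>)) \<longlongrightarrow> 0) at_top"
      using lim
    proof eventually_elim
      case (elim \<omega>)
      have "((\<lambda>T. max 0 (c - Y T \<omega>)) \<longlongrightarrow> max 0 (c - c)) at_top" by (intro tendsto_intros elim)
      then show ?case by simp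
    qed
    show "\<forall>\<^sub>F T in at_top. AE \<omega> in M. norm (max 0 (c - Y T \<omega>)) \<le> \<bar>c\<bar>"
      using eventually_ge_at_top[of 0]
    proof eventually_elim
      case (elim T)
      show ?case using nn[OF elim] by (intro AE_I2) (auto simp: max_def, smt (verit))
    qed
  qed auto
  have imax: "integrable M (\<lambda>\<omega>. max 0 (c - Y T \<omega>))" for T using int by (intro integrable_max) auto
  have eq: "\<bar>Y T \<omega> - c\<bar> = (Y T \<omega> - c) + 2 * max 0 (c - Y T \<omega>)" for T \<omega> by (auto simp: max_def)
  have "expectation (\<lambda>\<omega>. \<bar>Y T \<omega> - c\<bar>) = (expectation (Y T) - c) + 2 * expectation (\<lambda>\<omega>. max 0 (c - Y T \<omega>))" for T
    unfolding eq using int imax by (simp add: prob_space)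
  moreover have "((\<lambda>T. (expectation (Y T) - c) + 2 * expectation (\<lambda>\<omega>. max 0 (c - Y T \<omega>))) \<longlongrightarrow> (c - c) + 2 * expectation (\<lambda>\<omega>. 0)) at_top"
    by (intro tendsto_intros mean pos)
  ultimately show ?thesis by simp
qed

context square_integrable_levy
begin

definition residual_energy :: "real \<Rightarrow> 'a \<Rightarrow> real" where
  "residual_energy T \<omega> = (LBINT s:{0..T}. (residual s \<omega>)\<^sup>2)"

text \<open>
  For \<open>T \<ge> 1\<close>, four times this quantity bounds the difference between residual energy and minimal energy.
\<close>

definition discounted_energy :: "real \<Rightarrow> 'a \<Rightarrow> real" where
  "discounted_energy T \<omega> = (LBINT s:{0..T}. exp (- s) * (residual s \<omega>)\<^sup>2)"

text \<open>
  A measurable version of the energy of the minimizer: the minimizer itself is only specified on paths that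
  are square integrable.
\<close>

definition path_min_energy :: "real \<Rightarrow> 'a \<Rightarrow> real" where
  "path_min_energy T \<omega> = min_energy T (\<lambda>s. W s \<omega>)"

lemma residual_energy_nonneg: "0 \<le> residual_energy T \<omega>"
  unfolding residual_energy_def by (rule LBINT_nonneg) simp

lemma discounted_energy_nonneg: "0 \<le> discounted_energy T \<omega>"
  unfolding discounted_energy_def by (rule LBINT_nonneg) simp

lemma integrable_residual_square_path:
  assumes "\<forall>T. L2_on {0..T} (\<lambda>s. W s \<omega>)"
  shows "set_integrable lborel {0..T} (\<lambda>s. (residual s \<omega>)\<^sup>2)"
  using L2_on_exp_residual[of T "\<lambda>s. W s \<omega>"] assms by (simp add: L2_on_def residual_def)

lemma integrable_discounted_path:
  assumes w: "\<forall>T. L2_on {0..T} (\<lambda>s. W s \<omega>)" and a: "0 \<le> a" "a \<le> b"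
  shows "set_integrable lborel {a..b} (\<lambda>s. exp (- s) * (residual s \<omega>)\<^sup>2)"
proof -
  have r: "L2_on {a..b} (\<lambda>s. residual s \<omega>)"
    unfolding residual_def by (rule L2_on_subset[OF L2_on_exp_residual[OF spec[OF w, of b]]]) (use a in auto)
  have "set_integrable lborel {a..b} (\<lambda>s. (exp (- s) * residual s \<omega>) * residual s \<omega>)"
    by (intro set_integrable_L2_on_mult L2_on_continuous_mult r continuous_intros)
  then show ?thesis by (simp add: power2_eq_square mult.assoc)
qed

lemma residual_energy_mono:
  assumes "\<forall>T. L2_on {0..T} (\<lambda>s. W s \<omega>)" "0 \<le> s" "s \<le> t"
  shows "residual_energy s \<omega> \<le> residual_energy t \<omega>"
  unfolding residual_energy_def
  using LBINT_combine[OF integrable_residual_square_path[OF assms(1), of t] assms(2,3)]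
    LBINT_nonneg[of "{s..t}" "\<lambda>s. (residual s \<omega>)\<^sup>2"] by simp

lemma residual_energy_AE_tendsto: "AE \<omega> in M. ((\<lambda>T. residual_energy T \<omega> / T) \<longlongrightarrow> limit_energy) at_top"
  using path_L2_on residual_energy_law_integer_times
proof eventually_elim
  case (elim \<omega>)
  show ?case
  proof (rule average_tendsto_real_times[where A="\<lambda>T. residual_energy T \<omega>"])
    show "(\<lambda>N. residual_energy (real N) \<omega> / real N) \<longlonglongrightarrow> limit_energy"
      using elim(2) by (simp add: residual_energy_def)
  qed (use elim residual_energy_mono residual_energy_nonneg in auto)
qed

text \<open>
  Up to time \<open>S\<close> the weight is at most 1, afterwards at most \<open>exp(-S)\<close>.
\<close>

lemma discounted_energy_le:
  assumes w: "\<forall>T. L2_on {0..T} (\<lambda>s. W s \<omega>)" and S: "0 \<le> S" "S \<le> T"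
  shows "discounted_energy T \<omega> \<le> residual_energy S \<omega> + exp (- S) * residual_energy T \<omega>"
proof -
  have iR: "set_integrable lborel {0..T} (\<lambda>s. (residual s \<omega>)\<^sup>2)" for T by (rule integrable_residual_square_path[OF w])
  have "discounted_energy T \<omega> = (LBINT s:{0..S}. exp (- s) * (residual s \<omega>)\<^sup>2) + (LBINT s:{S..T}. exp (- s) * (residual s \<omega>)\<^sup>2)"
    unfolding discounted_energy_def using S by (intro LBINT_combine integrable_discounted_path w) auto
  also have "(LBINT s:{0..S}. exp (- s) * (residual s \<omega>)\<^sup>2) \<le> residual_energy S \<omega>"
    unfolding residual_energy_def
    by (rule set_integral_mono[OF integrable_discounted_path[OF w] iR]) (use S in \<open>auto intro!: mult_left_le_one_le\<close>)
  also have "(LBINT s:{S..T}. exp (- s) * (residual s \<omega>)\<^sup>2) \<le> (LBINT s:{S..T}. exp (- S) * (residual s \<omega>)\<^sup>2)"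
  proof (rule set_integral_mono[OF integrable_discounted_path[OF w S]])
    have "set_integrable lborel {S..T} (\<lambda>s. (residual s \<omega>)\<^sup>2)"
      by (rule set_integrable_subset[OF iR[of T]]) (use S in auto)
    then show "set_integrable lborel {S..T} (\<lambda>s. exp (- S) * (residual s \<omega>)\<^sup>2)" by simp
  qed (auto intro!: mult_right_mono)
  also have "(LBINT s:{S..T}. exp (- S) * (residual s \<omega>)\<^sup>2) = exp (- S) * (LBINT s:{S..T}. (residual s \<omega>)\<^sup>2)"
    by (rule set_integral_mult_right)
  also have "(LBINT s:{S..T}. (residual s \<omega>)\<^sup>2) \<le> residual_energy T \<omega>"
    unfolding residual_energy_def using LBINT_combine[OF iR[of T] S] LBINT_nonneg[of "{0..S}" "\<lambda>s. (residual s \<omega>)\<^sup>2"] by simp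
  finally show ?thesis by simp
qed

text \<open>
  The splitting time \<open>S = sqrt T\<close> makes both parts negligible against \<open>T\<close>, because the residual energy grows
  linearly.
\<close>

lemma discounted_energy_AE_tendsto: "AE \<omega> in M. ((\<lambda>T. discounted_energy T \<omega> / T) \<longlongrightarrow> 0) at_top"
  using path_L2_on residual_energy_AE_tendsto
proof eventually_elim
  case (elim \<omega>)
  show ?case
  proof (rule tendsto_sandwich[OF _ _ tendsto_const])
    have s: "filterlim sqrt at_top (at_top :: real filter)" by (rule sqrt_at_top)
    have 1: "((\<lambda>T. residual_energy (sqrt T) \<omega> / sqrt T) \<longlongrightarrow> limit_energy) at_top"
      by (rule filterlim_compose[OF elim(2) s])
    have 2: "((\<lambda>T::real. inverse (sqrt T)) \<longlongrightarrow> 0) at_top"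
      by (rule filterlim_compose[OF tendsto_inverse_0_at_top[OF filterlim_ident] s])
    have 3: "((\<lambda>T::real. exp (- sqrt T)) \<longlongrightarrow> 0) at_top"
      by (rule filterlim_compose[OF exp_at_bot filterlim_compose[OF filterlim_uminus_at_bot_at_top s]])
    have "((\<lambda>T. residual_energy (sqrt T) \<omega> / sqrt T * inverse (sqrt T) + exp (- sqrt T) * (residual_energy T \<omega> / T))
       \<longlongrightarrow> limit_energy * 0 + 0 * limit_energy) at_top"
      by (intro tendsto_intros 1 2 3 elim(2))
    then show "((\<lambda>T. residual_energy (sqrt T) \<omega> / sqrt T * inverse (sqrt T) + exp (- sqrt T) * (residual_energy T \<omega> / T)) \<longlongrightarrow> 0) at_top"
      by simp
    show "\<forall>\<^sub>F T in at_top. 0 \<le> discounted_energy T \<omega> / T"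
      by (rule eventually_at_top_linorderI[of 0]) (simp add: discounted_energy_nonneg)
    show "\<forall>\<^sub>F T in at_top. discounted_energy T \<omega> / T \<le> residual_energy (sqrt T) \<omega> / sqrt T * inverse (sqrt T) + exp (- sqrt T) * (residual_energy T \<omega> / T)"
    proof (rule eventually_at_top_linorderI[of 1])
      fix T :: real assume T: "1 \<le> T"
      have "sqrt T \<le> T" using T real_sqrt_le_mono[of T "T * T"] by (simp add: mult_le_cancel_left1)
      then have "discounted_energy T \<omega> \<le> residual_energy (sqrt T) \<omega> + exp (- sqrt T) * residual_energy T \<omega>"
        using T by (intro discounted_energy_le elim(1)) auto
      then have "discounted_energy T \<omega> / T \<le> (residual_energy (sqrt T) \<omega> + exp (- sqrt T) * residual_energy T \<omega>) / T"
        using T by (intro divide_right_mono) auto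
      also have "\<dots> = residual_energy (sqrt T) \<omega> / (sqrt T * sqrt T) + exp (- sqrt T) * (residual_energy T \<omega> / T)"
        using T by (simp add: add_divide_distrib)
      also have "residual_energy (sqrt T) \<omega> / (sqrt T * sqrt T) = residual_energy (sqrt T) \<omega> / sqrt T * inverse (sqrt T)"
        by (simp only: divide_inverse inverse_mult_distrib mult.assoc)
      finally show "discounted_energy T \<omega> / T \<le> residual_energy (sqrt T) \<omega> / sqrt T * inverse (sqrt T) + exp (- sqrt T) * (residual_energy T \<omega> / T)" .
    qed
  qed
qed

lemma integrable_residual_energy: "integrable M (residual_energy T)"
  unfolding residual_energy_def[abs_def] by (rule residual_square_Fubini(2))

lemma expectation_residual_energy:
  assumes T: "0 \<le> T"
  shows "expectation (residual_energy T) \<le> limit_energy * T"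
    "limit_energy * T - (diffusivity + 2 * drift\<^sup>2) \<le> expectation (residual_energy T)"
proof -
  have eq: "expectation (residual_energy T) = (LBINT s:{0..T}. expectation (\<lambda>\<omega>. (residual s \<omega>)\<^sup>2))"
    unfolding residual_energy_def[abs_def] by (rule residual_square_Fubini(3))
  define D where "D = diffusivity + 2 * drift\<^sup>2"
  have D: "0 \<le> D" using diffusivity_nonneg by (simp add: D_def)
  have "expectation (residual_energy T) \<le> (LBINT s:{0..T}. limit_energy)"
    unfolding eq
    by (rule set_integral_mono[OF residual_square_Fubini(4) borel_integrable_atLeastAtMost'[OF continuous_on_const]])
      (simp add: residual_square_bounds)
  also have "(LBINT s:{0..T}. limit_energy) = limit_energy * T" using T by (simp add: set_lebesgue_integral_def)
  finally show "expectation (residual_energy T) \<le> limit_energy * T" .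
  have c: "continuous_on {0..T} (\<lambda>s. limit_energy - D * exp (- s))" by (intro continuous_intros)
  have "(LBINT s:{0..T}. limit_energy - D * exp (- s)) = (limit_energy * T + D * exp (- T)) - (limit_energy * 0 + D * exp (- 0))"
    using T by (rule LBINT_FTC_real) (auto intro!: derivative_eq_intros continuous_intros)
  then have "limit_energy * T - D \<le> (LBINT s:{0..T}. limit_energy - D * exp (- s))" using D by simp
  also have "\<dots> \<le> expectation (residual_energy T)"
    unfolding eq
    by (rule set_integral_mono[OF borel_integrable_atLeastAtMost'[OF c] residual_square_Fubini(4)])
      (simp add: residual_square_bounds D_def)
  finally show "limit_energy * T - (diffusivity + 2 * drift\<^sup>2) \<le> expectation (residual_energy T)" by (simp add: D_def)
qed

lemma discounted_energy_expectation:
  assumes T: "0 \<le> T"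
  shows "integrable M (discounted_energy T)" "expectation (discounted_energy T) \<le> limit_energy"
proof -
  have m: "(\<lambda>(s, \<omega>). exp (- s) * (residual s \<omega>)\<^sup>2) \<in> borel_measurable (borel \<Otimes>\<^sub>M M)" by measurable
  have i: "integrable M (\<lambda>\<omega>. exp (- s) * (residual s \<omega>)\<^sup>2)" if "s \<in> {0..T}" for s
    by (rule Bochner_Integration.integrable_mult_right) (use that in \<open>auto intro: integrable_residual_square\<close>)
  have le: "expectation (\<lambda>\<omega>. exp (- s) * (residual s \<omega>)\<^sup>2) \<le> exp (- s) * limit_energy" if "s \<in> {0..T}" for s
    using residual_square_bounds(1)[of s] that by simp
  have c0: "0 \<le> limit_energy" using diffusivity_nonneg by (simp add: limit_energy_def)
  have b: "expectation (\<lambda>\<omega>. \<bar>exp (- s) * (residual s \<omega>)\<^sup>2\<bar>) \<le> limit_energy" if s: "s \<in> {0..T}" for s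
  proof -
    have "exp (- s) * limit_energy \<le> 1 * limit_energy" using s c0 by (intro mult_right_mono) auto
    moreover have "expectation (\<lambda>\<omega>. \<bar>exp (- s) * (residual s \<omega>)\<^sup>2\<bar>) = expectation (\<lambda>\<omega>. exp (- s) * (residual s \<omega>)\<^sup>2)"
      by (intro Bochner_Integration.integral_cong) (auto simp: abs_mult)
    ultimately show ?thesis using le[OF s] by linarith
  qed
  note F = process_integral_Fubini[OF m i b]
  show "integrable M (discounted_energy T)" unfolding discounted_energy_def[abs_def] by (rule F(2))
  have "expectation (discounted_energy T) = (LBINT s:{0..T}. expectation (\<lambda>\<omega>. exp (- s) * (residual s \<omega>)\<^sup>2))"
    unfolding discounted_energy_def[abs_def] by (rule F(3))
  also have "\<dots> \<le> (LBINT s:{0..T}. exp (- s) * limit_energy)"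
  proof (rule set_integral_mono)
    show "set_integrable lborel {0..T} (\<lambda>s. expectation (\<lambda>\<omega>. exp (- s) * (residual s \<omega>)\<^sup>2))" by (rule F(4))
    show "set_integrable lborel {0..T} (\<lambda>s. exp (- s) * limit_energy)"
      by (intro borel_integrable_atLeastAtMost' continuous_intros)
  qed (rule le)
  also have "\<dots> = - exp (- T) * limit_energy - (- exp (- 0) * limit_energy)"
    using T by (rule LBINT_FTC_real) (auto intro!: derivative_eq_intros continuous_intros)
  also have "\<dots> \<le> limit_energy" using c0 by simp
  finally show "expectation (discounted_energy T) \<le> limit_energy" .
qed

lemma measurable_path_min_energy[measurable]: "path_min_energy T \<in> borel_measurable M"
proof -
  have [measurable]: "(\<lambda>(\<omega>, s). residual s \<omega>) \<in> borel_measurable (M \<Otimes>\<^sub>M borel)"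
    using measurable_compose[OF measurable_pair_swap' measurable_residual_process] by (simp add: case_prod_unfold)
  have 1: "(\<lambda>\<omega>. LBINT s:{0..T}. (residual s \<omega>)\<^sup>2) \<in> borel_measurable M"
    by (intro measurable_LBINT) measurable
  have 2: "(\<lambda>\<omega>. LBINT s:{0..T}. exp (- s) * residual s \<omega>) \<in> borel_measurable M"
    by (intro measurable_LBINT) measurable
  have "path_min_energy T = (\<lambda>\<omega>. (LBINT s:{0..T}. (residual s \<omega>)\<^sup>2)
     - 2 * (LBINT s:{0..T}. exp (- s) * residual s \<omega>)\<^sup>2 / (1 - exp (- 2 * T)))"
    by (rule ext) (simp add: path_min_energy_def min_energy_def residual_def)
  then show ?thesis using 1 2 by simp
qed

lemma path_min_energy_bounds:
  "AE \<omega> in M. \<forall>T\<ge>1. \<bar>path_min_energy T \<omega> - residual_energy T \<omega>\<bar> \<le> 4 * discounted_energy T \<omega>"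
  using path_L2_on
proof eventually_elim
  case (elim \<omega>)
  show ?case
  proof (intro allI impI)
    fix T :: real assume T: "1 \<le> T"
    have w: "L2_on {0..T} (\<lambda>s. W s \<omega>)" using elim by blast
    show "\<bar>path_min_energy T \<omega> - residual_energy T \<omega>\<bar> \<le> 4 * discounted_energy T \<omega>"
      using min_energy_bounds[OF T w] discounted_energy_nonneg[of T \<omega>]
      unfolding residual_def residual_energy_def discounted_energy_def path_min_energy_def by linarith
  qed
qed

lemma integrable_path_min_energy:
  assumes T: "1 \<le> T" shows "integrable M (path_min_energy T)"
proof (rule Bochner_Integration.integrable_bound)
  show "integrable M (\<lambda>\<omega>. residual_energy T \<omega> + 4 * discounted_energy T \<omega>)"
    using integrable_residual_energy discounted_energy_expectation(1)[of T] T by simp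
  show "AE \<omega> in M. norm (path_min_energy T \<omega>) \<le> norm (residual_energy T \<omega> + 4 * discounted_energy T \<omega>)"
    using path_min_energy_bounds
  proof eventually_elim
    case (elim \<omega>)
    then have "\<bar>path_min_energy T \<omega> - residual_energy T \<omega>\<bar> \<le> 4 * discounted_energy T \<omega>" using T by blast
    then show ?case using residual_energy_nonneg[of T \<omega>] by simp
  qed
qed measurable

theorem path_min_energy_AE_tendsto: "AE \<omega> in M. ((\<lambda>T. path_min_energy T \<omega> / T) \<longlongrightarrow> limit_energy) at_top"
  using path_min_energy_bounds residual_energy_AE_tendsto discounted_energy_AE_tendsto
proof eventually_elim
  case (elim \<omega>)
  have "((\<lambda>T. path_min_energy T \<omega> / T - residual_energy T \<omega> / T) \<longlongrightarrow> 0) at_top"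
  proof (rule Lim_null_comparison)
    show "((\<lambda>T. 4 * (discounted_energy T \<omega> / T)) \<longlongrightarrow> 0) at_top"
      using tendsto_mult_left[OF elim(3), of 4] by simp
    show "\<forall>\<^sub>F T in at_top. norm (path_min_energy T \<omega> / T - residual_energy T \<omega> / T) \<le> 4 * (discounted_energy T \<omega> / T)"
    proof (rule eventually_at_top_linorderI[of 1])
      fix T :: real assume T: "1 \<le> T"
      then have "\<bar>path_min_energy T \<omega> - residual_energy T \<omega>\<bar> / T \<le> 4 * discounted_energy T \<omega> / T"
        using elim(1) by (intro divide_right_mono) auto
      then show "norm (path_min_energy T \<omega> / T - residual_energy T \<omega> / T) \<le> 4 * (discounted_energy T \<omega> / T)"
        using T by (simp add: diff_divide_distrib[symmetric] abs_divide)
    qed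
  qed
  from tendsto_add[OF this elim(2)] show ?case by simp
qed

text \<open>
  The averaged residual energy is nonnegative and converges almost surely and in expectation to the same
  constant; the expected discounted energy stays bounded, so the correction is of order \<open>1/T\<close>.
\<close>

theorem path_min_energy_L1_tendsto:
  "((\<lambda>T. expectation (\<lambda>\<omega>. \<bar>path_min_energy T \<omega> / T - limit_energy\<bar>)) \<longlongrightarrow> 0) at_top"
proof -
  define D where "D = diffusivity + 2 * drift\<^sup>2"
  have inv: "((\<lambda>T::real. 1 / T) \<longlongrightarrow> 0) at_top"
    using tendsto_inverse_0_at_top[OF filterlim_ident] by (simp add: divide_inverse)
  have mean: "((\<lambda>T. expectation (\<lambda>\<omega>. residual_energy T \<omega> / T)) \<longlongrightarrow> limit_energy) at_top"
  proof (rule tendsto_sandwich[OF _ _ _ tendsto_const])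
    have "((\<lambda>T. limit_energy - D * (1 / T)) \<longlongrightarrow> limit_energy - D * 0) at_top" by (intro tendsto_intros inv)
    then show "((\<lambda>T. limit_energy - D * (1 / T)) \<longlongrightarrow> limit_energy) at_top" by simp
    show "\<forall>\<^sub>F T in at_top. limit_energy - D * (1 / T) \<le> expectation (\<lambda>\<omega>. residual_energy T \<omega> / T)"
    proof (rule eventually_at_top_linorderI[of 1])
      fix T :: real assume T: "1 \<le> T"
      have "(limit_energy * T - D) / T \<le> expectation (residual_energy T) / T"
        using expectation_residual_energy(2)[of T] T by (intro divide_right_mono) (auto simp: D_def)
      then show "limit_energy - D * (1 / T) \<le> expectation (\<lambda>\<omega>. residual_energy T \<omega> / T)"
        using T by (simp add: diff_divide_distrib)
    qed
    show "\<forall>\<^sub>F T in at_top. expectation (\<lambda>\<omega>. residual_energy T \<omega> / T) \<le> limit_energy"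
    proof (rule eventually_at_top_linorderI[of 1])
      fix T :: real assume T: "1 \<le> T"
      have "expectation (residual_energy T) / T \<le> limit_energy * T / T"
        using expectation_residual_energy(1)[of T] T by (intro divide_right_mono) auto
      then show "expectation (\<lambda>\<omega>. residual_energy T \<omega> / T) \<le> limit_energy" using T by simp
    qed
  qed
  have L1: "((\<lambda>T. expectation (\<lambda>\<omega>. \<bar>residual_energy T \<omega> / T - limit_energy\<bar>)) \<longlongrightarrow> 0) at_top"
  proof (rule Scheffe_at_top[OF _ _ residual_energy_AE_tendsto mean])
    show "integrable M (\<lambda>\<omega>. residual_energy T \<omega> / T)" for T
      using integrable_residual_energy by (rule Bochner_Integration.integrable_divide)
  qed (simp add: residual_energy_nonneg)
  show ?thesis
  proof (rule tendsto_sandwich[OF _ _ tendsto_const])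
    have "((\<lambda>T. expectation (\<lambda>\<omega>. \<bar>residual_energy T \<omega> / T - limit_energy\<bar>) + 4 * limit_energy * (1 / T)) \<longlongrightarrow> 0 + 4 * limit_energy * 0) at_top"
      by (intro tendsto_intros L1 inv)
    then show "((\<lambda>T. expectation (\<lambda>\<omega>. \<bar>residual_energy T \<omega> / T - limit_energy\<bar>) + 4 * limit_energy * (1 / T)) \<longlongrightarrow> 0) at_top"
      by simp
    show "\<forall>\<^sub>F T in at_top. expectation (\<lambda>\<omega>. \<bar>path_min_energy T \<omega> / T - limit_energy\<bar>)
        \<le> expectation (\<lambda>\<omega>. \<bar>residual_energy T \<omega> / T - limit_energy\<bar>) + 4 * limit_energy * (1 / T)"
    proof (rule eventually_at_top_linorderI[of 1])
      fix T :: real assume T: "1 \<le> T"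
      have i1: "integrable M (\<lambda>\<omega>. \<bar>residual_energy T \<omega> / T - limit_energy\<bar>)"
        using integrable_residual_energy[of T] by simp
      have i2: "integrable M (discounted_energy T)" "expectation (discounted_energy T) \<le> limit_energy"
        using discounted_energy_expectation T by auto
      have "expectation (\<lambda>\<omega>. \<bar>path_min_energy T \<omega> / T - limit_energy\<bar>)
         \<le> expectation (\<lambda>\<omega>. \<bar>residual_energy T \<omega> / T - limit_energy\<bar> + (4 / T) * discounted_energy T \<omega>)"
      proof (rule integral_mono_AE)
        show "integrable M (\<lambda>\<omega>. \<bar>path_min_energy T \<omega> / T - limit_energy\<bar>)"
          using integrable_path_min_energy[OF T] by simp
        show "integrable M (\<lambda>\<omega>. \<bar>residual_energy T \<omega> / T - limit_energy\<bar> + (4 / T) * discounted_energy T \<omega>)"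
          by (intro Bochner_Integration.integrable_add i1 Bochner_Integration.integrable_mult_right i2)
        show "AE \<omega> in M. \<bar>path_min_energy T \<omega> / T - limit_energy\<bar> \<le> \<bar>residual_energy T \<omega> / T - limit_energy\<bar> + (4 / T) * discounted_energy T \<omega>"
          using path_min_energy_bounds
        proof eventually_elim
          case (elim \<omega>)
          have "\<bar>path_min_energy T \<omega> - residual_energy T \<omega>\<bar> / T \<le> 4 * discounted_energy T \<omega> / T"
            using elim T by (intro divide_right_mono) auto
          then have "\<bar>path_min_energy T \<omega> / T - residual_energy T \<omega> / T\<bar> \<le> 4 / T * discounted_energy T \<omega>"
            using T by (simp add: diff_divide_distrib[symmetric] abs_divide)
          then show ?case by linarith
        qed
      qed
      also have "\<dots> = expectation (\<lambda>\<omega>. \<bar>residual_energy T \<omega> / T - limit_energy\<bar>) + (4 / T) * expectation (discounted_energy T)"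
        using i1 i2 by simp
      also have "(4 / T) * expectation (discounted_energy T) \<le> (4 / T) * limit_energy"
        using T i2 by (intro mult_left_mono) auto
      finally show "expectation (\<lambda>\<omega>. \<bar>path_min_energy T \<omega> / T - limit_energy\<bar>)
        \<le> expectation (\<lambda>\<omega>. \<bar>residual_energy T \<omega> / T - limit_energy\<bar>) + 4 * limit_energy * (1 / T)" by simp
    qed
  qed (auto intro!: always_eventually integral_nonneg_AE)
qed

end

section \<open>The spectral constant\<close>

lemma square_integrable_measurable: "square_integrable M f \<Longrightarrow> f \<in> borel_measurable M"
  and square_integrable_integrable: "square_integrable M f \<Longrightarrow> integrable M (\<lambda>x. (norm (f x))\<^sup>2)"
  by (auto simp: square_integrable_def)

lemma square_integrable_add:
  fixes f g :: "'a \<Rightarrow> complex"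
  assumes "square_integrable M f" "square_integrable M g"
  shows "square_integrable M (\<lambda>x. f x + g x)"
proof -
  have [measurable]: "f \<in> borel_measurable M" "g \<in> borel_measurable M" using assms by (auto simp: square_integrable_def)
  have "integrable M (\<lambda>x. (norm (f x + g x))\<^sup>2)"
  proof (rule Bochner_Integration.integrable_bound)
    show "integrable M (\<lambda>x. 2 * (norm (f x))\<^sup>2 + 2 * (norm (g x))\<^sup>2)"
      using assms by (simp add: square_integrable_def)
    have "(norm (a + b))\<^sup>2 \<le> 2 * (norm a)\<^sup>2 + 2 * (norm b)\<^sup>2" for a b :: complex
    proof -
      have "(norm (a + b))\<^sup>2 \<le> (norm a + norm b)\<^sup>2" by (intro power_mono norm_triangle_ineq) simp
      also have "\<dots> \<le> 2 * (norm a)\<^sup>2 + 2 * (norm b)\<^sup>2"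
        using sum_squares_bound[of "norm a" "norm b"] by (simp add: power2_sum)
      finally show ?thesis .
    qed
    then show "AE x in M. norm ((norm (f x + g x))\<^sup>2) \<le> norm (2 * (norm (f x))\<^sup>2 + 2 * (norm (g x))\<^sup>2)"
      by (intro AE_I2) simp
  qed measurable
  then show ?thesis by (simp add: square_integrable_def)
qed

lemma square_integrable_cmult:
  fixes f :: "'a \<Rightarrow> complex"
  shows "square_integrable M f \<Longrightarrow> square_integrable M (\<lambda>x. c * f x)"
  by (auto simp: square_integrable_def norm_mult power_mult_distrib)

lemma square_integrable_diff:
  fixes f g :: "'a \<Rightarrow> complex"
  assumes "square_integrable M f" "square_integrable M g"
  shows "square_integrable M (\<lambda>x. f x - g x)"
  using square_integrable_add[OF assms(1) square_integrable_cmult[OF assms(2), of "-1"]] by simp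

lemma square_integrable_sum:
  fixes f :: "'i \<Rightarrow> 'a \<Rightarrow> complex"
  assumes "finite S" "\<And>i. i \<in> S \<Longrightarrow> square_integrable M (f i)"
  shows "square_integrable M (\<lambda>x. \<Sum>i\<in>S. f i x)"
  using assms by (induction S rule: finite_induct) (auto intro!: square_integrable_add simp: square_integrable_def[of M "\<lambda>x. 0"])

lemma square_integrable_mult_cnj:
  fixes f g :: "'a \<Rightarrow> complex"
  assumes "square_integrable M f" "square_integrable M g"
  shows "integrable M (\<lambda>x. f x * cnj (g x))"
    "norm (LINT x|M. f x * cnj (g x)) \<le> sqrt (LINT x|M. (norm (f x))\<^sup>2) * sqrt (LINT x|M. (norm (g x))\<^sup>2)"
proof -
  have m[measurable]: "f \<in> borel_measurable M" "g \<in> borel_measurable M" using assms by (auto simp: square_integrable_def)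
  have i: "integrable M (\<lambda>x. (norm (f x))\<^sup>2)" "integrable M (\<lambda>x. (norm (g x))\<^sup>2)"
    using assms by (auto simp: square_integrable_def)
  have n: "(\<lambda>x. norm (f x)) \<in> borel_measurable M" "(\<lambda>x. norm (g x)) \<in> borel_measurable M" by measurable
  note CS = integral_Cauchy_Schwarz[OF n i]
  have "integrable M (\<lambda>x. norm (f x * cnj (g x)))" using CS(1) by (simp add: norm_mult)
  moreover have "(\<lambda>x. f x * cnj (g x)) \<in> borel_measurable M"
    by (intro borel_measurable_times m measurable_compose[OF m(2)] borel_measurable_continuous_onI continuous_intros)
  ultimately show "integrable M (\<lambda>x. f x * cnj (g x))" by (rule integrable_norm_cancel)
  have "norm (LINT x|M. f x * cnj (g x)) \<le> (LINT x|M. norm (f x * cnj (g x)))" by (rule integral_norm_bound)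
  also have "\<dots> = (LINT x|M. norm (f x) * norm (g x))" by (simp add: norm_mult)
  also have "\<dots> \<le> sqrt ((LINT x|M. (norm (f x))\<^sup>2) * (LINT x|M. (norm (g x))\<^sup>2))"
    by (rule real_le_rsqrt) (rule CS(2))
  finally show "norm (LINT x|M. f x * cnj (g x)) \<le> sqrt (LINT x|M. (norm (f x))\<^sup>2) * sqrt (LINT x|M. (norm (g x))\<^sup>2)"
    by (simp add: real_sqrt_mult)
qed

lemma norm_square_add: "(norm (a + b))\<^sup>2 = (norm a)\<^sup>2 + (norm b)\<^sup>2 + 2 * Re (a * cnj b)" for a b :: complex
  unfolding cmod_power2 by (simp add: power2_eq_square algebra_simps)

text \<open>
  Continuity of the inner product and of the norm in \<open>L2\<close>.
\<close>

lemma mean_square_limit: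
  fixes f :: "nat \<Rightarrow> 'a \<Rightarrow> complex"
  assumes f: "\<And>n. square_integrable M (f n)" and g: "square_integrable M g"
    and lim: "(\<lambda>n. LINT x|M. (norm (f n x - g x))\<^sup>2) \<longlonglongrightarrow> 0"
  shows "square_integrable M h \<Longrightarrow> (\<lambda>n. LINT x|M. h x * cnj (f n x)) \<longlonglongrightarrow> (LINT x|M. h x * cnj (g x))"
    "(\<lambda>n. LINT x|M. (norm (f n x))\<^sup>2) \<longlonglongrightarrow> (LINT x|M. (norm (g x))\<^sup>2)"
proof -
  have d: "square_integrable M (\<lambda>x. f n x - g x)" for n by (intro square_integrable_diff f g)
  have cr: "(\<lambda>n. LINT x|M. h x * cnj (f n x - g x)) \<longlonglongrightarrow> 0" if h: "square_integrable M h" for h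
  proof (rule Lim_null_comparison)
    show "\<forall>\<^sub>F n in sequentially. norm (LINT x|M. h x * cnj (f n x - g x)) \<le>
      sqrt (LINT x|M. (norm (h x))\<^sup>2) * sqrt (LINT x|M. (norm (f n x - g x))\<^sup>2)"
      by (intro always_eventually allI square_integrable_mult_cnj h d)
    show "(\<lambda>n. sqrt (LINT x|M. (norm (h x))\<^sup>2) * sqrt (LINT x|M. (norm (f n x - g x))\<^sup>2)) \<longlonglongrightarrow> 0"
      using tendsto_mult_left[OF tendsto_real_sqrt[OF lim]] by simp
  qed
  show "(\<lambda>n. LINT x|M. h x * cnj (f n x)) \<longlonglongrightarrow> (LINT x|M. h x * cnj (g x))" if h: "square_integrable M h"
  proof -
    have "(LINT x|M. h x * cnj (f n x - g x)) = (LINT x|M. h x * cnj (f n x)) - (LINT x|M. h x * cnj (g x))" for n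
      using Bochner_Integration.integral_diff[OF square_integrable_mult_cnj(1)[OF h f[of n]] square_integrable_mult_cnj(1)[OF h g]]
      by (simp add: right_diff_distrib)
    then have "(LINT x|M. h x * cnj (f n x)) = (LINT x|M. h x * cnj (g x)) + (LINT x|M. h x * cnj (f n x - g x))" for n
      by simp
    moreover have "(\<lambda>n. (LINT x|M. h x * cnj (g x)) + (LINT x|M. h x * cnj (f n x - g x))) \<longlonglongrightarrow> (LINT x|M. h x * cnj (g x)) + 0"
      by (intro tendsto_intros cr h)
    ultimately show ?thesis by simp
  qed
  have "(LINT x|M. (norm (f n x))\<^sup>2) = (LINT x|M. (norm (g x))\<^sup>2) + (LINT x|M. (norm (f n x - g x))\<^sup>2)
      + 2 * Re (LINT x|M. g x * cnj (f n x - g x))" for n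
  proof -
    have i: "integrable M (\<lambda>x. g x * cnj (f n x - g x))" by (intro square_integrable_mult_cnj g d)
    define r where "r x = Re (g x * cnj (f n x - g x))" for x
    have r: "integrable M r" "integral\<^sup>L M r = Re (LINT x|M. g x * cnj (f n x - g x))"
      unfolding r_def[abs_def] by (rule integrable_Re[OF i], rule integral_Re[OF i])
    have "(norm (f n x))\<^sup>2 = (norm (g x))\<^sup>2 + (norm (f n x - g x))\<^sup>2 + 2 * r x" for x
      unfolding r_def using norm_square_add[of "g x" "f n x - g x"] by simp
    then have "(LINT x|M. (norm (f n x))\<^sup>2) = (LINT x|M. (norm (g x))\<^sup>2 + (norm (f n x - g x))\<^sup>2 + 2 * r x)" by simp
    also have "\<dots> = (LINT x|M. (norm (g x))\<^sup>2) + (LINT x|M. (norm (f n x - g x))\<^sup>2) + 2 * integral\<^sup>L M r"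
      using square_integrable_integrable[OF g] square_integrable_integrable[OF d] r(1) by simp
    finally show ?thesis unfolding r(2) .
  qed
  moreover have "(\<lambda>n. (LINT x|M. (norm (g x))\<^sup>2) + (LINT x|M. (norm (f n x - g x))\<^sup>2)
      + 2 * Re (LINT x|M. g x * cnj (f n x - g x))) \<longlonglongrightarrow> (LINT x|M. (norm (g x))\<^sup>2) + 0 + 2 * Re 0"
    by (intro tendsto_intros lim cr g)
  ultimately show "(\<lambda>n. LINT x|M. (norm (f n x))\<^sup>2) \<longlonglongrightarrow> (LINT x|M. (norm (g x))\<^sup>2)" by simp
qed

text \<open>
  The level sets of a simple function with nonzero values are disjoint and have finite measure, so all mixed
  terms vanish and the diagonal ones are given by \<open>\<mu>\<close>.
\<close>

lemma simple_stochastic_integral_isometry: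
  assumes X: "uncorrelated_random_measure M \<mu> X" and M: "prob_space M" and D: "square_integrable M D"
    and D0: "\<forall>A\<in>fmeasurable \<mu>. (LINT \<omega>|M. D \<omega> * cnj (X A \<omega>)) = 0"
    and s: "simple_function \<mu> s" "emeasure \<mu> {u \<in> space \<mu>. s u \<noteq> 0} < \<infinity>"
  defines "I \<equiv> simple_stochastic_integral \<mu> X s"
  shows "square_integrable M I" "square_integrable \<mu> s" "(LINT \<omega>|M. I \<omega>) = 0" "(LINT \<omega>|M. D \<omega> * cnj (I \<omega>)) = 0"
    "(LINT \<omega>|M. (norm (I \<omega>))\<^sup>2) = (LINT u|\<mu>. (norm (s u))\<^sup>2)"
proof -
  interpret prob_space M by fact
  define R where "R = s ` space \<mu> - {0}"
  define A where "A z = s -` {z} \<inter> space \<mu>" for z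
  have finR: "finite R" using s(1) by (auto simp: R_def simple_function_def)
  have Am: "A z \<in> sets \<mu>" for z
    unfolding A_def using s(1) by (rule simple_functionD(2))
  have supp: "{u \<in> space \<mu>. s u \<noteq> 0} \<in> sets \<mu>"
  proof -
    have "{u \<in> space \<mu>. s u \<noteq> 0} = s -` (- {0}) \<inter> space \<mu>" by auto
    then show ?thesis using s(1) by (simp add: simple_functionD(2))
  qed
  have A: "A z \<in> fmeasurable \<mu>" if "z \<in> R" for z
  proof (rule fmeasurableI[OF Am])
    have "emeasure \<mu> (A z) \<le> emeasure \<mu> {u \<in> space \<mu>. s u \<noteq> 0}"
      using that supp by (intro emeasure_mono) (auto simp: A_def R_def)
    then show "emeasure \<mu> (A z) < \<infinity>" using s(2) by (rule le_less_trans)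
  qed
  have Xs: "square_integrable M (X B)" "(LINT \<omega>|M. X B \<omega>) = 0" "(LINT \<omega>|M. (norm (X B \<omega>))\<^sup>2) = measure \<mu> B"
    if "B \<in> fmeasurable \<mu>" for B using X that by (auto simp: uncorrelated_random_measure_def)
  have Xo: "(LINT \<omega>|M. X B \<omega> * cnj (X B' \<omega>)) = 0" if "B \<in> fmeasurable \<mu>" "B' \<in> fmeasurable \<mu>" "B \<inter> B' = {}" for B B'
    using X that by (auto simp: uncorrelated_random_measure_def)
  have I: "I = (\<lambda>\<omega>. \<Sum>z\<in>R. z * X (A z) \<omega>)"
    unfolding I_def simple_stochastic_integral_def R_def A_def ..
  have zX: "square_integrable M (\<lambda>\<omega>. z * X (A z) \<omega>)" if "z \<in> R" for z
    using that by (intro square_integrable_cmult Xs A)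
  show "square_integrable M I" unfolding I by (intro square_integrable_sum finR zX)
  have int: "integrable M Y" if Y: "square_integrable M Y" for Y :: "'a \<Rightarrow> complex"
  proof -
    have "square_integrable M (\<lambda>_. 1 :: complex)" by (simp add: square_integrable_def)
    from square_integrable_mult_cnj(1)[OF Y this] show ?thesis by simp
  qed
  show "(LINT \<omega>|M. I \<omega>) = 0"
    unfolding I using zX int by (subst Bochner_Integration.integral_sum) (auto simp: Xs A)
  show "(LINT \<omega>|M. D \<omega> * cnj (I \<omega>)) = 0"
  proof -
    have "(LINT \<omega>|M. D \<omega> * cnj (I \<omega>)) = (LINT \<omega>|M. (\<Sum>z\<in>R. D \<omega> * cnj (z * X (A z) \<omega>)))"
      unfolding I by (simp add: sum_distrib_left)
    also have "\<dots> = (\<Sum>z\<in>R. LINT \<omega>|M. D \<omega> * cnj (z * X (A z) \<omega>))"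
      by (rule Bochner_Integration.integral_sum) (intro square_integrable_mult_cnj D zX)
    also have "\<dots> = (\<Sum>z\<in>R. 0)"
    proof (rule sum.cong)
      fix z assume z: "z \<in> R"
      have "(LINT \<omega>|M. D \<omega> * cnj (z * X (A z) \<omega>)) = (LINT \<omega>|M. cnj z * (D \<omega> * cnj (X (A z) \<omega>)))"
        by (simp add: mult.left_commute)
      also have "\<dots> = 0" using D0 A[OF z] by simp
      finally show "(LINT \<omega>|M. D \<omega> * cnj (z * X (A z) \<omega>)) = 0" .
    qed simp
    finally show ?thesis by simp
  qed
  have iA: "integrable \<mu> (indicator (A z) :: real \<Rightarrow> real)" if "z \<in> R" for z
    using A[OF that] by (intro integrable_real_indicator) (auto simp: fmeasurable_def)
  have sq: "(norm (s u))\<^sup>2 = (\<Sum>z\<in>R. (norm z)\<^sup>2 * indicator (A z) u)" if "u \<in> space \<mu>" for u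
  proof (cases "s u = 0")
    case True
    then show ?thesis by (auto simp: A_def R_def indicator_def intro!: sum.neutral[symmetric])
  next
    case False
    then have "s u \<in> R" using that by (auto simp: R_def)
    have "(\<Sum>z\<in>R. (norm z)\<^sup>2 * indicator (A z) u) = (\<Sum>z\<in>R. if z = s u then (norm z)\<^sup>2 else 0)"
      using that by (intro sum.cong) (auto simp: A_def indicator_def)
    also have "\<dots> = (norm (s u))\<^sup>2" using finR \<open>s u \<in> R\<close> by simp
    finally show ?thesis by simp
  qed
  have "integrable \<mu> (\<lambda>u. \<Sum>z\<in>R. (norm z)\<^sup>2 * indicator (A z) u)"
    by (intro Bochner_Integration.integrable_sum Bochner_Integration.integrable_mult_right iA)
  then have "integrable \<mu> (\<lambda>u. (norm (s u))\<^sup>2)"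
    by (rule Bochner_Integration.integrable_cong[THEN iffD2, OF refl sq, rotated])
  then show "square_integrable \<mu> s"
    using borel_measurable_simple_function[OF s(1)] by (simp add: square_integrable_def)
  have R2: "(LINT u|\<mu>. (norm (s u))\<^sup>2) = (\<Sum>z\<in>R. (norm z)\<^sup>2 * measure \<mu> (A z))"
  proof -
    have "(LINT u|\<mu>. (norm (s u))\<^sup>2) = (LINT u|\<mu>. (\<Sum>z\<in>R. (norm z)\<^sup>2 * indicator (A z) u))"
      by (rule Bochner_Integration.integral_cong[OF refl sq])
    also have "\<dots> = (\<Sum>z\<in>R. LINT u|\<mu>. (norm z)\<^sup>2 * indicator (A z) u)"
      by (intro Bochner_Integration.integral_sum Bochner_Integration.integrable_mult_right iA)
    also have "\<dots> = (\<Sum>z\<in>R. (norm z)\<^sup>2 * measure \<mu> (A z))"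
    proof (rule sum.cong)
      fix z assume "z \<in> R"
      have "A z \<inter> space \<mu> = A z" by (auto simp: A_def)
      then show "(LINT u|\<mu>. (norm z)\<^sup>2 * indicator (A z) u) = (norm z)\<^sup>2 * measure \<mu> (A z)" by simp
    qed simp
    finally show ?thesis .
  qed
  have XX: "(LINT \<omega>|M. X (A z) \<omega> * cnj (X (A z') \<omega>)) = (if z = z' then of_real (measure \<mu> (A z)) else 0)"
    if "z \<in> R" "z' \<in> R" for z z'
  proof (cases "z = z'")
    case True
    have "(LINT \<omega>|M. X (A z) \<omega> * cnj (X (A z) \<omega>)) = (LINT \<omega>|M. complex_of_real ((norm (X (A z) \<omega>))\<^sup>2))"
      by (simp only: complex_norm_square)
    also have "\<dots> = of_real (measure \<mu> (A z))" using Xs(3)[OF A[OF that(1)]] by (simp only: integral_complex_of_real)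
    finally show ?thesis using True by simp
  next
    case False
    then have "A z \<inter> A z' = {}" by (auto simp: A_def)
    then show ?thesis using False Xo[OF A[OF that(1)] A[OF that(2)]] by simp
  qed
  have "complex_of_real (LINT \<omega>|M. (norm (I \<omega>))\<^sup>2) = (LINT \<omega>|M. complex_of_real ((norm (I \<omega>))\<^sup>2))"
    by (simp only: integral_complex_of_real)
  also have "\<dots> = (LINT \<omega>|M. I \<omega> * cnj (I \<omega>))" by (simp only: complex_norm_square)
  also have "\<dots> = (LINT \<omega>|M. (\<Sum>z\<in>R. \<Sum>z'\<in>R. (z * X (A z) \<omega>) * cnj (z' * X (A z') \<omega>)))"
    unfolding I cnj_sum sum_product ..
  also have "\<dots> = (\<Sum>z\<in>R. \<Sum>z'\<in>R. LINT \<omega>|M. (z * X (A z) \<omega>) * cnj (z' * X (A z') \<omega>))"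
    by (subst Bochner_Integration.integral_sum, intro Bochner_Integration.integrable_sum square_integrable_mult_cnj zX, assumption, assumption)
      (intro sum.cong refl Bochner_Integration.integral_sum square_integrable_mult_cnj zX)
  also have "\<dots> = (\<Sum>z\<in>R. \<Sum>z'\<in>R. if z = z' then of_real ((norm z)\<^sup>2 * measure \<mu> (A z)) else 0)"
  proof (intro sum.cong refl)
    fix z z' assume z: "z \<in> R" "z' \<in> R"
    have "(LINT \<omega>|M. (z * X (A z) \<omega>) * cnj (z' * X (A z') \<omega>)) = (LINT \<omega>|M. (z * cnj z') * (X (A z) \<omega> * cnj (X (A z') \<omega>)))"
      by (simp add: mult.assoc mult.left_commute)
    also have "\<dots> = (z * cnj z') * (LINT \<omega>|M. X (A z) \<omega> * cnj (X (A z') \<omega>))" by (rule integral_mult_right_zero)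
    also have "\<dots> = (if z = z' then of_real ((norm z)\<^sup>2 * measure \<mu> (A z)) else 0)"
      unfolding XX[OF z] by (simp add: complex_norm_square[symmetric])
    finally show "(LINT \<omega>|M. (z * X (A z) \<omega>) * cnj (z' * X (A z') \<omega>)) = (if z = z' then of_real ((norm z)\<^sup>2 * measure \<mu> (A z)) else 0)" .
  qed
  also have "\<dots> = (\<Sum>z\<in>R. of_real ((norm z)\<^sup>2 * measure \<mu> (A z)))" using finR by simp
  also have "\<dots> = of_real (LINT u|\<mu>. (norm (s u))\<^sup>2)" unfolding R2 by simp
  finally show "(LINT \<omega>|M. (norm (I \<omega>))\<^sup>2) = (LINT u|\<mu>. (norm (s u))\<^sup>2)" by (simp only: of_real_eq_iff)
qed

lemma stochastic_integral_isometry: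
  assumes X: "uncorrelated_random_measure M \<mu> X" and M: "prob_space M" and D: "square_integrable M D"
    and D0: "\<forall>A\<in>fmeasurable \<mu>. (LINT \<omega>|M. D \<omega> * cnj (X A \<omega>)) = 0"
    and I: "has_stochastic_integral M \<mu> X g I"
  shows "(LINT \<omega>|M. I \<omega>) = 0" "(LINT \<omega>|M. D \<omega> * cnj (I \<omega>)) = 0"
    "(LINT \<omega>|M. (norm (I \<omega>))\<^sup>2) = (LINT u|\<mu>. (norm (g u))\<^sup>2)"
proof -
  interpret prob_space M by fact
  obtain s where s: "\<And>n. simple_function \<mu> (s n)" "\<And>n. emeasure \<mu> {u \<in> space \<mu>. s n u \<noteq> 0} < \<infinity>"
    and lim1: "(\<lambda>n. LINT u|\<mu>. (norm (s n u - g u))\<^sup>2) \<longlonglongrightarrow> 0"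
    and lim2: "(\<lambda>n. LINT \<omega>|M. (norm (simple_stochastic_integral \<mu> X (s n) \<omega> - I \<omega>))\<^sup>2) \<longlonglongrightarrow> 0"
    and g: "square_integrable \<mu> g" and I2: "square_integrable M I"
    using I by (auto simp: has_stochastic_integral_def)
  note iso = simple_stochastic_integral_isometry[OF X M D D0 s]
  note l2 = mean_square_limit[OF iso(1) I2 lim2]
  have one: "square_integrable M (\<lambda>_. 1 :: complex)" by (simp add: square_integrable_def)
  have "(\<lambda>n. LINT \<omega>|M. 1 * cnj (simple_stochastic_integral \<mu> X (s n) \<omega>)) \<longlonglongrightarrow> (LINT \<omega>|M. 1 * cnj (I \<omega>))"
    by (rule l2(1)[OF one])
  moreover have "(LINT \<omega>|M. 1 * cnj (simple_stochastic_integral \<mu> X (s n) \<omega>)) = 0" for n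
    using iso(3)[of n] by simp
  ultimately have "(LINT \<omega>|M. 1 * cnj (I \<omega>)) = 0" using LIMSEQ_unique[OF _ tendsto_const] by fastforce
  then show "(LINT \<omega>|M. I \<omega>) = 0" by simp
  have "(\<lambda>n. 0) \<longlonglongrightarrow> (LINT \<omega>|M. D \<omega> * cnj (I \<omega>))" using l2(1)[OF D] unfolding iso(4) .
  then show "(LINT \<omega>|M. D \<omega> * cnj (I \<omega>)) = 0" by (simp add: LIMSEQ_const_iff)
  have "(\<lambda>n. LINT u|\<mu>. (norm (s n u))\<^sup>2) \<longlonglongrightarrow> (LINT \<omega>|M. (norm (I \<omega>))\<^sup>2)"
    using l2(2) unfolding iso(5) .
  moreover have "(\<lambda>n. LINT u|\<mu>. (norm (s n u))\<^sup>2) \<longlonglongrightarrow> (LINT u|\<mu>. (norm (g u))\<^sup>2)"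
    by (rule mean_square_limit(2)[OF iso(2) g lim1])
  ultimately show "(LINT \<omega>|M. (norm (I \<omega>))\<^sup>2) = (LINT u|\<mu>. (norm (g u))\<^sup>2)"
    by (rule LIMSEQ_unique)
qed

lemma norm_exp_minus_1_square: "(norm (exp (\<i> * of_real x) - 1))\<^sup>2 = 2 - 2 * cos x" for x :: real
proof -
  have "(norm (exp (\<i> * of_real x) - 1))\<^sup>2 = (cos x - 1)\<^sup>2 + (sin x)\<^sup>2"
    by (simp add: cmod_power2 Re_exp Im_exp)
  also have "\<dots> = ((sin x)\<^sup>2 + (cos x)\<^sup>2) + 1 - 2 * cos x" by (simp add: power2_diff)
  finally show ?thesis by simp
qed

lemma one_minus_cos_bounds: "0 \<le> 2 - 2 * cos x" "2 - 2 * cos x \<le> 4" "2 - 2 * cos x \<le> x\<^sup>2" for x :: real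
proof -
  show "0 \<le> 2 - 2 * cos x" using cos_le_one[of x] by linarith
  show "2 - 2 * cos x \<le> 4" using cos_ge_minus_one[of x] by linarith
  have "2 - 2 * cos x = 4 * (sin (x / 2))\<^sup>2" using cos_double_sin[of "x / 2"] by simp
  also have "(sin (x / 2))\<^sup>2 \<le> (x / 2)\<^sup>2"
    using abs_sin_x_le_abs_x[of "x / 2"] by (simp only: abs_le_square_iff)
  finally show "2 - 2 * cos x \<le> x\<^sup>2" by (simp add: power_divide)
qed

lemma exp_minus_mult_tendsto_0:
  fixes n :: nat
  shows "((\<lambda>t::real. t ^ n * exp (- t)) \<longlongrightarrow> 0) at_top"
  using tendsto_power_div_exp_0[of n] by (simp add: exp_minus divide_inverse)

text \<open>
  The source of the weight \<open>u\<^sup>2/(1 + u\<^sup>2)\<close>: it is half of the Laplace transform at 1 of the variance kernel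
  \<open>2 - 2 cos(t u)\<close>. The integral is stated as a nonnegative one, so that Tonelli's theorem also yields
  integrability of the weight.
\<close>

lemma laplace_one_minus_cos:
  fixes u :: real
  shows "(\<integral>\<^sup>+t. ennreal (exp (- t) * (2 - 2 * cos (t * u))) * indicator {0..} t \<partial>lborel) = ennreal (2 * (u\<^sup>2 / (1 + u\<^sup>2)))"
proof -
  have p: "1 + u\<^sup>2 > 0" using zero_le_power2[of u] by linarith
  let ?F = "\<lambda>t. - 2 * exp (- t) - 2 * (exp (- t) * (u * sin (t * u) - cos (t * u))) / (1 + u\<^sup>2)"
  have "(\<integral>\<^sup>+t. ennreal (exp (- t) * (2 - 2 * cos (t * u))) * indicator {0..} t \<partial>lborel) = ennreal (0 - ?F 0)"
  proof (rule nn_integral_FTC_atLeast)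
    fix t :: real assume "0 \<le> t"
    have "(?F has_real_derivative
      2 * exp (- t) - 2 * (- exp (- t) * (u * sin (t * u) - cos (t * u)) + exp (- t) * (u * (cos (t * u) * u) + sin (t * u) * u)) / (1 + u\<^sup>2)) (at t)"
      using p by (auto intro!: derivative_eq_intros)
    moreover have "- exp (- t) * (u * sin (t * u) - cos (t * u)) + exp (- t) * (u * (cos (t * u) * u) + sin (t * u) * u)
       = (1 + u\<^sup>2) * (exp (- t) * cos (t * u))" by (simp add: power2_eq_square algebra_simps)
    moreover have "2 * exp (- t) - 2 * ((1 + u\<^sup>2) * (exp (- t) * cos (t * u))) / (1 + u\<^sup>2) = exp (- t) * (2 - 2 * cos (t * u))"
      using p by (simp add: right_diff_distrib)
    ultimately show "(?F has_real_derivative exp (- t) * (2 - 2 * cos (t * u))) (at t)"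
      by (simp only:)
    show "0 \<le> exp (- t) * (2 - 2 * cos (t * u))" using one_minus_cos_bounds(1)[of "t * u"] by simp
  next
    have e0: "((\<lambda>t::real. exp (- t)) \<longlongrightarrow> 0) at_top" using exp_minus_mult_tendsto_0[of 0] by simp
    have "((\<lambda>t. exp (- t) * (u * sin (t * u) - cos (t * u))) \<longlongrightarrow> 0) at_top"
    proof (rule Lim_null_comparison)
      show "((\<lambda>t::real. exp (- t) * (\<bar>u\<bar> + 1)) \<longlongrightarrow> 0) at_top" using tendsto_mult_right[OF e0, of "\<bar>u\<bar> + 1"] by simp
      have "\<bar>u * sin x - cos x\<bar> \<le> \<bar>u\<bar> + 1" for x
      proof -
        have "\<bar>u * sin x - cos x\<bar> \<le> \<bar>u\<bar> * \<bar>sin x\<bar> + \<bar>cos x\<bar>" unfolding abs_mult[symmetric] by (rule abs_triangle_ineq4)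
        also have "\<dots> \<le> \<bar>u\<bar> * 1 + 1" by (intro add_mono mult_left_mono) auto
        finally show ?thesis by simp
      qed
      then show "\<forall>\<^sub>F t in at_top. norm (exp (- t) * (u * sin (t * u) - cos (t * u))) \<le> exp (- t) * (\<bar>u\<bar> + 1)"
        by (intro always_eventually allI) (simp add: abs_mult)
    qed
    then have "((\<lambda>t. - 2 * exp (- t) - 2 * (exp (- t) * (u * sin (t * u) - cos (t * u))) / (1 + u\<^sup>2)) \<longlongrightarrow> - 2 * 0 - 2 * 0 / (1 + u\<^sup>2)) at_top"
      using p by (intro tendsto_intros e0) auto
    then show "(?F \<longlongrightarrow> 0) at_top" by simp
  qed measurable
  also have "0 - ?F 0 = 2 * (u\<^sup>2 / (1 + u\<^sup>2))" using p by (simp add: field_simps)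
  finally show ?thesis .
qed

lemma laplace_quadratic:
  fixes a b :: real
  assumes nn: "\<And>t. 0 \<le> t \<Longrightarrow> 0 \<le> a * t + b * t\<^sup>2"
  shows "(\<integral>\<^sup>+t. ennreal (exp (- t) * (a * t + b * t\<^sup>2)) * indicator {0..} t \<partial>lborel) = ennreal (a + 2 * b)"
proof -
  let ?F = "\<lambda>t. - (exp (- t) * (b * t\<^sup>2 + (a + 2 * b) * t + (a + 2 * b)))"
  have "(\<integral>\<^sup>+t. ennreal (exp (- t) * (a * t + b * t\<^sup>2)) * indicator {0..} t \<partial>lborel) = ennreal (0 - ?F 0)"
  proof (rule nn_integral_FTC_atLeast)
    fix t :: real assume t: "0 \<le> t"
    have "(?F has_real_derivative - (- exp (- t) * (b * t\<^sup>2 + (a + 2 * b) * t + (a + 2 * b)) + exp (- t) * (b * (2 * t) + (a + 2 * b)))) (at t)"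
      by (auto intro!: derivative_eq_intros)
    then show "(?F has_real_derivative exp (- t) * (a * t + b * t\<^sup>2)) (at t)" by (simp add: algebra_simps)
    show "0 \<le> exp (- t) * (a * t + b * t\<^sup>2)" using nn[OF t] by simp
  next
    have "((\<lambda>t. - (b * (t ^ 2 * exp (- t)) + (a + 2 * b) * (t ^ 1 * exp (- t)) + (a + 2 * b) * (t ^ 0 * exp (- t)))) \<longlongrightarrow>
      - (b * 0 + (a + 2 * b) * 0 + (a + 2 * b) * 0)) at_top"
      by (intro tendsto_intros exp_minus_mult_tendsto_0)
    then show "(?F \<longlongrightarrow> 0) at_top" by (simp add: algebra_simps)
  qed measurable
  also have "0 - ?F 0 = a + 2 * b" by simp
  finally show ?thesis .
qed

text \<open>
  For dominated convergence: \<open>(2 - 2 cos(t u))/t\<^sup>2\<close> is bounded by \<open>u\<^sup>2\<close>, and by 4 once \<open>t \<ge> 1\<close>.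
\<close>

lemma min_square_le_levy_weight: "min (u\<^sup>2) 4 \<le> 5 * (u\<^sup>2 / (1 + u\<^sup>2))" for u :: real
proof -
  define x where "x = u\<^sup>2"
  have x: "0 \<le> x" by (simp add: x_def)
  have "min x 4 * (1 + x) \<le> 5 * x"
  proof (cases "x \<le> 4")
    case True
    have "x * (1 + x) \<le> x * 5" using x True by (intro mult_left_mono) auto
    then show ?thesis using True by simp
  next
    case False then show ?thesis by simp
  qed
  then have "min x 4 \<le> 5 * x / (1 + x)" using x by (simp add: pos_le_divide_eq)
  then show ?thesis by (simp add: x_def)
qed

text \<open>
  The one equation for \<open>E B(t)\<^sup>2\<close> is read in two ways: its Laplace transform determines the sum of \<open>E|D|\<^sup>2\<close>
  and the integral of the weight, and its growth for large \<open>t\<close> determines \<open>E|D|\<^sup>2\<close> alone. Equality of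
  \<open>E|D|\<^sup>2\<close> and \<open>|E D|\<^sup>2\<close> then forces \<open>D\<close> to be constant.
\<close>

theorem spectral_data_of_linear_variance:
  fixes B :: "real \<Rightarrow> 'a \<Rightarrow> real" and m v :: real
  assumes M: "prob_space M" and spec: "spectral_representation M B D X \<mu>"
    and Bm: "\<And>t. 0 \<le> t \<Longrightarrow> B t \<in> borel_measurable M"
    and v: "0 \<le> v"
    and E1: "(LINT \<omega>|M. B 1 \<omega>) = m"
    and E2: "\<And>t. 0 \<le> t \<Longrightarrow> (LINT \<omega>|M. (B t \<omega>)\<^sup>2) = v * t + m\<^sup>2 * t\<^sup>2"
  shows "spectral_C M D \<mu> = m\<^sup>2 + v / 2" "AE \<omega> in M. spectral_Z D \<mu> \<omega> = m\<^sup>2 + v / 2"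
proof -
  interpret prob_space M by fact
  have D: "square_integrable M D" and X: "uncorrelated_random_measure M \<mu> X"
    and D0: "\<forall>A\<in>fmeasurable \<mu>. (LINT \<omega>|M. D \<omega> * cnj (X A \<omega>)) = 0"
    and rep: "\<And>t. \<exists>I. has_stochastic_integral M \<mu> X (\<lambda>u. exp (\<i> * of_real (t * u)) - 1) I \<and>
        (AE \<omega> in M. of_real (B t \<omega>) = D \<omega> * of_real t + I \<omega>)"
    using spec by (auto simp: spectral_representation_def)
  have sets\<mu>: "sets \<mu> = sets (restrict_space borel (- {0 :: real}))" using X by (simp add: uncorrelated_random_measure_def)
  have space\<mu>: "space \<mu> = - {0}" using sets_eq_imp_space_eq[OF sets\<mu>] by (simp add: space_restrict_space)
  have meas: "h \<in> borel_measurable \<mu>" if "h \<in> borel_measurable borel" for h :: "real \<Rightarrow> real"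
    using measurable_restrict_space1[OF that, of "- {0}"] measurable_cong_sets[OF sets\<mu> refl] by blast
  have Dm[measurable]: "D \<in> borel_measurable M" using D by (rule square_integrable_measurable)
  have one: "square_integrable M (\<lambda>_. 1 :: complex)" by (simp add: square_integrable_def)
  have iD: "integrable M D" using square_integrable_mult_cnj(1)[OF D one] by simp
  have iD2: "integrable M (\<lambda>\<omega>. (norm (D \<omega>))\<^sup>2)" using D by (rule square_integrable_integrable)
  define d where "d = (LINT \<omega>|M. (norm (D \<omega>))\<^sup>2)"
  (* The quadratic growth left for the integral part; it turns out to be 0. *)
  define \<kappa> where "\<kappa> = m\<^sup>2 - d"
  have icos: "integrable \<mu> (\<lambda>u. 2 - 2 * cos (t * u))" for t
  proof -
    obtain I where "has_stochastic_integral M \<mu> X (\<lambda>u. exp (\<i> * of_real (t * u)) - 1) I" using rep by blast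
    then have "integrable \<mu> (\<lambda>u. (norm (exp (\<i> * of_real (t * u)) - 1))\<^sup>2)"
      by (simp add: has_stochastic_integral_def square_integrable_def)
    then show ?thesis by (simp only: norm_exp_minus_1_square)
  qed
  have G: "(LINT u|\<mu>. 2 - 2 * cos (t * u)) = v * t + \<kappa> * t\<^sup>2" if t: "0 \<le> t" for t
  proof -
    obtain I where I: "has_stochastic_integral M \<mu> X (\<lambda>u. exp (\<i> * of_real (t * u)) - 1) I"
      and BI: "AE \<omega> in M. of_real (B t \<omega>) = D \<omega> * of_real t + I \<omega>" using rep by blast
    note iso = stochastic_integral_isometry[OF X M D D0 I]
    have I2: "square_integrable M I" using I by (simp add: has_stochastic_integral_def)
    have Im[measurable]: "I \<in> borel_measurable M" using I2 by (rule square_integrable_measurable)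
    have iDI: "integrable M (\<lambda>\<omega>. D \<omega> * cnj (I \<omega>))" by (rule square_integrable_mult_cnj[OF D I2])
    have AE: "AE \<omega> in M. (B t \<omega>)\<^sup>2 = t\<^sup>2 * (norm (D \<omega>))\<^sup>2 + (norm (I \<omega>))\<^sup>2 + (2 * t) * Re (D \<omega> * cnj (I \<omega>))"
      using BI
    proof eventually_elim
      case (elim \<omega>)
      have "(B t \<omega>)\<^sup>2 = (norm (complex_of_real (B t \<omega>)))\<^sup>2" by simp
      also have "\<dots> = (norm (D \<omega> * of_real t))\<^sup>2 + (norm (I \<omega>))\<^sup>2 + 2 * Re (D \<omega> * of_real t * cnj (I \<omega>))"
        unfolding elim by (rule norm_square_add)
      also have "(norm (D \<omega> * of_real t))\<^sup>2 = t\<^sup>2 * (norm (D \<omega>))\<^sup>2" by (simp add: norm_mult power_mult_distrib mult.commute)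
      also have "D \<omega> * of_real t * cnj (I \<omega>) = of_real t * (D \<omega> * cnj (I \<omega>))" by simp
      also have "Re (of_real t * (D \<omega> * cnj (I \<omega>))) = t * Re (D \<omega> * cnj (I \<omega>))" by (simp add: algebra_simps)
      finally show ?case by (simp only: mult.assoc)
    qed
    have "(LINT \<omega>|M. (B t \<omega>)\<^sup>2) = (LINT \<omega>|M. t\<^sup>2 * (norm (D \<omega>))\<^sup>2 + (norm (I \<omega>))\<^sup>2 + (2 * t) * Re (D \<omega> * cnj (I \<omega>)))"
      by (rule integral_cong_AE[OF _ _ AE]) (use Bm[OF t] borel_measurable_integrable[OF integrable_Re[OF iDI]] in measurable)
    also have "\<dots> = t\<^sup>2 * d + (LINT \<omega>|M. (norm (I \<omega>))\<^sup>2) + (2 * t) * (LINT \<omega>|M. Re (D \<omega> * cnj (I \<omega>)))"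
      using iD2 square_integrable_integrable[OF I2] integrable_Re[OF iDI] by (simp add: d_def)
    also have "(LINT \<omega>|M. Re (D \<omega> * cnj (I \<omega>))) = 0" using integral_Re[OF iDI] iso(2) by simp
    also have "(LINT \<omega>|M. (norm (I \<omega>))\<^sup>2) = (LINT u|\<mu>. 2 - 2 * cos (t * u))"
      using iso(3) by (simp only: norm_exp_minus_1_square)
    finally show ?thesis using E2[OF t] by (simp add: \<kappa>_def algebra_simps)
  qed
  have Gnn: "0 \<le> v * t + \<kappa> * t\<^sup>2" if "0 \<le> t" for t
    unfolding G[OF that, symmetric] by (intro integral_nonneg_AE AE_I2 one_minus_cos_bounds)
  (* Otherwise the nonnegative integral in G becomes negative for large t. *)
  have \<kappa>0: "0 \<le> \<kappa>"
  proof (rule ccontr)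
    assume "\<not> 0 \<le> \<kappa>"
    then have k: "\<kappa> < 0" by simp
    define t where "t = (v + 1) / (- \<kappa>)"
    have t: "0 < t" using k v by (simp add: t_def divide_pos_neg)
    have "v * t + \<kappa> * t\<^sup>2 = t * (v + \<kappa> * t)" by (simp add: power2_eq_square algebra_simps)
    also have "v + \<kappa> * t = - 1" using k by (simp add: t_def)
    finally show False using Gnn[of t] t by simp
  qed
  (* Tonelli needs this; it follows from integrability of the kernels 2 - 2 cos (t * u). *)
  have sf: "sigma_finite_measure \<mu>"
  proof
    (* For u \<noteq> 0 and large k the number u / (k + 1) lies in (-1, 1) without 0, where 2 - 2 cos is positive. *)
    define A where "A = (\<lambda>(k, n). {u \<in> space \<mu>. 1 / real (Suc n) \<le> 2 - 2 * cos (1 / real (Suc k) * u)})"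
    show "\<exists>A. countable A \<and> A \<subseteq> sets \<mu> \<and> \<Union> A = space \<mu> \<and> (\<forall>a\<in>A. emeasure \<mu> a \<noteq> \<infinity>)"
    proof (intro exI[of _ "range A"] conjI)
      show "countable (range A)" by simp
      have As: "A (k, n) \<in> sets \<mu>" for k n
      proof -
        have "(\<lambda>u. 2 - 2 * cos (1 / real (Suc k) * u)) \<in> borel_measurable \<mu>" by (rule meas) measurable
        then show ?thesis unfolding A_def by simp
      qed
      then show "range A \<subseteq> sets \<mu>" by auto
      show "\<Union> (range A) = space \<mu>"
      proof (intro subset_antisym subsetI)
        fix u assume u: "u \<in> space \<mu>"
        then have u0: "u \<noteq> 0" by (simp add: space\<mu>)
        obtain k :: nat where k: "\<bar>u\<bar> < real k" using reals_Archimedean2 by blast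
        define x where "x = 1 / real (Suc k) * u"
        have x: "x \<noteq> 0" "\<bar>x\<bar> < 1"
          using u0 k by (auto simp: x_def abs_mult field_simps)
        have "cos x < 1"
        proof -
          have "cos \<bar>x\<bar> < cos 0" using x pi_gt3 by (intro cos_monotone_0_pi) auto
          then show ?thesis by simp
        qed
        then have "0 < 2 - 2 * cos x" by simp
        then obtain n where "1 / real (Suc n) < 2 - 2 * cos x" using nat_approx_posE by blast
        then have "u \<in> A (k, n)" using u by (simp add: A_def x_def)
        then show "u \<in> \<Union> (range A)" by blast
      qed (auto simp: A_def)
      show "\<forall>a\<in>range A. emeasure \<mu> a \<noteq> \<infinity>"
      proof clarify
        fix k n assume inf: "emeasure \<mu> (A (k, n)) = \<infinity>"
        have "integrable \<mu> (indicator (A (k, n)) :: real \<Rightarrow> real)"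
        proof (rule Bochner_Integration.integrable_bound)
          show "integrable \<mu> (\<lambda>u. real (Suc n) * (2 - 2 * cos (1 / real (Suc k) * u)))"
            by (intro Bochner_Integration.integrable_mult_right icos)
          show "AE u in \<mu>. norm (indicator (A (k, n)) u :: real) \<le> norm (real (Suc n) * (2 - 2 * cos (1 / real (Suc k) * u)))"
          proof (intro AE_I2)
            fix u
            have "0 \<le> real (Suc n) * (2 - 2 * cos (1 / real (Suc k) * u))" using one_minus_cos_bounds(1) by (intro mult_nonneg_nonneg) auto
            moreover have "1 \<le> real (Suc n) * (2 - 2 * cos (1 / real (Suc k) * u))" if "u \<in> A (k, n)"
            proof -
              have "1 / real (Suc n) \<le> 2 - 2 * cos (1 / real (Suc k) * u)" using that by (simp add: A_def)
              then show ?thesis by (simp add: pos_divide_le_eq mult.commute del: of_nat_Suc)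
            qed
            ultimately show "norm (indicator (A (k, n)) u :: real) \<le> norm (real (Suc n) * (2 - 2 * cos (1 / real (Suc k) * u)))"
              by (simp add: indicator_def)
          qed
        qed (use As in simp)
        moreover have "A (k, n) \<inter> space \<mu> = A (k, n)" by (auto simp: A_def)
        ultimately have "emeasure \<mu> (A (k, n)) < \<infinity>" by (simp add: integrable_indicator_iff As)
        then show False using inf by simp
      qed
    qed
  qed
  interpret \<mu>: sigma_finite_measure \<mu> by (rule sf)
  interpret P: pair_sigma_finite lborel \<mu> ..
  define w where "w u = u\<^sup>2 / (1 + u\<^sup>2)" for u :: real
  have w0: "0 \<le> w u" for u by (simp add: w_def)
  have wm[measurable]: "w \<in> borel_measurable \<mu>" unfolding w_def[abs_def] by (rule meas) measurable
  have idm: "(\<lambda>u. u) \<in> borel_measurable \<mu>" by (rule meas) measurable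
  have jm: "(\<lambda>(t, u). ennreal (exp (- t) * (2 - 2 * cos (t * u))) * indicator {0..} t) \<in> borel_measurable (lborel \<Otimes>\<^sub>M \<mu>)"
  proof -
    have [measurable]: "snd \<in> borel_measurable (lborel \<Otimes>\<^sub>M \<mu> :: (real \<times> real) measure)"
      using measurable_compose[OF measurable_snd[of lborel \<mu>] idm] by simp
    have [measurable]: "fst \<in> borel_measurable (lborel \<Otimes>\<^sub>M \<mu> :: (real \<times> real) measure)"
      using measurable_fst[of lborel \<mu>] by simp
    show ?thesis unfolding case_prod_unfold by measurable
  qed
  have "(\<integral>\<^sup>+u. ennreal (2 * w u) \<partial>\<mu>) = (\<integral>\<^sup>+u. \<integral>\<^sup>+t. ennreal (exp (- t) * (2 - 2 * cos (t * u))) * indicator {0..} t \<partial>lborel \<partial>\<mu>)"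
    unfolding laplace_one_minus_cos w_def ..
  also have "\<dots> = (\<integral>\<^sup>+t. \<integral>\<^sup>+u. ennreal (exp (- t) * (2 - 2 * cos (t * u))) * indicator {0..} t \<partial>\<mu> \<partial>lborel)"
    by (rule P.Fubini'[OF jm])
  also have "\<dots> = (\<integral>\<^sup>+t. ennreal (exp (- t) * (v * t + \<kappa> * t\<^sup>2)) * indicator {0..} t \<partial>lborel)"
  proof (rule nn_integral_cong)
    fix t :: real
    show "(\<integral>\<^sup>+u. ennreal (exp (- t) * (2 - 2 * cos (t * u))) * indicator {0..} t \<partial>\<mu>) = ennreal (exp (- t) * (v * t + \<kappa> * t\<^sup>2)) * indicator {0..} t"
    proof (cases "0 \<le> t")
      case True
      have "(\<integral>\<^sup>+u. ennreal (exp (- t) * (2 - 2 * cos (t * u))) \<partial>\<mu>) = ennreal (LINT u|\<mu>. exp (- t) * (2 - 2 * cos (t * u)))"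
        by (intro nn_integral_eq_integral Bochner_Integration.integrable_mult_right icos AE_I2 mult_nonneg_nonneg one_minus_cos_bounds) auto
      also have "(LINT u|\<mu>. exp (- t) * (2 - 2 * cos (t * u))) = exp (- t) * (v * t + \<kappa> * t\<^sup>2)"
        using G[OF True] by simp
      finally show ?thesis using True by simp
    qed simp
  qed
  also have "\<dots> = ennreal (v + 2 * \<kappa>)" by (rule laplace_quadratic[OF Gnn])
  finally have nn: "(\<integral>\<^sup>+u. ennreal (2 * w u) \<partial>\<mu>) = ennreal (v + 2 * \<kappa>)" .
  have i2w: "integrable \<mu> (\<lambda>u. 2 * w u)"
    by (rule integrableI_nonneg) (use nn w0 in auto)
  then have iw: "integrable \<mu> w" by simp
  have "(LINT u|\<mu>. 2 * w u) = enn2real (\<integral>\<^sup>+u. ennreal (2 * w u) \<partial>\<mu>)"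
    by (rule integral_eq_nn_integral) (use w0 in auto)
  also have "\<dots> = v + 2 * \<kappa>" unfolding nn using v \<kappa>0 by (intro enn2real_ennreal) simp
  finally have "(LINT u|\<mu>. 2 * w u) = v + 2 * \<kappa>" .
  then have Ew: "(LINT u|\<mu>. w u) = v / 2 + \<kappa>" by simp
  have C: "spectral_C M D \<mu> = m\<^sup>2 + v / 2"
    unfolding spectral_C_def using Ew by (simp add: w_def d_def \<kappa>_def)
  show "spectral_C M D \<mu> = m\<^sup>2 + v / 2" by (rule C)
  (* Divide G by the square of t = n + 1 and let n tend to infinity. *)
  have "(\<lambda>n. LINT u|\<mu>. (2 - 2 * cos (real (Suc n) * u)) / (real (Suc n))\<^sup>2) \<longlonglongrightarrow> (LINT u|\<mu>. 0)"
  proof (rule integral_dominated_convergence[where w="\<lambda>u. 5 * w u"])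
    show "integrable \<mu> (\<lambda>u. 5 * w u)" using iw by simp
    show "AE u in \<mu>. (\<lambda>n. (2 - 2 * cos (real (Suc n) * u)) / (real (Suc n))\<^sup>2) \<longlonglongrightarrow> 0"
    proof (rule AE_I2)
      fix u
      show "(\<lambda>n. (2 - 2 * cos (real (Suc n) * u)) / (real (Suc n))\<^sup>2) \<longlonglongrightarrow> 0"
      proof (rule tendsto_sandwich[OF _ _ tendsto_const])
        have "(\<lambda>n. 4 * (inverse (real (Suc n)))\<^sup>2) \<longlonglongrightarrow> 4 * 0\<^sup>2"
          by (intro tendsto_intros LIMSEQ_inverse_real_of_nat)
        then show "(\<lambda>n. 4 * (inverse (real (Suc n)))\<^sup>2) \<longlonglongrightarrow> 0" by simp
        show "\<forall>\<^sub>F n in sequentially. 0 \<le> (2 - 2 * cos (real (Suc n) * u)) / (real (Suc n))\<^sup>2"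
          by (intro always_eventually allI divide_nonneg_nonneg one_minus_cos_bounds) auto
        show "\<forall>\<^sub>F n in sequentially. (2 - 2 * cos (real (Suc n) * u)) / (real (Suc n))\<^sup>2 \<le> 4 * (inverse (real (Suc n)))\<^sup>2"
        proof (intro always_eventually allI)
          fix n
          have "(2 - 2 * cos (real (Suc n) * u)) / (real (Suc n))\<^sup>2 \<le> 4 / (real (Suc n))\<^sup>2"
            by (intro divide_right_mono one_minus_cos_bounds) auto
          then show "(2 - 2 * cos (real (Suc n) * u)) / (real (Suc n))\<^sup>2 \<le> 4 * (inverse (real (Suc n)))\<^sup>2"
            by (simp only: divide_inverse power_inverse)
        qed
      qed
    qed
    show "AE u in \<mu>. norm ((2 - 2 * cos (real (Suc n) * u)) / (real (Suc n))\<^sup>2) \<le> 5 * w u" for n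
    proof (rule AE_I2)
      fix u
      have N: "1 \<le> (real (Suc n))\<^sup>2" by (rule one_le_power) simp
      have "(2 - 2 * cos (real (Suc n) * u)) / (real (Suc n))\<^sup>2 \<le> (real (Suc n) * u)\<^sup>2 / (real (Suc n))\<^sup>2"
        by (intro divide_right_mono one_minus_cos_bounds) auto
      also have "\<dots> = u\<^sup>2" by (simp add: power_mult_distrib del: of_nat_Suc)
      finally have 1: "(2 - 2 * cos (real (Suc n) * u)) / (real (Suc n))\<^sup>2 \<le> u\<^sup>2" .
      have "(2 - 2 * cos (real (Suc n) * u)) / (real (Suc n))\<^sup>2 \<le> 4 / 1"
        using N by (intro frac_le one_minus_cos_bounds) auto
      then have "(2 - 2 * cos (real (Suc n) * u)) / (real (Suc n))\<^sup>2 \<le> min (u\<^sup>2) 4" using 1 by simp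
      also have "\<dots> \<le> 5 * w u" unfolding w_def by (rule min_square_le_levy_weight)
      finally show "norm ((2 - 2 * cos (real (Suc n) * u)) / (real (Suc n))\<^sup>2) \<le> 5 * w u"
        using one_minus_cos_bounds(1)[of "real (Suc n) * u"] by simp
    qed
    show "(\<lambda>u. (2 - 2 * cos (real (Suc n) * u)) / (real (Suc n))\<^sup>2) \<in> borel_measurable \<mu>" for n
      by (rule meas) measurable
  qed simp
  moreover have "(LINT u|\<mu>. (2 - 2 * cos (real (Suc n) * u)) / (real (Suc n))\<^sup>2) = v * inverse (real (Suc n)) + \<kappa>" for n
  proof -
    have "(LINT u|\<mu>. (2 - 2 * cos (real (Suc n) * u)) / (real (Suc n))\<^sup>2) = (v * real (Suc n) + \<kappa> * (real (Suc n))\<^sup>2) / (real (Suc n))\<^sup>2"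
      using G[of "real (Suc n)"] by (simp del: of_nat_Suc)
    also have "\<dots> = v * inverse (real (Suc n)) + \<kappa>"
    proof -
      have "(v * x + \<kappa> * x\<^sup>2) / x\<^sup>2 = v * inverse x + \<kappa>" if "x \<noteq> 0" for x :: real
        using that by (simp add: field_simps power2_eq_square)
      then show ?thesis by simp
    qed
    finally show ?thesis .
  qed
  ultimately have "(\<lambda>n. v * inverse (real (Suc n)) + \<kappa>) \<longlonglongrightarrow> 0" by simp
  moreover have "(\<lambda>n. v * inverse (real (Suc n)) + \<kappa>) \<longlonglongrightarrow> v * 0 + \<kappa>"
    by (intro tendsto_intros LIMSEQ_inverse_real_of_nat)
  ultimately have \<kappa>: "\<kappa> = 0" using LIMSEQ_unique by fastforce
  then have d: "d = m\<^sup>2" by (simp add: \<kappa>_def)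
  have ED: "(LINT \<omega>|M. D \<omega>) = of_real m"
  proof -
    obtain I where I: "has_stochastic_integral M \<mu> X (\<lambda>u. exp (\<i> * of_real (1 * u)) - 1) I"
      and BI: "AE \<omega> in M. of_real (B 1 \<omega>) = D \<omega> * of_real 1 + I \<omega>" using rep by blast
    note iso = stochastic_integral_isometry[OF X M D D0 I]
    have I2: "square_integrable M I" using I by (simp add: has_stochastic_integral_def)
    have Im[measurable]: "I \<in> borel_measurable M" using I2 by (rule square_integrable_measurable)
    have iI: "integrable M I" using square_integrable_mult_cnj(1)[OF I2 one] by simp
    have Bm1[measurable]: "B 1 \<in> borel_measurable M" by (rule Bm) simp
    have "of_real m = (LINT \<omega>|M. complex_of_real (B 1 \<omega>))" using E1 by (simp only: integral_complex_of_real)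
    also have "\<dots> = (LINT \<omega>|M. D \<omega> + I \<omega>)"
      by (rule integral_cong_AE) (use BI in auto)
    also have "\<dots> = (LINT \<omega>|M. D \<omega>)" using iD iI iso(1) by simp
    finally show ?thesis by simp
  qed
  have "AE \<omega> in M. (norm (D \<omega> - of_real m))\<^sup>2 = 0"
  proof -
    have eq: "(norm (D \<omega> - of_real m))\<^sup>2 = (norm (D \<omega>))\<^sup>2 + m\<^sup>2 - (2 * m) * Re (D \<omega>)" for \<omega>
      using norm_square_add[of "D \<omega>" "- of_real m"] by simp
    have i: "integrable M (\<lambda>\<omega>. (norm (D \<omega> - of_real m))\<^sup>2)"
      unfolding eq using iD2 iD by simp
    have "(LINT \<omega>|M. (norm (D \<omega> - of_real m))\<^sup>2) = d + m\<^sup>2 - (2 * m) * (LINT \<omega>|M. Re (D \<omega>))"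
      unfolding eq using iD2 iD by (simp add: d_def prob_space)
    also have "(LINT \<omega>|M. Re (D \<omega>)) = m" using integral_Re[OF iD] ED by simp
    finally have "(LINT \<omega>|M. (norm (D \<omega> - of_real m))\<^sup>2) = 0" by (simp add: d power2_eq_square)
    then show ?thesis using integral_nonneg_eq_0_iff_AE[OF i] by simp
  qed
  then show "AE \<omega> in M. spectral_Z D \<mu> \<omega> = m\<^sup>2 + v / 2"
  proof eventually_elim
    case (elim \<omega>)
    then have "D \<omega> = of_real m" by simp
    then have "(norm (D \<omega>))\<^sup>2 = m\<^sup>2" by simp
    then show ?case unfolding spectral_Z_def using Ew by (simp add: w_def \<kappa>)
  qed
qed

section \<open>The limit theorem\<close>

lemma L2_on_imp_square_integrable:
  assumes "L2_on {0..T} w"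
  shows "square_integrable (lebesgue_on {0..T}) w"
proof -
  have m: "(\<lambda>x. indicator {0..T} x *\<^sub>R w x) \<in> borel_measurable lborel"
    and i: "integrable lborel (\<lambda>x. indicator {0..T} x *\<^sub>R (w x)\<^sup>2)"
    using assms by (auto simp: L2_on_def set_borel_measurable_def set_integrable_def)
  have "w \<in> borel_measurable (lebesgue_on {0..T})"
    using measurable_completion[OF m] by (subst borel_measurable_restrict_space_iff) auto
  moreover have "integrable (lebesgue_on {0..T}) (\<lambda>x. (w x)\<^sup>2)"
    using i by (subst integrable_restrict_space) (auto simp: integrable_completion borel_measurable_integrable[OF i])
  ultimately show ?thesis by (simp add: square_integrable_def)
qed

lemma energy_cong:
  assumes "\<And>s. s \<in> {0..T} \<Longrightarrow> w s = w' s"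
  shows "energy T f w = energy T f w'"
  unfolding energy_def using assms by (intro Bochner_Integration.integral_cong) auto

lemma square_integrable_path_cong:
  fixes w w' :: "real \<Rightarrow> real"
  assumes "\<And>s. s \<in> {0..T} \<Longrightarrow> w s = w' s"
  shows "square_integrable (lebesgue_on {0..T}) w \<longleftrightarrow> square_integrable (lebesgue_on {0..T}) w'"
  unfolding square_integrable_def using assms
  by (intro conj_cong measurable_cong Bochner_Integration.integrable_cong) auto

lemma levy_process_imp_square_integrable_levy:
  assumes levy: "levy_process M B" and sq: "\<And>t. 0 \<le> t \<Longrightarrow> integrable M (\<lambda>\<omega>. (B t \<omega>)\<^sup>2)"
  shows "square_integrable_levy M (\<lambda>t. B (max 0 t))"
proof -
  have M: "prob_space M"
    and meas: "(\<lambda>(t, \<omega>). B t \<omega>) \<in> borel_measurable (restrict_space borel {0..} \<Otimes>\<^sub>M M)"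
    and start: "AE \<omega> in M. B 0 \<omega> = 0"
    and ind: "\<And>n (t :: nat \<Rightarrow> real). 0 \<le> t 0 \<Longrightarrow> (\<forall>i<n. t i \<le> t (Suc i)) \<Longrightarrow>
        prob_space.indep_vars M (\<lambda>_. borel) (\<lambda>i \<omega>. B (t (Suc i)) \<omega> - B (t i) \<omega>) {..<n}"
    and stat: "\<And>s h. 0 \<le> s \<Longrightarrow> 0 \<le> h \<Longrightarrow> distr M borel (\<lambda>\<omega>. B (s + h) \<omega> - B s \<omega>) = distr M borel (B h)"
    and cont: "\<And>\<epsilon>. 0 < \<epsilon> \<Longrightarrow> ((\<lambda>t. measure M {\<omega> \<in> space M. \<epsilon> \<le> \<bar>B t \<omega> - B 0 \<omega>\<bar>}) \<longlongrightarrow> 0) (at 0 within {0..})"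
    using levy unfolding levy_process_def by auto
  interpret prob_space M by fact
  show ?thesis
  proof (intro square_integrable_levy.intro M square_integrable_levy_axioms.intro)
    have "(\<lambda>p. (max 0 (fst p), snd p)) \<in> measurable (borel \<Otimes>\<^sub>M M) (restrict_space borel {0::real..} \<Otimes>\<^sub>M M)"
    proof (rule measurable_Pair)
      show "(\<lambda>p. max 0 (fst p)) \<in> measurable (borel \<Otimes>\<^sub>M M) (restrict_space borel {0::real..})"
        by (rule measurable_restrict_space2) auto
    qed measurable
    from measurable_compose[OF this meas]
    show "(\<lambda>(t, \<omega>). B (max 0 t) \<omega>) \<in> borel_measurable (borel \<Otimes>\<^sub>M M)" by (simp add: case_prod_unfold)
    show "AE \<omega> in M. B (max 0 0) \<omega> = 0" using start by simp
    show "indep_vars (\<lambda>_. borel) (\<lambda>i \<omega>. B (max 0 (t (Suc i))) \<omega> - B (max 0 (t i)) \<omega>) {..<n}"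
      if t: "0 \<le> t 0" "\<And>i. i < n \<Longrightarrow> t i \<le> t (Suc i)" for n and t :: "nat \<Rightarrow> real"
    proof -
      have pos: "0 \<le> t i" if "i \<le> n" for i
        using that by (induction i) (use t in \<open>auto intro: order_trans\<close>)
      have "indep_vars (\<lambda>_. borel) (\<lambda>i \<omega>. B (t (Suc i)) \<omega> - B (t i) \<omega>) {..<n}" using t by (intro ind) auto
      then show ?thesis
        by (rule indep_vars_cong[THEN iffD1, rotated 3]) (use pos in \<open>auto simp: max_def\<close>)
    qed
    show "distr M borel (\<lambda>\<omega>. B (max 0 (s + h)) \<omega> - B (max 0 s) \<omega>) = distr M borel (B (max 0 h))"
      if "0 \<le> s" "0 \<le> h" for s h using stat[OF that] that by simp
    show "((\<lambda>t. prob {\<omega> \<in> space M. \<epsilon> \<le> \<bar>B (max 0 t) \<omega> - B (max 0 0) \<omega>\<bar>}) \<longlongrightarrow> 0) (at 0 within {0..})"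
      if "0 < \<epsilon>" for \<epsilon>
    proof (rule Lim_transform_eventually[OF cont[OF that]])
      show "\<forall>\<^sub>F t in at 0 within {0..}. prob {\<omega> \<in> space M. \<epsilon> \<le> \<bar>B t \<omega> - B 0 \<omega>\<bar>} = prob {\<omega> \<in> space M. \<epsilon> \<le> \<bar>B (max 0 t) \<omega> - B (max 0 0) \<omega>\<bar>}"
        unfolding eventually_at_filter by (intro always_eventually) auto
    qed
    show "integrable M (\<lambda>\<omega>. (B (max 0 t) \<omega>)\<^sup>2)" if "0 \<le> t" for t using sq[OF that] that by simp
  qed
qed

text \<open>
  The functions \<open>Y T\<close> and \<open>Z\<close> agree almost everywhere with measurable ones and are therefore measurable with
  respect to the completion.
\<close>

lemma tendsto_L1_of_AE_version:
  assumes \<Phi>: "\<And>T. 1 \<le> T \<Longrightarrow> integrable M (\<Phi> T)" and M: "prob_space M"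
    and eq: "AE \<omega> in M. \<forall>T\<ge>1. Y T \<omega> = \<Phi> T \<omega>" and Z: "AE \<omega> in M. Z \<omega> = c"
    and lim: "((\<lambda>T. LINT \<omega>|M. \<bar>\<Phi> T \<omega> - c\<bar>) \<longlongrightarrow> 0) at_top"
  shows "tendsto_L1 M Y Z"
  unfolding tendsto_L1_def
proof (intro conjI)
  interpret prob_space M by fact
  have eqc: "AE \<omega> in completion M. \<Phi> T \<omega> = Y T \<omega>" if "1 \<le> T" for T
    using AE_completion[OF eq] by eventually_elim (use that in simp)
  have Zc: "AE \<omega> in completion M. c = Z \<omega>" using AE_completion[OF Z] by eventually_elim simp
  have Ym: "Y T \<in> borel_measurable (completion M)" if "1 \<le> T" for T
    by (rule borel_measurable_completion_cong_AE[OF measurable_completion[OF borel_measurable_integrable[OF \<Phi>[OF that]]] eqc[OF that]])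
  have Zm: "Z \<in> borel_measurable (completion M)"
    by (rule borel_measurable_completion_cong_AE[OF _ Zc]) simp
  show "\<forall>\<^sub>F T in at_top. integrable (completion M) (Y T)"
  proof (rule eventually_at_top_linorderI[of 1])
    fix T :: real assume T: "1 \<le> T"
    have "integrable (completion M) (\<Phi> T)"
      using \<Phi>[OF T] borel_measurable_integrable[OF \<Phi>[OF T]] by (simp add: integrable_completion)
    then show "integrable (completion M) (Y T)"
      by (rule integrable_cong_AE_imp[OF _ Ym[OF T]]) (use eqc[OF T] in \<open>auto elim: eventually_mono\<close>)
  qed
  have "integrable (completion M) (\<lambda>_. c)" by (simp add: integrable_completion)
  then show "integrable (completion M) Z"
    by (rule integrable_cong_AE_imp[OF _ Zm]) (use Zc in \<open>auto elim: eventually_mono\<close>)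
  show "((\<lambda>T. LINT \<omega>|completion M. \<bar>Y T \<omega> - Z \<omega>\<bar>) \<longlongrightarrow> 0) at_top"
  proof (rule Lim_transform_eventually[OF lim])
    show "\<forall>\<^sub>F T in at_top. (LINT \<omega>|M. \<bar>\<Phi> T \<omega> - c\<bar>) = (LINT \<omega>|completion M. \<bar>Y T \<omega> - Z \<omega>\<bar>)"
    proof (rule eventually_at_top_linorderI[of 1])
      fix T :: real assume T: "1 \<le> T"
      have m: "(\<lambda>\<omega>. \<bar>\<Phi> T \<omega> - c\<bar>) \<in> borel_measurable M" using borel_measurable_integrable[OF \<Phi>[OF T]] by measurable
      have "(LINT \<omega>|M. \<bar>\<Phi> T \<omega> - c\<bar>) = (LINT \<omega>|completion M. \<bar>\<Phi> T \<omega> - c\<bar>)"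
        by (rule integral_completion[OF m, symmetric])
      also have "\<dots> = (LINT \<omega>|completion M. \<bar>Y T \<omega> - Z \<omega>\<bar>)"
      proof (rule integral_cong_AE[OF measurable_completion[OF m]])
        show "(\<lambda>\<omega>. \<bar>Y T \<omega> - Z \<omega>\<bar>) \<in> borel_measurable (completion M)" using Ym[OF T] Zm by measurable
        show "AE \<omega> in completion M. \<bar>\<Phi> T \<omega> - c\<bar> = \<bar>Y T \<omega> - Z \<omega>\<bar>"
          using eqc[OF T] Zc by eventually_elim simp
      qed
      finally show "(LINT \<omega>|M. \<bar>\<Phi> T \<omega> - c\<bar>) = (LINT \<omega>|completion M. \<bar>Y T \<omega> - Z \<omega>\<bar>)" .
    qed
  qed
qed

text \<open>
  The convergence is pulled back along a measure preserving map \<open>\<pi>\<close>. With the identity this is the statement on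
  the original space, with the projection of the two-sided extension the one on the extended space.
\<close>

lemma (in square_integrable_levy) minimal_energy_limit:
  assumes N: "prob_space N" and \<pi>: "\<pi> \<in> N \<rightarrow>\<^sub>M M" "distr N M \<pi> = M"
    and e: "AE \<omega> in M. \<forall>T>0. e T \<omega> = path_min_energy T \<omega>"
    and Y: "\<And>T \<omega>. 0 < T \<Longrightarrow> \<omega> \<in> space N \<Longrightarrow> Y T \<omega> = e T (\<pi> \<omega>) / T" and Z: "AE \<omega> in N. Z \<omega> = limit_energy"
  shows "tendsto_L1 N Y Z" "tendsto_AE N Y Z"
proof -
  have pull: "AE \<omega> in N. P (\<pi> \<omega>)" if "AE \<omega> in M. P \<omega>" for P
  proof (rule AE_distrD[OF \<pi>(1)])
    show "AE \<omega> in distr N M \<pi>. P \<omega>" unfolding \<pi>(2) by (rule that)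
  qed
  have Ye: "AE \<omega> in N. \<forall>T>0. Y T \<omega> = path_min_energy T (\<pi> \<omega>) / T"
    using pull[OF e] AE_space[of N]
  proof eventually_elim
    case (elim \<omega>)
    then show ?case using Y by simp
  qed
  show "tendsto_L1 N Y Z"
  proof (rule tendsto_L1_of_AE_version[OF _ N _ Z])
    show "integrable N (\<lambda>\<omega>. path_min_energy T (\<pi> \<omega>) / T)" if T: "1 \<le> T" for T
    proof -
      have "integrable (distr N M \<pi>) (path_min_energy T)" using integrable_path_min_energy[OF T] \<pi>(2) by simp
      then have "integrable N (\<lambda>\<omega>. path_min_energy T (\<pi> \<omega>))" by (rule integrable_distr[OF \<pi>(1)])
      then show ?thesis by simp
    qed
    show "AE \<omega> in N. \<forall>T\<ge>1. Y T \<omega> = path_min_energy T (\<pi> \<omega>) / T"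
      using Ye by eventually_elim auto
    have "(LINT \<omega>|N. \<bar>path_min_energy T (\<pi> \<omega>) / T - limit_energy\<bar>) = expectation (\<lambda>\<omega>. \<bar>path_min_energy T \<omega> / T - limit_energy\<bar>)" for T
    proof -
      have "expectation (\<lambda>\<omega>. \<bar>path_min_energy T \<omega> / T - limit_energy\<bar>) = (LINT \<omega>|distr N M \<pi>. \<bar>path_min_energy T \<omega> / T - limit_energy\<bar>)"
        by (simp only: \<pi>(2))
      also have "\<dots> = (LINT \<omega>|N. \<bar>path_min_energy T (\<pi> \<omega>) / T - limit_energy\<bar>)"
        by (rule integral_distr[OF \<pi>(1)]) measurable
      finally show ?thesis by simp
    qed
    then show "((\<lambda>T. LINT \<omega>|N. \<bar>path_min_energy T (\<pi> \<omega>) / T - limit_energy\<bar>) \<longlongrightarrow> 0) at_top"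
      using path_min_energy_L1_tendsto by simp
  qed
  show "tendsto_AE N Y Z"
    unfolding tendsto_AE_def
    using Ye Z pull[OF path_min_energy_AE_tendsto]
  proof eventually_elim
    case (elim \<omega>)
    have "((\<lambda>T. Y T \<omega>) \<longlongrightarrow> limit_energy) at_top"
    proof (rule Lim_transform_eventually[OF elim(3)])
      show "\<forall>\<^sub>F T in at_top. path_min_energy T (\<pi> \<omega>) / T = Y T \<omega>"
        using eventually_gt_at_top[of 0] by eventually_elim (use elim(1) in simp)
    qed
    then show ?case using elim(2) by simp
  qed
qed

theorem proposition3p8:
  fixes M :: "'a measure" and B :: "real \<Rightarrow> 'a \<Rightarrow> real"
    and f :: "real \<Rightarrow> 'a \<Rightarrow> real \<Rightarrow> real" and c :: real
  assumes levy: "levy_process M B"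
    and second_moments: "\<And>t. 0 \<le> t \<Longrightarrow> integrable M (\<lambda>\<omega>. (B t \<omega>)\<^sup>2)"
    and minimizer: "\<And>T \<omega>. 0 < T \<Longrightarrow> \<omega> \<in> space M \<Longrightarrow>
      square_integrable (lebesgue_on {0..T}) (\<lambda>s. B s \<omega>) \<Longrightarrow>
      energy_minimizer T (\<lambda>s. B s \<omega>) (f T \<omega>)"
    and c_eq: "c = \<bar>prob_space.expectation M (B 1)\<bar>\<^sup>2 + prob_space.variance M (B 1) / 2"
  shows
    "tendsto_L1 M (\<lambda>T \<omega>. energy T (f T \<omega>) (\<lambda>s. B s \<omega>) / T) (\<lambda>_. c) \<and>
     tendsto_AE M (\<lambda>T \<omega>. energy T (f T \<omega>) (\<lambda>s. B s \<omega>) / T) (\<lambda>_. c) \<and>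
     (\<forall>(M' :: 'b measure) \<pi> B' D X \<mu>.
        two_sided_extension M B M' \<pi> B' \<and> spectral_representation M' B' D X \<mu> \<longrightarrow>
        tendsto_L1 M' (\<lambda>T \<omega>. energy T (f T (\<pi> \<omega>)) (\<lambda>s. B' s \<omega>) / T) (spectral_Z D \<mu>) \<and>
        tendsto_AE M' (\<lambda>T \<omega>. energy T (f T (\<pi> \<omega>)) (\<lambda>s. B' s \<omega>) / T) (spectral_Z D \<mu>) \<and>
        (AE \<omega> in M'. spectral_Z D \<mu> \<omega> = spectral_C M' D \<mu>) \<and>
        spectral_C M' D \<mu> = c)"
proof -
  (* Negative times are replaced by 0; the energy only sees the path on [0, T]. *)
  interpret square_integrable_levy M "\<lambda>t. B (max 0 t)"
    using levy second_moments by (rule levy_process_imp_square_integrable_levy)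
  have B1: "B (max 0 1) = B 1" by simp
  have c: "c = limit_energy"
    unfolding limit_energy_def drift_def diffusivity_def c_eq B1 by simp
  define e where "e T \<omega> = energy T (f T \<omega>) (\<lambda>s. B s \<omega>)" for T \<omega>
  have e: "AE \<omega> in M. \<forall>T>0. e T \<omega> = path_min_energy T \<omega>"
    using path_L2_on AE_space
  proof eventually_elim
    case (elim \<omega>)
    show ?case
    proof (intro allI impI)
      fix T :: real assume T: "0 < T"
      have L2: "L2_on {0..T} (\<lambda>s. B (max 0 s) \<omega>)" using elim by blast
      have eqB: "B s \<omega> = B (max 0 s) \<omega>" if "s \<in> {0..T}" for s using that by simp
      have E: "energy T g (\<lambda>s. B s \<omega>) = energy T g (\<lambda>s. B (max 0 s) \<omega>)" for g
        by (rule energy_cong) (rule eqB)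
      have "square_integrable (lebesgue_on {0..T}) (\<lambda>s. B s \<omega>)"
        using L2_on_imp_square_integrable[OF L2] square_integrable_path_cong[of T "\<lambda>s. B s \<omega>" "\<lambda>s. B (max 0 s) \<omega>", OF eqB] by blast
      then have "energy_minimizer T (\<lambda>s. B s \<omega>) (f T \<omega>)" using T elim by (intro minimizer) auto
      then have "energy_minimizer T (\<lambda>s. B (max 0 s) \<omega>) (f T \<omega>)" unfolding energy_minimizer_def E .
      from energy_minimizer_value[OF T L2 this]
      show "e T \<omega> = path_min_energy T \<omega>" unfolding e_def path_min_energy_def E .
    qed
  qed
  have "tendsto_L1 M (\<lambda>T \<omega>. e T \<omega> / T) (\<lambda>_. c)" "tendsto_AE M (\<lambda>T \<omega>. e T \<omega> / T) (\<lambda>_. c)"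
    by (rule minimal_energy_limit[OF prob_space_axioms, of "\<lambda>\<omega>. \<omega>" e]; use e c in \<open>simp add: distr_id2\<close>)+
  moreover have "tendsto_L1 M' (\<lambda>T \<omega>. energy T (f T (\<pi> \<omega>)) (\<lambda>s. B' s \<omega>) / T) (spectral_Z D \<mu>) \<and>
        tendsto_AE M' (\<lambda>T \<omega>. energy T (f T (\<pi> \<omega>)) (\<lambda>s. B' s \<omega>) / T) (spectral_Z D \<mu>) \<and>
        (AE \<omega> in M'. spectral_Z D \<mu> \<omega> = spectral_C M' D \<mu>) \<and>
        spectral_C M' D \<mu> = c"
    if ext: "two_sided_extension M B M' \<pi> B'" and spec: "spectral_representation M' B' D X \<mu>"
    for M' :: "'b measure" and \<pi> B' D X \<mu>
  proof -
    have M': "prob_space M'" and \<pi>: "\<pi> \<in> M' \<rightarrow>\<^sub>M M" "distr M' M \<pi> = M"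
      and B': "\<And>t \<omega>. 0 \<le> t \<Longrightarrow> \<omega> \<in> space M' \<Longrightarrow> B' t \<omega> = B t (\<pi> \<omega>)"
      using ext unfolding two_sided_extension_def by auto
    have Bm: "B t \<in> borel_measurable M" if "0 \<le> t" for t using measurable_W[of t] that by simp
    have B'm: "B' t \<in> borel_measurable M'" if t: "0 \<le> t" for t
    proof -
      have "(\<lambda>\<omega>. B t (\<pi> \<omega>)) \<in> borel_measurable M'" by (rule measurable_compose[OF \<pi>(1) Bm[OF t]])
      then show ?thesis by (rule measurable_cong[THEN iffD2, rotated]) (use B' t in auto)
    qed
    have tr: "(LINT \<omega>|M'. h (B' t \<omega>)) = expectation (\<lambda>\<omega>. h (B t \<omega>))"
      if t: "0 \<le> t" and h: "h \<in> borel_measurable borel" for t and h :: "real \<Rightarrow> real"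
    proof -
      have "(LINT \<omega>|M'. h (B' t \<omega>)) = (LINT \<omega>|M'. h (B t (\<pi> \<omega>)))"
        by (intro Bochner_Integration.integral_cong) (use B' t in auto)
      also have "\<dots> = (LINT \<omega>|distr M' M \<pi>. h (B t \<omega>))"
        by (rule integral_distr[symmetric, OF \<pi>(1) measurable_compose[OF Bm[OF t] h]])
      finally show ?thesis by (simp only: \<pi>(2))
    qed
    have spectral: "spectral_C M' D \<mu> = drift\<^sup>2 + diffusivity / 2"
      "AE \<omega> in M'. spectral_Z D \<mu> \<omega> = drift\<^sup>2 + diffusivity / 2"
    proof -
      have E1: "(LINT \<omega>|M'. B' 1 \<omega>) = drift" using tr[of 1 "\<lambda>x. x"] by (simp add: drift_def)
      have E2: "(LINT \<omega>|M'. (B' t \<omega>)\<^sup>2) = diffusivity * t + drift\<^sup>2 * t\<^sup>2" if "0 \<le> t" for t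
        using tr[of t "\<lambda>x. x\<^sup>2"] second_moment_W[OF that] that by simp
      note S = spectral_data_of_linear_variance[OF M' spec B'm diffusivity_nonneg E1 E2]
      show "spectral_C M' D \<mu> = drift\<^sup>2 + diffusivity / 2" by (rule S(1))
      show "AE \<omega> in M'. spectral_Z D \<mu> \<omega> = drift\<^sup>2 + diffusivity / 2" by (rule S(2))
    qed
    have eM': "energy T (f T (\<pi> \<omega>)) (\<lambda>s. B' s \<omega>) / T = e T (\<pi> \<omega>) / T" if "\<omega> \<in> space M'" for T \<omega>
      unfolding e_def using energy_cong[of T "\<lambda>s. B' s \<omega>" "\<lambda>s. B s (\<pi> \<omega>)"] B' that by simp
    note L = minimal_energy_limit[OF M' \<pi> e, of "\<lambda>T \<omega>. energy T (f T (\<pi> \<omega>)) (\<lambda>s. B' s \<omega>) / T" "spectral_Z D \<mu>",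
        OF eM' spectral(2)[folded limit_energy_def]]
    show ?thesis
      using L spectral c by (simp add: limit_energy_def)
  qed
  ultimately show ?thesis unfolding e_def by blast
qed

end
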